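(* Let $\Lambda$ be a finite-dimensional algebra over a field $k$ with $\Lambda/\operatorname{rad}\Lambda$ separable over $k$ and $\operatorname{gl.dim}\Lambda=d$, $1\le d<\infty$. For every $\Lambda$-bimodule $X$ there are natural isomorphisms $$\mathrm{H}^d_\tau(\Lambda,X)\cong\operatorname{HH}^d(\Lambda,X),\qquad \mathrm{H}^\tau_d(\Lambda,X)\cong\operatorname{HH}_d(\Lambda,X).$$ In particular the degree-$d$ excess $\dim_k\operatorname{HH}^d_\tau(\Lambda)-\dim_k\operatorname{HH}^d(\Lambda)$ vanishes, and among degrees $n\ge1$ the $\tau$-theories $\mathrm{H}^n_\tau(\Lambda,X)$, $\mathrm{H}_n^\tau(\Lambda,X)$ differ from the ordinary $\operatorname{HH}^n(\Lambda,X)$, $\operatorname{HH}_n(\Lambda,X)$ only in the middle degrees $1\le n\le d-1$.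
   Context: $\mathsf{D}=\operatorname{Hom}_k(-,k)$; $\Lambda^{\mathrm e}=\Lambda\otimes_k\Lambda^{\mathrm{op}}$; $\Lambda$-bimodules are identified with left $\Lambda^{\mathrm e}$-modules, all finite-dimensional. $\operatorname{HH}^n(\Lambda,X)=\operatorname{Ext}^n_{\Lambda^{\mathrm e}}(\Lambda,X)$ and $\operatorname{HH}_n(\Lambda,X)=\operatorname{Tor}_n^{\Lambda^{\mathrm e}}(X,\Lambda)$ are ordinary Hochschild cohomology and homology; $\operatorname{HH}^n(\Lambda)=\operatorname{HH}^n(\Lambda,\Lambda)$. Let $\tau=\mathsf{D}\operatorname{Tr}$ be the Auslander--Reiten translate of $\operatorname{mod}\Lambda^{\mathrm e}$, $\Omega$ the syzygy with respect to minimal projective covers, and $\tau_n=\tau\Omega^{n-1}$ for $n\ge1$. The $\tau$-Hochschild cohomology and homology are, for $n\ge1$, $$\mathrm{H}^n_\tau(\Lambda,X)=\mathsf{D}\operatorname{Hom}_{\Lambda^{\mathrm e}}(X,\tau_n\Lambda)\cong \mathsf{D}\tau_n\Lambda\otimes_{\Lambda^{\mathrm e}}X,\qquad \mathrm{H}_n^\tau(\Lambda,X)=\operatorname{Hom}_{\Lambda^{\mathrm e}}(\mathsf{D}X,\tau_n\Lambda)\cong\operatorname{Hom}_{\Lambda^{\mathrm e}}(\mathsf{D}\tau_n\Lambda,X),$$ and $\operatorname{HH}^n_\tau(\Lambda)=\mathrm{H}^n_\tau(\Lambda,\Lambda)$. *)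

theory Defs
  imports "HOL-Library.FuncSet" "HOL-Library.Extended_Nat" "HOL-Algebra.QuotRing" "HOL-Algebra.Module"
begin

section \<open>Finite-dimensional algebras and their modules\<close>

text \<open>
  The locale \<^locale>\<open>module\<close> of HOL-Algebra requires a commutative base ring, so modules over
  a general ring are introduced here, on the same record type. The fields \<^const>\<open>mult\<close> and
  \<^const>\<open>one\<close> of a record that is only used as a module are irrelevant.
  A \<open>K\<close>-algebra is one record carrying both its ring structure and its \<open>K\<close>-action.
  Right \<open>A\<close>-modules are left modules over the opposite algebra.
\<close>

locale left_module = R?: ring R + M?: abelian_group M for R (structure) and M (structure) +
  assumes smult_closed:
      "\<lbrakk> a \<in> carrier R; x \<in> carrier M \<rbrakk> \<Longrightarrow> a \<odot>\<^bsub>M\<^esub> x \<in> carrier M"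
    and smult_l_distr:
      "\<lbrakk> a \<in> carrier R; b \<in> carrier R; x \<in> carrier M \<rbrakk> \<Longrightarrow>
        (a \<oplus> b) \<odot>\<^bsub>M\<^esub> x = a \<odot>\<^bsub>M\<^esub> x \<oplus>\<^bsub>M\<^esub> b \<odot>\<^bsub>M\<^esub> x"
    and smult_r_distr:
      "\<lbrakk> a \<in> carrier R; x \<in> carrier M; y \<in> carrier M \<rbrakk> \<Longrightarrow>
        a \<odot>\<^bsub>M\<^esub> (x \<oplus>\<^bsub>M\<^esub> y) = a \<odot>\<^bsub>M\<^esub> x \<oplus>\<^bsub>M\<^esub> a \<odot>\<^bsub>M\<^esub> y"
    and smult_assoc:
      "\<lbrakk> a \<in> carrier R; b \<in> carrier R; x \<in> carrier M \<rbrakk> \<Longrightarrow>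
        (a \<otimes> b) \<odot>\<^bsub>M\<^esub> x = a \<odot>\<^bsub>M\<^esub> (b \<odot>\<^bsub>M\<^esub> x)"
    and smult_one:
      "x \<in> carrier M \<Longrightarrow> \<one> \<odot>\<^bsub>M\<^esub> x = x"

definition vbasis :: "'k ring \<Rightarrow> ('k, 'v) module \<Rightarrow> 'v set \<Rightarrow> bool" where
  "vbasis K V B \<longleftrightarrow> finite B \<and> B \<subseteq> carrier V \<and>
     (\<forall>v \<in> carrier V. \<exists>!c. c \<in> B \<rightarrow>\<^sub>E carrier K \<and> v = (\<Oplus>\<^bsub>V\<^esub> b \<in> B. c b \<odot>\<^bsub>V\<^esub> b))"

definition fin_dim :: "'k ring \<Rightarrow> ('k, 'v) module \<Rightarrow> bool" where
  "fin_dim K V \<longleftrightarrow> module K V \<and> (\<exists>B. vbasis K V B)"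

definition vdim :: "'k ring \<Rightarrow> ('k, 'v) module \<Rightarrow> nat" where
  "vdim K V = card (SOME B. vbasis K V B)"

locale fd_algebra = K?: field K + A?: ring A + module K A for K and A (structure) +
  assumes smult_mult_left:
      "\<lbrakk> c \<in> carrier K; x \<in> carrier A; y \<in> carrier A \<rbrakk> \<Longrightarrow> (c \<odot> x) \<otimes> y = c \<odot> (x \<otimes> y)"
    and smult_mult_right:
      "\<lbrakk> c \<in> carrier K; x \<in> carrier A; y \<in> carrier A \<rbrakk> \<Longrightarrow> x \<otimes> (c \<odot> y) = c \<odot> (x \<otimes> y)"
    and finite_dimensional: "fin_dim K A"

definition opp :: "('k, 'a) module \<Rightarrow> ('k, 'a) module" where
  "opp A = A\<lparr>mult := (\<lambda>x y. y \<otimes>\<^bsub>A\<^esub> x)\<rparr>"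

definition reg :: "('a, 'c) ring_scheme \<Rightarrow> ('a, 'a) module" where
  "reg R = \<lparr>carrier = carrier R, mult = mult R, one = one R, zero = zero R, add = add R,
            smult = mult R\<rparr>"

text \<open>An \<open>A\<close>-module is a \<open>K\<close>-space through \<open>c \<mapsto> c \<cdot> 1\<close>.\<close>
definition scal :: "('k, 'a) module \<Rightarrow> ('a, 'm) module \<Rightarrow> ('k, 'm) module" where
  "scal A M = \<lparr>carrier = carrier M, mult = mult M, one = one M, zero = zero M, add = add M,
               smult = (\<lambda>c x. (c \<odot>\<^bsub>A\<^esub> \<one>\<^bsub>A\<^esub>) \<odot>\<^bsub>M\<^esub> x)\<rparr>"

definition fd_module :: "'k ring \<Rightarrow> ('k, 'a) module \<Rightarrow> ('a, 'm) module \<Rightarrow> bool" where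
  "fd_module K A M \<longleftrightarrow> left_module A M \<and> fin_dim K (scal A M)"

text \<open>Homomorphisms are extensional, so that equality of functions is equality of maps.\<close>
definition mhom ::
    "('a, 'c) ring_scheme \<Rightarrow> ('a, 'm) module \<Rightarrow> ('a, 'n) module \<Rightarrow> ('m \<Rightarrow> 'n) set" where
  "mhom R M N = {f \<in> carrier M \<rightarrow>\<^sub>E carrier N.
     (\<forall>x \<in> carrier M. \<forall>y \<in> carrier M. f (x \<oplus>\<^bsub>M\<^esub> y) = f x \<oplus>\<^bsub>N\<^esub> f y) \<and>
     (\<forall>a \<in> carrier R. \<forall>x \<in> carrier M. f (a \<odot>\<^bsub>M\<^esub> x) = a \<odot>\<^bsub>N\<^esub> f x)}"

definition miso ::
    "('a, 'c) ring_scheme \<Rightarrow> ('a, 'm) module \<Rightarrow> ('a, 'n) module \<Rightarrow> ('m \<Rightarrow> 'n) set" where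
  "miso R M N = {f \<in> mhom R M N. bij_betw f (carrier M) (carrier N)}"

definition mker :: "('a, 'm) module \<Rightarrow> ('a, 'n) module \<Rightarrow> ('m \<Rightarrow> 'n) \<Rightarrow> 'm set" where
  "mker M N f = {x \<in> carrier M. f x = \<zero>\<^bsub>N\<^esub>}"

definition submod :: "('a, 'm) module \<Rightarrow> 'm set \<Rightarrow> ('a, 'm) module" where
  "submod M N = M\<lparr>carrier := N\<rparr>"

text \<open>The quotient of \<open>M\<close> by a submodule \<open>N\<close>: its elements are the cosets of \<open>N\<close>.\<close>
definition quot :: "('a, 'm) module \<Rightarrow> 'm set \<Rightarrow> ('a, 'm set) module" where
  "quot M N = \<lparr>carrier = a_rcosets\<^bsub>M\<^esub> N, mult = undefined, one = undefined,
     zero = N, add = set_add M, smult = (\<lambda>a C. \<Union>x\<in>C. N +>\<^bsub>M\<^esub> (a \<odot>\<^bsub>M\<^esub> x))\<rparr>"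

text \<open>The map of quotients induced by \<open>f\<close>, with target the quotient of \<open>M'\<close> by \<open>N'\<close>.\<close>
definition quot_map :: "('a, 'm) module \<Rightarrow> 'm set \<Rightarrow> ('n \<Rightarrow> 'm) \<Rightarrow> 'n set \<Rightarrow> 'm set" where
  "quot_map M' N' f C = (\<Union>x\<in>C. N' +>\<^bsub>M'\<^esub> f x)"

definition quot_alg :: "('k, 'a) module \<Rightarrow> 'a set \<Rightarrow> ('k, 'a set) module" where
  "quot_alg A I = (quot A I)\<lparr>mult := rcoset_mult A I, one := I +>\<^bsub>A\<^esub> \<one>\<^bsub>A\<^esub>\<rparr>"

definition max_left_ideal :: "('k, 'a) module \<Rightarrow> 'a set \<Rightarrow> bool" where
  "max_left_ideal A I \<longleftrightarrow> submodule I A (reg A) \<and> I \<noteq> carrier A \<and>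
     (\<forall>J. submodule J A (reg A) \<and> I \<subseteq> J \<longrightarrow> J = I \<or> J = carrier A)"

definition jacobson_radical :: "('k, 'a) module \<Rightarrow> 'a set" where
  "jacobson_radical A = carrier A \<inter> \<Inter>{I. max_left_ideal A I}"


section \<open>Hom, duality, projectives, resolutions\<close>

definition Hom_space ::
    "('k, 'a) module \<Rightarrow> ('a, 'm) module \<Rightarrow> ('a, 'n) module \<Rightarrow> ('k, 'm \<Rightarrow> 'n) module" where
  "Hom_space A M N = \<lparr>carrier = mhom A M N, mult = undefined, one = undefined,
     zero = (\<lambda>x \<in> carrier M. \<zero>\<^bsub>N\<^esub>),
     add = (\<lambda>f g. \<lambda>x \<in> carrier M. f x \<oplus>\<^bsub>N\<^esub> g x),
     smult = (\<lambda>c f. \<lambda>x \<in> carrier M. (c \<odot>\<^bsub>A\<^esub> \<one>\<^bsub>A\<^esub>) \<odot>\<^bsub>N\<^esub> f x)\<rparr>"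

text \<open>
  The \<open>K\<close>-dual of an \<open>A\<close>-module, a module over \<^term>\<open>opp A\<close>.
  For a plain \<open>K\<close>-space \<open>V\<close>, its dual space is \<^term>\<open>dual K (reg K) V\<close>.
\<close>
definition dual :: "'k ring \<Rightarrow> ('k, 'a) module \<Rightarrow> ('a, 'm) module \<Rightarrow> ('a, 'm \<Rightarrow> 'k) module" where
  "dual K A M = \<lparr>carrier = mhom K (scal A M) (reg K), mult = undefined, one = undefined,
     zero = (\<lambda>x \<in> carrier M. \<zero>\<^bsub>K\<^esub>),
     add = (\<lambda>f g. \<lambda>x \<in> carrier M. f x \<oplus>\<^bsub>K\<^esub> g x),
     smult = (\<lambda>a f. \<lambda>x \<in> carrier M. f (a \<odot>\<^bsub>M\<^esub> x))\<rparr>"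

text \<open>The \<open>A\<close>-dual \<open>Hom\<^sub>A(M, A)\<close> of a left \<open>A\<close>-module, a module over \<^term>\<open>opp A\<close>.\<close>
definition star :: "('k, 'a) module \<Rightarrow> ('a, 'm) module \<Rightarrow> ('a, 'm \<Rightarrow> 'a) module" where
  "star A M = \<lparr>carrier = mhom A M (reg A), mult = undefined, one = undefined,
     zero = (\<lambda>x \<in> carrier M. \<zero>\<^bsub>A\<^esub>),
     add = (\<lambda>f g. \<lambda>x \<in> carrier M. f x \<oplus>\<^bsub>A\<^esub> g x),
     smult = (\<lambda>a f. \<lambda>x \<in> carrier M. f x \<otimes>\<^bsub>A\<^esub> a)\<rparr>"

text \<open>
  Every finite-dimensional \<open>K\<close>-space is isomorphic to one with carrier in \<^typ>\<open>nat \<Rightarrow> 'k\<close>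
  (coordinate tuples). This type is the universe for the existentially and universally
  quantified finite-dimensional modules below.
\<close>
type_synonym ('k, 'a) fdmod = "('a, nat \<Rightarrow> 'k) module"

definition projective :: "'k ring \<Rightarrow> ('k, 'a) module \<Rightarrow> ('a, 'm) module \<Rightarrow> bool" where
  "projective K A P \<longleftrightarrow> fd_module K A P \<and>
     (\<forall>(M :: ('k, 'a) fdmod) (N :: ('k, 'a) fdmod) g f.
        fd_module K A M \<and> fd_module K A N \<and>
        g \<in> mhom A M N \<and> g ` carrier M = carrier N \<and> f \<in> mhom A P N \<longrightarrow>
        (\<exists>h \<in> mhom A P M. \<forall>p \<in> carrier P. g (h p) = f p))"

definition proj_res ::
    "'k ring \<Rightarrow> ('k, 'a) module \<Rightarrow> ('a, 'm) module \<Rightarrow> (nat \<Rightarrow> ('k, 'a) fdmod) \<Rightarrow>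
     (nat \<Rightarrow> (nat \<Rightarrow> 'k) \<Rightarrow> nat \<Rightarrow> 'k) \<Rightarrow> ((nat \<Rightarrow> 'k) \<Rightarrow> 'm) \<Rightarrow> bool" where
  "proj_res K A M P \<delta> \<epsilon> \<longleftrightarrow>
     (\<forall>n. projective K A (P n)) \<and>
     \<epsilon> \<in> mhom A (P 0) M \<and> \<epsilon> ` carrier (P 0) = carrier M \<and>
     (\<forall>n. \<delta> n \<in> mhom A (P (Suc n)) (P n)) \<and>
     \<delta> 0 ` carrier (P 1) = mker (P 0) M \<epsilon> \<and>
     (\<forall>n. \<delta> (Suc n) ` carrier (P (Suc (Suc n))) = mker (P (Suc n)) (P n) (\<delta> n))"

text \<open>The zero module gets projective dimension 0.\<close>
definition proj_dim :: "'k ring \<Rightarrow> ('k, 'a) module \<Rightarrow> ('a, 'm) module \<Rightarrow> enat" where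
  "proj_dim K A M = Inf {enat n | n. \<exists>P \<delta> \<epsilon>. proj_res K A M P \<delta> \<epsilon> \<and>
                                       (\<forall>m>n. carrier (P m) = {\<zero>\<^bsub>P m\<^esub>})}"

text \<open>
  By Auslander's theorem the supremum over finite-dimensional left modules is the supremum over
  all left modules, and it is the same for right modules.
\<close>
definition gl_dim :: "'k ring \<Rightarrow> ('k, 'a) module \<Rightarrow> enat" where
  "gl_dim K A = Sup {proj_dim K A M | M :: ('k, 'a) fdmod. fd_module K A M}"

definition proj_cover ::
    "'k ring \<Rightarrow> ('k, 'a) module \<Rightarrow> ('a, 'm) module \<Rightarrow> ('k, 'a) fdmod \<Rightarrow>
     ((nat \<Rightarrow> 'k) \<Rightarrow> 'm) \<Rightarrow> bool" where
  "proj_cover K A M P p \<longleftrightarrow> projective K A P \<and> p \<in> mhom A P M \<and> p ` carrier P = carrier M \<and>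
     (\<forall>N. submodule N A P \<and> N <+>\<^bsub>P\<^esub> mker P M p = carrier P \<longrightarrow> N = carrier P)"

definition pcov ::
    "'k ring \<Rightarrow> ('k, 'a) module \<Rightarrow> ('a, 'm) module \<Rightarrow> ('k, 'a) fdmod \<times> ((nat \<Rightarrow> 'k) \<Rightarrow> 'm)" where
  "pcov K A M = (SOME (P, p). proj_cover K A M P p)"

definition syzygy :: "'k ring \<Rightarrow> ('k, 'a) module \<Rightarrow> ('a, 'm) module \<Rightarrow> ('k, 'a) fdmod" where
  "syzygy K A M = (let (P, p) = pcov K A M in submod P (mker P M p))"

text \<open>
  The transpose is the cokernel of the \<open>A\<close>-dual of the minimal projective presentation
  \<open>P1 \<rightarrow> P0 \<rightarrow> M \<rightarrow> 0\<close>; the cover \<open>p1\<close> of the syzygy, which is a subset of \<open>P0\<close>,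
  serves as the map \<open>P1 \<rightarrow> P0\<close>.
\<close>
definition transpose_mod ::
    "'k ring \<Rightarrow> ('k, 'a) module \<Rightarrow> ('a, 'm) module \<Rightarrow> ('a, ((nat \<Rightarrow> 'k) \<Rightarrow> 'a) set) module" where
  "transpose_mod K A M =
     (let (P0, p0) = pcov K A M; (P1, p1) = pcov K A (syzygy K A M)
      in quot (star A P1) ((\<lambda>f. compose (carrier P1) f p1) ` carrier (star A P0)))"

definition ar_translate ::
    "'k ring \<Rightarrow> ('k, 'a) module \<Rightarrow> ('a, 'm) module \<Rightarrow>
     ('a, ((nat \<Rightarrow> 'k) \<Rightarrow> 'a) set \<Rightarrow> 'k) module" where
  "ar_translate K A M = dual K (opp A) (transpose_mod K A M)"

text \<open>
  The translate of the \<open>(n-1)\<close>-st syzygy, meaningful for \<open>n \<ge> 1\<close>. The case distinction is forced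
  by the types: the zeroth syzygy \<open>M\<close> need not live in the universe \<^typ>\<open>nat \<Rightarrow> 'k\<close>.
\<close>
definition tau_n ::
    "'k ring \<Rightarrow> ('k, 'a) module \<Rightarrow> nat \<Rightarrow> ('a, 'm) module \<Rightarrow>
     ('a, ((nat \<Rightarrow> 'k) \<Rightarrow> 'a) set \<Rightarrow> 'k) module" where
  "tau_n K A n M = (if n \<le> 1 then ar_translate K A M
                    else ar_translate K A ((syzygy K A ^^ (n - 2)) (syzygy K A M)))"


section \<open>Tensor products\<close>

definition free_space :: "'k ring \<Rightarrow> 'p set \<Rightarrow> ('k, 'p \<Rightarrow> 'k) module" where
  "free_space K S = \<lparr>carrier = {f. (\<forall>p. f p \<in> carrier K) \<and>
        finite {p. f p \<noteq> \<zero>\<^bsub>K\<^esub>} \<and> {p. f p \<noteq> \<zero>\<^bsub>K\<^esub>} \<subseteq> S},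
     mult = undefined, one = undefined, zero = (\<lambda>p. \<zero>\<^bsub>K\<^esub>),
     add = (\<lambda>f g p. f p \<oplus>\<^bsub>K\<^esub> g p), smult = (\<lambda>c f p. c \<otimes>\<^bsub>K\<^esub> f p)\<rparr>"

definition free_gen :: "'k ring \<Rightarrow> 'p \<Rightarrow> 'p \<Rightarrow> 'k" where
  "free_gen K p = (\<lambda>q. if q = p then \<one>\<^bsub>K\<^esub> else \<zero>\<^bsub>K\<^esub>)"

text \<open>
  The relations defining the tensor product over the \<open>K\<close>-algebra \<open>A\<close> of a right module \<open>X\<close>
  (stored as an \<^term>\<open>opp A\<close>-module) and a left module \<open>Y\<close>. The tensor product over \<open>K\<close>
  is the case \<^term>\<open>A = reg K\<close>.
\<close>
definition tensor_rel ::
    "'k ring \<Rightarrow> ('k, 'a) module \<Rightarrow> ('a, 'x) module \<Rightarrow> ('a, 'y) module \<Rightarrow> ('x \<times> 'y \<Rightarrow> 'k) set" where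
  "tensor_rel K A X Y =
     (let F = free_space K (carrier X \<times> carrier Y); e = (\<lambda>x y. free_gen K (x, y)) in
      \<Inter>{N. submodule N K F \<and>
        (\<forall>x \<in> carrier X. \<forall>x' \<in> carrier X. \<forall>y \<in> carrier Y.
           e (x \<oplus>\<^bsub>X\<^esub> x') y \<ominus>\<^bsub>F\<^esub> (e x y \<oplus>\<^bsub>F\<^esub> e x' y) \<in> N) \<and>
        (\<forall>x \<in> carrier X. \<forall>y \<in> carrier Y. \<forall>y' \<in> carrier Y.
           e x (y \<oplus>\<^bsub>Y\<^esub> y') \<ominus>\<^bsub>F\<^esub> (e x y \<oplus>\<^bsub>F\<^esub> e x y') \<in> N) \<and>
        (\<forall>a \<in> carrier A. \<forall>x \<in> carrier X. \<forall>y \<in> carrier Y.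
           e (a \<odot>\<^bsub>X\<^esub> x) y \<ominus>\<^bsub>F\<^esub> e x (a \<odot>\<^bsub>Y\<^esub> y) \<in> N) \<and>
        (\<forall>c \<in> carrier K. \<forall>x \<in> carrier X. \<forall>y \<in> carrier Y.
           e ((c \<odot>\<^bsub>A\<^esub> \<one>\<^bsub>A\<^esub>) \<odot>\<^bsub>X\<^esub> x) y \<ominus>\<^bsub>F\<^esub> (c \<odot>\<^bsub>F\<^esub> e x y) \<in> N)})"

definition tensor ::
    "'k ring \<Rightarrow> ('k, 'a) module \<Rightarrow> ('a, 'x) module \<Rightarrow> ('a, 'y) module \<Rightarrow>
     ('k, ('x \<times> 'y \<Rightarrow> 'k) set) module" where
  "tensor K A X Y = quot (free_space K (carrier X \<times> carrier Y)) (tensor_rel K A X Y)"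

definition tens ::
    "'k ring \<Rightarrow> ('k, 'a) module \<Rightarrow> ('a, 'x) module \<Rightarrow> ('a, 'y) module \<Rightarrow> 'x \<Rightarrow> 'y \<Rightarrow>
     ('x \<times> 'y \<Rightarrow> 'k) set" where
  "tens K A X Y x y =
     tensor_rel K A X Y +>\<^bsub>free_space K (carrier X \<times> carrier Y)\<^esub> free_gen K (x, y)"

text \<open>The linear map on a tensor product induced by \<open>\<beta>\<close>, meaningful when \<open>\<beta>\<close> is balanced:
  then all representatives of the coset \<open>C\<close> have the same image in the \<open>K\<close>-space \<open>Z\<close>.\<close>
definition tensor_lift ::
    "'k ring \<Rightarrow> ('k, 'z) module \<Rightarrow> ('x \<Rightarrow> 'y \<Rightarrow> 'z) \<Rightarrow> ('x \<times> 'y \<Rightarrow> 'k) set \<Rightarrow> 'z" where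
  "tensor_lift K Z \<beta> C = the_elem
     ((\<lambda>f. \<Oplus>\<^bsub>Z\<^esub> p \<in> {p. f p \<noteq> \<zero>\<^bsub>K\<^esub>}. f p \<odot>\<^bsub>Z\<^esub> \<beta> (fst p) (snd p)) ` C)"

definition tensor_map ::
    "'k ring \<Rightarrow> ('k, 'a) module \<Rightarrow> ('a, 'v) module \<Rightarrow> ('a, 'w) module \<Rightarrow>
     ('x \<Rightarrow> 'v) \<Rightarrow> ('y \<Rightarrow> 'w) \<Rightarrow> ('x \<times> 'y \<Rightarrow> 'k) set \<Rightarrow> ('v \<times> 'w \<Rightarrow> 'k) set" where
  "tensor_map K A X' Y' f g =
     tensor_lift K (tensor K A X' Y') (\<lambda>x y. tens K A X' Y' (f x) (g y))"

definition tensor_alg ::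
    "'k ring \<Rightarrow> ('k, 'a) module \<Rightarrow> ('k, 'b) module \<Rightarrow> ('k, ('a \<times> 'b \<Rightarrow> 'k) set) module" where
  "tensor_alg K A B = (let T = tensor K (reg K) A B; t = tens K (reg K) A B in
     T\<lparr>mult := (\<lambda>C D. tensor_lift K T (\<lambda>a b.
                  tensor_lift K T (\<lambda>a' b'. t (a \<otimes>\<^bsub>A\<^esub> a') (b \<otimes>\<^bsub>B\<^esub> b')) D) C),
       one := t \<one>\<^bsub>A\<^esub> \<one>\<^bsub>B\<^esub>\<rparr>)"


section \<open>Bimodules\<close>

type_synonym ('k, 'a) env = "('a \<times> 'a \<Rightarrow> 'k) set"

definition env_alg :: "'k ring \<Rightarrow> ('k, 'a) module \<Rightarrow> ('k, ('k, 'a) env) module" where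
  "env_alg K A = tensor_alg K A (opp A)"

text \<open>\<open>A\<close> as a bimodule: \<open>a \<otimes> b\<close> maps \<open>x\<close> to \<open>a x b\<close>.\<close>
definition reg_bimod :: "'k ring \<Rightarrow> ('k, 'a) module \<Rightarrow> (('k, 'a) env, 'a) module" where
  "reg_bimod K A = \<lparr>carrier = carrier A, mult = mult A, one = one A, zero = zero A, add = add A,
     smult = (\<lambda>c x. tensor_lift K A (\<lambda>a b. a \<otimes>\<^bsub>A\<^esub> x \<otimes>\<^bsub>A\<^esub> b) c)\<rparr>"

text \<open>
  The anti-automorphism \<open>a \<otimes> b \<mapsto> b \<otimes> a\<close> of the enveloping algebra. Twisting by it turns
  bimodules, seen as left modules over the enveloping algebra, into right modules and conversely.
\<close>
definition flip :: "'k ring \<Rightarrow> ('k, 'a) module \<Rightarrow> ('k, 'a) env \<Rightarrow> ('k, 'a) env" where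
  "flip K A = tensor_lift K (env_alg K A) (\<lambda>a b. tens K (reg K) A (opp A) b a)"

definition twist ::
    "'k ring \<Rightarrow> ('k, 'a) module \<Rightarrow> (('k, 'a) env, 'x) module \<Rightarrow> (('k, 'a) env, 'x) module" where
  "twist K A X = X\<lparr>smult := (\<lambda>c x. flip K A c \<odot>\<^bsub>X\<^esub> x)\<rparr>"

definition bimod_dual ::
    "'k ring \<Rightarrow> ('k, 'a) module \<Rightarrow> (('k, 'a) env, 'x) module \<Rightarrow> (('k, 'a) env, 'x \<Rightarrow> 'k) module" where
  "bimod_dual K A X = twist K A (dual K (env_alg K A) X)"

text \<open>
  Of the equivalent standard definitions of separability over a field, the homological one.
\<close>
definition separable_alg :: "'k ring \<Rightarrow> ('k, 'a) module \<Rightarrow> bool" where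
  "separable_alg K A \<longleftrightarrow> projective K (env_alg K A) (reg_bimod K A)"


section \<open>Ext and Tor\<close>

text \<open>An arbitrary (not necessarily minimal) projective resolution, used for Ext and Tor.\<close>
definition resolution ::
    "'k ring \<Rightarrow> ('k, 'a) module \<Rightarrow> ('a, 'm) module \<Rightarrow>
     (nat \<Rightarrow> ('k, 'a) fdmod) \<times> (nat \<Rightarrow> (nat \<Rightarrow> 'k) \<Rightarrow> nat \<Rightarrow> 'k)" where
  "resolution K A M = (SOME (P, \<delta>). \<exists>\<epsilon>. proj_res K A M P \<delta> \<epsilon>)"

definition res_mod :: "'k ring \<Rightarrow> ('k, 'a) module \<Rightarrow> ('a, 'm) module \<Rightarrow> nat \<Rightarrow> ('k, 'a) fdmod" where
  "res_mod K A M = fst (resolution K A M)"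

definition res_diff ::
    "'k ring \<Rightarrow> ('k, 'a) module \<Rightarrow> ('a, 'm) module \<Rightarrow> nat \<Rightarrow> (nat \<Rightarrow> 'k) \<Rightarrow> nat \<Rightarrow> 'k" where
  "res_diff K A M = snd (resolution K A M)"

definition Ext_cochains ::
    "'k ring \<Rightarrow> ('k, 'a) module \<Rightarrow> nat \<Rightarrow> ('a, 'm) module \<Rightarrow> ('a, 'n) module \<Rightarrow>
     ('k, (nat \<Rightarrow> 'k) \<Rightarrow> 'n) module" where
  "Ext_cochains K A n M N = Hom_space A (res_mod K A M n) N"

definition Ext_diff ::
    "'k ring \<Rightarrow> ('k, 'a) module \<Rightarrow> nat \<Rightarrow> ('a, 'm) module \<Rightarrow>
     ((nat \<Rightarrow> 'k) \<Rightarrow> 'n) \<Rightarrow> ((nat \<Rightarrow> 'k) \<Rightarrow> 'n)" where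
  "Ext_diff K A n M f = compose (carrier (res_mod K A M (Suc n))) f (res_diff K A M n)"

definition Ext_cocycles ::
    "'k ring \<Rightarrow> ('k, 'a) module \<Rightarrow> nat \<Rightarrow> ('a, 'm) module \<Rightarrow> ('a, 'n) module \<Rightarrow>
     ((nat \<Rightarrow> 'k) \<Rightarrow> 'n) set" where
  "Ext_cocycles K A n M N =
     mker (Ext_cochains K A n M N) (Ext_cochains K A (Suc n) M N) (Ext_diff K A n M)"

definition Ext_cobounds ::
    "'k ring \<Rightarrow> ('k, 'a) module \<Rightarrow> nat \<Rightarrow> ('a, 'm) module \<Rightarrow> ('a, 'n) module \<Rightarrow>
     ((nat \<Rightarrow> 'k) \<Rightarrow> 'n) set" where
  "Ext_cobounds K A n M N = (case n of
       0 \<Rightarrow> {\<zero>\<^bsub>Ext_cochains K A 0 M N\<^esub>}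
     | Suc m \<Rightarrow> Ext_diff K A m M ` carrier (Ext_cochains K A m M N))"

definition Ext ::
    "'k ring \<Rightarrow> ('k, 'a) module \<Rightarrow> nat \<Rightarrow> ('a, 'm) module \<Rightarrow> ('a, 'n) module \<Rightarrow>
     ('k, ((nat \<Rightarrow> 'k) \<Rightarrow> 'n) set) module" where
  "Ext K A n M N =
     quot (submod (Ext_cochains K A n M N) (Ext_cocycles K A n M N)) (Ext_cobounds K A n M N)"

definition Ext_map ::
    "'k ring \<Rightarrow> ('k, 'a) module \<Rightarrow> nat \<Rightarrow> ('a, 'm) module \<Rightarrow> ('a, 'n2) module \<Rightarrow> ('n1 \<Rightarrow> 'n2) \<Rightarrow>
     ((nat \<Rightarrow> 'k) \<Rightarrow> 'n1) set \<Rightarrow> ((nat \<Rightarrow> 'k) \<Rightarrow> 'n2) set" where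
  "Ext_map K A n M N2 f =
     quot_map (Ext_cochains K A n M N2) (Ext_cobounds K A n M N2)
       (\<lambda>g. compose (carrier (res_mod K A M n)) f g)"

text \<open>\<open>X\<close> is a right module, i.e. an \<^term>\<open>opp A\<close>-module, and \<open>M\<close> a left \<open>A\<close>-module.\<close>

definition Tor_chains ::
    "'k ring \<Rightarrow> ('k, 'a) module \<Rightarrow> nat \<Rightarrow> ('a, 'x) module \<Rightarrow> ('a, 'm) module \<Rightarrow>
     ('k, ('x \<times> (nat \<Rightarrow> 'k) \<Rightarrow> 'k) set) module" where
  "Tor_chains K A n X M = tensor K A X (res_mod K A M n)"

definition Tor_diff ::
    "'k ring \<Rightarrow> ('k, 'a) module \<Rightarrow> nat \<Rightarrow> ('a, 'x) module \<Rightarrow> ('a, 'm) module \<Rightarrow>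
     ('x \<times> (nat \<Rightarrow> 'k) \<Rightarrow> 'k) set \<Rightarrow> ('x \<times> (nat \<Rightarrow> 'k) \<Rightarrow> 'k) set" where
  "Tor_diff K A n X M = tensor_map K A X (res_mod K A M n) (\<lambda>x. x) (res_diff K A M n)"

definition Tor_cycles ::
    "'k ring \<Rightarrow> ('k, 'a) module \<Rightarrow> nat \<Rightarrow> ('a, 'x) module \<Rightarrow> ('a, 'm) module \<Rightarrow>
     ('x \<times> (nat \<Rightarrow> 'k) \<Rightarrow> 'k) set set" where
  "Tor_cycles K A n X M = (case n of
       0 \<Rightarrow> carrier (Tor_chains K A 0 X M)
     | Suc m \<Rightarrow> mker (Tor_chains K A (Suc m) X M) (Tor_chains K A m X M) (Tor_diff K A m X M))"

definition Tor_bounds ::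
    "'k ring \<Rightarrow> ('k, 'a) module \<Rightarrow> nat \<Rightarrow> ('a, 'x) module \<Rightarrow> ('a, 'm) module \<Rightarrow>
     ('x \<times> (nat \<Rightarrow> 'k) \<Rightarrow> 'k) set set" where
  "Tor_bounds K A n X M = Tor_diff K A n X M ` carrier (Tor_chains K A (Suc n) X M)"

definition Tor ::
    "'k ring \<Rightarrow> ('k, 'a) module \<Rightarrow> nat \<Rightarrow> ('a, 'x) module \<Rightarrow> ('a, 'm) module \<Rightarrow>
     ('k, ('x \<times> (nat \<Rightarrow> 'k) \<Rightarrow> 'k) set set) module" where
  "Tor K A n X M =
     quot (submod (Tor_chains K A n X M) (Tor_cycles K A n X M)) (Tor_bounds K A n X M)"

definition Tor_map ::
    "'k ring \<Rightarrow> ('k, 'a) module \<Rightarrow> nat \<Rightarrow> ('a, 'x2) module \<Rightarrow> ('a, 'm) module \<Rightarrow> ('x1 \<Rightarrow> 'x2) \<Rightarrow>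
     ('x1 \<times> (nat \<Rightarrow> 'k) \<Rightarrow> 'k) set set \<Rightarrow> ('x2 \<times> (nat \<Rightarrow> 'k) \<Rightarrow> 'k) set set" where
  "Tor_map K A n X2 M f =
     quot_map (Tor_chains K A n X2 M) (Tor_bounds K A n X2 M)
       (tensor_map K A X2 (res_mod K A M n) f (\<lambda>p. p))"


section \<open>Hochschild and tau-Hochschild (co)homology\<close>

text \<open>
  Each theory is given on bimodules \<open>X\<close>, i.e. left modules over the enveloping algebra, and on
  bimodule homomorphisms \<open>f : X \<rightarrow> Y\<close>.
\<close>

definition "HH_coh K A n X = Ext K (env_alg K A) n (reg_bimod K A) X"

definition "HH_coh_map K A n X Y f = Ext_map K (env_alg K A) n (reg_bimod K A) Y f"

definition "HH_hom K A n X = Tor K (env_alg K A) n (twist K A X) (reg_bimod K A)"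

definition "HH_hom_map K A n X Y f = Tor_map K (env_alg K A) n (twist K A Y) (reg_bimod K A) f"

definition "tau_A K A n = tau_n K (env_alg K A) n (reg_bimod K A)"

definition "tau_coh K A n X = dual K (reg K) (Hom_space (env_alg K A) X (tau_A K A n))"

definition "tau_coh_map K A n X Y f =
  (\<lambda>\<phi>. \<lambda>g \<in> mhom (env_alg K A) Y (tau_A K A n). \<phi> (compose (carrier X) g f))"

definition "tau_hom K A n X = Hom_space (env_alg K A) (bimod_dual K A X) (tau_A K A n)"

definition "tau_hom_map K A n X Y f =
  (\<lambda>h. compose (carrier (bimod_dual K A Y)) h (\<lambda>\<psi>. compose (carrier X) \<psi> f))"

text \<open>
  Natural \<open>K\<close>-linear isomorphism between two functors from finite-dimensional \<open>A\<close>-modules to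
  \<open>K\<close>-spaces. A functor is an object part together with an action \<open>X Y f\<close> on morphisms
  \<open>f : X \<rightarrow> Y\<close>; the modules range over an arbitrary carrier type.
\<close>
definition naturally_iso ::
    "'k ring \<Rightarrow> ('k, 'a) module \<Rightarrow>
     (('a, 'x) module \<Rightarrow> ('k, 'f) module) \<Rightarrow>
     (('a, 'x) module \<Rightarrow> ('a, 'x) module \<Rightarrow> ('x \<Rightarrow> 'x) \<Rightarrow> 'f \<Rightarrow> 'f) \<Rightarrow>
     (('a, 'x) module \<Rightarrow> ('k, 'g) module) \<Rightarrow>
     (('a, 'x) module \<Rightarrow> ('a, 'x) module \<Rightarrow> ('x \<Rightarrow> 'x) \<Rightarrow> 'g \<Rightarrow> 'g) \<Rightarrow> bool" where
  "naturally_iso K A F F_map G G_map \<longleftrightarrow> (\<exists>\<Phi>.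
     (\<forall>X. fd_module K A X \<longrightarrow> \<Phi> X \<in> miso K (F X) (G X)) \<and>
     (\<forall>X Y f. fd_module K A X \<and> fd_module K A Y \<and> f \<in> mhom A X Y \<longrightarrow>
        (\<forall>\<xi> \<in> carrier (F X). \<Phi> Y (F_map X Y f \<xi>) = G_map X Y f (\<Phi> X \<xi>))))"

end

theory Submission
  imports Defs
begin

text \<open>
  If \<open>P1 \<rightarrow> P0 \<rightarrow> N\<close> is a minimal projective presentation, \<open>D Hom(X, D Tr N)\<close> is the cokernel of
  \<open>Hom(P0, X) \<rightarrow> Hom(P1, X)\<close>, by evaluation on a dual basis of \<open>P1\<close>. For the syzygy \<open>N = \<Omega>^(n-1) M\<close>
  this is \<open>Ext^n(M, X)\<close> as soon as \<open>\<Omega>^(n+1) M = 0\<close>, and \<open>Tor_n(X, M)\<close> follows by pairing with \<open>D X\<close>.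
  So the claim is that the minimal bimodule resolution of \<open>\<Lambda>\<close> has length at most \<open>d\<close>.
  Since \<open>Ext(\<Lambda>, Hom_k(S, N)) = Ext_\<Lambda>(S, N)\<close> for \<open>\<Lambda>\<close>-modules \<open>S\<close> and \<open>N\<close>, dimension shifting along a
  resolution of \<open>S\<close> extends every map \<open>\<Omega>^(d+1) \<Lambda> \<rightarrow> Hom_k(S, N)\<close> to the projective cover \<open>P_d\<close> of
  \<open>\<Omega>^d \<Lambda>\<close>. A Casimir element of the separable algebra \<open>\<Lambda> / rad \<Lambda>\<close> makes every bimodule \<open>X\<close> with
  \<open>X rad \<Lambda> = 0\<close> a direct summand of \<open>Hom_k(\<Lambda> / rad \<Lambda>, X)\<close>, and right socles filter an arbitrary bimodule
  by such. Hence the identity of \<open>\<Omega>^(d+1) \<Lambda>\<close> extends to \<open>P_d\<close>, and minimality forces \<open>\<Omega>^(d+1) \<Lambda> = 0\<close>.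
\<close>

text \<open>Ext and Tor are defined on an arbitrary projective resolution, the translate on minimal
  covers, so the two sides share no complex. Their syzygies agree only up to maps through
  projectives, and the comparison keeps a homotopy equivalence in two adjacent degrees. It closes up
  because \<open>\<Omega>^(n+1) M = 0\<close> makes \<open>P1 \<rightarrow> P0\<close> injective, so
  that every map out of \<open>P1\<close> is a cocycle. In the vanishing of the syzygy the bimodule
  Hom_k(S, N) admits an arbitrary left module \<open>N\<close>; hence only the right action of the
  radical has to be made trivial, and no simple bimodules appear. Long exact sequences are replaced
  by one property, the extension of maps from a syzygy to the cover, which is the vanishing of a
  first Ext. Definitions that quantify over modules fix the type
  \<open>nat \<Rightarrow> 'k\<close>, so modules of other types are moved there by coordinates.
  Finite dimension stands in for chain conditions: covers, maximal left ideals and socle elements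
  are found by optimizing a dimension.\<close>

abbreviation (input) "lmod \<equiv> left_module"
abbreviation (input) "car \<equiv> carrier"
abbreviation (input) mem_carrier (infix ":." 50) where "x :. M \<equiv> x \<in> carrier M"
abbreviation (input) smult_sub ("(_ *\<^sub>_ _)" [70, 1000, 71] 70) where "a *\<^sub>M x \<equiv> a \<odot>\<^bsub>M\<^esub> x"
abbreviation (input) add_sub ("(_ \<oplus>\<^sub>_ _)" [65, 1000, 66] 65) where "x \<oplus>\<^sub>M y \<equiv> x \<oplus>\<^bsub>M\<^esub> y"
abbreviation (input) mult_sub ("(_ \<otimes>\<^sub>_ _)" [70, 1000, 71] 70) where "x \<otimes>\<^sub>M y \<equiv> x \<otimes>\<^bsub>M\<^esub> y"
abbreviation (input) minus_sub ("(_ \<ominus>\<^sub>_ _)" [65, 1000, 66] 65) where "x \<ominus>\<^sub>M y \<equiv> x \<ominus>\<^bsub>M\<^esub> y"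
abbreviation (input) uminus_sub ("(\<ominus>\<^sub>_ _)" [1000, 81] 80) where "\<ominus>\<^sub>M y \<equiv> \<ominus>\<^bsub>M\<^esub> y"
abbreviation (input) zero_sub ("\<zero>\<^sub>_" [1000] 1000) where "\<zero>\<^sub>M \<equiv> \<zero>\<^bsub>M\<^esub>"
abbreviation (input) one_sub ("\<one>\<^sub>_" [1000] 1000) where "\<one>\<^sub>M \<equiv> \<one>\<^bsub>M\<^esub>"
abbreviation (input) coset_sub ("(_ +>\<^sub>_ _)" [60, 1000, 61] 60) where "N +>\<^sub>M x \<equiv> N +>\<^bsub>M\<^esub> x"


section \<open>Elementary laws of modules and submodules over a ring\<close>

context left_module
begin

declare smult_closed [simp] smult_one [simp]

lemma smult_l_null [simp]: "x :. M ==> \<zero> *\<^sub>M x = \<zero>\<^sub>M"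
 by (metis M.add.r_cancel_one' R.l_zero R.zero_closed smult_closed smult_l_distr)

lemma smult_r_null [simp]: "a :. R ==> a *\<^sub>M \<zero>\<^sub>M = \<zero>\<^sub>M"
 by (metis M.add.r_cancel_one' M.l_zero M.zero_closed smult_closed smult_r_distr)

lemma smult_r_minus:
 "[|a :. R; x :. M|] ==> a *\<^sub>M (\<ominus>\<^sub>M x) = \<ominus>\<^sub>M (a *\<^sub>M x)"
 by (metis M.add.inv_closed M.l_neg M.minus_equality smult_closed smult_r_distr smult_r_null)

lemma smult_l_minus:
 "[|a :. R; x :. M|] ==> (\<ominus> a) *\<^sub>M x = \<ominus>\<^sub>M (a *\<^sub>M x)"
 by (metis M.minus_equality R.add.inv_closed R.l_neg smult_closed smult_l_distr smult_l_null)

lemma smult_r_diff: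
 "[|a :. R; x :. M; y :. M|] ==>
  a *\<^sub>M (x \<ominus>\<^sub>M y) = a *\<^sub>M x \<ominus>\<^sub>M a *\<^sub>M y"
 by (simp add: M.minus_eq smult_r_distr smult_r_minus)

lemma finsum_smult:
 "[|finite A; a :. R; f : A \<rightarrow> car M|] ==>
  a *\<^sub>M (\<Oplus>\<^bsub>M\<^esub> i \<in> A. f i) = (\<Oplus>\<^bsub>M\<^esub> i \<in> A. a *\<^sub>M f i)"
 by (induct set: finite) (simp_all add: Pi_def smult_r_distr)

text \<open>Negatives come as multiples by \<open>\<ominus> \<one>\<close>.\<close>

lemma submodI:
 assumes "H \<subseteq> car M" "\<zero>\<^sub>M : H"
  and "!!x y. [|x : H; y : H|] ==> x \<oplus>\<^sub>M y : H"
  and "!!a x. [|a :. R; x : H|] ==> a *\<^sub>M x : H"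
 shows "submodule H R M"
proof (intro submodule.intro subgroup.intro)
 fix x assume "x : H"
 with assms(4)[of "\<ominus> \<one>" x] assms(1) have "\<ominus>\<^sub>M x : H" by (auto simp: smult_l_minus)
 then show "inv\<^bsub>add_monoid M\<^esub> x : H" by (simp add: a_inv_def)
qed (use assms in "auto simp: submodule_axioms_def")

lemma submodD:
 assumes "submodule H R M"
 shows submod_sub: "!!x. x : H ==> x :. M"
  and submod_zero: "\<zero>\<^sub>M : H"
  and submod_add: "!!x y. [|x : H; y : H|] ==> x \<oplus>\<^sub>M y : H"
  and submod_smult: "!!a x. [|a :. R; x : H|] ==> a *\<^sub>M x : H"
  and submod_minus: "!!x. x : H ==> \<ominus>\<^sub>M x : H"
  and submod_diff: "!!x y. [|x : H; y : H|] ==> x \<ominus>\<^sub>M y : H"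
proof -
 interpret H: submodule H R M by fact
 show 1: "!!x. x : H ==> x :. M" using H.subset by auto
 show "\<zero>\<^sub>M : H" using H.one_closed by simp
 show 2: "!!x y. [|x : H; y : H|] ==> x \<oplus>\<^sub>M y : H" using H.m_closed by simp
 show 3: "!!a x. [|a :. R; x : H|] ==> a *\<^sub>M x : H" by (rule H.smult_closed)
 show 4: "\<ominus>\<^sub>M x : H" if "x : H" for x
  using 3[of "\<ominus> \<one>" x] that 1 by (auto simp: smult_l_minus)
 show "!!x y. [|x : H; y : H|] ==> x \<ominus>\<^sub>M y : H" by (simp add: 2 4 M.minus_eq)
qed

lemma submod_finsum:
 assumes "submodule H R M" "f : A \<rightarrow> H" shows "(\<Oplus>\<^bsub>M\<^esub> i \<in> A. f i) : H"
proof (cases "finite A")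
 case True
 then show ?thesis using assms(2)
 proof (induct)
  case empty show ?case using submod_zero[OF assms(1)] by simp
 next
  case (insert x F)
  then have "f x :. M" "f : F \<rightarrow> car M" "f x : H"
   using submod_sub[OF assms(1)] by auto
  then show ?case using insert submod_add[OF assms(1)] by simp
 qed
qed (use submod_zero[OF assms(1)] in "simp add: M.finsum_infinite")

lemma submodule_carrier: "submodule (car M) R M"
 by (rule submodI) auto

lemma submodule_zero: "submodule {\<zero>\<^sub>M} R M"
 by (rule submodI) auto

lemma submodule_Inter:
 assumes "!!H. H : S ==> submodule H R M" "S ~= {}"
 shows "submodule (\<Inter>S) R M"
proof (rule submodI)
 show "\<Inter>S \<subseteq> car M" using assms submod_sub by blast
qed (use assms submod_zero submod_add submod_smult in blast)+

lemma diff_eq_zero_iff: "[|x :. M; y :. M|] ==> x \<ominus>\<^sub>M y = \<zero>\<^sub>M \<longleftrightarrow> x = y"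
 by (metis M.add.inv_closed M.minus_equality M.minus_eq M.minus_minus M.r_neg)

lemma add_diff_cancel: "[|x :. M; y :. M|] ==> x \<oplus>\<^sub>M (y \<ominus>\<^sub>M x) = y"
 by (metis M.add.inv_closed M.a_assoc M.a_comm M.minus_closed M.minus_eq M.r_neg1)

lemma diff_add_cancel: "[|x :. M; y :. M|] ==> (y \<ominus>\<^sub>M x) \<oplus>\<^sub>M x = y"
 by (simp add: M.minus_eq M.a_assoc M.l_neg)

lemma add_diff_cancel_right: "[|x :. M; y :. M|] ==> (x \<oplus>\<^sub>M y) \<ominus>\<^sub>M y = x"
 by (simp add: M.minus_eq M.a_assoc M.r_neg)

lemma diff_eq_diff:
 assumes "a \<oplus>\<^sub>M c = b \<oplus>\<^sub>M d" "a :. M" "b :. M" "c :. M" "d :. M"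
 shows "a \<ominus>\<^sub>M b = d \<ominus>\<^sub>M c"
proof -
 have "a = (d \<oplus>\<^sub>M b) \<ominus>\<^sub>M c"
  using assms add_diff_cancel_right[of a c] M.a_comm[of b d] by simp
 also have "\<dots> = (d \<ominus>\<^sub>M c) \<oplus>\<^sub>M b" using assms by (simp add: M.minus_eq M.a_ac)
 finally show ?thesis using add_diff_cancel_right[of "d \<ominus>\<^sub>M c" b] assms by simp
qed

end

lemma submod_sel [simp]:
 "car (submod M N) = N" "add (submod M N) = add M" "zero (submod M N) = zero M"
 "smult (submod M N) = smult M" "one (submod M N) = one M" "mult (submod M N) = mult M"
 by (simp_all add: submod_def)

lemma left_module_submod:
 assumes "lmod R M" "submodule N R M" shows "lmod R (submod M N)"
proof -
 interpret M: left_module R M by fact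
 note s = M.submod_sub[OF assms(2)] M.submod_zero[OF assms(2)] M.submod_add[OF assms(2)]
  M.submod_smult[OF assms(2)] M.submod_minus[OF assms(2)]
 have inv: "EX y : N. y \<oplus>\<^sub>M x = \<zero>\<^sub>M" if "x : N" for x
  using M.l_neg[OF s(1)[OF that]] s(5)[OF that] by blast
 have "abelian_group (submod M N)"
  by (rule abelian_groupI) (use inv in "simp_all add: s M.a_assoc, simp_all add: s M.a_comm")
 then show ?thesis
  by (intro left_module.intro left_module_axioms.intro)
   (simp_all add: s M.smult_l_distr M.smult_r_distr M.smult_assoc M.R.ring_axioms)
qed

text \<open>\<open>N\<close> starts as a bare record; the axioms are carried over along a surjection
  that respects the operations. This serves coset maps and also the identity between records that
  are built differently but have the same operations.\<close>

lemma left_module_image: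
 assumes "lmod R M" and f: "f ` car M = car N"
  and add: "!!x y. [|x :. M; y :. M|] ==> f (x \<oplus>\<^sub>M y) = f x \<oplus>\<^sub>N f y"
  and smult: "!!a x. [|a :. R; x :. M|] ==> f (a *\<^sub>M x) = a *\<^sub>N f x"
  and zero: "f \<zero>\<^sub>M = \<zero>\<^sub>N"
 shows "lmod R N"
proof -
 interpret M: left_module R M by fact
 have a: "f x \<oplus>\<^sub>N f y = f (x \<oplus>\<^sub>M y)" if "x :. M" "y :. M" for x y
  using add that by simp
 have s: "a *\<^sub>N f x = f (a *\<^sub>M x)" if "a :. R" "x :. M" for a x
  using smult that by simp
 have G: "abelian_group N"
 proof (rule abelian_groupI, unfold f[symmetric])
  fix x assume "x : f ` car M"
  then obtain u where "u :. M" "x = f u" by auto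
  then show "EX y : f ` car M. y \<oplus>\<^sub>N x = \<zero>\<^sub>N"
   by (intro bexI[of _ "f (\<ominus>\<^sub>M u)"]) (auto simp: a zero M.l_neg)
 qed (auto simp: a M.a_assoc zero[symmetric] intro!: arg_cong[where f = f] M.a_comm)
 show ?thesis
  by (intro left_module.intro left_module_axioms.intro G M.R.ring_axioms, unfold f[symmetric])
   (auto simp: a s M.smult_l_distr M.smult_r_distr M.smult_assoc)
qed

text \<open>Hom spaces, duals, \<open>star\<close>, free modules and finitely supported functions
  all carry pointwise operations on extensional functions; only the closure conditions differ from
  one to the next.\<close>

lemma abelian_group_fun:
 assumes N: "abelian_group N"
  and sub: "car F \<subseteq> X \<rightarrow>\<^sub>E car N"
  and add: "!!f g. add F f g = (\<lambda>x\<in>X. f x \<oplus>\<^sub>N g x)"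
  and zero: "zero F = (\<lambda>x\<in>X. \<zero>\<^sub>N)"
  and cl: "!!f g. [|f :. F; g :. F|] ==> (\<lambda>x\<in>X. f x \<oplus>\<^sub>N g x) :. F"
  and z: "(\<lambda>x\<in>X. \<zero>\<^sub>N) :. F"
  and neg: "!!f. f :. F ==> (\<lambda>x\<in>X. \<ominus>\<^sub>N f x) :. F"
 shows "abelian_group F"
proof -
 interpret N: abelian_group N by fact
 have m: "f x :. N" if "f :. F" "x : X" for f x using sub that by auto
 have e: "restrict f X = f" if "f :. F" for f
  using sub that by (meson extensional_restrict PiE_ext PiE_iff subsetD)
 show ?thesis
 proof (rule abelian_groupI)
  fix f assume f: "f :. F"
  show "EX g : car F. g \<oplus>\<^sub>F f = \<zero>\<^sub>F"
   by (rule bexI[OF _ neg[OF f]]) (auto simp: add zero m f N.l_neg intro!: restrict_ext)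
  show "\<zero>\<^sub>F \<oplus>\<^sub>F f = f"
   using e[OF f] by (auto simp: add zero m f cong: restrict_cong)
 qed (auto simp: add zero cl z m N.a_ac intro!: restrict_ext)
qed

text \<open>For maps known only to be additive, typically evaluation of a function at a
  point.\<close>

lemma finsum_additive:
 assumes "abelian_group M" "abelian_group N"
  and cl: "!!x. x :. M ==> f x :. N"
  and add: "!!x y. [|x :. M; y :. M|] ==> f (x \<oplus>\<^sub>M y) = f x \<oplus>\<^sub>N f y"
  and h: "h : S \<rightarrow> car M"
 shows "f (\<Oplus>\<^bsub>M\<^esub> s \<in> S. h s) = (\<Oplus>\<^bsub>N\<^esub> s \<in> S. f (h s))"
proof -
 interpret M: abelian_group M by fact
 interpret N: abelian_group N by fact
 have z: "f \<zero>\<^sub>M = \<zero>\<^sub>N"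
  by (metis M.l_zero M.zero_closed N.add.r_cancel_one' add cl)
 show ?thesis
 proof (cases "finite S")
  case True
  then show ?thesis using h
   by induct (auto simp: z add cl Pi_def)
 qed (simp add: z)
qed

subsection \<open>Homomorphisms\<close>

lemma mhomI:
 assumes "!!x. x :. M ==> f x :. N" "f : extensional (car M)"
  and "!!x y. [|x :. M; y :. M|] ==> f (x \<oplus>\<^sub>M y) = f x \<oplus>\<^sub>N f y"
  and "!!a x. [|a :. R; x :. M|] ==> f (a *\<^sub>M x) = a *\<^sub>N f x"
 shows "f : mhom R M N"
 using assms by (auto simp: mhom_def PiE_def)

lemma mhom_restrictI:
 assumes "lmod R M" "!!x. x :. M ==> f x :. N"
  and "!!x y. [|x :. M; y :. M|] ==> f (x \<oplus>\<^sub>M y) = f x \<oplus>\<^sub>N f y"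
  and "!!a x. [|a :. R; x :. M|] ==> f (a *\<^sub>M x) = a *\<^sub>N f x"
 shows "(\<lambda>x\<in>car M. f x) : mhom R M N"
proof -
 interpret M: left_module R M by fact
 show ?thesis by (rule mhomI) (auto simp: assms)
qed

lemma mhom_closed: "[|f : mhom R M N; x :. M|] ==> f x :. N"
 by (auto simp: mhom_def)

lemma mhom_add:
 "[|f : mhom R M N; x :. M; y :. M|] ==> f (x \<oplus>\<^sub>M y) = f x \<oplus>\<^sub>N f y"
 by (auto simp: mhom_def)

lemma mhom_smult:
 "[|f : mhom R M N; a :. R; x :. M|] ==> f (a *\<^sub>M x) = a *\<^sub>N f x"
 by (auto simp: mhom_def)

lemma mhom_ext: "f : mhom R M N ==> f : extensional (car M)"
 by (auto simp: mhom_def PiE_def)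

lemma mhom_eqI:
 "[|f : mhom R M N; g : mhom R' M N'; !!x. x :. M ==> f x = g x|] ==> f = g"
 by (auto intro: extensionalityI dest: mhom_ext)

locale mod_hom = M: left_module R M + N: left_module R N
 for R and M :: "('a, 'm) module" and N :: "('a, 'n) module" +
 fixes f assumes hom: "f : mhom R M N"
begin

lemma closed [simp]: "x :. M ==> f x :. N"
 using hom by (rule mhom_closed)
lemma add [simp]: "[|x :. M; y :. M|] ==> f (x \<oplus>\<^sub>M y) = f x \<oplus>\<^sub>N f y"
 using hom by (rule mhom_add)
lemma smult [simp]: "[|a :. R; x :. M|] ==> f (a *\<^sub>M x) = a *\<^sub>N f x"
 using hom by (rule mhom_smult)
lemma zero [simp]: "f \<zero>\<^sub>M = \<zero>\<^sub>N"
 by (metis M.M.l_zero M.M.zero_closed N.M.add.r_cancel_one' add closed)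
lemma neg [simp]: "x :. M ==> f (\<ominus>\<^sub>M x) = \<ominus>\<^sub>N f x"
 by (metis M.M.add.inv_closed M.M.l_neg N.M.minus_equality add closed zero)
lemma diff [simp]: "[|x :. M; y :. M|] ==> f (x \<ominus>\<^sub>M y) = f x \<ominus>\<^sub>N f y"
 by (simp add: M.M.minus_eq N.M.minus_eq)
lemma finsum: "h : S \<rightarrow> car M ==> f (\<Oplus>\<^bsub>M\<^esub> s \<in> S. h s) = (\<Oplus>\<^bsub>N\<^esub> s \<in> S. f (h s))"
 by (rule finsum_additive[OF M.M.abelian_group_axioms N.M.abelian_group_axioms]) auto

lemma submodule_ker: "submodule (mker M N f) R M"
 by (rule M.submodI) (auto simp: mker_def)

lemma submodule_vimage:
 assumes "submodule H R N" shows "submodule {x : car M. f x : H} R M"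
 using N.submodD[OF assms] by (intro M.submodI) auto

lemma submodule_image:
 assumes H: "submodule H R M" shows "submodule (f ` H) R N"
proof (rule N.submodI)
 show "f ` H \<subseteq> car N" using M.submod_sub[OF H] by auto
 show "\<zero>\<^sub>N : f ` H" using M.submod_zero[OF H] zero by (metis imageI)
next
 fix x y assume "x : f ` H" "y : f ` H"
 then obtain u v where "u : H" "v : H" "x = f u" "y = f v" by auto
 then show "x \<oplus>\<^sub>N y : f ` H"
  using M.submodD[OF H] by (intro image_eqI[of _ _ "u \<oplus>\<^sub>M v"]) auto
next
 fix a x assume "a :. R" "x : f ` H"
 then obtain u where "u : H" "x = f u" by auto
 with \<open>a :. R\<close> show "a *\<^sub>N x : f ` H"
  using M.submodD[OF H] by (intro image_eqI[of _ _ "a *\<^sub>M u"]) auto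
qed

lemma inj_iff: "inj_on f (car M) \<longleftrightarrow> (ALL x : car M. f x = \<zero>\<^sub>N --> x = \<zero>\<^sub>M)"
proof safe
 fix x assume "inj_on f (car M)" "x :. M" "f x = \<zero>\<^sub>N"
 then show "x = \<zero>\<^sub>M" by (metis M.M.zero_closed inj_onD zero)
next
 assume *: "ALL x : car M. f x = \<zero>\<^sub>N --> x = \<zero>\<^sub>M"
 show "inj_on f (car M)"
 proof (rule inj_onI)
  fix x y assume xy: "x :. M" "y :. M" "f x = f y"
  then have "f (x \<ominus>\<^sub>M y) = \<zero>\<^sub>N" by (simp add: N.diff_eq_zero_iff)
  then show "x = y" using * xy M.diff_eq_zero_iff by blast
 qed
qed

end

lemma mod_homI: "[|lmod R M; lmod R N; f : mhom R M N|] ==> mod_hom R M N f"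
 by (simp add: mod_hom_def mod_hom_axioms_def)

lemma mhom_compose:
 assumes "lmod R M" "f : mhom R M N" "g : mhom R N L"
 shows "compose (car M) g f : mhom R M L"
proof -
 interpret M: left_module R M by fact
 show ?thesis
  by (rule mhomI)
   (auto simp: compose_eq mhom_closed[OF assms(2)] mhom_closed[OF assms(3)]
    mhom_add[OF assms(2)] mhom_add[OF assms(3)] mhom_smult[OF assms(2)] mhom_smult[OF assms(3)])
qed

lemma mhom_id:
 assumes "lmod R M" shows "(\<lambda>x\<in>car M. x) : mhom R M M"
 by (rule mhom_restrictI[OF assms]) auto

lemma mhom_zero:
 assumes "lmod R M" "lmod R N" shows "(\<lambda>x\<in>car M. \<zero>\<^sub>N) : mhom R M N"
proof -
 interpret N: left_module R N by fact
 show ?thesis by (rule mhom_restrictI[OF assms(1)]) auto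
qed

lemma mhom_plus:
 assumes "lmod R M" "lmod R N" "f : mhom R M N" "g : mhom R M N"
 shows "(\<lambda>x\<in>car M. f x \<oplus>\<^sub>N g x) : mhom R M N"
proof -
 interpret f: mod_hom R M N f using assms by (intro mod_homI)
 interpret g: mod_hom R M N g using assms by (intro mod_homI)
 show ?thesis by (rule mhom_restrictI[OF assms(1)]) (auto simp: f.N.M.a_ac f.N.smult_r_distr)
qed

lemma mhom_uminus:
 assumes "lmod R M" "lmod R N" "f : mhom R M N"
 shows "(\<lambda>x\<in>car M. \<ominus>\<^sub>N f x) : mhom R M N"
proof -
 interpret f: mod_hom R M N f using assms by (intro mod_homI)
 show ?thesis
  by (rule mhom_restrictI[OF assms(1)]) (auto simp: f.N.M.minus_add f.N.smult_r_minus f.N.M.a_comm)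
qed

lemma mhom_diff:
 assumes "lmod R M" "lmod R N" "f : mhom R M N" "g : mhom R M N"
 shows "(\<lambda>x\<in>car M. f x \<ominus>\<^sub>N g x) : mhom R M N"
proof -
 have "(\<lambda>x\<in>car M. f x \<ominus>\<^sub>N g x) = (\<lambda>x\<in>car M. f x \<oplus>\<^sub>N (\<lambda>x\<in>car M. \<ominus>\<^sub>N g x) x)"
  by (auto simp: a_minus_def)
 then show ?thesis using mhom_plus[OF assms(1-3) mhom_uminus[OF assms(1,2,4)]] by simp
qed

lemma mhom_submod:
 "f : mhom R M (submod N H) \<longleftrightarrow> f : mhom R M N & f ` car M \<subseteq> H" if "submodule H R N" "lmod R N"
 using left_module.submod_sub[OF that(2,1)] by (auto simp: mhom_def PiE_def Pi_def)

lemma mhom_inclusion: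
 "submodule H R N ==> lmod R N ==> (\<lambda>x\<in>H. x) : mhom R (submod N H) N"
 using mhom_id[OF left_module_submod, of R N H] mhom_submod[of H R N _ "submod N H"] by auto

lemma mhom_restrict_sub:
 assumes "submodule H R M" "lmod R M" "f : mhom R M N"
 shows "restrict f H : mhom R (submod M H) N"
 using left_module.submodD[OF assms(2,1)] assms(3) by (auto simp: mhom_def)

lemma misoI:
 "[|f : mhom R M N; inj_on f (car M); f ` car M = car N|] ==> f : miso R M N"
 by (auto simp: miso_def bij_betw_def)

lemma miso_inv:
 assumes "lmod R M" "lmod R N" "f : miso R M N"
 shows "EX g : miso R N M. (ALL x : car M. g (f x) = x) & (ALL y : car N. f (g y) = y)"
proof -
 interpret f: mod_hom R M N f using assms by (intro mod_homI) (auto simp: miso_def)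
 have b: "bij_betw f (car M) (car N)" using assms(3) by (simp add: miso_def)
 define g where "g = (\<lambda>y\<in>car N. inv_into (car M) f y)"
 have gf: "g (f x) = x" if "x :. M" for x
  using that b by (simp add: g_def bij_betw_inv_into_left)
 have fg: "f (g y) = y" "g y :. M" if "y :. N" for y
  using that b by (simp_all add: g_def bij_betw_inv_into_right bij_betwE[OF bij_betw_inv_into])
 have "g : mhom R N M"
 proof (rule mhomI)
  fix x y assume xy: "x :. N" "y :. N"
  show "g (x \<oplus>\<^sub>N y) = g x \<oplus>\<^sub>M g y"
   using gf[of "g x \<oplus>\<^sub>M g y"] xy by (simp add: fg)
 next
  fix a x assume ax: "a :. R" "x :. N"
  show "g (a *\<^sub>N x) = a *\<^sub>M g x"
   using gf[of "a *\<^sub>M g x"] ax by (simp add: fg)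
 qed (auto simp: fg, simp add: g_def)
 moreover have "bij_betw g (car N) (car M)"
  by (rule bij_betw_byWitness[of _ f]) (auto simp: gf fg)
 ultimately show ?thesis using gf fg by (auto simp: miso_def)
qed

subsection \<open>Quotients\<close>

lemma submodule_abelian_subgroup:
 assumes "lmod R M" "submodule N R M" shows "abelian_subgroup N M"
 using assms by (intro abelian_subgroupI3 additive_subgroup.intro)
  (auto simp: left_module_def submodule_def)

lemma quot_zero [simp]: "zero (quot M N) = N"
 by (simp add: quot_def)

lemma quot_carrier: "car (quot M N) = (%x. N +>\<^sub>M x) ` car M"
 by (auto simp: quot_def A_RCOSETS_def' )

locale submod_of = left_module R M for R and M :: "('a, 'm) module" +
 fixes N assumes sub: "submodule N R M"
begin

lemmas ab = submodule_abelian_subgroup[OF left_module_axioms sub]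

lemma cos_eq: "[|x :. M; y :. M|] ==> N +>\<^sub>M x = N +>\<^sub>M y \<longleftrightarrow> x \<ominus>\<^sub>M y : N"
 by (metis M.minus_eq abelian_subgroup.a_rcos_module[OF ab] abelian_subgroup.a_rcos_self[OF ab] abelian_subgroup.a_repr_independence'[OF ab])

lemma cos_zero: "x :. M ==> N +>\<^sub>M x = N \<longleftrightarrow> x : N"
 by (metis abelian_subgroup.a_rcos_const[OF ab] abelian_subgroup.a_rcos_self[OF ab])

lemma cos_mem: "[|x :. M; y : N +>\<^sub>M x|] ==> y :. M & N +>\<^sub>M y = N +>\<^sub>M x"
 by (metis abelian_subgroup.a_elemrcos_carrier[OF ab] abelian_subgroup.a_repr_independence'[OF ab])

lemma cos_self: "x :. M ==> x : N +>\<^sub>M x"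
 by (rule abelian_subgroup.a_rcos_self[OF ab])

text \<open>\<open>quot\<close> and \<open>quot_map\<close> are defined by unions over all
  representatives of a coset; such a union collapses to a single value once the representatives
  agree.\<close>

lemma cos_const_Union:
 assumes "x :. M" "!!y. y : N +>\<^sub>M x ==> F y = F x"
 shows "(\<Union>y\<in>N +>\<^sub>M x. F y) = F x"
 using cos_self[OF assms(1)] assms(2) by blast

lemma quot_add [simp]: "[|x :. M; y :. M|] ==>
  (N +>\<^sub>M x) \<oplus>\<^bsub>quot M N\<^esub> (N +>\<^sub>M y) = N +>\<^sub>M (x \<oplus>\<^sub>M y)"
 by (simp add: quot_def abelian_subgroup.a_rcos_sum[OF ab])

lemma quot_smult [simp]:
 assumes "a :. R" "x :. M"
 shows "a \<odot>\<^bsub>quot M N\<^esub> (N +>\<^sub>M x) = N +>\<^sub>M (a *\<^sub>M x)"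
proof -
 have "N +>\<^sub>M (a *\<^sub>M y) = N +>\<^sub>M (a *\<^sub>M x)" if "y : N +>\<^sub>M x" for y
 proof -
  have y: "y :. M" "y \<ominus>\<^sub>M x : N"
   using cos_mem[OF assms(2) that] cos_eq assms(2) by auto
  then have "a *\<^sub>M y \<ominus>\<^sub>M a *\<^sub>M x : N"
   using submod_smult[OF sub assms(1)] smult_r_diff[OF assms(1)] assms(2) by metis
  then show ?thesis using cos_eq y assms by auto
 qed
 then show ?thesis using cos_const_Union[OF assms(2), of "%y. N +>\<^sub>M (a *\<^sub>M y)"] by (simp add: quot_def)
qed

lemma left_module_quot: "lmod R (quot M N)"
 by (rule left_module_image[OF left_module_axioms, of "%x. N +>\<^sub>M x"])
  (use cos_zero submod_zero[OF sub] in "auto simp: quot_carrier")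

lemma cos_closed [simp]: "x :. M ==> N +>\<^sub>M x :. (quot M N)"
 by (simp add: quot_carrier)

lemma quotE:
 assumes "C :. (quot M N)" obtains x where "x :. M" "C = N +>\<^sub>M x"
 using assms by (auto simp: quot_carrier)

lemma quot_proj: "(\<lambda>x\<in>car M. N +>\<^sub>M x) : mhom R M (quot M N)"
 by (rule mhom_restrictI[OF left_module_axioms])
  (auto simp: quot_carrier)

text \<open>The value is read off at a chosen representative. Two representatives differ by an
  element of \<open>N\<close>, which \<open>f\<close> kills.\<close>

lemma quot_lift:
 assumes "lmod R L" "f : mhom R M L" "!!x. x : N ==> f x = \<zero>\<^sub>L"
 shows "EX g : mhom R (quot M N) L. ALL x : car M. g (N +>\<^sub>M x) = f x"
proof -
 interpret f: mod_hom R M L f using assms by (intro mod_homI left_module_axioms)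
 define g where "g = (\<lambda>C\<in>car (quot M N). f (SOME x. x : C))"
 have g: "g (N +>\<^sub>M x) = f x" if x: "x :. M" for x
 proof -
  have "(SOME y. y : N +>\<^sub>M x) : N +>\<^sub>M x"
   by (rule someI[of "%y. y : N +>\<^sub>M x", OF cos_self[OF x]])
  then have y: "(SOME y. y : N +>\<^sub>M x) :. M" "(SOME y. y : N +>\<^sub>M x) \<ominus>\<^sub>M x : N"
   using cos_mem[OF x] cos_eq x by blast+
  then have "f (SOME y. y : N +>\<^sub>M x) = f x"
   using assms(3)[OF y(2)] x by (simp add: f.N.diff_eq_zero_iff)
  then show ?thesis by (simp add: g_def x)
 qed
 have "g : mhom R (quot M N) L"
 proof (rule mhomI)
  show "g : extensional (car (quot M N))" by (simp add: g_def)
 next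
  fix C D assume "C :. (quot M N)" "D :. (quot M N)"
  then obtain x y where "x :. M" "C = N +>\<^sub>M x" "y :. M" "D = N +>\<^sub>M y"
   by (metis quotE)
  then show "g (C \<oplus>\<^bsub>quot M N\<^esub> D) = g C \<oplus>\<^sub>L g D"
   by (simp add: g)
 next
  fix a C assume "a :. R" "C :. (quot M N)"
  moreover then obtain x where "x :. M" "C = N +>\<^sub>M x" by (metis quotE)
  ultimately show "g (a \<odot>\<^bsub>quot M N\<^esub> C) = a *\<^sub>L g C"
   by (simp add: g)
 next
  fix C assume "C :. (quot M N)"
  then show "g C :. L" by (metis quotE g f.closed)
 qed
 then show ?thesis using g by blast
qed

end

lemma submod_ofI: "[|lmod R M; submodule N R M|] ==> submod_of R M N"
 by (simp add: submod_of_def submod_of_axioms_def)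

lemma quot_map_cos:
 assumes "submod_of R M N" "submod_of R M' N'" "f : mhom R M M'"
  and "!!x. x : N ==> f x : N'" "x :. M"
 shows "quot_map M' N' f (N +>\<^sub>M x) = N' +>\<^sub>M' f x"
proof -
 interpret N: submod_of R M N by fact
 interpret N': submod_of R M' N' by fact
 interpret f: mod_hom R M M' f by (rule mod_homI) (unfold_locales, rule assms(3))
 have "N' +>\<^sub>M' f y = N' +>\<^sub>M' f x" if "y : N +>\<^sub>M x" for y
  using N.cos_mem[OF assms(5) that] N.cos_eq[of y x] assms(4)[of "y \<ominus>\<^sub>M x"] assms(5)
  by (simp add: N'.cos_eq)
 then show ?thesis unfolding quot_map_def by (rule N.cos_const_Union[OF assms(5)])
qed

section \<open>Linear algebra over a field\<close>

lemma image_eq_subsetI: "[|f ` A = B; !!x. x : A ==> f x : N|] ==> B \<subseteq> N"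
 by auto

lemma retract_image_eq:
 "[|!!x. x : A ==> f x : B; !!y. y : B ==> y : A & f y = y|] ==> f ` A = B"
 by force

lemma reg_sel [simp]:
 "car (reg R) = car R" "add (reg R) = add R" "zero (reg R) = zero R"
 "smult (reg R) = mult R" "one (reg R) = one R" "mult (reg R) = mult R"
 by (simp_all add: reg_def)

lemma scal_sel [simp]:
 "car (scal A M) = car M" "add (scal A M) = add M" "zero (scal A M) = zero M"
 "smult (scal A M) = (%c x. (c *\<^sub>A \<one>\<^sub>A) *\<^sub>M x)"
 by (simp_all add: scal_def)

lemma Hom_space_sel [simp]:
 "car (Hom_space A M N) = mhom A M N" "zero (Hom_space A M N) = (\<lambda>x\<in> car M. \<zero>\<^sub>N)"
 "add (Hom_space A M N) = (%f g. \<lambda>x\<in> car M. f x \<oplus>\<^sub>N g x)"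
 "smult (Hom_space A M N) = (%c f. \<lambda>x\<in> car M. (c *\<^sub>A \<one>\<^sub>A) *\<^sub>N f x)"
 by (simp_all add: Hom_space_def)

lemma dual_sel [simp]:
 "car (dual K A M) = mhom K (scal A M) (reg K)" "zero (dual K A M) = (\<lambda>x\<in> car M. \<zero>\<^sub>K)"
 "add (dual K A M) = (%f g. \<lambda>x\<in> car M. f x \<oplus>\<^sub>K g x)"
 "smult (dual K A M) = (%a f. \<lambda>x\<in> car M. f (a *\<^sub>M x))"
 by (simp_all add: dual_def)

lemma left_module_reg: "ring R ==> lmod R (reg R)"
proof -
 assume "ring R"
 then interpret ring R .
 have "abelian_group (reg R)"
  by (rule abelian_groupI) (use l_neg in "auto simp: a_ac")
 then show ?thesis
  by (intro left_module.intro left_module_axioms.intro)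
   (simp_all add: l_distr r_distr m_assoc ring_axioms)
qed

lemma finsum_reg [simp]: "finsum (reg R) = finsum R"
 by (intro ext) (simp add: finsum_def finprod_def reg_def)

lemma a_inv_reg [simp]: "a_inv (reg R) = a_inv R"
 by (intro ext) (simp add: a_inv_def m_inv_def)

lemma a_inv_scal [simp]: "a_inv (scal A M) = a_inv M"
 by (intro ext) (simp add: a_inv_def m_inv_def)

lemma finsum_scal [simp]: "finsum (scal A M) = finsum M"
 by (intro ext) (simp add: finsum_def finprod_def scal_def)

lemma finsum_submod_eq:
 assumes "lmod R M" "submodule N R M" "f : S \<rightarrow> N"
 shows "finsum (submod M N) f S = finsum M f S"
proof -
 interpret M: left_module R M by fact
 interpret N: left_module R "submod M N" using assms by (intro left_module_submod)
 show ?thesis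
  using finsum_additive[OF N.M.abelian_group_axioms M.M.abelian_group_axioms, of "%x. x" f S]
   M.submod_sub[OF assms(2)] assms(3) by simp
qed

subsection \<open>Generating sets and bases\<close>

text \<open>Generation is phrased through submodules instead of linear combinations, so that a
  property of all elements follows once it defines a submodule containing \<open>C\<close>.\<close>

definition gen :: "('a, 'c) ring_scheme \<Rightarrow> ('a, 'm) module \<Rightarrow> 'm set \<Rightarrow> bool" where
 "gen R M C \<longleftrightarrow> C \<subseteq> car M & (ALL N. submodule N R M --> C \<subseteq> N --> car M \<subseteq> N)"

lemma genD: "[|gen R M C; submodule N R M; C \<subseteq> N; x :. M|] ==> x : N"
 by (auto simp: gen_def)

lemma gen_sub: "gen R M C ==> C \<subseteq> car M"
 by (auto simp: gen_def)

lemma gen_image: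
 assumes "lmod R M" "lmod R N" "f : mhom R M N" "f ` car M = car N" "gen R M C"
 shows "gen R N (f ` C)"
proof -
 interpret f: mod_hom R M N f using assms by (intro mod_homI)
 show ?thesis unfolding gen_def
 proof safe
  fix H y assume H: "submodule H R N" "f ` C \<subseteq> H" "y :. N"
  then obtain x where x: "x :. M" "y = f x" using assms(4) by blast
  have "x : {x : car M. f x : H}"
   using genD[OF assms(5) f.submodule_vimage[OF H(1)]] H(2) x(1) gen_sub[OF assms(5)] by blast
  then show "y : H" using x by simp
 qed (use gen_sub[OF assms(5)] in auto)
qed

lemma gen_hom_eq:
 assumes "lmod R M" "lmod R N" "f : mhom R M N" "g : mhom R M N" "gen R M C"
  and "!!x. x : C ==> f x = g x" "x :. M"
 shows "f x = g x"
proof -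
 interpret f: mod_hom R M N f using assms by (intro mod_homI)
 interpret g: mod_hom R M N g using assms by (intro mod_homI)
 have "submodule {x : car M. f x = g x} R M"
  by (rule f.M.submodI) auto
 from genD[OF assms(5) this] assms(6,7) gen_sub[OF assms(5)] show ?thesis by auto
qed

text \<open>The linear combinations form a submodule, and each generator is the combination with
  Kronecker coefficients. Coefficients are made extensional in order to match
  \<open>vbasis\<close>.\<close>

lemma gen_comb:
 assumes "lmod R M" "finite C" "gen R M C" "x :. M"
 shows "EX c : C \<rightarrow>\<^sub>E car R. x = (\<Oplus>\<^bsub>M\<^esub> b \<in> C. c b *\<^sub>M b)"
proof -
 interpret M: left_module R M by fact
 let ?s = "%c. \<Oplus>\<^bsub>M\<^esub> b \<in> C. c b *\<^sub>M b"
 have C: "!!b. b : C ==> b :. M" using gen_sub[OF assms(3)] by auto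
 have cong: "?s (restrict c C) = ?s c" if "c : C \<rightarrow> car R" for c
  using that C by (intro M.M.finsum_cong') (auto intro!: M.smult_closed)
 let ?N = "?s ` (C \<rightarrow> car R)"
 have "submodule ?N R M"
 proof (rule M.submodI)
  have "?s (%b. \<zero>\<^sub>R) = (\<Oplus>\<^bsub>M\<^esub> b \<in> C. \<zero>\<^sub>M)" using C by (intro M.M.finsum_cong') (auto intro!: M.smult_closed)
  then show "\<zero>\<^sub>M : ?N" by (intro image_eqI[of _ _ "%b. \<zero>\<^sub>R"]) auto
 next
  fix x y assume "x : ?N" "y : ?N"
  then obtain c d where c: "c : C \<rightarrow> car R" "x = ?s c" and d: "d : C \<rightarrow> car R" "y = ?s d"
   by auto
  have "?s (%b. c b \<oplus>\<^sub>R d b) = (\<Oplus>\<^bsub>M\<^esub> b \<in> C. c b *\<^sub>M b \<oplus>\<^sub>M d b *\<^sub>M b)"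
   using c d C by (intro M.M.finsum_cong') (auto simp: M.smult_l_distr Pi_iff intro!: M.smult_closed)
  also have "\<dots> = x \<oplus>\<^sub>M y"
   unfolding c d using c d C by (intro M.M.finsum_addf) (auto intro!: M.smult_closed)
  finally show "x \<oplus>\<^sub>M y : ?N"
   using c d by (intro image_eqI[of _ _ "%b. c b \<oplus>\<^sub>R d b"]) auto
 next
  fix a x assume a: "a :. R" "x : ?N"
  then obtain c where c: "c : C \<rightarrow> car R" "x = ?s c" by auto
  have "a *\<^sub>M x = (\<Oplus>\<^bsub>M\<^esub> b \<in> C. a *\<^sub>M (c b *\<^sub>M b))"
   unfolding c using a c C by (intro M.finsum_smult assms(2)) (auto intro!: M.smult_closed)
  also have "\<dots> = ?s (%b. a \<otimes>\<^sub>R c b)"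
   using a c C by (intro M.M.finsum_cong') (auto simp: M.smult_assoc Pi_iff intro!: M.smult_closed)
  finally show "a *\<^sub>M x : ?N"
   using a c by (intro image_eqI[of _ _ "%b. a \<otimes>\<^sub>R c b"]) auto
 qed (use C in "auto intro!: M.M.finsum_closed M.smult_closed")
 moreover have "C \<subseteq> ?N"
 proof
  fix x assume x: "x : C"
  have "?s (%b. if x = b then \<one>\<^sub>R else \<zero>\<^sub>R) = (\<Oplus>\<^bsub>M\<^esub> b \<in> C. if x = b then b else \<zero>\<^sub>M)"
   using C by (intro M.M.finsum_cong') (auto intro!: M.smult_closed)
  also have "\<dots> = x"
   using M.M.finsum_singleton[OF x assms(2), of "%b. b"] C by auto
  finally show "x : ?N"
   by (intro image_eqI[of _ _ "%b. if x = b then \<one>\<^sub>R else \<zero>\<^sub>R"]) auto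
 qed
 ultimately have "x : ?N" using genD[OF assms(3)] assms(4) by blast
 then obtain c where "c : C \<rightarrow> car R" "x = ?s c" by auto
 then show ?thesis using cong[of c] by (intro bexI[of _ "restrict c C"]) auto
qed

locale vs = field K for K :: "'k ring"
begin

lemma module_iff: "module K V \<longleftrightarrow> lmod K V"
proof
 assume "module K V"
 then interpret module K V .
 show "lmod K V"
  by unfold_locales (auto simp: smult_l_distr smult_r_distr smult_assoc1)
next
 assume "lmod K V"
 then interpret left_module K V .
 show "module K V"
  by unfold_locales (auto simp: smult_l_distr smult_r_distr smult_assoc)
qed

lemma lm_reg: "lmod K (reg K)"
 by (rule left_module_reg) (rule ring_axioms)

lemma smult_cancel_mem:
 assumes "lmod K V" "submodule N K V" "a :. K" "a ~= \<zero>\<^sub>K" "x :. V"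
  "a *\<^sub>V x : N"
 shows "x : N"
proof -
 interpret V: left_module K V by fact
 have "a : Units K" using assms by (simp add: field_Units)
 then have "inv\<^bsub>K\<^esub> a *\<^sub>V (a *\<^sub>V x) = x"
  using assms by (simp flip: V.smult_assoc add: Units_l_inv)
 then show ?thesis using V.submod_smult[OF assms(2) _ assms(6), of "inv\<^bsub>K\<^esub> a"] \<open>a : Units K\<close> by simp
qed

text \<open>One of the generators occurring in a nonzero kernel element becomes redundant in the image.\<close>
lemma gen_drop:
 assumes V: "lmod K V" and W: "lmod K W"
  and f: "f : mhom K V W" "f ` car V = car W"
  and C: "finite C" "gen K V C" and w: "w :. V" "w ~= \<zero>\<^sub>V" "f w = \<zero>\<^sub>W"
 shows "EX D. finite D & gen K W D & card D < card C"
proof -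
 interpret f: mod_hom K V W f using V W f(1) by (intro mod_homI)
 have CV: "!!b. b : C ==> b :. V" using gen_sub[OF C(2)] by auto
 obtain c where c: "c : C \<rightarrow>\<^sub>E car K" "w = (\<Oplus>\<^bsub>V\<^esub> b \<in> C. c b *\<^sub>V b)"
  using gen_comb[OF V C w(1)] by auto
 have "EX j : C. c j ~= \<zero>\<^sub>K"
 proof (rule ccontr)
  assume "\<not> ?thesis"
  then have "w = (\<Oplus>\<^bsub>V\<^esub> b \<in> C. \<zero>\<^sub>V)"
   unfolding c(2) using CV by (intro f.M.M.finsum_cong') (auto intro!: f.M.smult_closed)
  then show False using w(2) by simp
 qed
 then obtain j where j: "j : C" "c j ~= \<zero>\<^sub>K" by auto
 have cj: "c j :. K" using c j by auto
 let ?D = "f ` (C - {j})"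
 have split: "w = c j *\<^sub>V j \<oplus>\<^sub>V (\<Oplus>\<^bsub>V\<^esub> b \<in> C - {j}. c b *\<^sub>V b)"
 proof -
  have "w = (\<Oplus>\<^bsub>V\<^esub> b \<in> insert j (C - {j}). c b *\<^sub>V b)"
   using j c(2) by (simp add: insert_absorb)
  also have "\<dots> = c j *\<^sub>V j \<oplus>\<^sub>V (\<Oplus>\<^bsub>V\<^esub> b \<in> C - {j}. c b *\<^sub>V b)"
   using C(1) j CV c(1) by (intro f.M.M.finsum_insert) (auto intro!: f.M.smult_closed)
  finally show ?thesis .
 qed
 have "gen K W ?D"
  unfolding gen_def
 proof (intro conjI allI impI)
  show "?D \<subseteq> car W" using CV by auto
 next
  fix N assume N: "submodule N K W" "?D \<subseteq> N"
  let ?N = "{x : car V. f x : N}"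
  note sN = f.submodule_vimage[OF N(1)]
  have "(%b. c b *\<^sub>V b) : C - {j} \<rightarrow> ?N"
  proof
   fix b assume b: "b : C - {j}"
   then have "c b :. K" "b :. V" "f b : N" using N(2) CV c(1) by auto
   then show "c b *\<^sub>V b : ?N" using f.N.submod_smult[OF N(1)] by simp
  qed
  then have 1: "(\<Oplus>\<^bsub>V\<^esub> b \<in> C - {j}. c b *\<^sub>V b) : ?N" (is "?u : _")
   by (rule f.M.submod_finsum[OF sN])
  \<comment> \<open>Since \<open>f w\<close> is zero, \<open>w\<close> lies in the preimage of
    \<open>N\<close>; so does the rest of the sum, hence also \<open>c j\<close> times
    \<open>j\<close>, and \<open>c j\<close> is invertible.\<close>
  have "w : ?N" using w f.N.submod_zero[OF N(1)] by simp
  moreover have "c j *\<^sub>V j = w \<ominus>\<^sub>V ?u"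
   using 1 cj CV[OF j(1)] by (subst split) (simp add: f.M.add_diff_cancel_right)
  ultimately have "c j *\<^sub>V j : ?N"
   using f.M.submod_diff[OF sN _ 1] by simp
  then have "j : ?N"
   using smult_cancel_mem[OF V sN cj j(2) CV[OF j(1)]] by blast
  then have "C \<subseteq> ?N" using N(2) CV by auto
  then have "car V \<subseteq> ?N" using genD[OF C(2) sN] by blast
  then have "!!x. x :. V ==> f x : N" by (simp add: subset_iff)
  then show "car W \<subseteq> N" by (rule image_eq_subsetI[OF f(2)])
 qed
 moreover have "card ?D < card C"
  using card_image_le[of "C - {j}" f] card_Diff1_less[OF C(1) j(1)] C(1) by simp
 ultimately show ?thesis using C(1) by (intro exI[of _ ?D]) simp
qed

lemma vbasis_gen:
 assumes "lmod K V" "vbasis K V B" shows "finite B" "gen K V B"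
proof -
 interpret V: left_module K V by fact
 show "finite B" using assms(2) by (simp add: vbasis_def)
 show "gen K V B" unfolding gen_def
 proof safe
  fix N x assume N: "submodule N K V" "B \<subseteq> N" "x :. V"
  then obtain c where "c : B \<rightarrow>\<^sub>E car K" "x = (\<Oplus>\<^bsub>V\<^esub> b \<in> B. c b *\<^sub>V b)"
   using assms(2) unfolding vbasis_def by metis
  then show "x : N" using N by (auto intro!: V.submod_finsum V.submod_smult)
 qed (use assms(2) in "auto simp: vbasis_def")
qed

text \<open>A generating set of least size is a basis: if two coefficient families give the same
  vector, they differ at some \<open>j\<close>, and dividing by the difference expresses
  \<open>j\<close> through the other generators.\<close>

lemma ex_vbasis:
 assumes V: "lmod K V" and C: "finite C" "gen K V C"
 shows "EX B. vbasis K V B"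
proof -
 interpret V: left_module K V by fact
 define n where "n = (LEAST n. EX C. finite C & gen K V C & card C = n)"
 have "EX C. finite C & gen K V C & card C = n"
  unfolding n_def by (rule LeastI_ex) (use C in blast)
 then obtain B where B: "finite B" "gen K V B" "card B = n" by blast
 have min: "\<not> gen K V D" if "finite D" "card D < n" for D
  using that not_less_Least unfolding n_def by blast
 have BV: "!!b. b : B ==> b :. V" using gen_sub[OF B(2)] by auto
 have uniq: "c = d" if c: "c : B \<rightarrow>\<^sub>E car K" and d: "d : B \<rightarrow>\<^sub>E car K"
  and e: "(\<Oplus>\<^bsub>V\<^esub> b \<in> B. c b *\<^sub>V b) = (\<Oplus>\<^bsub>V\<^esub> b \<in> B. d b *\<^sub>V b)" for c d
 proof (rule ccontr)
  assume "c ~= d"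
  then obtain j where j: "j : B" "c j ~= d j" using c d by (metis PiE_ext)
  have cd: "c b :. K" "d b :. K" if "b : B" for b using c d that by auto
  have s: "(\<Oplus>\<^bsub>V\<^esub> b \<in> B. h b *\<^sub>V b) = h j *\<^sub>V j \<oplus>\<^sub>V (\<Oplus>\<^bsub>V\<^esub> b \<in> B - {j}. h b *\<^sub>V b)"
   if "h : B \<rightarrow>\<^sub>E car K" for h
  proof -
   have "(\<Oplus>\<^bsub>V\<^esub> b \<in> B. h b *\<^sub>V b) = (\<Oplus>\<^bsub>V\<^esub> b \<in> insert j (B - {j}). h b *\<^sub>V b)"
    using j by (simp add: insert_absorb)
   also have "\<dots> = h j *\<^sub>V j \<oplus>\<^sub>V (\<Oplus>\<^bsub>V\<^esub> b \<in> B - {j}. h b *\<^sub>V b)"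
    using B(1) j BV that by (intro V.M.finsum_insert) (auto intro!: V.smult_closed)
   finally show ?thesis .
  qed
  have "gen K V (B - {j})" unfolding gen_def
  proof (intro conjI allI impI)
   show "B - {j} \<subseteq> car V" using BV by auto
  next
   fix N assume N: "submodule N K V" "B - {j} \<subseteq> N"
   have u: "(\<Oplus>\<^bsub>V\<^esub> b \<in> B - {j}. h b *\<^sub>V b) : N" if "h : B \<rightarrow>\<^sub>E car K" for h
    by (rule V.submod_finsum[OF N(1)]) (use N that in "auto intro!: V.submod_smult")
   note uc = u[OF c] and ud = u[OF d]
   note uV = V.submod_sub[OF N(1) uc] V.submod_sub[OF N(1) ud]
   have "(c j \<ominus>\<^sub>K d j) *\<^sub>V j = (\<Oplus>\<^bsub>V\<^esub> b \<in> B - {j}. d b *\<^sub>V b) \<ominus>\<^sub>V (\<Oplus>\<^bsub>V\<^esub> b \<in> B - {j}. c b *\<^sub>V b)"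
    (is "_ = ?d \<ominus>\<^sub>V ?c")
   proof -
    have "c j *\<^sub>V j \<oplus>\<^sub>V ?c = d j *\<^sub>V j \<oplus>\<^sub>V ?d" using e s[OF c] s[OF d] by simp
    moreover have "(c j \<ominus>\<^sub>K d j) *\<^sub>V j = c j *\<^sub>V j \<ominus>\<^sub>V d j *\<^sub>V j"
     using cd[OF j(1)] BV[OF j(1)]
     by (simp add: a_minus_def V.smult_l_distr V.smult_l_minus)
    ultimately show ?thesis
     using uV cd[OF j(1)] BV[OF j(1)] V.diff_eq_diff[of "c j *\<^sub>V j" ?c "d j *\<^sub>V j" ?d] by simp
   qed
   then have "(c j \<ominus>\<^sub>K d j) *\<^sub>V j : N" using V.submod_diff[OF N(1) ud uc] by simp
   moreover have "c j \<ominus>\<^sub>K d j ~= \<zero>\<^sub>K"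
    using left_module.diff_eq_zero_iff[OF lm_reg, of "c j" "d j"] cd[OF j(1)] j(2)
    by (simp add: a_minus_def)
   ultimately have "j : N"
    using smult_cancel_mem[OF V N(1) _ _ BV[OF j(1)]] cd[OF j(1)] by blast
   then have "B \<subseteq> N" using N(2) by auto
   then show "car V \<subseteq> N" using genD[OF B(2) N(1)] by blast
  qed
  moreover have "card (B - {j}) < n" using j B by (metis card_Diff1_less)
  ultimately show False using min[of "B - {j}"] B(1) by blast
 qed
 have "vbasis K V B" unfolding vbasis_def
 proof (intro conjI ballI)
  fix v assume "v :. V"
  then obtain c where c: "c : B \<rightarrow>\<^sub>E car K" "v = (\<Oplus>\<^bsub>V\<^esub> b \<in> B. c b *\<^sub>V b)"
   using gen_comb[OF V B(1,2)] by blast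
  show "EX! c. c : B \<rightarrow>\<^sub>E car K & v = (\<Oplus>\<^bsub>V\<^esub> b \<in> B. c b *\<^sub>V b)"
  proof (rule ex1I[of _ c])
   fix d assume "d : B \<rightarrow>\<^sub>E car K & v = (\<Oplus>\<^bsub>V\<^esub> b \<in> B. d b *\<^sub>V b)"
   then show "d = c" using uniq[of d c] c by metis
  qed (use c in blast)
 qed (use B BV in auto)
 then show ?thesis ..
qed

lemma fin_dimI: "[|lmod K V; finite C; gen K V C|] ==> fin_dim K V"
 using ex_vbasis by (auto simp: fin_dim_def module_iff)

lemma fin_dimD: "fin_dim K V ==> lmod K V"
 by (simp add: fin_dim_def module_iff)

lemma fin_dimE:
 assumes "fin_dim K V" obtains B where "vbasis K V B" "finite B" "gen K V B"
proof -
 obtain B where "vbasis K V B" using assms by (auto simp: fin_dim_def)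
 then show thesis using that vbasis_gen[OF fin_dimD[OF assms]] by blast
qed

lemma fin_dim_onto:
 assumes "fin_dim K V" "lmod K W" "f : mhom K V W" "f ` car V = car W"
 shows "fin_dim K W"
proof -
 obtain B where "finite B" "gen K V B" using assms(1) by (rule fin_dimE)
 then show ?thesis
  using gen_image[OF fin_dimD[OF assms(1)] assms(2-4)] fin_dimI[OF assms(2)] by blast
qed

definition coord :: "('k, 'v) module \<Rightarrow> 'v set \<Rightarrow> 'v \<Rightarrow> 'v \<Rightarrow> 'k" where
 "coord V B v = (THE c. c : B \<rightarrow>\<^sub>E car K & v = (\<Oplus>\<^bsub>V\<^esub> b \<in> B. c b *\<^sub>V b))"

lemma coords:
 assumes V: "lmod K V" and B: "vbasis K V B"
 defines "co \<equiv> coord V B"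
 shows "!!v. v :. V ==> co v : B \<rightarrow>\<^sub>E car K"
  "!!v. v :. V ==> v = (\<Oplus>\<^bsub>V\<^esub> b \<in> B. co v b *\<^sub>V b)"
  "!!b. b : B ==> (\<lambda>v\<in>car V. co v b) : mhom K V (reg K)"
  "!!b b'. [|b : B; b' : B|] ==> co b b' = (if b = b' then \<one>\<^sub>K else \<zero>\<^sub>K)"
proof -
 interpret V: left_module K V by fact
 have fB: "finite B" and BV: "!!b. b : B ==> b :. V" using B by (auto simp: vbasis_def)
 let ?P = "%v c. c : B \<rightarrow>\<^sub>E car K & v = (\<Oplus>\<^bsub>V\<^esub> b \<in> B. c b *\<^sub>V b)"
 have ex1: "EX! c. ?P v c" if "v :. V" for v using B that unfolding vbasis_def by blast
 have co: "?P v (co v)" if "v :. V" for v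
  unfolding co_def coord_def by (rule theI'[OF ex1[OF that]])
 have un: "co v = c" if "v :. V" "?P v c" for v c
  using ex1[OF that(1)] co[OF that(1)] that(2) by blast
 have cc: "co v b :. K" if "v :. V" "b : B" for v b using co that by blast
 have cong: "(\<Oplus>\<^bsub>V\<^esub> b \<in> B. restrict c B b *\<^sub>V b) = (\<Oplus>\<^bsub>V\<^esub> b \<in> B. c b *\<^sub>V b)" if "c : B \<rightarrow> car K" for c
  using that BV by (intro V.M.finsum_cong') (auto intro!: V.smult_closed)
 have add: "co (v \<oplus>\<^sub>V w) = (\<lambda>b\<in>B. co v b \<oplus>\<^sub>K co w b)" if v: "v :. V" and w: "w :. V" for v w
 proof (rule un, safe)
  have "v \<oplus>\<^sub>V w = (\<Oplus>\<^bsub>V\<^esub> b \<in> B. co v b *\<^sub>V b) \<oplus>\<^sub>V (\<Oplus>\<^bsub>V\<^esub> b \<in> B. co w b *\<^sub>V b)"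
   using co v w by metis
  also have "\<dots> = (\<Oplus>\<^bsub>V\<^esub> b \<in> B. co v b *\<^sub>V b \<oplus>\<^sub>V co w b *\<^sub>V b)"
   using cc v w BV by (intro V.M.finsum_addf[symmetric]) (auto intro!: V.smult_closed)
  also have "\<dots> = (\<Oplus>\<^bsub>V\<^esub> b \<in> B. (\<lambda>b\<in>B. co v b \<oplus>\<^sub>K co w b) b *\<^sub>V b)"
   using cc v w BV by (intro V.M.finsum_cong') (auto simp: V.smult_l_distr intro!: V.smult_closed)
  finally show "v \<oplus>\<^sub>V w = (\<Oplus>\<^bsub>V\<^esub> b \<in> B. (\<lambda>b\<in>B. co v b \<oplus>\<^sub>K co w b) b *\<^sub>V b)" .
 qed (use cc v w in auto)
 have smult: "co (a *\<^sub>V v) = (\<lambda>b\<in>B. a \<otimes>\<^sub>K co v b)" if a: "a :. K" and v: "v :. V" for a v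
 proof (rule un, safe)
  have "a *\<^sub>V v = a *\<^sub>V (\<Oplus>\<^bsub>V\<^esub> b \<in> B. co v b *\<^sub>V b)" using co v by metis
  also have "\<dots> = (\<Oplus>\<^bsub>V\<^esub> b \<in> B. a *\<^sub>V (co v b *\<^sub>V b))"
   using cc v BV a fB by (intro V.finsum_smult) (auto intro!: V.smult_closed)
  also have "\<dots> = (\<Oplus>\<^bsub>V\<^esub> b \<in> B. (\<lambda>b\<in>B. a \<otimes>\<^sub>K co v b) b *\<^sub>V b)"
   using cc v BV a by (intro V.M.finsum_cong') (auto simp: V.smult_assoc intro!: V.smult_closed)
  finally show "a *\<^sub>V v = (\<Oplus>\<^bsub>V\<^esub> b \<in> B. (\<lambda>b\<in>B. a \<otimes>\<^sub>K co v b) b *\<^sub>V b)" .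
 qed (use cc v a in auto)
 have delta: "co b = (\<lambda>b'\<in>B. if b = b' then \<one>\<^sub>K else \<zero>\<^sub>K)" if b: "b : B" for b
 proof (rule un, safe)
  have "(\<Oplus>\<^bsub>V\<^esub> b' \<in> B. (\<lambda>b'\<in>B. if b = b' then \<one>\<^sub>K else \<zero>\<^sub>K) b' *\<^sub>V b') = (\<Oplus>\<^bsub>V\<^esub> b' \<in> B. if b = b' then b' else \<zero>\<^sub>V)"
   using BV by (intro V.M.finsum_cong') (auto intro!: V.smult_closed)
  also have "\<dots> = b" using V.M.finsum_singleton[OF b fB, of "%b. b"] BV by auto
  finally show "b = (\<Oplus>\<^bsub>V\<^esub> b' \<in> B. (\<lambda>b'\<in>B. if b = b' then \<one>\<^sub>K else \<zero>\<^sub>K) b' *\<^sub>V b')" by simp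
 qed (use BV b in "auto split: if_splits")
 show "!!v. v :. V ==> co v : B \<rightarrow>\<^sub>E car K"
  "!!v. v :. V ==> v = (\<Oplus>\<^bsub>V\<^esub> b \<in> B. co v b *\<^sub>V b)"
  using co by blast+
 show "(\<lambda>v\<in>car V. co v b) : mhom K V (reg K)" if "b : B" for b
  by (rule mhom_restrictI[OF V]) (use that cc add smult in auto)
 show "co b b' = (if b = b' then \<one>\<^sub>K else \<zero>\<^sub>K)" if "b : B" "b' : B" for b b'
  using delta[OF that(1)] that(2) by simp
qed

lemma linear_extension:
 assumes V: "lmod K V" and W: "lmod K W" and B: "vbasis K V B"
  and phi: "!!b. b : B ==> \<phi> b :. W"
 shows "EX f : mhom K V W. ALL b : B. f b = \<phi> b"
proof -
 interpret V: left_module K V by fact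
 interpret W: left_module K W by fact
 have fB: "finite B" and BV: "!!b. b : B ==> b :. V" using B by (auto simp: vbasis_def)
 note co = coords[OF V B]
 let ?co = "coord V B"
 have cc: "?co v b :. K" if "v :. V" "b : B" for v b using co that by blast
 have ca: "?co (v \<oplus>\<^sub>V w) b = ?co v b \<oplus>\<^sub>K ?co w b" if "v :. V" "w :. V" "b : B" for v w b
  using mhom_add[OF co(3)[OF that(3)] that(1,2)] that by simp
 have cs: "?co (a *\<^sub>V w) b = a \<otimes>\<^sub>K ?co w b" if "a :. K" "w :. V" "b : B" for a w b
  using mhom_smult[OF co(3)[OF that(3)] that(1,2)] that by simp
 let ?f = "\<lambda>v\<in>car V. \<Oplus>\<^bsub>W\<^esub> b \<in> B. ?co v b *\<^sub>W \<phi> b"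
 have "?f : mhom K V W"
 proof (rule mhom_restrictI[OF V])
  fix v w assume v: "v :. V" and w: "w :. V"
  have "(\<Oplus>\<^bsub>W\<^esub> b \<in> B. ?co (v \<oplus>\<^sub>V w) b *\<^sub>W \<phi> b) = (\<Oplus>\<^bsub>W\<^esub> b \<in> B. ?co v b *\<^sub>W \<phi> b \<oplus>\<^sub>W ?co w b *\<^sub>W \<phi> b)"
   using v w cc phi by (intro W.M.finsum_cong') (auto simp: ca W.smult_l_distr intro!: W.smult_closed V.smult_closed)
  also have "\<dots> = (\<Oplus>\<^bsub>W\<^esub> b \<in> B. ?co v b *\<^sub>W \<phi> b) \<oplus>\<^sub>W (\<Oplus>\<^bsub>W\<^esub> b \<in> B. ?co w b *\<^sub>W \<phi> b)"
   using v w cc phi by (intro W.M.finsum_addf) (auto intro!: W.smult_closed V.smult_closed)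
  finally show "(\<Oplus>\<^bsub>W\<^esub> b \<in> B. ?co (v \<oplus>\<^sub>V w) b *\<^sub>W \<phi> b) =
   (\<Oplus>\<^bsub>W\<^esub> b \<in> B. ?co v b *\<^sub>W \<phi> b) \<oplus>\<^sub>W (\<Oplus>\<^bsub>W\<^esub> b \<in> B. ?co w b *\<^sub>W \<phi> b)" .
 next
  fix a v assume a: "a :. K" and v: "v :. V"
  have "a *\<^sub>W (\<Oplus>\<^bsub>W\<^esub> b \<in> B. ?co v b *\<^sub>W \<phi> b) = (\<Oplus>\<^bsub>W\<^esub> b \<in> B. a *\<^sub>W (?co v b *\<^sub>W \<phi> b))"
   using a v cc phi fB by (intro W.finsum_smult) (auto intro!: W.smult_closed V.smult_closed)
  also have "\<dots> = (\<Oplus>\<^bsub>W\<^esub> b \<in> B. ?co (a *\<^sub>V v) b *\<^sub>W \<phi> b)"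
   using a v cc phi by (intro W.M.finsum_cong') (auto simp: cs W.smult_assoc intro!: W.smult_closed V.smult_closed)
  finally show "(\<Oplus>\<^bsub>W\<^esub> b \<in> B. ?co (a *\<^sub>V v) b *\<^sub>W \<phi> b) = a *\<^sub>W (\<Oplus>\<^bsub>W\<^esub> b \<in> B. ?co v b *\<^sub>W \<phi> b)" by simp
 qed (use cc phi in "auto intro!: W.M.finsum_closed W.smult_closed")
 moreover have "?f b = \<phi> b" if b: "b : B" for b
 proof -
  have "?f b = (\<Oplus>\<^bsub>W\<^esub> b' \<in> B. if b = b' then \<phi> b' else \<zero>\<^sub>W)"
   using b BV phi by (auto simp: co(4) intro!: W.M.finsum_cong' W.smult_closed)
  also have "\<dots> = \<phi> b" using W.M.finsum_singleton[OF b fB, of \<phi>] phi by auto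
  finally show ?thesis .
 qed
 ultimately show ?thesis by blast
qed

lemma linear_section:
 assumes V: "lmod K V" and W: "fin_dim K W" and f: "f : mhom K V W" "f ` car V = car W"
 shows "EX s : mhom K W V. ALL w : car W. f (s w) = w"
proof -
 obtain B where B: "vbasis K W B" "gen K W B" using fin_dimE[OF W] by metis
 note W' = fin_dimD[OF W]
 have "ALL b : B. EX v. v :. V & f v = b" using gen_sub[OF B(2)] f(2) by (metis imageE subsetD)
 then obtain \<phi> where p: "!!b. b : B ==> \<phi> b :. V" "!!b. b : B ==> f (\<phi> b) = b" by metis
 obtain s where s: "s : mhom K W V" "ALL b : B. s b = \<phi> b"
  using linear_extension[where \<phi> = \<phi>, OF W' V B(1)] p(1) by blast
 have "compose (car W) f s w = (\<lambda>w\<in>car W. w) w" if "w :. W" for w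
  by (rule gen_hom_eq[OF W' W' mhom_compose[OF W' s(1) f(1)] mhom_id[OF W'] B(2) _ that])
   (use s(2) p gen_sub[OF B(2)] in "auto simp: compose_eq")
 then have "ALL w : car W. f (s w) = w" by (simp add: compose_eq)
 then show ?thesis using s by blast
qed

text \<open>With a linear section \<open>s\<close> of the quotient map,
  \<open>p x = x - s (N + x)\<close> lands in \<open>N\<close> and fixes \<open>N\<close>.\<close>

lemma linear_projection:
 assumes V: "fin_dim K V" and N: "submodule N K V"
 shows "EX p : mhom K V V. (ALL x : car V. p x : N) & (ALL x : N. p x = x)"
proof -
 note V' = fin_dimD[OF V]
 interpret q: submod_of K V N by (rule submod_ofI[OF V' N])
 let ?q = "\<lambda>x\<in>car V. N +>\<^sub>V x"
 have on: "?q ` car V = car (quot V N)" by (auto simp: quot_carrier)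
 have "fin_dim K (quot V N)"
  by (rule fin_dim_onto[OF V q.left_module_quot q.quot_proj on])
 then obtain s where s: "s : mhom K (quot V N) V" "ALL w : car (quot V N). ?q (s w) = w"
  using linear_section[OF V' _ q.quot_proj on] by blast
 interpret s: mod_hom K "quot V N" V s by (rule mod_homI[OF q.left_module_quot V' s(1)])
 let ?sq = "compose (car V) s ?q"
 have sq: "?sq : mhom K V V" by (rule mhom_compose[OF V' q.quot_proj s(1)])
 interpret sq: mod_hom K V V ?sq by (rule mod_homI[OF V' V' sq])
 have e: "?sq x = s (N +>\<^sub>V x)" if "x :. V" for x using that by (simp add: compose_eq)
 let ?p = "\<lambda>x\<in>car V. (\<lambda>x\<in>car V. x) x \<ominus>\<^sub>V ?sq x"
 have "?p : mhom K V V" by (rule mhom_diff[OF V' V' mhom_id[OF V'] sq])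
 moreover have "?p x : N" if x: "x :. V" for x
 proof -
  have "s (N +>\<^sub>V x) :. V" using x by simp
  moreover have "N +>\<^sub>V s (N +>\<^sub>V x) = N +>\<^sub>V x" using s(2) x by (metis q.cos_closed calculation restrict_apply')
  ultimately show ?thesis using x q.cos_eq[of x "s (N +>\<^sub>V x)"] by (simp add: e)
 qed
 moreover have "?p x = x" if x: "x : N" for x
 proof -
  have xV: "x :. V" using q.submod_sub[OF N x] .
  then have "?sq x = \<zero>\<^sub>V" using q.cos_zero[OF xV] x s.zero by (simp add: e)
  then show ?thesis using xV by (simp add: q.M.minus_eq)
 qed
 ultimately show ?thesis by blast
qed

lemma projection_sub:
 assumes V: "fin_dim K V" and N: "submodule N K V"
 obtains p where "p : mhom K V (submod V N)" "p ` car V = N" "!!x. x : N ==> p x = x"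
proof -
 obtain p where p: "p : mhom K V V" "ALL x : car V. p x : N" "ALL x : N. p x = x"
  using linear_projection[OF V N] by blast
 have "p ` car V = N"
  using p(2,3) left_module.submod_sub[OF fin_dimD[OF V] N] by (auto intro!: image_eqI)
 then show ?thesis using that p mhom_submod[OF N fin_dimD[OF V]] by blast
qed

lemma fin_dim_sub: "[|fin_dim K V; submodule N K V|] ==> fin_dim K (submod V N)"
 using projection_sub fin_dim_onto[OF _ left_module_submod[OF fin_dimD]] by (metis submod_sel(1))

text \<open>The image is a subspace of \<open>W\<close>, hence finite-dimensional, and the inverse
  of \<open>f\<close> carries this back to \<open>V\<close>.\<close>

lemma fin_dim_inj:
 assumes "lmod K V" "fin_dim K W" "f : mhom K V W" "inj_on f (car V)"
 shows "fin_dim K V"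
proof -
 note W' = fin_dimD[OF assms(2)]
 interpret f: mod_hom K V W f using assms W' by (intro mod_homI)
 have sub: "submodule (f ` car V) K W" by (rule f.submodule_image[OF f.M.submodule_carrier])
 note fdS = fin_dim_sub[OF assms(2) sub]
 have "f : miso K V (submod W (f ` car V))"
  by (rule misoI) (use assms(4) mhom_submod[OF sub W'] assms(3) in auto)
 then obtain g where "g : miso K (submod W (f ` car V)) V"
  using miso_inv[OF assms(1) fin_dimD[OF fdS]] by blast
 then show ?thesis using fin_dim_onto[OF fdS assms(1)] by (auto simp: miso_def bij_betw_def)
qed

text \<open>If \<open>p\<close> projects onto \<open>N\<close>, then \<open>d = id - p\<close> kills
  \<open>N\<close> but not \<open>v\<close>; some coordinate of \<open>d v\<close> is nonzero, and
  that coordinate composed with \<open>d\<close> separates.\<close>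

lemma separating_functional:
 assumes V: "fin_dim K V" and N: "submodule N K V" and v: "v :. V" "v \<notin> N"
 shows "EX \<phi> : mhom K V (reg K). \<phi> v ~= \<zero>\<^sub>K & (ALL x : N. \<phi> x = \<zero>\<^sub>K)"
proof -
 note V' = fin_dimD[OF V]
 interpret V: left_module K V by fact
 obtain p where p: "p : mhom K V V" "ALL x : car V. p x : N" "ALL x : N. p x = x"
  using linear_projection[OF V N] by blast
 define d where "d = (\<lambda>x\<in>car V. (\<lambda>x\<in>car V. x) x \<ominus>\<^sub>V p x)"
 have d: "d : mhom K V V" unfolding d_def by (rule mhom_diff[OF V' V' mhom_id[OF V'] p(1)])
 have d_app: "d x = x \<ominus>\<^sub>V p x" if "x :. V" for x using that by (simp add: d_def)
 have pv: "p v :. V" "p v : N" using p v V.submod_sub[OF N] by auto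
 then have dv: "d v :. V" "d v ~= \<zero>\<^sub>V" using v V.diff_eq_zero_iff[of v "p v"] by (auto simp: d_app)
 obtain B where B: "vbasis K V B" using fin_dimE[OF V] by metis
 then have BV: "!!b. b : B ==> b :. V" by (auto simp: vbasis_def)
 note co = coords[OF V' B]
 let ?co = "coord V B"
 have "EX b : B. ?co (d v) b ~= \<zero>\<^sub>K"
 proof (rule ccontr)
  assume "\<not> ?thesis"
  then have "(\<Oplus>\<^bsub>V\<^esub> b \<in> B. ?co (d v) b *\<^sub>V b) = (\<Oplus>\<^bsub>V\<^esub> b \<in> B. \<zero>\<^sub>V)"
   using BV by (intro V.M.finsum_cong') auto
  then show False using co(2)[OF dv(1)] dv(2) by simp
 qed
 then obtain b where b: "b : B" "?co (d v) b ~= \<zero>\<^sub>K" by blast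
 let ?f = "compose (car V) (\<lambda>v\<in>car V. ?co v b) d"
 have f: "?f : mhom K V (reg K)" by (rule mhom_compose[OF V' d co(3)[OF b(1)]])
 moreover have "?f v ~= \<zero>\<^sub>K" using b(2) dv(1) v(1) by (simp add: compose_eq)
 moreover have "?f x = \<zero>\<^sub>K" if x: "x : N" for x
 proof -
  interpret c: mod_hom K V "reg K" "\<lambda>v\<in>car V. ?co v b"
   by (rule mod_homI[OF V' lm_reg co(3)[OF b(1)]])
  have xV: "x :. V" using V.submod_sub[OF N x] .
  moreover have "d x = \<zero>\<^sub>V" using p(3) x xV V.diff_eq_zero_iff[of x x] by (simp add: d_app)
  ultimately show ?thesis using c.zero by (simp add: compose_eq)
 qed
 ultimately show ?thesis by blast
qed

lemma extend_functional:
 assumes V: "fin_dim K V" and N: "submodule N K V" and f: "f : mhom K (submod V N) L"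
 shows "EX g : mhom K V L. ALL x : N. g x = f x"
proof -
 obtain p where p: "p : mhom K V (submod V N)" "!!x. x : N ==> p x = x"
  using projection_sub[OF V N] by blast
 show ?thesis
  by (rule bexI[of _ "compose (car V) f p"])
   (use p left_module.submod_sub[OF fin_dimD[OF V] N] mhom_compose[OF fin_dimD[OF V] p(1) f]
   in "auto simp: compose_eq")
qed

subsection \<open>Dimension\<close>

text \<open>The exchange argument by induction on the basis: the kernel of one coordinate has the
  remaining vectors as a basis, and the projection onto this kernel lets \<open>gen_drop\<close>
  remove a member of \<open>C\<close> at the same time.\<close>

lemma vbasis_card_le:
 assumes "lmod K V" "vbasis K V B" "finite C" "gen K V C"
 shows "card B \<le> card C"
 using assms
proof (induction "card B" arbitrary: B C V)
 case (Suc n)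
 note V = Suc.prems(1) and B = Suc.prems(2) and C = Suc.prems(3,4)
 interpret V: left_module K V by fact
 have fB: "finite B" and BV: "!!b. b : B ==> b :. V" using B by (auto simp: vbasis_def)
 obtain b where b: "b : B" using Suc(2) by (metis card.empty ex_in_conv nat.distinct(1))
 note co = coords[OF V B]
 let ?co = "coord V B"
 interpret e: mod_hom K V "reg K" "\<lambda>v\<in>car V. ?co v b"
  by (rule mod_homI[OF V lm_reg co(3)[OF b]])
 let ?W = "mker V (reg K) (\<lambda>v\<in>car V. ?co v b)"
 note sW = e.submodule_ker
 have W: "lmod K (submod V ?W)" by (rule left_module_submod[OF V sW])
 have mW: "x : ?W \<longleftrightarrow> x :. V & ?co x b = \<zero>\<^sub>K" for x by (auto simp: mker_def)
 have BW: "b' : ?W" if "b' : B" "b' ~= b" for b' using that b BV co(4)[of b' b] by (auto simp: mW)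
 have uniq: "c = d" if "c : B \<rightarrow>\<^sub>E car K" "d : B \<rightarrow>\<^sub>E car K"
  "(\<Oplus>\<^bsub>V\<^esub> b \<in> B. c b *\<^sub>V b) = (\<Oplus>\<^bsub>V\<^esub> b \<in> B. d b *\<^sub>V b)" for c d
 proof -
  have "(\<Oplus>\<^bsub>V\<^esub> b \<in> B. c b *\<^sub>V b) :. V" using that(1) BV by (intro V.M.finsum_closed) (auto intro!: V.smult_closed)
  then show ?thesis using B that unfolding vbasis_def by blast
 qed
 \<comment> \<open>Coefficients on \<open>B - {b}\<close> are extended by zero at \<open>b\<close>,
   so uniqueness in the kernel is inherited from uniqueness in \<open>V\<close>.\<close>
 define ext where "ext c = (%x. if x = b then \<zero>\<^sub>K else c x)" for c :: "_ \<Rightarrow> 'k"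
 have ext: "ext c : B \<rightarrow>\<^sub>E car K" if "c : B - {b} \<rightarrow>\<^sub>E car K" for c
  using that b by (auto simp: ext_def PiE_iff extensional_def)
 have exts: "(\<Oplus>\<^bsub>V\<^esub> x \<in> B. ext c x *\<^sub>V x) = (\<Oplus>\<^bsub>submod V ?W\<^esub> x \<in> B - {b}. c x *\<^sub>V x)"
  if c: "c : B - {b} \<rightarrow>\<^sub>E car K" for c
 proof -
  have "(\<Oplus>\<^bsub>V\<^esub> x \<in> insert b (B - {b}). ext c x *\<^sub>V x) = ext c b *\<^sub>V b \<oplus>\<^sub>V (\<Oplus>\<^bsub>V\<^esub> x \<in> B - {b}. ext c x *\<^sub>V x)"
   using ext[OF c] fB BV b by (intro V.M.finsum_insert) (auto intro!: V.smult_closed)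
  also have "\<dots> = (\<Oplus>\<^bsub>V\<^esub> x \<in> B - {b}. ext c x *\<^sub>V x)"
  proof -
   have "(\<Oplus>\<^bsub>V\<^esub> x \<in> B - {b}. ext c x *\<^sub>V x) :. V"
    using ext[OF c] BV by (intro V.M.finsum_closed) (auto intro!: V.smult_closed)
   then show ?thesis using BV[OF b] by (simp add: ext_def)
  qed
  also have "\<dots> = (\<Oplus>\<^bsub>V\<^esub> x \<in> B - {b}. c x *\<^sub>V x)"
   using c BV by (intro V.M.finsum_cong') (auto simp: ext_def intro!: V.smult_closed)
  also have "\<dots> = (\<Oplus>\<^bsub>submod V ?W\<^esub> x \<in> B - {b}. c x *\<^sub>V x)"
   by (rule finsum_submod_eq[symmetric, OF V sW]) (use c BW V.submod_smult[OF sW] in auto)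
  finally show ?thesis using b by (simp add: insert_absorb)
 qed
 have bW: "vbasis K (submod V ?W) (B - {b})" unfolding vbasis_def
 proof (intro conjI ballI)
  show "finite (B - {b})" using fB by simp
  show "B - {b} \<subseteq> car (submod V ?W)" using BW by auto
  fix v assume v: "v :. (submod V ?W)"
  then have vV: "v :. V" "?co v b = \<zero>\<^sub>K" using mW by auto
  let ?c = "restrict (?co v) (B - {b})"
  have c: "?c : B - {b} \<rightarrow>\<^sub>E car K" using co(1)[OF vV(1)] by auto
  have "ext ?c = ?co v" using vV(2) co(1)[OF vV(1)] b by (auto simp: ext_def PiE_iff extensional_def)
  then have v': "v = (\<Oplus>\<^bsub>submod V ?W\<^esub> x \<in> B - {b}. ?c x *\<^sub>V x)"
   using exts[OF c] co(2)[OF vV(1)] by simp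
  show "EX! c. c : B - {b} \<rightarrow>\<^sub>E car K & v = (\<Oplus>\<^bsub>submod V ?W\<^esub> x \<in> B - {b}. c x \<odot>\<^bsub>submod V ?W\<^esub> x)"
  proof (rule ex1I[of _ ?c])
   show "?c : B - {b} \<rightarrow>\<^sub>E car K & v = (\<Oplus>\<^bsub>submod V ?W\<^esub> x \<in> B - {b}. ?c x \<odot>\<^bsub>submod V ?W\<^esub> x)"
    using c v' by simp
  next
   fix d assume d: "d : B - {b} \<rightarrow>\<^sub>E car K & v = (\<Oplus>\<^bsub>submod V ?W\<^esub> x \<in> B - {b}. d x \<odot>\<^bsub>submod V ?W\<^esub> x)"
   then have "ext d = ext ?c"
    using uniq[OF ext[of d] ext[OF c]] exts[of d] exts[OF c] v' by simp
   then have "ALL x. x ~= b --> d x = ?c x" unfolding ext_def by metis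
   moreover have "d b = ?c b" using d by (auto simp: PiE_iff extensional_def)
   ultimately show "d = ?c" by (intro HOL.ext) metis
  qed
 qed
 \<comment> \<open>The projection onto \<open>?W\<close> along \<open>b\<close>. It fixes
   \<open>?W\<close> and kills the nonzero vector \<open>b\<close>, which is what
   \<open>gen_drop\<close> asks for.\<close>
 let ?f = "\<lambda>v\<in>car V. v \<ominus>\<^sub>V ?co v b *\<^sub>V b"
 have cb: "?co v b :. K" if "v :. V" for v using co(1)[OF that] b by auto
 have bb: "?co b b = \<one>\<^sub>K" using co(4)[OF b b] by simp
 have fV: "?f : mhom K V V"
 proof -
  have "(\<lambda>v\<in>car V. ?co v b *\<^sub>V b) : mhom K V V"
   by (rule mhom_restrictI[OF V])
    (use e.add e.smult BV[OF b] cb in "auto simp: V.smult_l_distr V.smult_assoc")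
  from mhom_diff[OF V V mhom_id[OF V] this] show ?thesis by (simp cong: restrict_cong)
 qed
 interpret f: mod_hom K V V ?f by (rule mod_homI[OF V V fV])
 have fW: "?f v : ?W" if v: "v :. V" for v
 proof -
  have "?co (v \<ominus>\<^sub>V ?co v b *\<^sub>V b) b = ?co v b \<ominus>\<^bsub>reg K\<^esub> ?co v b \<otimes>\<^sub>K ?co b b"
   using e.diff[of v "?co v b *\<^sub>V b"] e.smult[of "?co v b" b] v cb BV[OF b] by simp
  also have "\<dots> = \<zero>\<^sub>K"
   using cb[OF v] left_module.diff_eq_zero_iff[OF lm_reg, of "?co v b" "?co v b"] by (simp add: bb)
  finally show ?thesis using v BV[OF b] cb by (simp add: mW)
 qed
 have fid: "?f v = v" if "v : ?W" for v
  using that BV[OF b] by (simp add: mW V.M.minus_eq)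
 have "?f ` car V = car (submod V ?W)"
 proof (rule retract_image_eq)
  show "?f x :. (submod V ?W)" if "x :. V" for x
   unfolding submod_sel by (rule fW[OF that])
  show "y :. V & ?f y = y" if "y :. (submod V ?W)" for y
   using that fid[of y] unfolding submod_sel by (simp only: mW)
 qed
 moreover have "?f : mhom K V (submod V ?W)" using fV fW mhom_submod[OF sW V] by blast
 moreover have "b ~= \<zero>\<^sub>V" using bb BV[OF b] e.zero by auto
 moreover have "?f b = \<zero>\<^bsub>submod V ?W\<^esub>" using BV[OF b] bb V.diff_eq_zero_iff[of b b] by simp
 ultimately obtain D where D: "finite D" "gen K (submod V ?W) D" "card D < card C"
  using gen_drop[OF V W _ _ C BV[OF b]] by blast
 have "card (B - {b}) \<le> card D"
  by (rule Suc.hyps(1)[OF _ W bW D(1,2)]) (use Suc(2) b fB in simp)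
 then show ?case using D(3) Suc(2) b fB by simp
qed simp

text \<open>Any two bases generate, so each bounds the size of the other; the choice made in
  \<open>vdim\<close> is therefore harmless.\<close>

lemma vdim_eq: assumes "lmod K V" "vbasis K V B" shows "vdim K V = card B"
proof -
 have "vbasis K V (SOME B. vbasis K V B)" using assms(2) by (rule someI)
 with assms show ?thesis
  unfolding vdim_def by (meson dual_order.antisym vbasis_card_le vbasis_gen)
qed

lemma vdim_le: "[|lmod K V; finite C; gen K V C|] ==> vdim K V \<le> card C"
 using ex_vbasis vdim_eq vbasis_card_le by metis

lemma vdim_onto_less:
 assumes "fin_dim K V" "lmod K W" "f : mhom K V W" "f ` car V = car W"
  and "w :. V" "w ~= \<zero>\<^sub>V" "f w = \<zero>\<^sub>W"
 shows "vdim K W < vdim K V"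
proof -
 note V = fin_dimD[OF assms(1)]
 obtain B where B: "vbasis K V B" "finite B" "gen K V B" using fin_dimE[OF assms(1)] by metis
 obtain D where "finite D" "gen K W D" "card D < card B"
  using gen_drop[OF V assms(2-4) B(2,3) assms(5-7)] by blast
 then show ?thesis using vdim_le[OF assms(2)] vdim_eq[OF V B(1)] by fastforce
qed

text \<open>A projection onto \<open>N\<close> kills \<open>v - p v\<close>, which is nonzero for
  \<open>v\<close> outside \<open>N\<close>.\<close>

lemma vdim_sub_less:
 assumes "fin_dim K V" "submodule N K V" "N ~= car V"
 shows "vdim K (submod V N) < vdim K V"
proof -
 note V = fin_dimD[OF assms(1)]
 interpret V: left_module K V by fact
 obtain v where v: "v :. V" "v \<notin> N" using assms(3) V.submod_sub[OF assms(2)] by blast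
 obtain p where p: "p : mhom K V (submod V N)" "p ` car V = N" "!!x. x : N ==> p x = x"
  using projection_sub[OF assms(1,2)] by blast
 interpret p: mod_hom K V "submod V N" p
  by (rule mod_homI[OF V left_module_submod[OF V assms(2)] p(1)])
 have pv: "p v : N" "p v :. V" using p(2) v V.submod_sub[OF assms(2)] by auto
 show ?thesis
 proof (rule vdim_onto_less[OF assms(1) p.N.left_module_axioms p(1)])
  show "p ` car V = car (submod V N)" using p(2) by simp
  show "v \<ominus>\<^sub>V p v :. V" using v pv by simp
  show "v \<ominus>\<^sub>V p v ~= \<zero>\<^sub>V" using v pv V.diff_eq_zero_iff by metis
  show "p (v \<ominus>\<^sub>V p v) = \<zero>\<^bsub>submod V N\<^esub>"
   using v pv p(3)[OF pv(1)] p.N.diff_eq_zero_iff[of "p v" "p v"] by simp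
 qed
qed

lemma vdim_onto_le:
 assumes "fin_dim K V" "lmod K W" "f : mhom K V W" "f ` car V = car W"
 shows "vdim K W \<le> vdim K V"
proof -
 note V = fin_dimD[OF assms(1)]
 obtain B where B: "vbasis K V B" "finite B" "gen K V B" using fin_dimE[OF assms(1)] by metis
 show ?thesis
  using vdim_le[OF assms(2) _ gen_image[OF V assms(2-4) B(3)]] B(2) card_image_le[OF B(2), of f]
   vdim_eq[OF V B(1)] by simp
qed

lemma vdim_iso:
 assumes "fin_dim K V" "lmod K W" "f : miso K V W"
 shows "vdim K V = vdim K W"
proof -
 note V = fin_dimD[OF assms(1)]
 obtain g where g: "g : miso K W V" using miso_inv[OF V assms(2,3)] by blast
 have "fin_dim K W"
  by (rule fin_dim_onto[OF assms(1,2)]) (use assms(3) in "auto simp: miso_def bij_betw_def")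
 then show ?thesis
  using vdim_onto_le[OF assms(1,2)] vdim_onto_le[OF _ V] g assms(3)
  by (intro antisym) (auto simp: miso_def bij_betw_def)
qed

end


section \<open>Spaces of linear maps\<close>

context vs
begin

lemma mhom_reg [simp]: "mhom (reg K) V W = mhom K V W"
 by (simp add: mhom_def)

lemma mhom_scal_reg [simp]:
 "lmod K V ==> mhom K (scal (reg K) V) W = mhom K V W"
 by (auto simp: mhom_def left_module.smult_one)

lemma lm_vHom:
 assumes V: "lmod K V" and W: "lmod K W"
 shows "lmod K (Hom_space (reg K) V W)"
proof -
 interpret V: left_module K V by fact
 interpret W: left_module K W by fact
 have c: "f x :. W" if "f : mhom K V W" "x :. V" for f x
  using that by (rule mhom_closed)
 have e: "restrict f (car V) = f" if "f : mhom K V W" for f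
  using mhom_ext[OF that] by (rule extensional_restrict)
 have s: "(\<lambda>x\<in>car V. a *\<^sub>W f x) : mhom K V W" if "f : mhom K V W" "a :. K" for f a
 proof (rule mhom_restrictI[OF V])
  fix b x assume "b :. K" "x :. V"
  then show "a *\<^sub>W f (b *\<^sub>V x) = b *\<^sub>W (a *\<^sub>W f x)"
   using that c[OF that(1)] by (simp add: mhom_smult[OF that(1)] m_comm flip: W.smult_assoc)
 qed (use that in "auto simp: c mhom_add W.smult_r_distr")
 have "abelian_group (Hom_space (reg K) V W)"
  by (rule abelian_group_fun[of W _ "car V"])
   (use mhom_plus[OF V W] mhom_uminus[OF V W] mhom_zero[OF V W] W.M.abelian_group_axioms
    in "auto simp: mhom_def")
 then show ?thesis
  by (intro left_module.intro left_module_axioms.intro ring_axioms)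
   (auto simp: c s e W.smult_l_distr W.smult_r_distr W.smult_assoc intro!: restrict_ext cong: restrict_cong)
qed

text \<open>The rank-one maps \<open>F b w\<close>, the coordinate at \<open>b\<close> times
  \<open>w\<close>, span: every \<open>f\<close> is the sum of the maps \<open>F b (f b)\<close>,
  and \<open>w\<close> may be restricted to generators of \<open>W\<close>.\<close>

lemma fin_dim_vHom:
 assumes V: "fin_dim K V" and W: "fin_dim K W"
 shows "fin_dim K (Hom_space (reg K) V W)" (is "fin_dim K ?H")
proof -
 note V' = fin_dimD[OF V] and W' = fin_dimD[OF W]
 interpret V: left_module K V by fact
 interpret W: left_module K W by fact
 interpret H: left_module K ?H by (rule lm_vHom[OF V' W'])
 obtain B where B: "vbasis K V B" "finite B" "gen K V B" using fin_dimE[OF V] by metis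
 obtain C where C: "finite C" "gen K W C" using fin_dimE[OF W] by metis
 note co = coords[OF V' B(1)]
 have BV: "!!b. b : B ==> b :. V" using gen_sub[OF B(3)] by auto
 have cc: "coord V B v b :. K" if "v :. V" "b : B" for v b using co(1) that by blast
 define F where "F b w = (\<lambda>v\<in>car V. coord V B v b *\<^sub>W w)" for b w
 have ca: "coord V B (v \<oplus>\<^sub>V w) b = coord V B v b \<oplus>\<^sub>K coord V B w b"
  if "v :. V" "w :. V" "b : B" for v w b
  using mhom_add[OF co(3)[OF that(3)] that(1,2)] that by simp
 have cs: "coord V B (a *\<^sub>V w) b = a \<otimes>\<^sub>K coord V B w b"
  if "a :. K" "w :. V" "b : B" for a w b
  using mhom_smult[OF co(3)[OF that(3)] that(1,2)] that by simp
 have F: "F b w : mhom K V W" if "b : B" "w :. W" for b w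
  unfolding F_def by (rule mhom_restrictI[OF V'])
   (use that cc in "auto simp: ca cs W.smult_l_distr W.smult_assoc")
 have Fadd: "F b (w \<oplus>\<^sub>W w') = F b w \<oplus>\<^sub>?H F b w'" if "b : B" "w :. W" "w' :. W" for b w w'
  using that cc by (auto simp: F_def W.smult_r_distr intro!: restrict_ext)
 have Fsm: "F b (a *\<^sub>W w) = a *\<^sub>?H F b w" if "b : B" "w :. W" "a :. K" for b w a
  using that cc by (auto simp: F_def m_comm simp flip: W.smult_assoc intro!: restrict_ext)
 have F0: "F b \<zero>\<^sub>W = \<zero>\<^sub>?H" if "b : B" for b
  using that cc by (auto simp: F_def intro!: restrict_ext)
 let ?G = "(%(b, c). F b c) ` (B \<times> C)"
 have CW: "!!c. c : C ==> c :. W" using gen_sub[OF C(2)] by auto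
 have "gen K ?H ?G" unfolding gen_def
 proof (intro conjI allI impI subsetI)
  show "x :. ?H" if "x : ?G" for x using that F CW by auto
 next
  fix N f assume N: "submodule N K ?H" "?G \<subseteq> N" "f :. ?H"
  then have f: "f : mhom K V W" by simp
  interpret f: mod_hom K V W f by (rule mod_homI[OF V' W' f])
  have FN: "F b w : N" if b: "b : B" and w: "w :. W" for b w
  proof -
   have "submodule {w : car W. F b w : N} K W"
    by (rule W.submodI)
     (use b H.submodD[OF N(1)] in "auto simp: Fadd Fsm F0 simp del: Hom_space_sel")
   from genD[OF C(2) this _ w] show ?thesis using N(2) b CW by auto
  qed
  have fb: "f b :. W" if "b : B" for b using that BV by simp
  have "f = (\<Oplus>\<^bsub>?H\<^esub> b \<in> B. F b (f b))"
  proof (rule mhom_eqI[OF f])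
   have "(\<Oplus>\<^bsub>?H\<^esub> b \<in> B. F b (f b)) :. ?H"
    by (rule H.M.finsum_closed) (use F fb in auto)
   then show "(\<Oplus>\<^bsub>?H\<^esub> b \<in> B. F b (f b)) : mhom K V W" by simp
   fix v assume v: "v :. V"
   have "(\<Oplus>\<^bsub>?H\<^esub> b \<in> B. F b (f b)) v = (\<Oplus>\<^bsub>W\<^esub> b \<in> B. F b (f b) v)"
    by (rule finsum_additive[OF H.M.abelian_group_axioms W.M.abelian_group_axioms, of "%h. h v"])
     (use v F fb in "auto simp: mhom_closed")
   also have "\<dots> = (\<Oplus>\<^bsub>W\<^esub> b \<in> B. f (coord V B v b *\<^sub>V b))"
    using v cc BV fb by (intro W.M.finsum_cong') (auto simp: F_def)
   also have "\<dots> = f (\<Oplus>\<^bsub>V\<^esub> b \<in> B. coord V B v b *\<^sub>V b)"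
    by (rule f.finsum[symmetric]) (use v cc BV in auto)
   also have "\<dots> = f v" using co(2)[OF v] by simp
   finally show "f v = (\<Oplus>\<^bsub>?H\<^esub> b \<in> B. F b (f b)) v" ..
  qed
  then show "f : N" using H.submod_finsum[OF N(1), of "%b. F b (f b)" B] FN fb by auto
 qed
 then show ?thesis using B(2) C(1) by (intro fin_dimI[OF H.left_module_axioms]) auto
qed

subsection \<open>Dual spaces\<close>

lemma vdual_smult:
 "[|lmod K V; f : mhom K V (reg K); a :. K|] ==>
  (\<lambda>x\<in>car V. f (a *\<^sub>V x)) = (\<lambda>x\<in>car V. a \<otimes>\<^sub>K f x)"
 by (auto simp: mhom_smult intro!: restrict_ext)

lemma lm_vdual: assumes V: "lmod K V" shows "lmod K (dual K (reg K) V)"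
proof (rule left_module_image[OF lm_vHom[OF V lm_reg], of "%f. f"])
 fix a f assume "a :. K" "f :. (Hom_space (reg K) V (reg K))"
 then show "a \<odot>\<^bsub>Hom_space (reg K) V (reg K)\<^esub> f = a \<odot>\<^bsub>dual K (reg K) V\<^esub> f"
  using V by (simp add: vdual_smult)
qed (use V in auto)

lemma fin_dim_vdual: assumes V: "fin_dim K V" shows "fin_dim K (dual K (reg K) V)"
proof -
 note V' = fin_dimD[OF V]
 have K: "fin_dim K (reg K)"
 proof (rule fin_dimI[OF lm_reg, of "{\<one>\<^sub>K}"])
  interpret k: left_module K "reg K" by (rule lm_reg)
  show "gen K (reg K) {\<one>\<^sub>K}" unfolding gen_def
  proof (intro conjI allI impI subsetI)
   fix N x assume "submodule N K (reg K)" "{\<one>\<^sub>K} \<subseteq> N" "x :. (reg K)"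
   then show "x : N" using k.submod_smult[of N x "\<one>\<^sub>K"] by simp
  qed auto
 qed simp
 let ?H = "Hom_space (reg K) V (reg K)"
 show ?thesis
 proof (rule fin_dim_onto[OF fin_dim_vHom[OF V K] lm_vdual[OF V']])
  show "(\<lambda>f\<in>car ?H. f) : mhom K ?H (dual K (reg K) V)"
   by (rule mhom_restrictI[OF lm_vHom[OF V' lm_reg]]) (use V' in "auto simp: vdual_smult")
 qed (use V' in auto)
qed

text \<open>The vector whose coordinates are the values of \<mu> on the coordinate functionals
  represents \<mu>.\<close>

lemma double_dual:
 assumes V: "fin_dim K V" and m: "\<mu> : mhom K (dual K (reg K) V) (reg K)"
 shows "EX v : car V. ALL \<phi> : mhom K V (reg K). \<mu> \<phi> = \<phi> v"
proof -
 note V' = fin_dimD[OF V]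
 let ?D = "dual K (reg K) V"
 interpret V: left_module K V by fact
 interpret D: left_module K ?D by (rule lm_vdual[OF V'])
 interpret m: mod_hom K ?D "reg K" \<mu> by (rule mod_homI[OF lm_vdual[OF V'] lm_reg m])
 obtain B where B: "vbasis K V B" "finite B" "gen K V B" using fin_dimE[OF V] by metis
 note co = coords[OF V' B(1)]
 have BV: "!!b. b : B ==> b :. V" using gen_sub[OF B(3)] by auto
 have cc: "coord V B v b :. K" if "v :. V" "b : B" for v b using co(1) that by blast
 define e where "e b = (\<lambda>v\<in>car V. coord V B v b)" for b
 have e: "e b : mhom K V (reg K)" if "b : B" for b unfolding e_def by (rule co(3)[OF that])
 then have me: "\<mu> (e b) :. K" if "b : B" for b using m.closed[of "e b"] that V' by simp
 let ?v = "\<Oplus>\<^bsub>V\<^esub> b \<in> B. \<mu> (e b) *\<^sub>V b"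
 have "\<mu> \<phi> = \<phi> ?v" if phi: "\<phi> : mhom K V (reg K)" for \<phi>
 proof -
  interpret p: mod_hom K V "reg K" \<phi> by (rule mod_homI[OF V' lm_reg phi])
  have pb: "\<phi> b :. K" if "b : B" for b using p.closed that BV by simp
  have sc: "\<phi> b *\<^sub>?D e b : mhom K V (reg K)" if "b : B" for b
   using D.smult_closed[of "\<phi> b" "e b"] pb e that V' by simp
  have "\<phi> = (\<Oplus>\<^bsub>?D\<^esub> b \<in> B. \<phi> b *\<^sub>?D e b)"
  proof (rule mhom_eqI[OF phi])
   have "(\<Oplus>\<^bsub>?D\<^esub> b \<in> B. \<phi> b *\<^sub>?D e b) :. ?D"
    by (rule D.M.finsum_closed) (use sc V' in auto)
   then show "(\<Oplus>\<^bsub>?D\<^esub> b \<in> B. \<phi> b *\<^sub>?D e b) : mhom K V (reg K)" using V' by simp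
   fix v assume v: "v :. V"
   have "(\<Oplus>\<^bsub>?D\<^esub> b \<in> B. \<phi> b *\<^sub>?D e b) v = (\<Oplus>\<^bsub>reg K\<^esub> b \<in> B. (\<phi> b *\<^sub>?D e b) v)"
    by (rule finsum_additive[OF D.M.abelian_group_axioms m.N.M.abelian_group_axioms, of "%h. h v"])
     (use v sc V' in "auto dest: mhom_closed")
   also have "\<dots> = (\<Oplus>\<^bsub>reg K\<^esub> b \<in> B. \<phi> (coord V B v b *\<^sub>V b))"
   proof (rule m.N.M.finsum_cong')
    fix b assume b: "b : B"
    have "(\<phi> b *\<^sub>?D e b) v = \<phi> b \<otimes>\<^sub>K e b v"
     using v mhom_smult[OF e[OF b] pb[OF b] v] by simp
    then show "(\<phi> b *\<^sub>?D e b) v = \<phi> (coord V B v b *\<^sub>V b)"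
     using v cc b BV pb by (simp add: e_def m_comm)
   qed (use v cc BV p.closed V.smult_closed in "auto simp del: p.smult")
   also have "\<dots> = \<phi> (\<Oplus>\<^bsub>V\<^esub> b \<in> B. coord V B v b *\<^sub>V b)"
    by (rule p.finsum[symmetric]) (use v cc BV in auto)
   also have "\<dots> = \<phi> v" using co(2)[OF v] by simp
   finally show "\<phi> v = (\<Oplus>\<^bsub>?D\<^esub> b \<in> B. \<phi> b *\<^sub>?D e b) v" ..
  qed
  then have "\<mu> \<phi> = \<mu> (\<Oplus>\<^bsub>?D\<^esub> b \<in> B. \<phi> b *\<^sub>?D e b)" by simp
  also have "\<dots> = (\<Oplus>\<^bsub>reg K\<^esub> b \<in> B. \<mu> (\<phi> b *\<^sub>?D e b))"
   by (rule m.finsum) (use sc V' in auto)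
  also have "\<dots> = (\<Oplus>\<^bsub>reg K\<^esub> b \<in> B. \<phi> (\<mu> (e b) *\<^sub>V b))"
  proof (rule m.N.M.finsum_cong')
   fix b assume b: "b : B"
   have "\<mu> (\<phi> b *\<^sub>?D e b) = \<phi> b \<otimes>\<^sub>K \<mu> (e b)"
    using m.smult[of "\<phi> b" "e b"] pb[OF b] e[OF b] V' by simp
   then show "\<mu> (\<phi> b *\<^sub>?D e b) = \<phi> (\<mu> (e b) *\<^sub>V b)"
    using b BV pb me by (simp add: m_comm)
  qed (use me BV p.closed V.smult_closed in "auto simp del: p.smult")
  also have "\<dots> = \<phi> ?v" by (rule p.finsum[symmetric]) (use me BV in auto)
  finally show ?thesis .
 qed
 moreover have "?v :. V" by (rule V.M.finsum_closed) (use me BV in auto)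
 ultimately show ?thesis by blast
qed

end

section \<open>Modules over a finite-dimensional algebra\<close>

sublocale fd_algebra \<subseteq> vs K ..

context fd_algebra
begin

definition unit_map :: "'a \<Rightarrow> 'b" where "unit_map c = c *\<^sub>A \<one>\<^sub>A"

lemma unit_map [simp]:
 "c :. K ==> unit_map c :. A"
 by (simp add: unit_map_def)

lemma unit_map_mult:
 "[|c :. K; a :. A|] ==> unit_map c \<otimes>\<^sub>A a = c *\<^sub>A a"
 "[|c :. K; a :. A|] ==> a \<otimes>\<^sub>A unit_map c = c *\<^sub>A a"
 by (simp_all add: unit_map_def smult_mult_left smult_mult_right)

lemma unit_map_ring:
 "[|c :. K; d :. K|] ==> unit_map (c \<oplus>\<^sub>K d) = unit_map c \<oplus>\<^sub>A unit_map d"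
 "[|c :. K; d :. K|] ==> unit_map (c \<otimes>\<^sub>K d) = unit_map c \<otimes>\<^sub>A unit_map d"
 "unit_map \<one>\<^sub>K = \<one>\<^sub>A"
proof -
 show "[|c :. K; d :. K|] ==> unit_map (c \<otimes>\<^sub>K d) = unit_map c \<otimes>\<^sub>A unit_map d"
  by (subst unit_map_mult) (simp_all add: unit_map_def smult_assoc1)
qed (simp_all add: unit_map_def smult_l_distr)

lemma scal_smult: "c \<odot>\<^bsub>scal A M\<^esub> x = unit_map c *\<^sub>M x"
 by (simp add: unit_map_def)

lemma lm_scal: assumes "lmod A M" shows "lmod K (scal A M)"
proof -
 interpret M: left_module A M by fact
 have "abelian_group (scal A M)"
  by (rule abelian_groupI) (use M.M.l_neg in "auto simp: M.M.a_ac")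
 then show ?thesis
  by (intro left_module.intro left_module_axioms.intro K.ring_axioms)
   (simp_all add: unit_map_ring M.smult_l_distr M.smult_r_distr M.smult_assoc
    flip: unit_map_def)
qed

lemma mhom_scal: "f : mhom A M N ==> f : mhom K (scal A M) (scal A N)"
 by (auto simp: mhom_def simp flip: unit_map_def)

lemma submodule_scal:
 assumes "lmod A M" "submodule N A M" shows "submodule N K (scal A M)"
proof -
 interpret M: left_module A M by fact
 interpret S: left_module K "scal A M" by (rule lm_scal[OF assms(1)])
 show ?thesis
  by (rule S.submodI) (use M.submodD[OF assms(2)] in "auto simp flip: unit_map_def")
qed

lemma scal_submod: "scal A (submod M N) = submod (scal A M) N"
 by (simp add: scal_def submod_def)

lemma fdmD: "fd_module K A M ==> lmod A M" "fd_module K A M ==> fin_dim K (scal A M)"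
 by (auto simp: fd_module_def)

lemma fdm_submod: "[|fd_module K A M; submodule N A M|] ==> fd_module K A (submod M N)"
 by (simp add: fd_module_def left_module_submod scal_submod fin_dim_sub submodule_scal)

lemma fdm_onto:
 assumes "fd_module K A M" "lmod A N" "f : mhom A M N" "f ` car M = car N"
 shows "fd_module K A N"
 using assms fin_dim_onto[OF _ lm_scal mhom_scal, of M N f] by (auto simp: fd_module_def)

lemma fdm_quot:
 assumes "fd_module K A M" "submodule N A M" shows "fd_module K A (quot M N)"
proof -
 interpret q: submod_of A M N using assms by (intro submod_ofI fdmD)
 show ?thesis
  by (rule fdm_onto[OF assms(1) q.left_module_quot q.quot_proj]) (auto simp: quot_carrier)
qed

lemma fdm_reg: "fd_module K A (reg A)"
 unfolding fd_module_def
proof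
 show lm: "lmod A (reg A)" by (rule left_module_reg) (rule A.ring_axioms)
 have "lmod K A" using finite_dimensional by (rule fin_dimD)
 show "fin_dim K (scal A (reg A))"
  by (rule fin_dim_onto[OF finite_dimensional lm_scal[OF lm], of "\<lambda>x\<in>car A. x"])
   (auto intro!: mhom_restrictI \<open>left_module K A\<close> simp: unit_map_mult simp flip: unit_map_def)
qed

lemma lm_Hom_space:
 assumes M: "lmod A M" and N: "lmod A N"
 shows "lmod K (Hom_space A M N)"
proof -
 interpret M: left_module A M by fact
 interpret N: left_module A N by fact
 have c: "f x :. N" if "f : mhom A M N" "x :. M" for f x
  using that by (rule mhom_closed)
 have e: "restrict f (car M) = f" if "f : mhom A M N" for f
  using mhom_ext[OF that] by (rule extensional_restrict)
 have s: "(\<lambda>x\<in>car M. unit_map a *\<^sub>N f x) : mhom A M N" if "f : mhom A M N" "a :. K" for f a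
 proof (rule mhom_restrictI[OF M])
  fix b x assume "b :. A" "x :. M"
  then show "unit_map a *\<^sub>N f (b *\<^sub>M x) = b *\<^sub>N (unit_map a *\<^sub>N f x)"
   using that c[OF that(1)] by (simp add: mhom_smult[OF that(1)] unit_map_mult flip: N.smult_assoc)
 qed (use that in "auto simp: c mhom_add N.smult_r_distr")
 have "abelian_group (Hom_space A M N)"
  by (rule abelian_group_fun[of N _ "car M"])
   (use mhom_plus[OF M N] mhom_uminus[OF M N] mhom_zero[OF M N] N.M.abelian_group_axioms
    in "auto simp: mhom_def")
 then show ?thesis
  by (intro left_module.intro left_module_axioms.intro K.ring_axioms)
   (auto simp: c s e N.smult_l_distr N.smult_r_distr N.smult_assoc unit_map_ring
    intro!: restrict_ext cong: restrict_cong simp flip: unit_map_def)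
qed

lemma fin_dim_Hom_space:
 assumes M: "fd_module K A M" and N: "fd_module K A N"
 shows "fin_dim K (Hom_space A M N)"
proof (rule fin_dim_inj[OF lm_Hom_space fin_dim_vHom])
 show "lmod A M" "lmod A N" "fin_dim K (scal A M)" "fin_dim K (scal A N)"
  using M N by (simp_all add: fdmD)
 note lm = lm_Hom_space[OF this(1,2)]
 show "(\<lambda>f\<in>mhom A M N. f) : mhom K (Hom_space A M N) (Hom_space (reg K) (scal A M) (scal A N))"
  using mhom_restrictI[OF lm, of "%f. f" "Hom_space (reg K) (scal A M) (scal A N)"]
  by (simp add: mhom_scal)
qed auto

end


lemma left_module_group: "lmod R M ==> abelian_group M"
 by (simp add: left_module_def)

lemma compose_image: "compose A f g ` A = f ` (g ` A)"
 by (simp add: compose_def image_image)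

lemma submod_submod: "submod (submod M N) L = submod M L"
 by (simp add: submod_def)

lemma opp_sel [simp]:
 "car (opp A) = car A" "add (opp A) = add A" "zero (opp A) = zero A"
 "one (opp A) = one A" "smult (opp A) = smult A" "mult (opp A) = (%x y. y \<otimes>\<^sub>A x)"
 by (simp_all add: opp_def)

lemma opp_opp [simp]: "opp (opp A) = A"
 by (cases A) (simp add: opp_def)

lemma finsum_opp [simp]: "finsum (opp A) = finsum A"
 by (intro ext) (simp add: finsum_def finprod_def opp_def)

lemma (in fd_algebra) fd_algebra_opp: "fd_algebra K (opp A)"
proof -
 have ab: "abelian_group (opp A)"
  by (rule abelian_groupI) (use A.l_neg in "auto simp: A.a_ac")
 have ring: "ring (opp A)"
  by (rule ringI[OF ab]) (auto intro!: monoidI simp: A.m_assoc A.l_distr A.r_distr)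
 have mod: "module K (opp A)"
  by (rule moduleI[OF is_cring ab]) (auto simp: smult_l_distr smult_r_distr smult_assoc1)
 have "vbasis K (opp A) = vbasis K A" by (simp add: vbasis_def fun_eq_iff)
 then have "fin_dim K (opp A)" using finite_dimensional mod by (simp add: fin_dim_def)
 then show ?thesis
  by (intro fd_algebra.intro fd_algebra_axioms.intro ring mod field_axioms)
   (auto simp: smult_mult_left smult_mult_right)
qed

subsection \<open>Transport of structure\<close>

text \<open>Copies the structure along an injection \<phi>; this is how a module enters the type of
  coordinate tuples.\<close>

definition transport :: "('a, 'm) module \<Rightarrow> ('m \<Rightarrow> 'n) \<Rightarrow> ('a, 'n) module" where
 "transport M \<phi> = \<lparr>carrier = \<phi> ` car M, mult = undefined, one = undefined, zero = \<phi> \<zero>\<^sub>M,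
  add = (%x y. \<phi> (inv_into (car M) \<phi> x \<oplus>\<^sub>M inv_into (car M) \<phi> y)),
  smult = (%a x. \<phi> (a *\<^sub>M inv_into (car M) \<phi> x))\<rparr>"

lemma transport_iso:
 assumes M: "lmod R M" and inj: "inj_on \<phi> (car M)"
 shows "lmod R (transport M \<phi>)" "(\<lambda>x\<in>car M. \<phi> x) : miso R M (transport M \<phi>)"
proof -
 have a: "\<phi> (x \<oplus>\<^sub>M y) = \<phi> x \<oplus>\<^bsub>transport M \<phi>\<^esub> \<phi> y" if "x :. M" "y :. M" for x y
  using that inj by (simp add: transport_def)
 have s: "\<phi> (c *\<^sub>M x) = c \<odot>\<^bsub>transport M \<phi>\<^esub> \<phi> x" if "x :. M" for x c
  using that inj by (simp add: transport_def)
 show "lmod R (transport M \<phi>)"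
  by (rule left_module_image[OF M, of \<phi>]) (auto simp: a s, simp_all add: transport_def)
 show "(\<lambda>x\<in>car M. \<phi> x) : miso R M (transport M \<phi>)"
 proof (rule misoI)
  show "(\<lambda>x\<in>car M. \<phi> x) : mhom R M (transport M \<phi>)"
   by (rule mhom_restrictI[OF M]) (auto simp: a s, simp add: transport_def)
 qed (use inj in "auto simp: transport_def inj_on_def")
qed

context fd_algebra
begin

lemma fdm_iso: "[|fd_module K A M; lmod A N; f : miso A M N|] ==> fd_module K A N"
 by (rule fdm_onto[of M N f]) (auto simp: miso_def bij_betw_def)

text \<open>The coordinates in a basis numbered by the naturals, padded by zero beyond the
  dimension, give an injection into \<open>nat \<Rightarrow> 'a\<close>. Thus statements quantified
  over \<open>fdmod\<close> reach modules of every type.\<close>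

lemma ex_coordinate_module:
 assumes M: "fd_module K A M"
 shows "EX (M' :: ('a, 'b) fdmod) f. fd_module K A M' & f : miso A M M'"
proof -
 note M' = fdmD[OF M]
 note S = lm_scal[OF M'(1)]
 obtain B where B: "vbasis K (scal A M) B" "finite B" using fin_dimE[OF M'(2)] by metis
 note co = coords[OF S B(1)]
 obtain h where h: "bij_betw h {0..<card B} B" using ex_bij_betw_nat_finite[OF B(2)] by blast
 define \<phi> where "\<phi> v = (%i. if i < card B then coord (scal A M) B v (h i) else \<zero>\<^sub>K)" for v
 have "inj_on \<phi> (car M)"
 proof (rule inj_onI)
  fix v w assume vw: "v :. M" "w :. M" "\<phi> v = \<phi> w"
  have "coord (scal A M) B v b = coord (scal A M) B w b" if b: "b : B" for b
  proof -
   obtain i where "i < card B" "h i = b"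
    using h b by (metis atLeastLessThan_iff bij_betw_imp_surj_on imageE)
   then show ?thesis using fun_cong[OF vw(3), of i] by (simp add: \<phi>_def)
  qed
  moreover have "coord (scal A M) B v : B \<rightarrow>\<^sub>E car K" "coord (scal A M) B w : B \<rightarrow>\<^sub>E car K"
   using co(1) vw by simp_all
  ultimately have "coord (scal A M) B v = coord (scal A M) B w" by (blast intro: PiE_ext)
  then show "v = w" using co(2)[of v] co(2)[of w] vw by simp
 qed
 from transport_iso[OF M'(1) this] show ?thesis using fdm_iso[OF M] by blast
qed

subsection \<open>Projective modules\<close>

lemma projD: "projective K A P ==> fd_module K A P" "projective K A P ==> lmod A P"
 by (auto simp: projective_def fdmD)

text \<open>\<open>projective\<close> tests only targets in the fixed universe. Here
  \<open>M\<close> and \<open>N\<close> have arbitrary types; they are replaced by coordinate copies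
  and the lift is carried back.\<close>

lemma proj_lift:
 assumes P: "projective K A P" and M: "fd_module K A M" and N: "fd_module K A N"
  and g: "g : mhom A M N" "g ` car M = car N" and f: "f : mhom A P N"
 shows "EX h : mhom A P M. ALL p : car P. g (h p) = f p"
proof -
 note lm = fdmD(1)[OF M] fdmD(1)[OF N] projD(2)[OF P]
 obtain M' :: "('a, 'b) fdmod" and s where M': "fd_module K A M'" and s: "s : miso A M M'"
  using ex_coordinate_module[OF M] by blast
 obtain N' :: "('a, 'b) fdmod" and t where N': "fd_module K A N'" and t: "t : miso A N N'"
  using ex_coordinate_module[OF N] by blast
 note lm' = fdmD(1)[OF M'] fdmD(1)[OF N']
 obtain s' where s': "s' : miso A M' M" "ALL x : car M. s' (s x) = x" using miso_inv[OF lm(1) lm'(1) s] by blast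
 obtain t' where t': "t' : miso A N' N" "ALL x : car N. t' (t x) = x"
  using miso_inv[OF lm(2) lm'(2) t] by blast
 have h: "s : mhom A M M'" "s' : mhom A M' M" "t : mhom A N N'" "t' : mhom A N' N"
  using s t s' t' by (auto simp: miso_def)
 let ?g = "compose (car M') t (compose (car M') g s')"
 have gm: "?g : mhom A M' N'" by (rule mhom_compose[OF lm'(1) mhom_compose[OF lm'(1) h(2) g(1)] h(3)])
 have "?g ` car M' = car N'"
 proof (intro equalityI subsetI)
  fix y assume "y :. N'"
  then obtain n where n: "n :. N" "y = t n" using t by (auto simp: miso_def bij_betw_def)
  then obtain m where m: "m :. M" "n = g m" using g(2) by auto
  have "s m :. M'" using mhom_closed[OF h(1) m(1)] .
  then show "y : ?g ` car M'"
   using n m s'(2) by (intro image_eqI[of _ _ "s m"]) (simp_all add: compose_eq)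
 qed (use mhom_closed[OF gm] in auto)
 then obtain h' where h': "h' : mhom A P M'" "ALL p : car P. ?g (h' p) = compose (car P) t f p"
  using P gm M' N' mhom_compose[OF lm(3) f h(3)] unfolding projective_def by blast
 have "g (s' (h' p)) = f p" if p: "p :. P" for p
 proof -
  have hp: "h' p :. M'" using mhom_closed[OF h'(1) p] .
  have "t (g (s' (h' p))) = t (f p)"
   using bspec[OF h'(2) p] hp p by (simp add: compose_eq)
  moreover have "g (s' (h' p)) :. N" "f p :. N"
   using mhom_closed[OF g(1) mhom_closed[OF h(2) hp]] mhom_closed[OF f p] by auto
  ultimately show ?thesis using t'(2) by metis
 qed
 then show ?thesis
  by (intro bexI[of _ "compose (car P) s' h'"] mhom_compose[OF lm(3) h'(1) h(2)])
   (simp_all add: compose_eq)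
qed

lemma retract_projective:
 assumes P: "projective K A P" and Q: "fd_module K A Q" and i: "i : mhom A Q P" and r: "r : mhom A P Q"
  and ri: "!!q. q :. Q ==> r (i q) = q"
 shows "projective K A Q"
 unfolding projective_def
proof (intro conjI allI impI Q)
 fix M N :: "('a, 'b) fdmod" and g f
 assume *: "fd_module K A M & fd_module K A N & g : mhom A M N & g ` car M = car N & f : mhom A Q N"
 then obtain h where h: "h : mhom A P M" "ALL p : car P. g (h p) = compose (car P) f r p"
  using proj_lift[OF P, of M N g "compose (car P) f r"] mhom_compose[OF projD(2)[OF P] r] by blast
 show "EX h : mhom A Q M. ALL p : car Q. g (h p) = f p"
  by (rule bexI[of _ "compose (car Q) h i"])
   (use h(2) mhom_closed[OF i] ri mhom_compose[OF fdmD(1)[OF Q] i h(1)] in "auto simp: compose_eq")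
qed

lemma iso_projective:
 assumes P: "projective K A P" and Q: "lmod A Q" and f: "f : miso A P Q"
 shows "projective K A Q"
proof -
 obtain g where g: "g : miso A Q P" "ALL y : car Q. f (g y) = y"
  using miso_inv[OF projD(2)[OF P] Q f] by blast
 show ?thesis
  by (rule retract_projective[OF P fdm_iso[OF projD(1)[OF P] Q f], of g f])
   (use f g in "auto simp: miso_def")
qed

lemma projective_section:
 assumes P: "projective K A P" and M: "fd_module K A M" and g: "g : mhom A M P" "g ` car M = car P"
 shows "EX s : mhom A P M. ALL p : car P. g (s p) = p"
 using proj_lift[OF P M projD(1)[OF P] g mhom_id[OF projD(2)[OF P]]] by simp

subsection \<open>Free modules\<close>

definition free :: "'i set \<Rightarrow> ('b, 'i \<Rightarrow> 'b) module" where
 "free B = \<lparr>carrier = B \<rightarrow>\<^sub>E car A, mult = undefined, one = undefined, zero = (\<lambda>b\<in>B. \<zero>\<^sub>A),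
  add = (%f g. \<lambda>b\<in>B. f b \<oplus>\<^sub>A g b), smult = (%a f. \<lambda>b\<in>B. a \<otimes>\<^sub>A f b)\<rparr>"

lemma free_sel [simp]:
 "car (free B) = B \<rightarrow>\<^sub>E car A" "zero (free B) = (\<lambda>b\<in>B. \<zero>\<^sub>A)"
 "add (free B) = (%f g. \<lambda>b\<in>B. f b \<oplus>\<^sub>A g b)" "smult (free B) = (%a f. \<lambda>b\<in>B. a \<otimes>\<^sub>A f b)"
 by (simp_all add: free_def)

lemma lm_free: "lmod A (free B)"
proof -
 have "abelian_group (free B)"
  by (rule abelian_group_fun[of A _ B]) (auto simp: A.abelian_group_axioms)
 moreover have "restrict f B = f" if "f : B \<rightarrow>\<^sub>E car A" for f
  using that by (auto simp: PiE_iff intro: extensional_restrict)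
 moreover have "f b :. A" if "f : B \<rightarrow>\<^sub>E car A" "b : B" for f b
  using that by auto
 ultimately show ?thesis
  by (intro left_module.intro left_module_axioms.intro A.ring_axioms)
   (auto simp: A.l_distr A.r_distr A.m_assoc intro!: restrict_ext cong: restrict_cong)
qed

definition inc :: "'i set \<Rightarrow> 'i \<Rightarrow> 'b \<Rightarrow> 'i \<Rightarrow> 'b" where
 "inc B b x = (\<lambda>b'\<in>B. if b' = b then x else \<zero>\<^sub>A)"

lemma inc [simp]: "x :. A ==> inc B b x : B \<rightarrow>\<^sub>E car A"
 by (auto simp: inc_def)

lemma free_expand:
 assumes "finite B" "\<phi> :. (free B)"
 shows "\<phi> = (\<Oplus>\<^bsub>free B\<^esub> b \<in> B. inc B b (\<phi> b))"
proof -
 interpret F: left_module A "free B" by (rule lm_free)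
 have p: "\<phi> b :. A" if "b : B" for b using assms(2) that by auto
 have "(\<Oplus>\<^bsub>free B\<^esub> b \<in> B. inc B b (\<phi> b)) :. (free B)"
  by (rule F.M.finsum_closed) (use p in auto)
 then have cl: "(\<Oplus>\<^bsub>free B\<^esub> b \<in> B. inc B b (\<phi> b)) : B \<rightarrow>\<^sub>E car A" by simp
 show ?thesis
 proof (rule PiE_ext[OF _ cl])
  show "\<phi> : B \<rightarrow>\<^sub>E car A" using assms(2) by simp
  fix b' assume b': "b' : B"
  have "(\<Oplus>\<^bsub>free B\<^esub> b \<in> B. inc B b (\<phi> b)) b' = (\<Oplus>\<^bsub>A\<^esub> b \<in> B. inc B b (\<phi> b) b')"
   by (rule finsum_additive[OF F.M.abelian_group_axioms A.abelian_group_axioms, of "%f. f b'"])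
    (use b' p in auto)
  also have "\<dots> = (\<Oplus>\<^bsub>A\<^esub> b \<in> B. if b' = b then \<phi> b else \<zero>\<^sub>A)"
   using b' p by (intro A.finsum_cong') (auto simp: inc_def)
  also have "\<dots> = \<phi> b'" by (rule A.finsum_singleton[OF b' assms(1)]) (use p in auto)
  finally show "\<phi> b' = (\<Oplus>\<^bsub>free B\<^esub> b \<in> B. inc B b (\<phi> b)) b'" ..
 qed
qed

lemma free_lift:
 assumes M: "lmod A M" and B: "finite B" and m: "!!b. b : B ==> m b :. M"
 shows "(\<lambda>\<phi>\<in>car (free B). \<Oplus>\<^bsub>M\<^esub> b \<in> B. \<phi> b *\<^sub>M m b) : mhom A (free B) M"
proof -
 interpret M: left_module A M by fact
 have c: "\<phi> b :. A" if "\<phi> :. (free B)" "b : B" for \<phi> b using that by auto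
 show ?thesis
 proof (rule mhom_restrictI[OF lm_free])
  fix f g assume fg: "f :. (free B)" "g :. (free B)"
  have "(\<Oplus>\<^bsub>M\<^esub> b \<in> B. (f \<oplus>\<^bsub>free B\<^esub> g) b *\<^sub>M m b) = (\<Oplus>\<^bsub>M\<^esub> b \<in> B. f b *\<^sub>M m b \<oplus>\<^sub>M g b *\<^sub>M m b)"
   using c fg m by (intro M.M.finsum_cong') (auto simp: M.smult_l_distr intro!: M.smult_closed)
  also have "\<dots> = (\<Oplus>\<^bsub>M\<^esub> b \<in> B. f b *\<^sub>M m b) \<oplus>\<^sub>M (\<Oplus>\<^bsub>M\<^esub> b \<in> B. g b *\<^sub>M m b)"
   using c fg m by (intro M.M.finsum_addf) (auto intro!: M.smult_closed)
  finally show "(\<Oplus>\<^bsub>M\<^esub> b \<in> B. (f \<oplus>\<^bsub>free B\<^esub> g) b *\<^sub>M m b) =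
   (\<Oplus>\<^bsub>M\<^esub> b \<in> B. f b *\<^sub>M m b) \<oplus>\<^sub>M (\<Oplus>\<^bsub>M\<^esub> b \<in> B. g b *\<^sub>M m b)" .
 next
  fix a f assume af: "a :. A" "f :. (free B)"
  have "a *\<^sub>M (\<Oplus>\<^bsub>M\<^esub> b \<in> B. f b *\<^sub>M m b) = (\<Oplus>\<^bsub>M\<^esub> b \<in> B. a *\<^sub>M (f b *\<^sub>M m b))"
   using c af m B by (intro M.finsum_smult) (auto intro!: M.smult_closed)
  also have "\<dots> = (\<Oplus>\<^bsub>M\<^esub> b \<in> B. (a \<odot>\<^bsub>free B\<^esub> f) b *\<^sub>M m b)"
   using c af m by (intro M.M.finsum_cong') (auto simp: M.smult_assoc intro!: M.smult_closed)
  finally show "(\<Oplus>\<^bsub>M\<^esub> b \<in> B. (a \<odot>\<^bsub>free B\<^esub> f) b *\<^sub>M m b) = a *\<^sub>M (\<Oplus>\<^bsub>M\<^esub> b \<in> B. f b *\<^sub>M m b)" ..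
 qed (use c m in "auto intro!: M.M.finsum_closed M.smult_closed")
qed

lemma fdm_free: assumes B: "finite B" shows "fd_module K A (free B)"
proof -
 note F = lm_free[of B]
 interpret S: left_module K "scal A (free B)" by (rule lm_scal[OF F])
 interpret a: left_module K "scal A (reg A)" by (rule lm_scal[OF fdmD(1)[OF fdm_reg]])
 obtain C where C: "finite C" "gen K (scal A (reg A)) C" using fin_dimE[OF fdmD(2)[OF fdm_reg]] by metis
 have CA: "!!x. x : C ==> x :. A" using gen_sub[OF C(2)] by auto
 have i: "inc B b (x \<oplus>\<^sub>A y) = inc B b x \<oplus>\<^bsub>free B\<^esub> inc B b y" if "x :. A" "y :. A" for b x y
  using that by (auto simp: inc_def intro!: restrict_ext)
 have ismul: "inc B b (a \<otimes>\<^sub>A x) = a \<odot>\<^bsub>free B\<^esub> inc B b x" if "x :. A" "a :. A" for b a x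
  using that by (auto simp: inc_def intro!: restrict_ext)
 have i0: "inc B b \<zero>\<^sub>A = \<zero>\<^bsub>free B\<^esub>" for b by (auto simp: inc_def intro!: restrict_ext)
 let ?G = "(%(b, c). inc B b c) ` (B \<times> C)"
 have "gen K (scal A (free B)) ?G" unfolding gen_def
 proof (intro conjI allI impI subsetI)
  show "x :. (scal A (free B))" if "x : ?G" for x
  proof -
   from that obtain b c where "x = inc B b c" "c : C" by auto
   then show ?thesis using CA inc by simp
  qed
 next
  fix N \<phi> assume N: "submodule N K (scal A (free B))" "?G \<subseteq> N" "\<phi> :. (scal A (free B))"
  note sN = S.submodD[OF N(1), simplified scal_sel]
  have "inc B b x : N" if b: "b : B" and x: "x :. A" for b x
  proof -
   have "submodule {x : car A. inc B b x : N} K (scal A (reg A))"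
    by (rule a.submodI)
     (use sN in "auto simp: i ismul i0 simp del: free_sel simp flip: unit_map_def")
   from genD[OF C(2) this] show ?thesis using N(2) b CA x by auto
  qed
  then have "(\<Oplus>\<^bsub>scal A (free B)\<^esub> b \<in> B. inc B b (\<phi> b)) : N"
   by (intro S.submod_finsum[OF N(1)]) (use N(3) in auto)
  then show "\<phi> : N" using free_expand[OF B, of \<phi>] N(3) by simp
 qed
 then have "fin_dim K (scal A (free B))"
  using B C(1) by (intro fin_dimI[OF S.left_module_axioms]) auto
 then show ?thesis using F by (simp add: fd_module_def)
qed

lemma projective_free: assumes B: "finite B" shows "projective K A (free B)"
 unfolding projective_def
proof (intro conjI allI impI fdm_free B)
 fix M N :: "('a, 'b) fdmod" and g f
 assume *: "fd_module K A M & fd_module K A N & g : mhom A M N & g ` car M = car N & f : mhom A (free B) N"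
 interpret F: left_module A "free B" by (rule lm_free)
 interpret g: mod_hom A M N g using * by (intro mod_homI fdmD) auto
 interpret f: mod_hom A "free B" N f using * by (intro mod_homI fdmD lm_free) auto
 have "ALL b : B. EX m. m :. M & g m = f (inc B b \<one>\<^sub>A)"
 proof
  fix b assume "b : B"
  have "f (inc B b \<one>\<^sub>A) :. N" by (rule f.closed) simp
  then show "EX m. m :. M & g m = f (inc B b \<one>\<^sub>A)" using * by (metis imageE)
 qed
 then obtain m where m: "!!b. b : B ==> m b :. M" "!!b. b : B ==> g (m b) = f (inc B b \<one>\<^sub>A)"
  by metis
 let ?h = "\<lambda>\<phi>\<in>car (free B). \<Oplus>\<^bsub>M\<^esub> b \<in> B. \<phi> b *\<^sub>M m b"
 have "g (?h \<phi>) = f \<phi>" if p: "\<phi> :. (free B)" for \<phi>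
 proof -
  have c: "\<phi> b :. A" if "b : B" for b using p that by auto
  have "g (\<Oplus>\<^bsub>M\<^esub> b \<in> B. \<phi> b *\<^sub>M m b) = (\<Oplus>\<^bsub>N\<^esub> b \<in> B. g (\<phi> b *\<^sub>M m b))"
   by (rule g.finsum) (use c m in "auto intro!: g.M.smult_closed")
  also have "\<dots> = (\<Oplus>\<^bsub>N\<^esub> b \<in> B. f (inc B b (\<phi> b)))"
  proof (rule g.N.M.finsum_cong')
   fix b assume b: "b : B"
   have "inc B b (\<phi> b) = \<phi> b \<odot>\<^bsub>free B\<^esub> inc B b \<one>\<^sub>A"
    using c[OF b] by (auto simp: inc_def intro!: restrict_ext)
   then show "g (\<phi> b *\<^sub>M m b) = f (inc B b (\<phi> b))"
    using c[OF b] m[OF b] f.smult[of "\<phi> b" "inc B b \<one>\<^sub>A"] by simp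
  qed (use c f.closed in auto)
  also have "\<dots> = f (\<Oplus>\<^bsub>free B\<^esub> b \<in> B. inc B b (\<phi> b))"
   by (rule f.finsum[symmetric]) (use c in auto)
  also have "\<dots> = f \<phi>" using free_expand[OF B p] by simp
  finally show ?thesis using p by simp
 qed
 then show "EX h : mhom A (free B) M. ALL p : car (free B). g (h p) = f p"
  using free_lift[OF g.M.left_module_axioms B, of m] m(1) by blast
qed

text \<open>A set that spans over \<open>K\<close> also generates over \<open>A\<close>:
  coefficients in \<open>K\<close> become coefficients in \<open>A\<close> through
  \<open>unit_map\<close>.\<close>

lemma free_cover:
 assumes M: "fd_module K A M"
 obtains B where "finite B" "B \<subseteq> car M"
  "(\<lambda>\<phi>\<in>car (free B). \<Oplus>\<^bsub>M\<^esub> b \<in> B. \<phi> b *\<^sub>M b) ` car (free B) = car M"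
proof -
 note M' = fdmD[OF M]
 interpret M: left_module A M by (rule M')
 obtain B where B: "finite B" "gen K (scal A M) B" using fin_dimE[OF M'(2)] by metis
 have BM: "!!b. b : B ==> b :. M" using gen_sub[OF B(2)] by auto
 let ?p = "\<lambda>\<phi>\<in>car (free B). \<Oplus>\<^bsub>M\<^esub> b \<in> B. \<phi> b *\<^sub>M b"
 have p: "?p : mhom A (free B) M" by (rule free_lift[OF M'(1) B(1) BM])
 have "car M \<subseteq> ?p ` car (free B)"
 proof
  fix x assume "x :. M"
  then obtain c where c: "c : B \<rightarrow>\<^sub>E car K" "x = (\<Oplus>\<^bsub>M\<^esub> b \<in> B. unit_map (c b) *\<^sub>M b)"
   using gen_comb[OF lm_scal[OF M'(1)] B, of x] by (auto simp flip: unit_map_def)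
  have ub: "(\<lambda>b\<in>B. unit_map (c b)) :. (free B)" using c(1) by (auto intro!: unit_map)
  have "x = (\<Oplus>\<^bsub>M\<^esub> b \<in> B. (\<lambda>b\<in>B. unit_map (c b)) b *\<^sub>M b)"
   unfolding c(2) using c(1) BM by (intro M.M.finsum_cong') (auto intro!: M.smult_closed unit_map)
  with ub show "x : ?p ` car (free B)"
   by (intro image_eqI[of _ _ "\<lambda>b\<in>B. unit_map (c b)"]) simp_all
 qed
 then have "?p ` car (free B) = car M" using mhom_closed[OF p] by blast
 then show ?thesis using that B(1) BM by blast
qed

lemma ex_projective_onto:
 assumes M: "fd_module K A M"
 shows "EX (P :: ('a, 'b) fdmod) p. projective K A P & p : mhom A P M & p ` car P = car M"
proof -
 obtain B where B: "finite B" "B \<subseteq> car M"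
  "(\<lambda>\<phi>\<in>car (free B). \<Oplus>\<^bsub>M\<^esub> b \<in> B. \<phi> b *\<^sub>M b) ` car (free B) = car M" (is "?p ` _ = _")
  using free_cover[OF M] by blast
 have p: "?p : mhom A (free B) M" by (rule free_lift[OF fdmD(1)[OF M] B(1)]) (use B(2) in auto)
 obtain P :: "('a, 'b) fdmod" and f where P: "fd_module K A P" "f : miso A (free B) P"
  using ex_coordinate_module[OF fdm_free[OF B(1)]] by blast
 obtain g where g: "g : miso A P (free B)" using miso_inv[OF lm_free fdmD(1)[OF P(1)] P(2)] by blast
 have gm: "g : mhom A P (free B)" "g ` car P = car (free B)"
  using g by (auto simp: miso_def bij_betw_def)
 have "compose (car P) ?p g ` car P = car M"
  unfolding compose_image gm(2) by (rule B(3))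
 with mhom_compose[OF fdmD(1)[OF P(1)] gm(1) p] iso_projective[OF projective_free[OF B(1)] fdmD(1)[OF P(1)] P(2)]
 show ?thesis by (intro exI conjI)
qed

text \<open>The functionals are the components of a section of a free cover, which splits because
  \<open>P\<close> is projective.\<close>

lemma dual_basis:
 assumes P: "projective K A P"
 obtains B \<xi> where "finite B" "B \<subseteq> car P" "!!b. b : B ==> \<xi> b : mhom A P (reg A)"
  "!!p. p :. P ==> p = (\<Oplus>\<^bsub>P\<^esub> b \<in> B. \<xi> b p *\<^sub>P b)"
proof -
 note lmP = projD(2)[OF P]
 obtain B where B: "finite B" "B \<subseteq> car P"
  "(\<lambda>\<phi>\<in>car (free B). \<Oplus>\<^bsub>P\<^esub> b \<in> B. \<phi> b *\<^sub>P b) ` car (free B) = car P" (is "?p ` _ = _")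
  using free_cover[OF projD(1)[OF P]] by blast
 have p: "?p : mhom A (free B) P" by (rule free_lift[OF lmP B(1)]) (use B(2) in auto)
 obtain s where s: "s : mhom A P (free B)" "ALL x : car P. ?p (s x) = x"
  using projective_section[OF P fdm_free[OF B(1)] p B(3)] by blast
 show ?thesis
 proof (rule that[of B "%b. \<lambda>x\<in>car P. s x b", OF B(1,2)])
  fix b assume b: "b : B"
  show "(\<lambda>x\<in>car P. s x b) : mhom A P (reg A)"
   by (rule mhom_restrictI[OF lmP])
    (use b mhom_closed[OF s(1)] mhom_add[OF s(1)] mhom_smult[OF s(1)] in auto)
 next
  fix x assume x: "x :. P"
  have "x = (\<Oplus>\<^bsub>P\<^esub> b \<in> B. s x b *\<^sub>P b)"
   using bspec[OF s(2) x] mhom_closed[OF s(1) x] by simp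
  then show "x = (\<Oplus>\<^bsub>P\<^esub> b \<in> B. (\<lambda>x\<in>car P. s x b) x *\<^sub>P b)" using x by simp
 qed
qed

subsection \<open>Projective covers\<close>

text \<open>Take a projective \<open>P\<close> of least dimension among those mapping onto
  \<open>M\<close>. A supplement \<open>N\<close> of the kernel contains a projective that still
  maps onto \<open>M\<close>, and minimality makes this the whole of \<open>P\<close>.\<close>

lemma ex_proj_cover:
 assumes M: "fd_module K A M"
 shows "EX P p. proj_cover K A M P p"
proof -
 let ?Q = "%(P :: ('a, 'b) fdmod) p. projective K A P & p : mhom A P M & p ` car P = car M"
 define n where "n = (LEAST n. EX P p. ?Q P p & vdim K (scal A P) = n)"
 have "EX P p. ?Q P p & vdim K (scal A P) = n"
  unfolding n_def by (rule LeastI_ex) (use ex_projective_onto[OF M] in blast)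
 then obtain P :: "('a, 'b) fdmod" and p where P: "projective K A P" and p: "p : mhom A P M" "p ` car P = car M"
  and n: "vdim K (scal A P) = n" by blast
 have min: "n \<le> vdim K (scal A P')" if "?Q P' p'" for P' p'
  unfolding n_def by (rule Least_le) (use that in blast)
 note lm = projD(2)[OF P] fdmD(1)[OF M]
 interpret p: mod_hom A P M p by (rule mod_homI[OF lm p(1)])
 have "N = car P" if N: "submodule N A P" "N <+>\<^bsub>P\<^esub> mker P M p = car P" for N
 proof -
  note lmN = left_module_submod[OF lm(1) N(1)]
  have rN: "restrict p N : mhom A (submod P N) M" by (rule mhom_restrict_sub[OF N(1) lm(1) p(1)])
  have "restrict p N ` N = car M"
  proof (intro equalityI subsetI)
   fix y assume "y :. M"
   then obtain x where x: "x :. P" "y = p x" using p(2) by auto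
   then obtain h k where "h : N" "k : mker P M p" "x = h \<oplus>\<^sub>P k"
    using x(1) unfolding N(2)[symmetric] set_add_def' by blast
   then have "y = p h" using p.M.submod_sub[OF N(1)] x(2) by (simp add: mker_def)
   then show "y : restrict p N ` N" using \<open>h : N\<close> by (intro image_eqI[of _ _ h]) auto
  qed (use p.M.submod_sub[OF N(1)] in auto)
  then obtain h0 where h0: "h0 : mhom A P (submod P N)" "ALL x : car P. restrict p N (h0 x) = p x"
   using proj_lift[OF P fdm_submod[OF projD(1)[OF P] N(1)] M rN _ p(1)] by auto
  \<comment> \<open>Endomorphisms of \<open>P\<close> over \<open>M\<close> with image in
    \<open>N\<close>. They exist because \<open>N\<close> maps onto \<open>M\<close>, so that
    \<open>p\<close> lifts through its restriction to \<open>N\<close>.\<close>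
  let ?H = "%h. h : mhom A P P & h ` car P \<subseteq> N & (ALL x : car P. p (h x) = p x)"
  define m where "m h = vdim K (scal A (submod P (h ` car P)))" for h :: "(nat \<Rightarrow> 'a) \<Rightarrow> nat \<Rightarrow> 'a"
  have H0: "?H h0"
   using h0 mhom_submod[OF N(1) lm(1)] mhom_closed[OF h0(1)] by auto
  \<comment> \<open>A Fitting argument: for an image of least dimension, applying \<open>h\<close>
    once more cannot shrink it, so \<open>h\<close> is surjective and then bijective on its
    image.\<close>
  obtain h where H: "?H h" and minh: "!!h'. ?H h' ==> m h \<le> m h'"
   using ex_has_least_nat[of ?H h0 m, OF H0] by metis
  note h = H[THEN conjunct1] H[THEN conjunct2, THEN conjunct1] H[THEN conjunct2, THEN conjunct2]
  interpret h: mod_hom A P P h by (rule mod_homI[OF lm(1) lm(1) h(1)])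
  let ?I = "h ` car P"
  have I: "submodule ?I A P" by (rule h.submodule_image[OF p.M.submodule_carrier])
  note fI = fdm_submod[OF projD(1)[OF P] I]
  note lmI = fdmD(1)[OF fI]
  have rI: "restrict h ?I : mhom A (submod P ?I) (submod P ?I)"
   using mhom_restrict_sub[OF I lm(1) h(1)] p.M.submod_sub[OF I] by (auto simp: mhom_submod[OF I lm(1)])
  interpret r: mod_hom A "submod P ?I" "submod P ?I" "restrict h ?I" by (rule mod_homI[OF lmI lmI rI])
  have hh: "compose (car P) h h : mhom A P P" by (rule mhom_compose[OF lm(1) h(1) h(1)])
  have im: "compose (car P) h h ` car P = h ` ?I" by (rule compose_image)
  have "?H (compose (car P) h h)"
   using h hh im by (auto simp: compose_eq)
  then have le: "m h \<le> vdim K (scal A (submod P (h ` ?I)))"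
   using minh[of "compose (car P) h h"] unfolding m_def im by simp
  have sI: "submodule (h ` ?I) A (submod P ?I)" using r.submodule_image[OF left_module.submodule_carrier[OF lmI]] by simp
  have II: "h ` ?I = ?I"
  proof (rule ccontr)
   assume "h ` ?I ~= ?I"
   from vdim_sub_less[OF fdmD(2)[OF fI] submodule_scal[OF lmI sI]] this
   have "vdim K (scal A (submod P (h ` ?I))) < m h" unfolding m_def by (simp add: scal_submod submod_submod)
   with le show False by simp
  qed
  have inj: "inj_on (restrict h ?I) (car (submod P ?I))"
   unfolding r.inj_iff
  proof (rule ccontr)
   assume "\<not> (ALL x : car (submod P ?I). restrict h ?I x = \<zero>\<^bsub>submod P ?I\<^esub> --> x = \<zero>\<^bsub>submod P ?I\<^esub>)"
   then obtain x where x: "x : ?I" "restrict h ?I x = \<zero>\<^sub>P" "x ~= \<zero>\<^sub>P" by auto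
   have "vdim K (scal A (submod P ?I)) < vdim K (scal A (submod P ?I))"
    by (rule vdim_onto_less[OF fdmD(2)[OF fI] lm_scal[OF lmI] mhom_scal[OF rI], of x])
     (use x II in auto)
   then show False by simp
  qed
  have "restrict h ?I : miso A (submod P ?I) (submod P ?I)"
   by (rule misoI[OF rI inj]) (use II in auto)
  then obtain k where k: "k : miso A (submod P ?I) (submod P ?I)"
   "ALL x : car (submod P ?I). k (restrict h ?I x) = x"
   using miso_inv[OF lmI lmI] by blast
  have km: "k : mhom A (submod P ?I) (submod P ?I)" using k(1) by (simp add: miso_def)
  have hI: "h : mhom A P (submod P ?I)" using mhom_submod[OF I lm(1)] h(1) by blast
  \<comment> \<open>If \<open>k\<close> inverts \<open>h\<close> on the image, then \<open>h\<close>
    followed by \<open>k\<close> is a retraction of \<open>P\<close> onto that image.\<close>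
  have "projective K A (submod P ?I)"
   by (rule retract_projective[OF P fI mhom_inclusion[OF I lm(1)] mhom_compose[OF lm(1) hI km]])
    (use k(2) p.M.submod_sub[OF I] in "auto simp: compose_eq")
  moreover have "restrict p ?I : mhom A (submod P ?I) M" by (rule mhom_restrict_sub[OF I lm(1) p(1)])
  moreover have "restrict p ?I ` car (submod P ?I) = car M"
   using h(3) p(2) by (auto simp: image_image)
  ultimately have "n \<le> vdim K (scal A (submod P ?I))" using min by blast
  \<comment> \<open>A proper submodule would have smaller dimension than the least possible
    \<open>n\<close>. As the image lies in \<open>N\<close>, also \<open>N\<close> is
    everything.\<close>
  then have "?I = car P"
   using vdim_sub_less[OF fdmD(2)[OF projD(1)[OF P]] submodule_scal[OF lm(1) I]] n
   by (auto simp: scal_submod)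
  then show ?thesis using h(2) p.M.submod_sub[OF N(1)] by auto
 qed
 then show ?thesis using P p unfolding proj_cover_def by blast
qed

lemma pcov: "fd_module K A M ==> proj_cover K A M (fst (pcov K A M)) (snd (pcov K A M))"
 using someI_ex[of "%x. proj_cover K A M (fst x) (snd x)"] ex_proj_cover[of M]
 unfolding pcov_def by (auto simp: case_prod_beta')

lemma pcovD:
 assumes "fd_module K A M"
 shows "projective K A (fst (pcov K A M))" "snd (pcov K A M) : mhom A (fst (pcov K A M)) M"
  "snd (pcov K A M) ` car (fst (pcov K A M)) = car M"
 using pcov[OF assms] by (auto simp: proj_cover_def)

lemma syzygy_eq: "syzygy K A M = submod (fst (pcov K A M)) (mker (fst (pcov K A M)) M (snd (pcov K A M)))"
 by (simp add: syzygy_def case_prod_beta)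

lemma submodule_syzygy:
 "fd_module K A M ==> submodule (mker (fst (pcov K A M)) M (snd (pcov K A M))) A (fst (pcov K A M))"
 by (rule mod_hom.submodule_ker[OF mod_homI[OF projD(2)[OF pcovD(1)] fdmD(1) pcovD(2)]])

lemma fdm_syzygy: "fd_module K A M ==> fd_module K A (syzygy K A M)"
 unfolding syzygy_eq by (rule fdm_submod[OF projD(1)[OF pcovD(1)] submodule_syzygy])

lemma fdm_syzygy_pow:
 fixes M :: "('a, 'b) fdmod"
 assumes "fd_module K A M" shows "fd_module K A ((syzygy K A ^^ n) M)"
proof (induction n)
 case 0 show ?case using assms by simp
next
 case (Suc n) then show ?case using fdm_syzygy by simp
qed

text \<open>The minimal covers of iterated syzygies are spliced together. Index 0 is separate
  because \<open>M\<close> may have another type: \<open>?S n\<close> is the syzygy of order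
  \<open>n + 1\<close> and is covered by \<open>?P (Suc n)\<close>.\<close>

lemma ex_proj_res:
 assumes M: "fd_module K A M"
 shows "EX P \<delta> \<epsilon>. proj_res K A M P \<delta> \<epsilon>"
proof -
 let ?S = "%n. (syzygy K A ^^ n) (syzygy K A M)"
 let ?P = "%n. case n of 0 \<Rightarrow> fst (pcov K A M) | Suc n \<Rightarrow> fst (pcov K A (?S n))"
 have S: "fd_module K A (?S n)" for n by (intro fdm_syzygy_pow fdm_syzygy M)
 have S_Suc: "?S (Suc n) = syzygy K A (?S n)" for n by simp
 have sub: "?S n = submod (?P n) (car (?S n))" "submodule (car (?S n)) A (?P n)" "lmod A (?P n)" for n
  using submodule_syzygy[OF S, of "n - 1"] submodule_syzygy[OF M] projD(2)[OF pcovD(1)[OF S[of "n - 1"]]]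
   projD(2)[OF pcovD(1)[OF M]]
  by (cases n; simp add: syzygy_eq)+
 have d: "snd (pcov K A (?S n)) : mhom A (?P (Suc n)) (?P n)" for n
  using pcovD(2)[OF S[of n]] mhom_submod[OF sub(2,3)] sub(1)[of n] by (metis nat.case(2))
 have k: "mker (?P (Suc n)) (?P n) (snd (pcov K A (?S n))) = car (?S (Suc n))" for n
 proof -
  have "\<zero>\<^bsub>?P n\<^esub> = \<zero>\<^bsub>?S n\<^esub>" by (subst sub(1)) simp
  then show ?thesis unfolding S_Suc by (simp add: syzygy_eq mker_def)
 qed
 have p: "projective K A (?P n)" for n
  using pcovD(1)[OF M] pcovD(1)[OF S[of "n - 1"]] by (cases n) auto
 have i: "snd (pcov K A (?S n)) ` car (?P (Suc n)) = car (?S n)" for n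
  using pcovD(3)[OF S[of n]] by simp
 have "proj_res K A M ?P (%n. snd (pcov K A (?S n))) (snd (pcov K A M))"
  unfolding proj_res_def
 proof (intro conjI allI)
  show "snd (pcov K A (?S 0)) ` car (?P 1) = mker (?P 0) M (snd (pcov K A M))"
   using i[of 0] by (simp add: syzygy_eq)
  show "snd (pcov K A (?S (Suc n))) ` car (?P (Suc (Suc n))) =
    mker (?P (Suc n)) (?P n) (snd (pcov K A (?S n)))" for n
   unfolding k by (rule i)
 qed (use p d pcovD(2,3)[OF M] in simp_all)
 then show ?thesis by blast
qed

lemma resolution:
 assumes "fd_module K A M"
 shows "EX \<epsilon>. proj_res K A M (res_mod K A M) (res_diff K A M) \<epsilon>"
 using someI_ex[of "%x. EX \<epsilon>. proj_res K A M (fst x) (snd x) \<epsilon>"] ex_proj_res[OF assms]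
 unfolding res_mod_def res_diff_def resolution_def by (auto simp: case_prod_beta')

subsection \<open>Comparison of syzygies\<close>

text \<open>\<open>f\<close> vanishes in the stable category: it factors through a projective.
  \<open>f\<close> is a bare function, so that differences such as \<open>x - g x\<close> can be
  written without restriction to the carrier.\<close>

definition pfact :: "('b, 'm) module \<Rightarrow> ('b, 'n) module \<Rightarrow> ('m \<Rightarrow> 'n) \<Rightarrow> bool" where
 "pfact M N f \<longleftrightarrow> (EX (R :: ('a, 'b) fdmod) u v. projective K A R & v : mhom A M R & u : mhom A R N &
  (ALL x : car M. f x = u (v x)))"

text \<open>Let \<open>f\<close> lift \<open>g\<close> to the cover and let \<open>id - g\<close> be
  \<open>u v\<close> through a projective. Lift \<open>u\<close> through \<open>p\<close> to
  \<open>w\<close>; then \<open>id - f - w v p\<close> has image in the kernel of \<open>p\<close>,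
  and on that kernel it equals \<open>id - f\<close> since \<open>v p\<close> vanishes there. So
  \<open>id - f\<close> on the syzygy extends to all of \<open>P\<close>.\<close>

lemma syzygy_homotopy:
 assumes M: "fd_module K A M" and P: "projective K A P" and p: "p : mhom A P M" "p ` car P = car M"
  and f: "f : mhom A P P" and pf: "pfact M M (%x. x \<ominus>\<^sub>M g x)"
  and fg: "!!x. x :. P ==> p (f x) = g (p x)"
 shows "EX \<theta> : mhom A P (submod P (mker P M p)). ALL x : mker P M p. \<theta> x = x \<ominus>\<^sub>P f x"
proof -
 note lm = projD(2)[OF P] fdmD(1)[OF M]
 interpret p: mod_hom A P M p by (rule mod_homI[OF lm p(1)])
 interpret f: mod_hom A P P f by (rule mod_homI[OF lm(1) lm(1) f])
 obtain R :: "('a, 'b) fdmod" and u v where R: "projective K A R" and v: "v : mhom A M R" and u: "u : mhom A R M"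
  and uv: "ALL x : car M. x \<ominus>\<^sub>M g x = u (v x)" using pf unfolding pfact_def by blast
 obtain w where w: "w : mhom A R P" "ALL x : car R. p (w x) = u x"
  using proj_lift[OF R projD(1)[OF P] M p u] by blast
 let ?d = "\<lambda>x\<in>car P. (\<lambda>x\<in>car P. x) x \<ominus>\<^sub>P f x"
 let ?e = "compose (car P) w (compose (car P) v p)"
 let ?t = "\<lambda>x\<in>car P. ?d x \<ominus>\<^sub>P ?e x"
 have d: "?d : mhom A P P" by (rule mhom_diff[OF lm(1) lm(1) mhom_id[OF lm(1)] f])
 have e: "?e : mhom A P P" by (rule mhom_compose[OF lm(1) mhom_compose[OF lm(1) p(1) v] w(1)])
 interpret e: mod_hom A P P ?e by (rule mod_homI[OF lm(1) lm(1) e])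
 have t: "?t : mhom A P P" by (rule mhom_diff[OF lm(1) lm(1) d e])
 have te: "?t x = (x \<ominus>\<^sub>P f x) \<ominus>\<^sub>P w (v (p x))" if "x :. P" for x
  using that by (simp add: compose_eq)
 have wv: "w (v (p x)) :. P" "v (p x) :. R" if "x :. P" for x
  using that mhom_closed[OF v] mhom_closed[OF w(1)] by auto
 have "p (?t x) = \<zero>\<^sub>M" if x: "x :. P" for x
 proof -
  have gx: "g (p x) :. M" using fg[OF x] p.closed[of "f x"] x by simp
  have "p (?t x) = (p x \<ominus>\<^sub>M g (p x)) \<ominus>\<^sub>M u (v (p x))"
   unfolding te[OF x] using x wv[OF x] w(2) fg by simp
  also have "\<dots> = \<zero>\<^sub>M"
   using uv x gx mhom_closed[OF u wv(2)[OF x]]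
    p.N.diff_eq_zero_iff[of "p x \<ominus>\<^sub>M g (p x)" "u (v (p x))"] by simp
  finally show ?thesis .
 qed
 then have "?t : mhom A P (submod P (mker P M p))"
  unfolding mhom_submod[OF p.submodule_ker lm(1)] using t mhom_closed[OF t] by (auto simp: mker_def)
 moreover have "?t x = x \<ominus>\<^sub>P f x" if "x : mker P M p" for x
 proof -
  have x: "x :. P" "p x = \<zero>\<^sub>M" using that by (auto simp: mker_def)
  have "w (v (p x)) = \<zero>\<^sub>P"
   using mod_hom.zero[OF mod_homI[OF lm(2) projD(2)[OF R] v]]
    mod_hom.zero[OF mod_homI[OF projD(2)[OF R] lm(1) w(1)]] by (simp add: x(2))
  then show ?thesis unfolding te[OF x(1)] using x(1) by (simp add: p.M.M.minus_eq)
 qed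
 ultimately show ?thesis by blast
qed

end


section \<open>A duality criterion for pairings\<close>

context vs
begin

text \<open>The assumptions say that \<beta> identifies \<open>W\<close> with the functionals on
  \<open>V\<close> that vanish on \<open>I\<close>; hence \<open>V / I\<close> is the dual of
  \<open>W\<close>, stated through \<Psi> to avoid the quotient. The kernel is \<open>I\<close>
  because functionals separate points from \<open>I\<close>. A functional vanishing on the image of
  \<Psi> is evaluation at some \<open>w\<close> by reflexivity, and nondegeneracy gives
  \<open>w = 0\<close>, so \<Psi> is onto.\<close>

lemma pairing_dual:
 assumes V: "fin_dim K V" and W: "lmod K W" and I: "submodule I K V"
  and B1: "!!w. w :. W ==> (\<lambda>v\<in>car V. \<beta> v w) : mhom K V (reg K)"
  and B2: "!!v. v :. V ==> (\<lambda>w\<in>car W. \<beta> v w) : mhom K W (reg K)"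
  and BI: "!!v w. [|v : I; w :. W|] ==> \<beta> v w = \<zero>\<^sub>K"
  and rep: "!!l. [|l : mhom K V (reg K); !!v. v : I ==> l v = \<zero>\<^sub>K|] ==>
   EX w : car W. ALL v : car V. \<beta> v w = l v"
  and nondeg: "!!w. [|w :. W; !!v. v :. V ==> \<beta> v w = \<zero>\<^sub>K|] ==> w = \<zero>\<^sub>W"
 defines "\<Psi> \<equiv> \<lambda>v\<in>car V. \<lambda>w\<in>car W. \<beta> v w"
 shows "fin_dim K W" "\<Psi> : mhom K V (dual K (reg K) W)" "\<Psi> ` car V = car (dual K (reg K) W)"
  "!!v. v :. V ==> \<Psi> v = \<zero>\<^bsub>dual K (reg K) W\<^esub> \<longleftrightarrow> v : I"
proof -
 note V' = fin_dimD[OF V]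
 interpret V: left_module K V by fact
 interpret W: left_module K W by fact
 have cl: "\<beta> v w :. K" if "v :. V" "w :. W" for v w
  using mhom_closed[OF B1[OF that(2)] that(1)] that by simp
 have l1: "\<beta> (v \<oplus>\<^sub>V v') w = \<beta> v w \<oplus>\<^sub>K \<beta> v' w" if "v :. V" "v' :. V" "w :. W" for v v' w
  using mhom_add[OF B1[OF that(3)] that(1,2)] that by simp
 have l2: "\<beta> (a *\<^sub>V v) w = a \<otimes>\<^sub>K \<beta> v w" if "a :. K" "v :. V" "w :. W" for a v w
  using mhom_smult[OF B1[OF that(3)] that(1,2)] that by simp
 have r1: "\<beta> v (w \<oplus>\<^sub>W w') = \<beta> v w \<oplus>\<^sub>K \<beta> v w'" if "v :. V" "w :. W" "w' :. W" for v w w'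
  using mhom_add[OF B2[OF that(1)] that(2,3)] that by simp
 have r2: "\<beta> v (a *\<^sub>W w) = a \<otimes>\<^sub>K \<beta> v w" if "a :. K" "v :. V" "w :. W" for a v w
  using mhom_smult[OF B2[OF that(2)] that(1,3)] that by simp
 have Df: "lmod K (dual K (reg K) V)" by (rule lm_vdual[OF V'])
 show W': "fin_dim K W"
 proof (rule fin_dim_inj[OF W fin_dim_vdual[OF V]])
  let ?f = "\<lambda>w\<in>car W. \<lambda>v\<in>car V. \<beta> v w"
  show f: "?f : mhom K W (dual K (reg K) V)"
   by (rule mhom_restrictI[OF W])
    (use V' B1 in "auto simp: r1 r2 l2 intro!: restrict_ext")
  interpret f: mod_hom K W "dual K (reg K) V" ?f by (rule mod_homI[OF W Df f])
  show "inj_on ?f (car W)"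
   unfolding f.inj_iff
  proof (intro ballI impI)
   fix w assume w: "w :. W" "?f w = \<zero>\<^bsub>dual K (reg K) V\<^esub>"
   have "\<beta> v w = \<zero>\<^sub>K" if "v :. V" for v using fun_cong[OF w(2), of v] w(1) that by simp
   then show "w = \<zero>\<^sub>W" using nondeg w(1) by blast
  qed
 qed
 let ?D = "dual K (reg K) W"
 interpret D: left_module K ?D by (rule lm_vdual[OF W])
 show psi: "\<Psi> : mhom K V ?D" unfolding \<Psi>_def
  by (rule mhom_restrictI[OF V']) (use W B2 in "auto simp: l1 l2 r2 intro!: restrict_ext")
 interpret psi: mod_hom K V ?D \<Psi> by (rule mod_homI[OF V' D.left_module_axioms psi])
 show "\<Psi> v = \<zero>\<^sub>?D \<longleftrightarrow> v : I" if v: "v :. V" for v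
 proof
  assume z: "\<Psi> v = \<zero>\<^sub>?D"
  show "v : I"
  proof (rule ccontr)
   assume "v \<notin> I"
   then obtain l where l: "l : mhom K V (reg K)" "l v ~= \<zero>\<^sub>K" "ALL x : I. l x = \<zero>\<^sub>K"
    using separating_functional[OF V I v] by blast
   then obtain w where w: "w :. W" "\<beta> v w = l v" using rep[OF l(1)] v by blast
   then have "\<beta> v w = \<zero>\<^sub>K" using fun_cong[OF z, of w] v by (simp add: \<Psi>_def)
   then show False using l(2) w(2) by simp
  qed
 next
  assume "v : I" then show "\<Psi> v = \<zero>\<^sub>?D" using v BI by (auto simp: \<Psi>_def intro!: restrict_ext)
 qed
 have sub: "submodule (\<Psi> ` car V) K ?D" by (rule psi.submodule_image[OF V.submodule_carrier])
 show "\<Psi> ` car V = car ?D"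
 proof (rule ccontr)
  assume "\<not> ?thesis"
  then obtain x where x: "x :. ?D" "x \<notin> \<Psi> ` car V" using D.submod_sub[OF sub] by blast
  obtain m where m: "m : mhom K ?D (reg K)" "m x ~= \<zero>\<^sub>K" "ALL y : \<Psi> ` car V. m y = \<zero>\<^sub>K"
   using separating_functional[OF fin_dim_vdual[OF W'] sub x] by blast
  obtain w where w: "w :. W" "ALL \<phi> : mhom K W (reg K). m \<phi> = \<phi> w"
   using double_dual[OF W' m(1)] by blast
  have "\<beta> v w = \<zero>\<^sub>K" if v: "v :. V" for v
  proof -
   have "\<Psi> v : mhom K W (reg K)" using psi.closed[OF v] W by simp
   then have "m (\<Psi> v) = \<Psi> v w" using w(2) by blast
   then show ?thesis using m(3) v w(1) by (simp add: \<Psi>_def)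
  qed
  then have "w = \<zero>\<^sub>W" using nondeg w(1) by blast
  moreover have "x : mhom K W (reg K)" using x(1) W by simp
  ultimately have "m x = \<zero>\<^sub>K" using w(2) mod_hom.zero[OF mod_homI[OF W lm_reg]] by simp
  then show False using m(2) by simp
 qed
qed

end

lemma a_r_coset_scal [simp]: "a_r_coset (scal A M) = a_r_coset M"
 by (intro ext) (simp add: a_r_coset_def r_coset_def)

lemma set_add_scal [simp]: "set_add (scal A M) = set_add M"
 by (intro ext) (simp add: set_add_def set_mult_def)

lemma A_RCOSETS_scal [simp]: "A_RCOSETS (scal A M) = A_RCOSETS M"
 by (intro ext) (simp add: A_RCOSETS_def RCOSETS_def r_coset_def)

lemma scal_quot: "scal A (quot M N) = quot (scal A M) N"
 by (simp add: quot_def, simp add: scal_def)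

lemma star_sel [simp]:
 "car (star A M) = mhom A M (reg A)" "zero (star A M) = (\<lambda>x\<in> car M. \<zero>\<^sub>A)"
 "add (star A M) = (%f g. \<lambda>x\<in> car M. f x \<oplus>\<^sub>A g x)"
 "smult (star A M) = (%a f. \<lambda>x\<in> car M. f x \<otimes>\<^sub>A a)"
 by (simp_all add: star_def)

section \<open>Duals over the field and over the algebra\<close>

context fd_algebra
begin

lemma lm_reg_alg: "lmod A (reg A)"
 by (rule fdmD(1)[OF fdm_reg])

lemma ring_opp: "ring (opp A)"
 using fd_algebra_opp by (simp add: fd_algebra_def)

lemma unit_map_opp: "c \<odot>\<^bsub>opp A\<^esub> \<one>\<^bsub>opp A\<^esub> = unit_map c"
 by (simp add: unit_map_def)

lemma scal_mhom_smult:
 assumes "lmod A M" "f : mhom K (scal A M) N" "c :. K" "x :. M"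
 shows "f (unit_map c *\<^sub>M x) = c *\<^sub>N f x"
 using mhom_smult[OF assms(2,3), of x] assms(4) by (simp flip: unit_map_def)

lemma lm_dual:
 assumes M: "lmod A M" shows "lmod (opp A) (dual K A M)"
proof -
 interpret M: left_module A M by fact
 note S = lm_scal[OF M]
 have c: "f x :. K" if "f : mhom K (scal A M) (reg K)" "x :. M" for f x
  using mhom_closed[OF that(1)] that(2) by simp
 have ad: "f (x \<oplus>\<^sub>M y) = f x \<oplus>\<^sub>K f y"
  if "f : mhom K (scal A M) (reg K)" "x :. M" "y :. M" for f x y
  using mhom_add[OF that(1), of x y] that(2,3) by simp
 have e: "restrict f (car M) = f" if "f : mhom K (scal A M) (reg K)" for f
  using mhom_ext[OF that] by (simp add: extensional_restrict)
 have s: "(\<lambda>x\<in>car M. f (a *\<^sub>M x)) : mhom K (scal A M) (reg K)"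
  if f: "f : mhom K (scal A M) (reg K)" and a: "a :. A" for f a
 proof -
  have "(\<lambda>x\<in>car (scal A M). f (a *\<^sub>M x)) : mhom K (scal A M) (reg K)"
  proof (rule mhom_restrictI[OF S])
   fix b x assume b: "b :. K" and x: "x :. (scal A M)"
   have "a *\<^sub>M (unit_map b *\<^sub>M x) = unit_map b *\<^sub>M (a *\<^sub>M x)"
    using a b x by (simp add: unit_map_mult flip: M.smult_assoc)
   then show "f (a *\<^sub>M (b \<odot>\<^bsub>scal A M\<^esub> x)) = b \<odot>\<^bsub>reg K\<^esub> f (a *\<^sub>M x)"
    using scal_mhom_smult[OF M f b, of "a *\<^sub>M x"] a x by (simp flip: unit_map_def)
  qed (use a f in "auto simp: c ad M.smult_r_distr")
  then show ?thesis by simp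
 qed
 have ab: "abelian_group (dual K A M)"
  by (rule abelian_group_fun[of "reg K" _ "car M"])
   (use mhom_plus[OF S lm_reg] mhom_uminus[OF S lm_reg] mhom_zero[OF S lm_reg] left_module_group[OF lm_reg]
    in "auto simp: mhom_def")
 show ?thesis
  by (intro left_module.intro left_module_axioms.intro ring_opp ab)
   (auto simp: c s e ad M.smult_l_distr M.smult_assoc intro!: restrict_ext cong: restrict_cong)
qed

lemma fdm_dual:
 assumes M: "fd_module K A M" shows "fd_module K (opp A) (dual K A M)"
proof -
 note M' = fdmD[OF M]
 interpret M: left_module A M by (rule M')
 interpret O: fd_algebra K "opp A" by (rule fd_algebra_opp)
 note S = lm_scal[OF M'(1)]
 have "fin_dim K (scal (opp A) (dual K A M))"
 proof (rule fin_dim_onto[OF fin_dim_vdual[OF M'(2)] O.lm_scal[OF lm_dual[OF M'(1)]]])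
  show "(\<lambda>f\<in>car (dual K (reg K) (scal A M)). f) : 
    mhom K (dual K (reg K) (scal A M)) (scal (opp A) (dual K A M))"
   by (rule mhom_restrictI[OF lm_vdual[OF S]]) (use S in auto)
 qed (use S in auto)
 then show ?thesis using lm_dual[OF M'(1)] by (simp add: fd_module_def)
qed

lemma lm_star:
 assumes M: "lmod A M" shows "lmod (opp A) (star A M)"
proof -
 interpret M: left_module A M by fact
 have c: "f x :. A" if "f : mhom A M (reg A)" "x :. M" for f x
  using mhom_closed[OF that] by simp
 have e: "restrict f (car M) = f" if "f : mhom A M (reg A)" for f
  using mhom_ext[OF that] by (simp add: extensional_restrict)
 have s: "(\<lambda>x\<in>car M. f x \<otimes>\<^sub>A a) : mhom A M (reg A)"
  if f: "f : mhom A M (reg A)" and a: "a :. A" for f a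
  by (rule mhom_restrictI[OF M])
   (use a in "auto simp: c[OF f] mhom_add[OF f] mhom_smult[OF f] A.l_distr A.m_assoc")
 have ab: "abelian_group (star A M)"
  by (rule abelian_group_fun[of "reg A" _ "car M"])
   (use mhom_plus[OF M lm_reg_alg] mhom_uminus[OF M lm_reg_alg] mhom_zero[OF M lm_reg_alg]
    left_module_group[OF lm_reg_alg] in "auto simp: mhom_def")
 show ?thesis
  by (intro left_module.intro left_module_axioms.intro ring_opp ab)
   (auto simp: c s e A.l_distr A.r_distr A.m_assoc intro!: restrict_ext cong: restrict_cong)
qed

subsection \<open>Homomorphisms out of a projective module\<close>

text \<open>The image of the tensor of \<xi> and \<open>x\<close> under the canonical map from
  \<open>star A P\<close> tensored with \<open>X\<close> to the homomorphisms from \<open>P\<close>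
  to \<open>X\<close>.\<close>

definition pure_hom :: "('b, 'p) module \<Rightarrow> ('b, 'x) module \<Rightarrow> ('p \<Rightarrow> 'b) \<Rightarrow> 'x \<Rightarrow> 'p \<Rightarrow> 'x" where
 "pure_hom P X \<xi> x = (\<lambda>p\<in>car P. \<xi> p *\<^sub>X x)"

lemma pure_hom:
 assumes "lmod A P" "lmod A X" "\<xi> : mhom A P (reg A)" "x :. X"
 shows "pure_hom P X \<xi> x : mhom A P X"
proof -
 interpret X: left_module A X by fact
 note xi = mhom_closed[OF assms(3)] mhom_add[OF assms(3)] mhom_smult[OF assms(3)]
 show ?thesis unfolding pure_hom_def
  by (rule mhom_restrictI[OF assms(1)]) (use assms(4) xi in "auto simp: X.smult_l_distr X.smult_assoc")
qed

text \<open>The canonical map just described is onto for projective \<open>P\<close>: the dual basis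
  writes \<open>h p\<close> as the sum of \<open>\<xi> b p\<close> acting on
  \<open>h b\<close>.\<close>

lemma hom_expand:
 assumes P: "lmod A P" and X: "lmod A X" and B: "B \<subseteq> car P"
  and xi: "!!b. b : B ==> \<xi> b : mhom A P (reg A)"
  and db: "!!p. p :. P ==> p = (\<Oplus>\<^bsub>P\<^esub> b \<in> B. \<xi> b p *\<^sub>P b)"
  and h: "h : mhom A P X"
 shows "h = (\<Oplus>\<^bsub>Hom_space A P X\<^esub> b \<in> B. pure_hom P X (\<xi> b) (h b))"
proof -
 interpret h: mod_hom A P X h by (rule mod_homI[OF P X h])
 interpret H: left_module K "Hom_space A P X" by (rule lm_Hom_space[OF P X])
 have xc: "\<xi> b p :. A" if "b : B" "p :. P" for b p
  using mhom_closed[OF xi[OF that(1)] that(2)] by simp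
 have ph: "pure_hom P X (\<xi> b) (h b) : mhom A P X" if "b : B" for b
  using that B by (intro pure_hom P X xi) auto
 show ?thesis
 proof (rule mhom_eqI[OF h])
  have "(\<Oplus>\<^bsub>Hom_space A P X\<^esub> b \<in> B. pure_hom P X (\<xi> b) (h b)) :. (Hom_space A P X)"
   by (rule H.M.finsum_closed) (use ph in auto)
  then show "(\<Oplus>\<^bsub>Hom_space A P X\<^esub> b \<in> B. pure_hom P X (\<xi> b) (h b)) : mhom A P X" by simp
  fix p assume p: "p :. P"
  have "(\<Oplus>\<^bsub>Hom_space A P X\<^esub> b \<in> B. pure_hom P X (\<xi> b) (h b)) p = (\<Oplus>\<^bsub>X\<^esub> b \<in> B. pure_hom P X (\<xi> b) (h b) p)"
   by (rule finsum_additive[OF H.M.abelian_group_axioms left_module_group[OF X], of "%f. f p"])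
    (use p ph in "auto simp: mhom_closed")
  also have "\<dots> = (\<Oplus>\<^bsub>X\<^esub> b \<in> B. h (\<xi> b p *\<^sub>P b))"
   using p B xc by (intro h.N.M.finsum_cong') (auto simp: pure_hom_def)
  also have "\<dots> = h (\<Oplus>\<^bsub>P\<^esub> b \<in> B. \<xi> b p *\<^sub>P b)"
   by (rule h.finsum[symmetric]) (use B xc p in "auto intro!: h.M.smult_closed")
  also have "\<dots> = h p" using db[OF p] by simp
  finally show "h p = (\<Oplus>\<^bsub>Hom_space A P X\<^esub> b \<in> B. pure_hom P X (\<xi> b) (h b)) p" ..
 qed
qed

end

section \<open>The duality formula for the translate of a presentation\<close>

locale dual_presentation = fd_algebra K A for K :: "'k ring" and A :: "('k, 'a) module" +
 fixes P0 :: "('a, 'p) module" and P1 :: "('a, 'q) module" and p1 :: "'q \<Rightarrow> 'p"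
  and B :: "'q set" and \<xi> :: "'q \<Rightarrow> 'q \<Rightarrow> 'a"
 assumes P0: "projective K A P0" and P1: "projective K A P1" and p1: "p1 : mhom A P1 P0"
  and B: "finite B" "B \<subseteq> car P1" and xi: "!!b. b : B ==> \<xi> b : mhom A P1 (reg A)"
  and db: "!!p. p :. P1 ==> p = (\<Oplus>\<^bsub>P1\<^esub> b \<in> B. \<xi> b p *\<^sub>P1 b)"
begin

text \<open>For the minimal presentation of a module, \<open>T\<close> is its transpose and
  \<open>tau\<close> its translate, by unfolding. The dual basis of \<open>P1\<close> is fixed in
  the locale to make the pairing explicit.\<close>

definition Im where "Im = (%f. compose (car P1) f p1) ` car (star A P0)"
definition T where "T = quot (star A P1) Im"
definition tau where "tau = dual K (opp A) T"

lemmas lmP0 = projD(2)[OF P0]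
lemmas lmP1 = projD(2)[OF P1]

sublocale op: fd_algebra K "opp A" by (rule fd_algebra_opp)
sublocale st: left_module "opp A" "star A P1" by (rule lm_star[OF lmP1])

lemma comp_p1: "f : mhom A P0 N ==> compose (car P1) f p1 : mhom A P1 N"
 by (rule mhom_compose[OF lmP1 p1])

lemma submodule_Im: "submodule Im (opp A) (star A P1)"
proof -
 have pc: "p1 x :. P0" if "x :. P1" for x using mhom_closed[OF p1 that] .
 interpret s0: left_module "opp A" "star A P0" by (rule lm_star[OF lmP0])
 show ?thesis unfolding Im_def
 proof (rule st.submodI)
  show "\<zero>\<^bsub>star A P1\<^esub> : (%f. compose (car P1) f p1) ` car (star A P0)"
   by (rule image_eqI[OF _ s0.M.zero_closed]) (auto simp: compose_def pc intro!: restrict_ext)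
 next
  fix x y assume "x : (%f. compose (car P1) f p1) ` car (star A P0)"
   "y : (%f. compose (car P1) f p1) ` car (star A P0)"
  then obtain f g where fg: "f :. (star A P0)" "x = compose (car P1) f p1"
   "g :. (star A P0)" "y = compose (car P1) g p1" by auto
  show "x \<oplus>\<^bsub>star A P1\<^esub> y : (%f. compose (car P1) f p1) ` car (star A P0)"
   by (rule image_eqI[OF _ s0.M.add.m_closed[OF fg(1,3)]])
    (auto simp: fg compose_def pc intro!: restrict_ext)
 next
  fix a x assume a: "a :. (opp A)" and "x : (%f. compose (car P1) f p1) ` car (star A P0)"
  then obtain f where f: "f :. (star A P0)" "x = compose (car P1) f p1" by auto
  show "a \<odot>\<^bsub>star A P1\<^esub> x : (%f. compose (car P1) f p1) ` car (star A P0)"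
   by (rule image_eqI[OF _ s0.smult_closed[OF a f(1)]])
    (auto simp: f compose_def pc intro!: restrict_ext)
 qed (auto simp: comp_p1)
qed

sublocale q: submod_of "opp A" "star A P1" Im
 by (rule submod_ofI[OF st.left_module_axioms submodule_Im])

lemma lm_T: "lmod (opp A) T" unfolding T_def by (rule q.left_module_quot)

lemma lm_tau: "lmod A tau"
 using op.lm_dual[OF lm_T] unfolding tau_def by simp

abbreviation cl where "cl \<equiv> a_r_coset (star A P1) Im"

lemma cl_closed: "f : mhom A P1 (reg A) ==> cl f :. T"
 unfolding T_def by (rule q.cos_closed) simp

lemma tau_closed: "[|\<phi> :. tau; f : mhom A P1 (reg A)|] ==> \<phi> (cl f) :. K"
 using mhom_closed[of \<phi> K "scal (opp A) T" "reg K" "cl f"] cl_closed[of f] by (simp add: tau_def)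

lemma tau_add:
 assumes "\<phi> :. tau" "f : mhom A P1 (reg A)" "g : mhom A P1 (reg A)"
 shows "\<phi> (cl (f \<oplus>\<^bsub>star A P1\<^esub> g)) = \<phi> (cl f) \<oplus>\<^sub>K \<phi> (cl g)"
proof -
 have "cl (f \<oplus>\<^bsub>star A P1\<^esub> g) = cl f \<oplus>\<^sub>T cl g"
  unfolding T_def using assms by (subst q.quot_add) auto
 then show ?thesis
  using mhom_add[of \<phi> K "scal (opp A) T" "reg K" "cl f" "cl g"] assms cl_closed by (simp add: tau_def)
qed

lemma tau_smult:
 assumes "\<phi> :. tau" "f : mhom A P1 (reg A)" "a :. A"
 shows "(a *\<^sub>tau \<phi>) (cl f) = \<phi> (cl (a \<odot>\<^bsub>star A P1\<^esub> f))"
proof -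
 have "a *\<^sub>T cl f = cl (a \<odot>\<^bsub>star A P1\<^esub> f)"
  unfolding T_def using assms by (intro q.quot_smult) auto
 then show ?thesis using cl_closed[OF assms(2)] by (simp add: tau_def)
qed

lemma tau_eqI:
 assumes "\<phi> :. tau" "\<psi> :. tau" "!!f. f : mhom A P1 (reg A) ==> \<phi> (cl f) = \<psi> (cl f)"
 shows "\<phi> = \<psi>"
proof (rule mhom_eqI)
 show "\<phi> : mhom K (scal (opp A) T) (reg K)" "\<psi> : mhom K (scal (opp A) T) (reg K)"
  using assms by (simp_all add: tau_def)
 fix x assume "x :. (scal (opp A) T)"
 then obtain f where "f :. (star A P1)" "x = cl f" by (auto simp: T_def quot_carrier)
 then show "\<phi> x = \<psi> x" using assms(3) by simp
qed

lemma tau_zero_Im: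
 assumes "\<phi> :. tau" "f : Im" shows "\<phi> (cl f) = \<zero>\<^sub>K"
proof -
 have f: "f :. (star A P1)" by (rule st.submod_sub[OF submodule_Im assms(2)])
 have "cl f = \<zero>\<^sub>T" using q.cos_zero[OF f] assms(2) by (simp add: T_def)
 then show ?thesis
  using mod_hom.zero[OF mod_homI[OF op.lm_scal[OF lm_T] lm_reg], of \<phi>] assms(1) by (simp add: tau_def)
qed

text \<open>On a pure homomorphism made from \<open>f\<close> and \<open>x\<close> the pairing is
  meant to be \<open>g x (cl f)\<close>. A general \<open>h\<close> is the sum of the pure
  homomorphisms made from \<open>\<xi> b\<close> and \<open>h b\<close>, which gives this
  formula.\<close>

definition pair :: "('q \<Rightarrow> 'x) \<Rightarrow> ('x \<Rightarrow> ('q \<Rightarrow> 'a) set \<Rightarrow> 'k) \<Rightarrow> 'k" where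
 "pair h g = (\<Oplus>\<^bsub>K\<^esub> b \<in> B. g (h b) (cl (\<xi> b)))"

context
 fixes X :: "('a, 'x) module"
 assumes X: "lmod A X"
begin

interpretation X: left_module A X by (rule X)
interpretation HX: left_module K "Hom_space A P1 X" by (rule lm_Hom_space[OF lmP1 X])
interpretation t: left_module A tau by (rule lm_tau)

lemma pair_mem:
 assumes "h : mhom A P1 X" "g : mhom A X tau" "b : B"
 shows "g (h b) (cl (\<xi> b)) :. K" "h b :. X" "g (h b) :. tau"
proof -
 show 1: "h b :. X" by (rule mhom_closed[OF assms(1)]) (use B assms in auto)
 show 2: "g (h b) :. tau" by (rule mhom_closed[OF assms(2) 1])
 show "g (h b) (cl (\<xi> b)) :. K" by (rule tau_closed[OF 2 xi[OF assms(3)]])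
qed

lemma tau_add_app: "[|t :. T|] ==> (\<phi> \<oplus>\<^sub>tau \<psi>) t = \<phi> t \<oplus>\<^sub>K \<psi> t"
 by (simp add: tau_def)

lemma tau_scal_app:
 assumes "\<phi> :. tau" "t :. T" "c :. K"
 shows "(unit_map c *\<^sub>tau \<phi>) t = c \<otimes>\<^sub>K \<phi> t"
 using op.scal_mhom_smult[OF lm_T _ assms(3,2), of \<phi> "reg K"] assms
 by (simp add: tau_def unit_map_opp op.unit_map_def unit_map_def)

lemma pair_hom1:
 assumes g: "g : mhom A X tau"
 shows "(\<lambda>h\<in>car (Hom_space A P1 X). pair h g) : mhom K (Hom_space A P1 X) (reg K)"
proof (rule mhom_restrictI[OF HX.left_module_axioms])
 fix h h' assume hh: "h :. (Hom_space A P1 X)" "h' :. (Hom_space A P1 X)"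
 then have m: "h : mhom A P1 X" "h' : mhom A P1 X" by simp_all
 have "pair (h \<oplus>\<^bsub>Hom_space A P1 X\<^esub> h') g = (\<Oplus>\<^bsub>K\<^esub> b \<in> B. g (h b) (cl (\<xi> b)) \<oplus>\<^sub>K g (h' b) (cl (\<xi> b)))"
  unfolding pair_def
 proof (rule K.finsum_cong')
  fix b assume b: "b : B"
  then have "b :. P1" using B by auto
  then show "g ((h \<oplus>\<^bsub>Hom_space A P1 X\<^esub> h') b) (cl (\<xi> b)) = g (h b) (cl (\<xi> b)) \<oplus>\<^sub>K g (h' b) (cl (\<xi> b))"
   using mhom_add[OF g pair_mem(2)[OF m(1) g b] pair_mem(2)[OF m(2) g b]] cl_closed[OF xi[OF b]]
   by (simp add: tau_add_app)
 qed (use pair_mem[OF m(1) g] pair_mem[OF m(2) g] in auto)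
 also have "\<dots> = pair h g \<oplus>\<^sub>K pair h' g" unfolding pair_def
  by (rule K.finsum_addf) (use pair_mem[OF m(1) g] pair_mem[OF m(2) g] in auto)
 finally show "pair (h \<oplus>\<^bsub>Hom_space A P1 X\<^esub> h') g = pair h g \<oplus>\<^bsub>reg K\<^esub> pair h' g" by simp
next
 fix c h assume c: "c :. K" and "h :. (Hom_space A P1 X)"
 then have m: "h : mhom A P1 X" by simp
 have "pair (c \<odot>\<^bsub>Hom_space A P1 X\<^esub> h) g = (\<Oplus>\<^bsub>K\<^esub> b \<in> B. c \<otimes>\<^sub>K g (h b) (cl (\<xi> b)))"
  unfolding pair_def
 proof (rule K.finsum_cong')
  fix b assume b: "b : B"
  then have "b :. P1" using B by auto
  then show "g ((c \<odot>\<^bsub>Hom_space A P1 X\<^esub> h) b) (cl (\<xi> b)) = c \<otimes>\<^sub>K g (h b) (cl (\<xi> b))"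
   using mhom_smult[OF g _ pair_mem(2)[OF m g b], of "unit_map c"] c
    tau_scal_app[OF pair_mem(3)[OF m g b] cl_closed[OF xi[OF b]] c] by (simp flip: unit_map_def)
 qed (use pair_mem[OF m g] c in auto)
 also have "\<dots> = c \<otimes>\<^sub>K pair h g" unfolding pair_def
  by (rule K.finsum_rdistr[symmetric]) (use B c pair_mem[OF m g] in auto)
 finally show "pair (c \<odot>\<^bsub>Hom_space A P1 X\<^esub> h) g = c \<odot>\<^bsub>reg K\<^esub> pair h g" by simp
qed (use pair_mem g in "auto simp: pair_def intro!: K.finsum_closed")

lemma pair_hom2:
 assumes h: "h : mhom A P1 X"
 shows "(\<lambda>g\<in>car (Hom_space A X tau). pair h g) : mhom K (Hom_space A X tau) (reg K)"
proof (rule mhom_restrictI[OF lm_Hom_space[OF X lm_tau]])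
 fix g g' assume "g :. (Hom_space A X tau)" "g' :. (Hom_space A X tau)"
 then have m: "g : mhom A X tau" "g' : mhom A X tau" by simp_all
 have "pair h (g \<oplus>\<^bsub>Hom_space A X tau\<^esub> g') = (\<Oplus>\<^bsub>K\<^esub> b \<in> B. g (h b) (cl (\<xi> b)) \<oplus>\<^sub>K g' (h b) (cl (\<xi> b)))"
  unfolding pair_def
  by (rule K.finsum_cong')
   (use pair_mem[OF h m(1)] pair_mem[OF h m(2)] cl_closed[OF xi] in "auto simp: tau_add_app")
 also have "\<dots> = pair h g \<oplus>\<^sub>K pair h g'" unfolding pair_def
  by (rule K.finsum_addf) (use pair_mem[OF h m(1)] pair_mem[OF h m(2)] in auto)
 finally show "pair h (g \<oplus>\<^bsub>Hom_space A X tau\<^esub> g') = pair h g \<oplus>\<^bsub>reg K\<^esub> pair h g'" by simp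
next
 fix c g assume c: "c :. K" and "g :. (Hom_space A X tau)"
 then have m: "g : mhom A X tau" by simp
 have "pair h (c \<odot>\<^bsub>Hom_space A X tau\<^esub> g) = (\<Oplus>\<^bsub>K\<^esub> b \<in> B. c \<otimes>\<^sub>K g (h b) (cl (\<xi> b)))"
  unfolding pair_def
  by (rule K.finsum_cong')
   (use pair_mem[OF h m] c cl_closed[OF xi] in "auto simp: tau_scal_app simp flip: unit_map_def")
 also have "\<dots> = c \<otimes>\<^sub>K pair h g" unfolding pair_def
  by (rule K.finsum_rdistr[symmetric]) (use B c pair_mem[OF h m] in auto)
 finally show "pair h (c \<odot>\<^bsub>Hom_space A X tau\<^esub> g) = c \<odot>\<^bsub>reg K\<^esub> pair h g" by simp
qed (use pair_mem h in "auto simp: pair_def intro!: K.finsum_closed")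

text \<open>The same dual basis seen from the other side: the functionals \<xi> generate
  \<open>star A P1\<close>, with coefficients the values \<open>f b\<close>.\<close>

lemma star_expand:
 assumes f: "f : mhom A P1 (reg A)"
 shows "f = (\<Oplus>\<^bsub>star A P1\<^esub> b \<in> B. f b \<odot>\<^bsub>star A P1\<^esub> \<xi> b)"
proof (rule mhom_eqI[OF f])
 interpret f: mod_hom A P1 "reg A" f by (rule mod_homI[OF lmP1 lm_reg_alg f])
 have fb: "f b :. A" if "b : B" for b using f.closed[of b] that B by auto
 have xc: "\<xi> b p :. A" if "b : B" "p :. P1" for b p
  using mhom_closed[OF xi[OF that(1)] that(2)] by simp
 have sx: "f b \<odot>\<^bsub>star A P1\<^esub> \<xi> b :. (star A P1)" if "b : B" for b
  using that fb xi by (intro st.smult_closed) auto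
 have "(\<Oplus>\<^bsub>star A P1\<^esub> b \<in> B. f b \<odot>\<^bsub>star A P1\<^esub> \<xi> b) :. (star A P1)"
  by (rule st.M.finsum_closed) (use sx in auto)
 then show "(\<Oplus>\<^bsub>star A P1\<^esub> b \<in> B. f b \<odot>\<^bsub>star A P1\<^esub> \<xi> b) : mhom A P1 (reg A)" by simp
 fix p assume p: "p :. P1"
 have "(\<Oplus>\<^bsub>star A P1\<^esub> b \<in> B. f b \<odot>\<^bsub>star A P1\<^esub> \<xi> b) p = (\<Oplus>\<^bsub>reg A\<^esub> b \<in> B. (f b \<odot>\<^bsub>star A P1\<^esub> \<xi> b) p)"
  by (rule finsum_additive[OF st.M.abelian_group_axioms left_module_group[OF lm_reg_alg], of "%f. f p"])
   (use p sx in "auto dest: mhom_closed")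
 also have "\<dots> = (\<Oplus>\<^bsub>reg A\<^esub> b \<in> B. f (\<xi> b p *\<^sub>P1 b))"
  by (rule f.N.M.finsum_cong') (use p B xc fb in auto)
 also have "\<dots> = f (\<Oplus>\<^bsub>P1\<^esub> b \<in> B. \<xi> b p *\<^sub>P1 b)"
  by (rule f.finsum[symmetric]) (use B xc p in "auto intro!: f.M.smult_closed")
 also have "\<dots> = f p" using db[OF p] by simp
 finally show "f p = (\<Oplus>\<^bsub>star A P1\<^esub> b \<in> B. f b \<odot>\<^bsub>star A P1\<^esub> \<xi> b) p" ..
qed

text \<open>The intended value, in which the dual basis no longer occurs. The kernel of the pairing,
  its nondegeneracy and the representation of functionals all reduce to it.\<close>

lemma pair_pure:
 assumes f: "f : mhom A P1 (reg A)" and x: "x :. X" and g: "g : mhom A X tau"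
 shows "pair (pure_hom P1 X f x) g = g x (cl f)"
proof -
 have gx: "g x :. tau" by (rule mhom_closed[OF g x])
 have fb: "f b :. A" if "b : B" for b using mhom_closed[OF f, of b] that B by auto
 have sx: "f b \<odot>\<^bsub>star A P1\<^esub> \<xi> b :. (star A P1)" if "b : B" for b
  using that fb xi by (intro st.smult_closed) auto
 have "pair (pure_hom P1 X f x) g = (\<Oplus>\<^bsub>K\<^esub> b \<in> B. g x (cl (f b \<odot>\<^bsub>star A P1\<^esub> \<xi> b)))"
  unfolding pair_def
 proof (rule K.finsum_cong')
  fix b assume b: "b : B"
  then have "pure_hom P1 X f x b = f b *\<^sub>X x" using B by (auto simp: pure_hom_def)
  then show "g (pure_hom P1 X f x b) (cl (\<xi> b)) = g x (cl (f b \<odot>\<^bsub>star A P1\<^esub> \<xi> b))"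
   using mhom_smult[OF g fb[OF b] x] tau_smult[OF gx xi[OF b] fb[OF b]] by simp
 qed (use tau_closed[OF gx] sx in auto)
 also have "\<dots> = g x (cl (\<Oplus>\<^bsub>star A P1\<^esub> b \<in> B. f b \<odot>\<^bsub>star A P1\<^esub> \<xi> b))"
  by (rule finsum_additive[OF st.M.abelian_group_axioms K.abelian_group_axioms,
     of "%f. g x (cl f)", symmetric])
   (use sx tau_closed[OF gx] tau_add[OF gx] in auto)
 also have "\<dots> = g x (cl f)" using star_expand[OF f] by simp
 finally show ?thesis .
qed

lemma pair_finsum:
 assumes g: "g : mhom A X tau" and h: "h : S \<rightarrow> mhom A P1 X"
 shows "pair (\<Oplus>\<^bsub>Hom_space A P1 X\<^esub> s \<in> S. h s) g = (\<Oplus>\<^bsub>K\<^esub> s \<in> S. pair (h s) g)"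
 by (rule finsum_additive[OF HX.M.abelian_group_axioms K.abelian_group_axioms, of "%h. pair h g"])
  (use h mhom_closed[OF pair_hom1[OF g]] mhom_add[OF pair_hom1[OF g]] HX.M.add.m_closed in "auto simp del: Hom_space_sel(3)")

definition ImX where "ImX = (%h. compose (car P1) h p1) ` mhom A P0 X"

text \<open>If \<open>h\<close> factors as \<open>h'\<close> after \<open>p1\<close>, expanding
  \<open>h'\<close> in a dual basis of \<open>P0\<close> makes \<open>h\<close> a sum of pure
  homomorphisms whose functionals lie in \<open>Im\<close>, and these vanish in
  \<open>T\<close>.\<close>

lemma pair_ImX:
 assumes g: "g : mhom A X tau" and h: "h : ImX" shows "pair h g = \<zero>\<^sub>K"
proof -
 obtain h' where h': "h' : mhom A P0 X" "h = compose (car P1) h' p1" using h by (auto simp: ImX_def)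
 obtain B0 \<eta> where B0: "finite B0" "B0 \<subseteq> car P0" and eta: "!!b. b : B0 ==> \<eta> b : mhom A P0 (reg A)"
  and db0: "!!p. p :. P0 ==> p = (\<Oplus>\<^bsub>P0\<^esub> b \<in> B0. \<eta> b p *\<^sub>P0 b)" by (rule dual_basis[OF P0]) blast
 interpret H0: left_module K "Hom_space A P0 X" by (rule lm_Hom_space[OF lmP0 X])
 have hb: "h' b :. X" if "b : B0" for b using mhom_closed[OF h'(1)] that B0 by auto
 have pc: "p1 x :. P0" if "x :. P1" for x using mhom_closed[OF p1 that] .
 have ph: "pure_hom P0 X (\<eta> b) (h' b) : mhom A P0 X" if "b : B0" for b
  using that hb eta by (intro pure_hom lmP0 X)
 have e: "compose (car P1) (pure_hom P0 X (\<eta> b) (h' b)) p1 =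
   pure_hom P1 X (compose (car P1) (\<eta> b) p1) (h' b)" for b
  by (auto simp: pure_hom_def compose_def pc intro!: restrict_ext)
 have "h = compose (car P1) (\<Oplus>\<^bsub>Hom_space A P0 X\<^esub> b \<in> B0. pure_hom P0 X (\<eta> b) (h' b)) p1"
  unfolding h'(2) using hom_expand[OF lmP0 X B0(2) eta db0 h'(1)] by simp
 also have "\<dots> = (\<Oplus>\<^bsub>Hom_space A P1 X\<^esub> b \<in> B0. compose (car P1) (pure_hom P0 X (\<eta> b) (h' b)) p1)"
  by (rule finsum_additive[OF H0.M.abelian_group_axioms HX.M.abelian_group_axioms,
     of "%h. compose (car P1) h p1"])
   (use ph comp_p1 in "auto simp: compose_def pc intro!: restrict_ext")
 finally have "pair h g = (\<Oplus>\<^bsub>K\<^esub> b \<in> B0. pair (pure_hom P1 X (compose (car P1) (\<eta> b) p1) (h' b)) g)"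
  using pair_finsum[OF g, of "%b. pure_hom P1 X (compose (car P1) (\<eta> b) p1) (h' b)" B0]
   pure_hom[OF lmP1 X comp_p1[OF eta] hb] by (simp add: e)
 also have "\<dots> = (\<Oplus>\<^bsub>K\<^esub> b \<in> B0. \<zero>\<^sub>K)"
 proof (rule K.finsum_cong')
  fix b assume b: "b : B0"
  have "compose (car P1) (\<eta> b) p1 : Im" using eta[OF b] by (auto simp: Im_def)
  then show "pair (pure_hom P1 X (compose (car P1) (\<eta> b) p1) (h' b)) g = \<zero>\<^sub>K"
   using pair_pure[OF comp_p1[OF eta[OF b]] hb[OF b] g] tau_zero_Im mhom_closed[OF g hb[OF b]] by simp
 qed auto
 finally show ?thesis by simp
qed

text \<open>The tensor-hom adjunction: \<open>g x\<close> is the functional on \<open>T\<close> that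
  sends the class of \<open>f\<close> to the value of \<open>l\<close> at the pure homomorphism made
  from \<open>f\<close> and \<open>x\<close>.\<close>

lemma pair_rep:
 assumes l: "l : mhom K (Hom_space A P1 X) (reg K)" and z: "!!h. h : ImX ==> l h = \<zero>\<^sub>K"
 shows "EX g : mhom A X tau. ALL h : mhom A P1 X. pair h g = l h"
proof -
 have pc: "p1 x :. P0" if "x :. P1" for x using mhom_closed[OF p1 that] .
 interpret l: mod_hom K "Hom_space A P1 X" "reg K" l by (rule mod_homI[OF HX.left_module_axioms lm_reg l])
 have lc: "l h :. K" if "h : mhom A P1 X" for h using l.closed[of h] that by simp
 have ph: "pure_hom P1 X f x : mhom A P1 X" if "f : mhom A P1 (reg A)" "x :. X" for f x
  by (rule pure_hom[OF lmP1 X that])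
 have ex: "EX \<phi> : car tau. ALL f : mhom A P1 (reg A). \<phi> (cl f) = l (pure_hom P1 X f x)" if x: "x :. X" for x
 proof -
  let ?m = "\<lambda>f\<in>car (scal (opp A) (star A P1)). l (pure_hom P1 X f x)"
  have xc: "f p :. A" if "f : mhom A P1 (reg A)" "p :. P1" for f p
   using mhom_closed[OF that] by simp
  have m: "?m : mhom K (scal (opp A) (star A P1)) (reg K)"
  proof (rule mhom_restrictI[OF op.lm_scal[OF st.left_module_axioms]])
   fix f g assume "f :. (scal (opp A) (star A P1))" "g :. (scal (opp A) (star A P1))"
   then have fg: "f : mhom A P1 (reg A)" "g : mhom A P1 (reg A)" by simp_all
   have "pure_hom P1 X (f \<oplus>\<^bsub>scal (opp A) (star A P1)\<^esub> g) x = pure_hom P1 X f x \<oplus>\<^bsub>Hom_space A P1 X\<^esub> pure_hom P1 X g x"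
    using xc[OF fg(1)] xc[OF fg(2)] x by (auto simp: pure_hom_def X.smult_l_distr intro!: restrict_ext)
   then show "l (pure_hom P1 X (f \<oplus>\<^bsub>scal (opp A) (star A P1)\<^esub> g) x) =
     l (pure_hom P1 X f x) \<oplus>\<^bsub>reg K\<^esub> l (pure_hom P1 X g x)"
    using ph[OF fg(1) x] ph[OF fg(2) x] l.add[of "pure_hom P1 X f x" "pure_hom P1 X g x"] by simp
  next
   fix c f assume c: "c :. K" and "f :. (scal (opp A) (star A P1))"
   then have f: "f : mhom A P1 (reg A)" by simp
   have "pure_hom P1 X (c \<odot>\<^bsub>scal (opp A) (star A P1)\<^esub> f) x = c \<odot>\<^bsub>Hom_space A P1 X\<^esub> pure_hom P1 X f x"
    using xc[OF f] x c by (auto simp: pure_hom_def unit_map_mult simp flip: unit_map_def X.smult_assoc intro!: restrict_ext)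
   then show "l (pure_hom P1 X (c \<odot>\<^bsub>scal (opp A) (star A P1)\<^esub> f) x) = c \<odot>\<^bsub>reg K\<^esub> l (pure_hom P1 X f x)"
    using ph[OF f x] l.smult[of c "pure_hom P1 X f x"] c by simp
  qed (use lc ph x in auto)
  \<comment> \<open>Descent to \<open>T\<close>: a pure homomorphism with functional in
    \<open>Im\<close> factors through \<open>p1\<close>, and \<open>l\<close> kills such
    maps.\<close>
  have "?m f = \<zero>\<^bsub>reg K\<^esub>" if fI: "f : Im" for f
  proof -
   obtain f' where f': "f' : mhom A P0 (reg A)" "f = compose (car P1) f' p1" using fI by (auto simp: Im_def)
   have "pure_hom P1 X f x = compose (car P1) (pure_hom P0 X f' x) p1"
    by (auto simp: f' pure_hom_def compose_def pc intro!: restrict_ext)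
   then have "pure_hom P1 X f x : ImX" using pure_hom[OF lmP0 X f'(1) x] by (auto simp: ImX_def)
   then show ?thesis using z st.submod_sub[OF submodule_Im fI] by simp
  qed
  then obtain \<phi> where phi: "\<phi> : mhom K (quot (scal (opp A) (star A P1)) Im) (reg K)"
   "ALL f : car (scal (opp A) (star A P1)). \<phi> (Im +>\<^bsub>scal (opp A) (star A P1)\<^esub> f) = ?m f"
   using submod_of.quot_lift[OF submod_ofI[OF op.lm_scal[OF st.left_module_axioms]
      op.submodule_scal[OF st.left_module_axioms submodule_Im]] lm_reg m] by blast
  show ?thesis
   by (rule bexI[of _ \<phi>]) (use phi in "auto simp: tau_def T_def scal_quot")
 qed
 then obtain g0 where g0: "!!x. x :. X ==> g0 x :. tau"
  "!!x f. [|x :. X; f : mhom A P1 (reg A)|] ==> g0 x (cl f) = l (pure_hom P1 X f x)" by metis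
 have fc: "f p :. A" if "f : mhom A P1 (reg A)" "p :. P1" for f p
  using mhom_closed[OF that] by simp
 have g: "(\<lambda>x\<in>car X. g0 x) : mhom A X tau"
 proof (rule mhom_restrictI[OF X])
  fix x y assume xy: "x :. X" "y :. X"
  show "g0 (x \<oplus>\<^sub>X y) = g0 x \<oplus>\<^sub>tau g0 y"
  proof (rule tau_eqI)
   fix f assume f: "f : mhom A P1 (reg A)"
   have "pure_hom P1 X f (x \<oplus>\<^sub>X y) = pure_hom P1 X f x \<oplus>\<^bsub>Hom_space A P1 X\<^esub> pure_hom P1 X f y"
    using xy fc[OF f] by (auto simp: pure_hom_def X.smult_r_distr intro!: restrict_ext)
   then show "g0 (x \<oplus>\<^sub>X y) (cl f) = (g0 x \<oplus>\<^sub>tau g0 y) (cl f)"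
    using xy g0(2)[OF _ f] ph[OF f xy(1)] ph[OF f xy(2)] l.add[of "pure_hom P1 X f x" "pure_hom P1 X f y"]
    by (simp add: tau_add_app cl_closed[OF f])
  qed (use xy g0(1) in auto)
 next
  fix a x assume ax: "a :. A" "x :. X"
  show "g0 (a *\<^sub>X x) = a *\<^sub>tau g0 x"
  proof (rule tau_eqI)
   fix f assume f: "f : mhom A P1 (reg A)"
   have af: "a \<odot>\<^bsub>star A P1\<^esub> f : mhom A P1 (reg A)"
    using st.smult_closed[of a f] ax f by simp
   \<comment> \<open>The scalar moves across the tensor sign: the left action on \<open>X\<close>
     matches the right multiplication on values of \<open>f\<close>.\<close>
   have "pure_hom P1 X f (a *\<^sub>X x) = pure_hom P1 X (a \<odot>\<^bsub>star A P1\<^esub> f) x"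
    using ax fc[OF f] by (auto simp: pure_hom_def X.smult_assoc intro!: restrict_ext)
   then show "g0 (a *\<^sub>X x) (cl f) = (a *\<^sub>tau g0 x) (cl f)"
    using ax g0(2)[OF _ f] g0(2)[OF ax(2) af] tau_smult[OF g0(1)[OF ax(2)] f ax(1)] by simp
  qed (use ax g0(1) in auto)
 qed (use g0 in auto)
 have "pair h (\<lambda>x\<in>car X. g0 x) = l h" if h: "h : mhom A P1 X" for h
 proof -
  have hb: "h b :. X" if "b : B" for b using mhom_closed[OF h] that B by auto
  have "l h = l (\<Oplus>\<^bsub>Hom_space A P1 X\<^esub> b \<in> B. pure_hom P1 X (\<xi> b) (h b))"
   using hom_expand[OF lmP1 X B(2) xi db h] by simp
  also have "\<dots> = (\<Oplus>\<^bsub>reg K\<^esub> b \<in> B. l (pure_hom P1 X (\<xi> b) (h b)))"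
   by (rule l.finsum) (use ph xi hb in auto)
  also have "\<dots> = pair h (\<lambda>x\<in>car X. g0 x)"
   unfolding pair_def finsum_reg
   by (rule K.finsum_cong') (use hb g0 xi tau_closed lc ph in auto)
  finally show ?thesis ..
 qed
 then show ?thesis using g by blast
qed

lemma submodule_ImX: "submodule ImX K (Hom_space A P1 X)"
proof -
 have pc: "p1 x :. P0" if "x :. P1" for x using mhom_closed[OF p1 that] .
 interpret H0: left_module K "Hom_space A P0 X" by (rule lm_Hom_space[OF lmP0 X])
 let ?c = "\<lambda>h\<in>car (Hom_space A P0 X). compose (car P1) h p1"
 have "?c : mhom K (Hom_space A P0 X) (Hom_space A P1 X)"
  by (rule mhom_restrictI[OF H0.left_module_axioms])
   (auto simp: comp_p1[unfolded compose_def] compose_def pc intro!: restrict_ext)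
 from mod_hom.submodule_image[OF mod_homI[OF H0.left_module_axioms HX.left_module_axioms this] H0.submodule_carrier]
 show ?thesis by (simp add: ImX_def image_def)
qed

end

text \<open>An instance of \<open>pairing_dual\<close> in which \<open>I\<close> consists of the
  maps that factor through \<open>p1\<close>. The finite dimension of
  \<open>Hom_space A X tau\<close> comes out of it as well.\<close>

theorem transpose_duality:
 assumes X: "fd_module K A X"
 defines "\<Psi> \<equiv> \<lambda>h\<in>mhom A P1 X. \<lambda>g\<in>mhom A X tau. pair h g"
 shows "fin_dim K (Hom_space A X tau)"
  "\<Psi> : mhom K (Hom_space A P1 X) (dual K (reg K) (Hom_space A X tau))"
  "\<Psi> ` mhom A P1 X = car (dual K (reg K) (Hom_space A X tau))"
  "!!h. h : mhom A P1 X ==> \<Psi> h = \<zero>\<^bsub>dual K (reg K) (Hom_space A X tau)\<^esub> \<longleftrightarrow>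
   (EX h' : mhom A P0 X. h = compose (car P1) h' p1)"
proof -
 note X' = fdmD(1)[OF X]
 note Wm = lm_Hom_space[OF X' lm_tau]
 \<comment> \<open>Pure homomorphisms detect \<open>g\<close>: their pairings with \<open>g\<close>
   are all the values \<open>g x (cl f)\<close>.\<close>
 have nondeg: "g = \<zero>\<^bsub>Hom_space A X tau\<^esub>"
  if g: "g :. (Hom_space A X tau)" and z: "!!h. h :. (Hom_space A P1 X) ==> pair h g = \<zero>\<^sub>K" for g
 proof -
  interpret t: left_module A tau by (rule lm_tau)
  have g': "g : mhom A X tau" using g by simp
  have "g x = \<zero>\<^sub>tau" if x: "x :. X" for x
  proof (rule tau_eqI[OF mhom_closed[OF g' x] t.M.zero_closed])
   fix f assume f: "f : mhom A P1 (reg A)"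
   show "g x (cl f) = \<zero>\<^sub>tau (cl f)"
    using pair_pure[OF X' f x g'] z[of "pure_hom P1 X f x"] pure_hom[OF lmP1 X' f x] cl_closed[OF f]
    by (simp add: tau_def)
  qed
  then show ?thesis using mhom_ext[OF g'] by (auto intro: extensionalityI)
 qed
 have rep: "EX w : car (Hom_space A X tau). ALL v : car (Hom_space A P1 X). pair v w = l v"
  if "l : mhom K (Hom_space A P1 X) (reg K)" "!!v. v : ImX X ==> l v = \<zero>\<^sub>K" for l
  using pair_rep[OF X' that] by simp
 have h1: "!!w. w :. (Hom_space A X tau) ==>
   (\<lambda>v\<in>car (Hom_space A P1 X). pair v w) : mhom K (Hom_space A P1 X) (reg K)"
  using pair_hom1[OF X'] by simp
 have h2: "!!v. v :. (Hom_space A P1 X) ==>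
   (\<lambda>w\<in>car (Hom_space A X tau). pair v w) : mhom K (Hom_space A X tau) (reg K)"
  using pair_hom2[OF X'] by simp
 have h3: "!!v w. v : ImX X ==> w :. (Hom_space A X tau) ==> pair v w = \<zero>\<^sub>K"
  using pair_ImX[OF X'] by simp
 note pd = pairing_dual[OF fin_dim_Hom_space[OF projD(1)[OF P1] X] Wm submodule_ImX[OF X'],
   of pair, OF h1 h2 h3 rep nondeg]
 show "fin_dim K (Hom_space A X tau)" by (rule pd(1))
 show "\<Psi> : mhom K (Hom_space A P1 X) (dual K (reg K) (Hom_space A X tau))"
  using pd(2) unfolding \<Psi>_def Hom_space_sel(1) .
 show "\<Psi> ` mhom A P1 X = car (dual K (reg K) (Hom_space A X tau))"
  using pd(3) unfolding \<Psi>_def Hom_space_sel(1) .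
 show "\<Psi> h = \<zero>\<^bsub>dual K (reg K) (Hom_space A X tau)\<^esub> \<longleftrightarrow>
   (EX h' : mhom A P0 X. h = compose (car P1) h' p1)" if "h : mhom A P1 X" for h
  using pd(4)[of h] that unfolding \<Psi>_def Hom_space_sel(1) ImX_def[OF X'] by blast
qed

end


lemma submod_diff_eq:
 assumes "lmod R M" "submodule N R M" "x : N" "y : N"
 shows "x \<ominus>\<^bsub>submod M N\<^esub> y = x \<ominus>\<^sub>M y"
proof -
 note lmN = left_module_submod[OF assms(1,2)]
 interpret i: mod_hom R "submod M N" M "\<lambda>x\<in>N. x"
  by (rule mod_homI[OF lmN assms(1) mhom_inclusion[OF assms(2,1)]])
 have "x \<ominus>\<^bsub>submod M N\<^esub> y : N"
  using abelian_group.minus_closed[OF left_module_group[OF lmN], of x y] assms by simp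
 then show ?thesis using i.diff[of x y] assms by simp
qed

lemma a_r_coset_submod [simp]: "a_r_coset (submod M N) = a_r_coset M"
 by (intro ext) (simp add: a_r_coset_def r_coset_def)

text \<open>For a function that agrees with a homomorphism on the carrier without being extensional;
  the maps inside \<open>Ext_map\<close> and \<open>Tor_map\<close> are of this kind.\<close>

lemma quot_map_cos':
 assumes "submod_of R M N" "submod_of R M' N'" "f' : mhom R M M'"
  and "!!x. x :. M ==> f x = f' x" "!!x. x : N ==> f' x : N'" "x :. M"
 shows "quot_map M' N' f (N +>\<^sub>M x) = N' +>\<^sub>M' f x"
proof -
 interpret N: submod_of R M N by fact
 have "quot_map M' N' f (N +>\<^sub>M x) = quot_map M' N' f' (N +>\<^sub>M x)"
  unfolding quot_map_def using N.cos_mem[OF assms(6)] assms(4) by (metis (no_types, lifting) SUP_cong)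
 then show ?thesis using quot_map_cos[OF assms(1-3,5,6)] assms(4,6) by simp
qed

lemma quot_map_submod [simp]: "quot_map (submod M N) = quot_map M"
 by (intro ext) (simp add: quot_map_def)

subsection \<open>Natural isomorphisms\<close>

text \<open>\<open>F X\<close> and \<open>G X\<close> are quotients of one space \<open>V X\<close>
  with the same kernel, and the isomorphism sends \<open>u X v\<close> to \<open>w X v\<close>. No
  action of morphisms on \<open>V\<close> is fixed: naturality only needs some \<open>v'\<close>
  with the two prescribed images.\<close>

lemma nat_iso_span:
 assumes V: "!!X. fd_module K A X ==> lmod K (V X)"
  and F: "!!X. fd_module K A X ==> lmod K (F X)"
  and G: "!!X. fd_module K A X ==> lmod K (G X)"
  and u: "!!X. fd_module K A X ==> u X : mhom K (V X) (F X)"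
   "!!X. fd_module K A X ==> u X ` car (V X) = car (F X)"
  and w: "!!X. fd_module K A X ==> w X : mhom K (V X) (G X)"
   "!!X. fd_module K A X ==> w X ` car (V X) = car (G X)"
  and ker: "!!X v. [|fd_module K A X; v :. (V X)|] ==> u X v = \<zero>\<^bsub>F X\<^esub> \<longleftrightarrow> w X v = \<zero>\<^bsub>G X\<^esub>"
  and nat: "!!X Y f v. [|fd_module K A X; fd_module K A Y; f : mhom A X Y; v :. (V X)|] ==>
   EX v' : car (V Y). u Y v' = F_map X Y f (u X v) & w Y v' = G_map X Y f (w X v)"
 shows "naturally_iso K A F F_map G G_map"
proof -
 \<comment> \<open>A preimage under \<open>u X\<close> is chosen; equality of the kernels makes the
   value under \<open>w X\<close> independent of the choice.\<close>
 define \<Phi> where "\<Phi> X = (\<lambda>\<phi>\<in>car (F X). w X (SOME v. v :. (V X) & u X v = \<phi>))" for X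
 have phi: "\<Phi> X (u X v) = w X v" if X: "fd_module K A X" and v: "v :. (V X)" for X v
 proof -
  interpret u: mod_hom K "V X" "F X" "u X" by (rule mod_homI[OF V[OF X] F[OF X] u(1)[OF X]])
  interpret w: mod_hom K "V X" "G X" "w X" by (rule mod_homI[OF V[OF X] G[OF X] w(1)[OF X]])
  let ?v = "SOME v'. v' :. (V X) & u X v' = u X v"
  have v': "?v :. (V X) & u X ?v = u X v"
   by (rule someI[of "%v'. v' :. (V X) & u X v' = u X v" v]) (simp add: v)
  then have "u X (?v \<ominus>\<^bsub>V X\<^esub> v) = \<zero>\<^bsub>F X\<^esub>"
   using v u.N.diff_eq_zero_iff[of "u X ?v" "u X v"] by simp
  moreover have "?v \<ominus>\<^bsub>V X\<^esub> v :. (V X)" using v v' by simp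
  ultimately have "w X (?v \<ominus>\<^bsub>V X\<^esub> v) = \<zero>\<^bsub>G X\<^esub>" using ker[OF X] by blast
  then have "w X ?v = w X v" using v v' w.N.diff_eq_zero_iff[of "w X ?v" "w X v"] by simp
  then show ?thesis using v by (simp add: \<Phi>_def)
 qed
 have "\<Phi> X : miso K (F X) (G X)" if X: "fd_module K A X" for X
 proof -
  interpret u: mod_hom K "V X" "F X" "u X" by (rule mod_homI[OF V[OF X] F[OF X] u(1)[OF X]])
  interpret w: mod_hom K "V X" "G X" "w X" by (rule mod_homI[OF V[OF X] G[OF X] w(1)[OF X]])
  note p = phi[OF X]
  have pre: "EX v. v :. (V X) & x = u X v" if "x :. (F X)" for x
   using u(2)[OF X] that by blast
  have m: "\<Phi> X : mhom K (F X) (G X)"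
  proof (rule mhomI)
   show "\<Phi> X : extensional (car (F X))" by (simp add: \<Phi>_def)
  next
   fix x assume "x :. (F X)"
   then obtain v where "v :. (V X)" "x = u X v" using pre by blast
   then show "\<Phi> X x :. (G X)" by (simp add: p)
  next
   fix x y assume "x :. (F X)" "y :. (F X)"
   then obtain v v' where v: "v :. (V X)" "x = u X v" "v' :. (V X)" "y = u X v'"
    using pre by metis
   then show "\<Phi> X (x \<oplus>\<^bsub>F X\<^esub> y) = \<Phi> X x \<oplus>\<^bsub>G X\<^esub> \<Phi> X y"
    using p[of "v \<oplus>\<^bsub>V X\<^esub> v'"] by (simp add: p)
  next
   fix a x assume a: "a :. K" "x :. (F X)"
   then obtain v where v: "v :. (V X)" "x = u X v" using pre by blast
   then show "\<Phi> X (a \<odot>\<^bsub>F X\<^esub> x) = a \<odot>\<^bsub>G X\<^esub> \<Phi> X x"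
    using p[of "a \<odot>\<^bsub>V X\<^esub> v"] a by (simp add: p)
  qed
  interpret m: mod_hom K "F X" "G X" "\<Phi> X" by (rule mod_homI[OF F[OF X] G[OF X] m])
  show ?thesis
  proof (rule misoI[OF m])
   show "inj_on (\<Phi> X) (car (F X))" unfolding m.inj_iff
   proof (intro ballI impI)
    fix x assume x: "x :. (F X)" "\<Phi> X x = \<zero>\<^bsub>G X\<^esub>"
    then obtain v where "v :. (V X)" "x = u X v" using pre by blast
    then show "x = \<zero>\<^bsub>F X\<^esub>" using x(2) ker[OF X] by (simp add: p)
   qed
   show "\<Phi> X ` car (F X) = car (G X)"
   proof (intro equalityI subsetI)
    fix y assume "y :. (G X)"
    then obtain v where v: "v :. (V X)" "y = w X v" using w(2)[OF X] by blast
    then show "y : \<Phi> X ` car (F X)" by (intro image_eqI[of _ _ "u X v"]) (simp_all add: p)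
   qed auto
  qed
 qed
 moreover have "\<Phi> Y (F_map X Y f \<xi>) = G_map X Y f (\<Phi> X \<xi>)"
  if a: "fd_module K A X" "fd_module K A Y" "f : mhom A X Y" "\<xi> :. (F X)" for X Y f \<xi>
 proof -
  obtain v where v: "v :. (V X)" "\<xi> = u X v" using u(2)[OF a(1)] a(4) by blast
  obtain v' where "v' :. (V Y)" "u Y v' = F_map X Y f (u X v)" "w Y v' = G_map X Y f (w X v)"
   using nat[OF a(1-3) v(1)] by blast
  then show ?thesis using phi[OF a(2)] phi[OF a(1) v(1)] v(2) by metis
 qed
 ultimately show ?thesis unfolding naturally_iso_def by blast
qed

context fd_algebra
begin

subsection \<open>Comparison of resolutions\<close>

text \<open>\<open>a\<close> and \<open>b\<close> are inverse to each other in the stable category,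
  where maps through projectives are zero.\<close>

definition stab :: "('b, 'm) module \<Rightarrow> ('b, 'n) module \<Rightarrow> ('m \<Rightarrow> 'n) \<Rightarrow> ('n \<Rightarrow> 'm) \<Rightarrow> bool" where
 "stab M N a b \<longleftrightarrow> a : mhom A M N & b : mhom A N M &
  pfact M M (%x. x \<ominus>\<^sub>M b (a x)) & pfact N N (%y. y \<ominus>\<^sub>N a (b y))"

text \<open>The difference is zero, and the zero map factors through any projective; one exists in
  the universe because \<open>M\<close> has a projective mapping onto it.\<close>

lemma stab_id:
 assumes "fd_module K A M" shows "stab M M (\<lambda>x\<in>car M. x) (\<lambda>x\<in>car M. x)"
proof -
 note M = fdmD(1)[OF assms]
 interpret M: left_module A M by (rule M)
 obtain P :: "('a, 'b) fdmod" where P: "projective K A P" using ex_projective_onto[OF assms] by blast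
 note lmP = projD(2)[OF P]
 have "pfact M M (%x. x \<ominus>\<^sub>M (\<lambda>x\<in>car M. x) ((\<lambda>x\<in>car M. x) x))"
  unfolding pfact_def
  by (intro exI[of _ P] exI[of _ "\<lambda>x\<in>car P. \<zero>\<^sub>M"] exI[of _ "\<lambda>x\<in>car M. \<zero>\<^sub>P"] conjI P
    mhom_zero M lmP)
   (use M.diff_eq_zero_iff abelian_monoid.zero_closed[OF abelian_group.axioms(1)[OF left_module_group[OF lmP]]]
    in auto)
 then show ?thesis using mhom_id[OF M] by (simp add: stab_def)
qed

text \<open>\<open>a\<close> and \<open>b\<close> lift to the covers as \<alpha> and \<beta>.
  Applying \<open>syzygy_homotopy\<close> to both composites shows that their defects on the kernels
  extend to the covers, as \<theta> and \<open>\<theta>'\<close>.\<close>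

lemma stab_lift:
 assumes N: "fd_module K A N" and V: "fd_module K A V" and st: "stab N V a b"
  and P: "projective K A P" "p : mhom A P N" "p ` car P = car N"
  and R: "projective K A R" "r : mhom A R V" "r ` car R = car V"
 shows "EX \<alpha> : mhom A P R. EX \<beta> : mhom A R P.
  EX \<theta> : mhom A P (submod P (mker P N p)). EX \<theta>' : mhom A R (submod R (mker R V r)).
  (ALL x : car P. r (\<alpha> x) = a (p x)) & (ALL y : car R. p (\<beta> y) = b (r y)) &
  (ALL x : mker P N p. \<theta> x = x \<ominus>\<^sub>P \<beta> (\<alpha> x)) & (ALL y : mker R V r. \<theta>' y = y \<ominus>\<^sub>R \<alpha> (\<beta> y))"
proof -
 note ab = st[unfolded stab_def]
 note lmP = projD(2)[OF P(1)] and lmR = projD(2)[OF R(1)]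
 obtain \<alpha> where al: "\<alpha> : mhom A P R" "ALL x : car P. r (\<alpha> x) = compose (car P) a p x"
  using proj_lift[OF P(1) projD(1)[OF R(1)] V R(2,3) mhom_compose[OF lmP P(2), of a V]] ab by blast
 obtain \<beta> where be: "\<beta> : mhom A R P" "ALL x : car R. p (\<beta> x) = compose (car R) b r x"
  using proj_lift[OF R(1) projD(1)[OF P(1)] N P(2,3) mhom_compose[OF lmR R(2), of b N]] ab by blast
 have a: "r (\<alpha> x) = a (p x)" "\<alpha> x :. R" if "x :. P" for x
  using al that mhom_closed[OF al(1)] by (auto simp: compose_eq)
 have b: "p (\<beta> x) = b (r x)" "\<beta> x :. P" if "x :. R" for x
  using be that mhom_closed[OF be(1)] by (auto simp: compose_eq)
 have mem: "x : mker P N p ==> x :. P" "y : mker R V r ==> y :. R" for x y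
  by (auto simp: mker_def)
 obtain \<theta> where t: "\<theta> : mhom A P (submod P (mker P N p))"
  "ALL x : mker P N p. \<theta> x = x \<ominus>\<^sub>P compose (car P) \<beta> \<alpha> x"
  using syzygy_homotopy[OF N P mhom_compose[OF lmP al(1) be(1)], of "%x. b (a x)"] ab a b
  by (auto simp: compose_eq)
 obtain \<theta>' where t': "\<theta>' : mhom A R (submod R (mker R V r))"
  "ALL x : mker R V r. \<theta>' x = x \<ominus>\<^sub>R compose (car R) \<alpha> \<beta> x"
  using syzygy_homotopy[OF V R mhom_compose[OF lmR be(1) al(1)], of "%x. a (b x)"] ab a b
  by (auto simp: compose_eq)
 show ?thesis
  by (rule bexI[OF _ al(1)], rule bexI[OF _ be(1)], rule bexI[OF _ t(1)], rule bexI[OF _ t'(1)])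
   (use a b t(2) t'(2) mem in "simp add: compose_eq")
qed

lemma lift_ker:
 assumes P: "lmod A P" and N: "lmod A N" and R: "lmod A R" and V: "lmod A V"
  and p: "p : mhom A P N" and r: "r : mhom A R V" and a: "a : mhom A N V" and \<alpha>: "\<alpha> : mhom A P R"
  and e: "!!x. x :. P ==> r (\<alpha> x) = a (p x)" and x: "x : mker P N p"
 shows "\<alpha> x : mker R V r"
 using e[of x] x mhom_closed[OF \<alpha>, of x] mod_hom.zero[OF mod_homI[OF N V a]] by (auto simp: mker_def)

text \<open>A form of Schanuel's lemma: the kernels of two arbitrary projective covers inherit a
  stable equivalence. The lifts restrict to the kernels, and each defect factors as the inclusion
  into the cover followed by \<theta> or \<open>\<theta>'\<close>.\<close>

lemma stab_step:
 fixes P R :: "('a, 'b) fdmod"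
 assumes N: "fd_module K A N" and V: "fd_module K A V" and st: "stab N V a b"
  and P: "projective K A P" "p : mhom A P N" "p ` car P = car N"
  and R: "projective K A R" "r : mhom A R V" "r ` car R = car V"
 shows "EX a b. stab (submod P (mker P N p)) (submod R (mker R V r)) a b"
proof -
 note lmP = projD(2)[OF P(1)] and lmR = projD(2)[OF R(1)] and lmN = fdmD(1)[OF N] and lmV = fdmD(1)[OF V]
 have ab: "a : mhom A N V" "b : mhom A V N" using st by (auto simp: stab_def)
 obtain \<alpha> \<beta> \<theta> \<theta>' where al: "\<alpha> : mhom A P R" and be: "\<beta> : mhom A R P"
  and t: "\<theta> : mhom A P (submod P (mker P N p))" and t': "\<theta>' : mhom A R (submod R (mker R V r))"
  and ra: "ALL x : car P. r (\<alpha> x) = a (p x)" and pb: "ALL y : car R. p (\<beta> y) = b (r y)"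
  and te: "ALL x : mker P N p. \<theta> x = x \<ominus>\<^sub>P \<beta> (\<alpha> x)"
  and te': "ALL y : mker R V r. \<theta>' y = y \<ominus>\<^sub>R \<alpha> (\<beta> y)"
  using stab_lift[OF N V st P R] by blast
 let ?U = "mker P N p" and ?W = "mker R V r"
 have U: "submodule ?U A P" by (rule mod_hom.submodule_ker[OF mod_homI[OF lmP lmN P(2)]])
 have W: "submodule ?W A R" by (rule mod_hom.submodule_ker[OF mod_homI[OF lmR lmV R(2)]])
 have aU: "\<alpha> x : ?W" if "x : ?U" for x
  by (rule lift_ker[OF lmP lmN lmR lmV P(2) R(2) ab(1) al _ that]) (use ra in blast)
 have bW: "\<beta> x : ?U" if "x : ?W" for x
  by (rule lift_ker[OF lmR lmV lmP lmN R(2) P(2) ab(2) be _ that]) (use pb in blast)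
 have mem: "x : ?U ==> x :. P" "y : ?W ==> y :. R" for x y by (auto simp: mker_def)
 have "restrict \<alpha> ?U : mhom A (submod P ?U) (submod R ?W)"
  using mhom_restrict_sub[OF U lmP al] aU by (auto simp: mhom_submod[OF W lmR])
 moreover have "restrict \<beta> ?W : mhom A (submod R ?W) (submod P ?U)"
  using mhom_restrict_sub[OF W lmR be] bW by (auto simp: mhom_submod[OF U lmP])
 moreover have "pfact (submod P ?U) (submod P ?U) (%x. x \<ominus>\<^bsub>submod P ?U\<^esub> restrict \<beta> ?W (restrict \<alpha> ?U x))"
  unfolding pfact_def
  by (intro exI[of _ P] exI[of _ \<theta>] exI[of _ "\<lambda>x\<in>?U. x"] conjI P(1) t mhom_inclusion[OF U lmP] ballI)
   (use te aU bW in "simp add: submod_diff_eq[OF lmP U]")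
 moreover have "pfact (submod R ?W) (submod R ?W) (%x. x \<ominus>\<^bsub>submod R ?W\<^esub> restrict \<alpha> ?U (restrict \<beta> ?W x))"
  unfolding pfact_def
  by (intro exI[of _ R] exI[of _ \<theta>'] exI[of _ "\<lambda>x\<in>?W. x"] conjI R(1) t' mhom_inclusion[OF W lmR] ballI)
   (use te' aU bW in "simp add: submod_diff_eq[OF lmR W]")
 ultimately show ?thesis unfolding stab_def by blast
qed

text \<open>A homotopy equivalence between the short complex \<open>P1 \<rightarrow> P0\<close> and
  the segment \<open>R2 \<rightarrow> R1 \<rightarrow> R0\<close>, reduced to what cohomology at
  index 1 needs. On the \<open>P\<close> side nothing lies above \<open>P1\<close>, so the homotopy
  is \<open>s\<close> alone; on the \<open>R\<close> side it is \<open>t\<close> up to the image of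
  \<open>r2\<close>.\<close>

definition chain_equiv where
 "chain_equiv P0 P1 p1 R0 R1 R2 r1 r2 \<longleftrightarrow>
  (EX c : mhom A R1 P1. EX d : mhom A P1 R1. EX \<alpha> : mhom A P0 R0. EX \<beta> : mhom A R0 P0.
  EX s : mhom A P0 P1. EX t : mhom A R0 R1.
   (ALL y : car R2. c (r2 y) = \<zero>\<^sub>P1) & (ALL y : car R1. p1 (c y) = \<beta> (r1 y)) &
   (ALL x : car P1. r1 (d x) = \<alpha> (p1 x)) & (ALL x : car P1. x \<ominus>\<^sub>P1 c (d x) = s (p1 x)) &
   (ALL y : car R1. (y \<ominus>\<^sub>R1 d (c y)) \<ominus>\<^sub>R1 t (r1 y) : r2 ` car R2))"

text \<open>\<open>c\<close>, \<open>d\<close>, \<open>s\<close> and \<open>t\<close> are lifts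
  along the covers \<open>P1\<close> and \<open>R1\<close> of the two kernels. Injectivity of
  \<open>p1\<close> turns identities that hold after applying \<open>p1\<close> into identities in
  \<open>P1\<close>; this gives both that \<open>c\<close> kills the image of \<open>r2\<close> and
  that \<open>id - c d\<close> is \<open>s p1\<close>.\<close>

lemma chain_equivI:
 assumes N: "fd_module K A N" and V: "fd_module K A V" and st: "stab N V a b"
  and P: "projective K A P0" "p0 : mhom A P0 N" "p0 ` car P0 = car N"
  and R: "projective K A R0" "r0 : mhom A R0 V" "r0 ` car R0 = car V"
  and P1: "projective K A P1" "p1 : mhom A P1 P0" "p1 ` car P1 = mker P0 N p0" "inj_on p1 (car P1)"
  and R1: "projective K A R1" "r1 : mhom A R1 R0" "r1 ` car R1 = mker R0 V r0"
  and r2: "lmod A R2" "r2 : mhom A R2 R1" "r2 ` car R2 = mker R1 R0 r1"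
 shows "chain_equiv P0 P1 p1 R0 R1 R2 r1 r2"
proof -
 note lmP = projD(2)[OF P(1)] and lmR = projD(2)[OF R(1)] and lmN = fdmD(1)[OF N] and lmV = fdmD(1)[OF V]
 note lmP1 = projD(2)[OF P1(1)] and lmR1 = projD(2)[OF R1(1)]
 have ab: "a : mhom A N V" "b : mhom A V N" using st by (auto simp: stab_def)
 obtain \<alpha> \<beta> \<theta> \<theta>' where al: "\<alpha> : mhom A P0 R0" and be: "\<beta> : mhom A R0 P0"
  and t: "\<theta> : mhom A P0 (submod P0 (mker P0 N p0))" and t': "\<theta>' : mhom A R0 (submod R0 (mker R0 V r0))"
  and ra: "ALL x : car P0. r0 (\<alpha> x) = a (p0 x)" and pb: "ALL y : car R0. p0 (\<beta> y) = b (r0 y)"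
  and te: "ALL x : mker P0 N p0. \<theta> x = x \<ominus>\<^sub>P0 \<beta> (\<alpha> x)"
  and te': "ALL y : mker R0 V r0. \<theta>' y = y \<ominus>\<^sub>R0 \<alpha> (\<beta> y)"
  using stab_lift[OF N V st P R] by blast
 let ?U = "mker P0 N p0" and ?W = "mker R0 V r0"
 have U: "submodule ?U A P0" by (rule mod_hom.submodule_ker[OF mod_homI[OF lmP lmN P(2)]])
 have W: "submodule ?W A R0" by (rule mod_hom.submodule_ker[OF mod_homI[OF lmR lmV R(2)]])
 note fU = fdm_submod[OF projD(1)[OF P(1)] U] and fW = fdm_submod[OF projD(1)[OF R(1)] W]
 have aU: "\<alpha> x : ?W" if "x : ?U" for x
  by (rule lift_ker[OF lmP lmN lmR lmV P(2) R(2) ab(1) al _ that]) (use ra in blast)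
 have bW: "\<beta> x : ?U" if "x : ?W" for x
  by (rule lift_ker[OF lmR lmV lmP lmN R(2) P(2) ab(2) be _ that]) (use pb in blast)
 have p1U: "p1 : mhom A P1 (submod P0 ?U)" "p1 ` car P1 = car (submod P0 ?U)"
  using P1 by (simp_all add: mhom_submod[OF U lmP])
 have r1W: "r1 : mhom A R1 (submod R0 ?W)" "r1 ` car R1 = car (submod R0 ?W)"
  using R1 by (simp_all add: mhom_submod[OF W lmR])
 interpret p1: mod_hom A P1 P0 p1 by (rule mod_homI[OF lmP1 lmP P1(2)])
 interpret r1: mod_hom A R1 R0 r1 by (rule mod_homI[OF lmR1 lmR R1(2)])
 interpret al: mod_hom A P0 R0 \<alpha> by (rule mod_homI[OF lmP lmR al])
 interpret be: mod_hom A R0 P0 \<beta> by (rule mod_homI[OF lmR lmP be])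
 have p1m: "p1 x : ?U" if "x :. P1" for x using P1(3) that by blast
 have r1m: "r1 x : ?W" if "x :. R1" for x using R1(3) that by blast
 have "compose (car R1) \<beta> r1 : mhom A R1 (submod P0 ?U)"
  using mhom_compose[OF lmR1 R1(2) be] bW r1m by (auto simp: mhom_submod[OF U lmP] compose_eq)
 then obtain c where c: "c : mhom A R1 P1" "ALL y : car R1. p1 (c y) = compose (car R1) \<beta> r1 y"
  using proj_lift[OF R1(1) projD(1)[OF P1(1)] fU p1U] by blast
 have "compose (car P1) \<alpha> p1 : mhom A P1 (submod R0 ?W)"
  using mhom_compose[OF lmP1 P1(2) al] aU p1m by (auto simp: mhom_submod[OF W lmR] compose_eq)
 then obtain d where d: "d : mhom A P1 R1" "ALL y : car P1. r1 (d y) = compose (car P1) \<alpha> p1 y"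
  using proj_lift[OF P1(1) projD(1)[OF R1(1)] fW r1W] by blast
 obtain s where s: "s : mhom A P0 P1" "ALL x : car P0. p1 (s x) = \<theta> x"
  using proj_lift[OF P(1) projD(1)[OF P1(1)] fU p1U t] by blast
 obtain u where u: "u : mhom A R0 R1" "ALL x : car R0. r1 (u x) = \<theta>' x"
  using proj_lift[OF R(1) projD(1)[OF R1(1)] fW r1W t'] by blast
 interpret c: mod_hom A R1 P1 c by (rule mod_homI[OF lmR1 lmP1 c(1)])
 interpret d: mod_hom A P1 R1 d by (rule mod_homI[OF lmP1 lmR1 d(1)])
 have pc: "p1 (c y) = \<beta> (r1 y)" if "y :. R1" for y using c(2) that by (simp add: compose_eq)
 have rd: "r1 (d y) = \<alpha> (p1 y)" if "y :. P1" for y using d(2) that by (simp add: compose_eq)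
 have sm: "s x :. P1" if "x :. P0" for x using mhom_closed[OF s(1) that] .
 have um: "u x :. R1" if "x :. R0" for x using mhom_closed[OF u(1) that] .
 have "c (r2 y) = \<zero>\<^sub>P1" if y: "y :. R2" for y
 proof -
  have r: "r2 y :. R1" "r1 (r2 y) = \<zero>\<^sub>R0" using r2(3) y by (auto simp: mker_def)
  then have "p1 (c (r2 y)) = \<zero>\<^sub>P0" using pc by simp
  then show ?thesis using P1(4) p1.inj_iff r(1) by simp
 qed
 moreover have "x \<ominus>\<^sub>P1 c (d x) = s (p1 x)" if x: "x :. P1" for x
 proof -
  have "p1 (x \<ominus>\<^sub>P1 c (d x)) = p1 (s (p1 x))"
   using x s(2) te p1m[OF x] by (simp add: pc rd)
  from inj_onD[OF P1(4) this] show ?thesis using x sm by simp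
 qed
 \<comment> \<open>On this side \<open>r1\<close> is only exact: the element is killed by
   \<open>r1\<close>, hence lies in the image of \<open>r2\<close>.\<close>
 moreover have "(y \<ominus>\<^sub>R1 d (c y)) \<ominus>\<^sub>R1 u (r1 y) : r2 ` car R2" if y: "y :. R1" for y
 proof -
  have "r1 ((y \<ominus>\<^sub>R1 d (c y)) \<ominus>\<^sub>R1 u (r1 y)) = (r1 y \<ominus>\<^sub>R0 \<alpha> (\<beta> (r1 y))) \<ominus>\<^sub>R0 (r1 y \<ominus>\<^sub>R0 \<alpha> (\<beta> (r1 y)))"
   using y um u(2) te' r1m[OF y] by (simp add: pc rd)
  also have "\<dots> = \<zero>\<^sub>R0"
   using y r1.N.diff_eq_zero_iff[of "r1 y \<ominus>\<^sub>R0 \<alpha> (\<beta> (r1 y))" "r1 y \<ominus>\<^sub>R0 \<alpha> (\<beta> (r1 y))"] by simp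
  finally show ?thesis unfolding r2(3) using y um by (simp add: mker_def)
 qed
 ultimately show ?thesis
  unfolding chain_equiv_def
  by (intro bexI[OF _ c(1)] bexI[OF _ d(1)] bexI[OF _ al] bexI[OF _ be] bexI[OF _ s(1)] bexI[OF _ u(1)])
   (simp add: pc rd)
qed

subsection \<open>Cochains\<close>

lemma comp_left_hom:
 assumes "lmod A P" "lmod A X" "lmod A Y" "f : mhom A X Y"
 shows "(\<lambda>g\<in>mhom A P X. compose (car P) f g) : mhom K (Hom_space A P X) (Hom_space A P Y)"
proof -
 have gc: "g x :. X" if "g : mhom A P X" "x :. P" for g x using mhom_closed[OF that] .
 have "(\<lambda>g\<in>car (Hom_space A P X). compose (car P) f g) : mhom K (Hom_space A P X) (Hom_space A P Y)"
  by (rule mhom_restrictI[OF lm_Hom_space[OF assms(1,2)]])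
   (use mhom_compose[OF assms(1) _ assms(4)] gc mhom_add[OF assms(4)] mhom_smult[OF assms(4)]
    in \<open>auto simp: compose_eq simp flip: unit_map_def intro!: extensionalityI[of _ "car P"]\<close>)
 then show ?thesis by simp
qed

lemma comp_right_hom:
 assumes "lmod A P" "lmod A R" "lmod A X" "c : mhom A R P"
 shows "(\<lambda>h\<in>mhom A P X. compose (car R) h c) : mhom K (Hom_space A P X) (Hom_space A R X)"
proof -
 have "(\<lambda>h\<in>car (Hom_space A P X). compose (car R) h c) : mhom K (Hom_space A P X) (Hom_space A R X)"
  by (rule mhom_restrictI[OF lm_Hom_space[OF assms(1,3)]])
   (use mhom_compose[OF assms(2,4)] mhom_closed[OF assms(4)]
    in \<open>auto simp: compose_eq simp flip: unit_map_def intro!: extensionalityI[of _ "car R"]\<close>)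
 then show ?thesis by simp
qed

end


lemma mker_restrict: "S = car M ==> mker M N (restrict f S) = mker M N f"
 by (auto simp: mker_def)

lemma mhom_submodD:
 "[|f : mhom R Q S; S = submod P H; submodule H R P; lmod R P|] ==> f : mhom R Q P"
 by (simp add: mhom_submod)

lemma submodule_submod:
 assumes "lmod R M" "submodule Z R M" "submodule N R M" "N \<subseteq> Z"
 shows "submodule N R (submod M Z)"
proof -
 interpret Z: left_module R "submod M Z" by (rule left_module_submod[OF assms(1,2)])
 show ?thesis
  by (rule Z.submodI) (use assms(4) left_module.submodD[OF assms(1,3)] in auto)
qed

context fd_algebra
begin

lemma pcov_syzygy:
 assumes "fd_module K A N"
 shows "snd (pcov K A (syzygy K A N)) : mhom A (fst (pcov K A (syzygy K A N))) (fst (pcov K A N))"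
  "snd (pcov K A (syzygy K A N)) ` car (fst (pcov K A (syzygy K A N))) =
   mker (fst (pcov K A N)) N (snd (pcov K A N))"
proof -
 show "snd (pcov K A (syzygy K A N)) : mhom A (fst (pcov K A (syzygy K A N))) (fst (pcov K A N))"
  by (rule mhom_submodD[OF pcovD(2)[OF fdm_syzygy[OF assms]] syzygy_eq submodule_syzygy[OF assms]
     projD(2)[OF pcovD(1)[OF assms]]])
 have "car (syzygy K A N) = mker (fst (pcov K A N)) N (snd (pcov K A N))" by (simp add: syzygy_eq)
 then show "snd (pcov K A (syzygy K A N)) ` car (fst (pcov K A (syzygy K A N))) =
   mker (fst (pcov K A N)) N (snd (pcov K A N))"
  using pcovD(3)[OF fdm_syzygy[OF assms]] by (rule trans[rotated])
qed

subsection \<open>Extension groups\<close>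

context
 fixes M :: "('b, 'm) module"
 assumes M: "fd_module K A M"
begin

abbreviation "rm \<equiv> res_mod K A M"
abbreviation "rd \<equiv> res_diff K A M"

lemma res:
 shows res_proj: "projective K A (rm n)"
  and res_diff_hom: "rd n : mhom A (rm (Suc n)) (rm n)"
  and res_exact: "rd (Suc n) ` car (rm (Suc (Suc n))) = mker (rm (Suc n)) (rm n) (rd n)"
proof -
 obtain \<epsilon> where e: "proj_res K A M rm rd \<epsilon>" using resolution[OF M] ..
 note e = e[unfolded proj_res_def]
 show "projective K A (rm n)" using e[THEN conjunct1] ..
 show "rd n : mhom A (rm (Suc n)) (rm n)"
  using e[THEN conjunct2, THEN conjunct2, THEN conjunct2, THEN conjunct1] ..
 show "rd (Suc n) ` car (rm (Suc (Suc n))) = mker (rm (Suc n)) (rm n) (rd n)"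
  using e[THEN conjunct2, THEN conjunct2, THEN conjunct2, THEN conjunct2, THEN conjunct2] ..
qed

lemma res_lm: "lmod A (rm n)" by (rule projD(2)[OF res_proj])

lemma res_comp: "y :. (rm (Suc (Suc n))) ==> rd n (rd (Suc n) y) = \<zero>\<^bsub>rm n\<^esub>"
 using res_exact[of n] by (auto simp: mker_def)

lemma Ext_diff_hom:
 fixes X :: "('b, 'd) module"
 assumes "lmod A X"
 shows "restrict (Ext_diff K A n M) (mhom A (rm n) X) : 
  mhom K (Hom_space A (rm n) X) (Hom_space A (rm (Suc n)) X)"
proof -
 have "Ext_diff K A n M = (%f :: (nat \<Rightarrow> 'a) \<Rightarrow> 'd. compose (car (rm (Suc n))) f (rd n))"
  by (rule ext) (simp add: Ext_diff_def)
 then show ?thesis using comp_right_hom[OF res_lm res_lm assms res_diff_hom] by simp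
qed

lemma Ext_cocycles_iff:
 "f : Ext_cocycles K A n M X \<longleftrightarrow> f : mhom A (rm n) X & (ALL y : car (rm (Suc n)). f (rd n y) = \<zero>\<^sub>X)"
 by (auto simp: Ext_cocycles_def mker_def Ext_cochains_def Ext_diff_def compose_def fun_eq_iff)

lemma submodule_Ext_cocycles:
 assumes X: "lmod A X" shows "submodule (Ext_cocycles K A n M X) K (Hom_space A (rm n) X)"
 using mod_hom.submodule_ker[OF mod_homI[OF lm_Hom_space[OF res_lm X] lm_Hom_space[OF res_lm X] Ext_diff_hom[OF X]]]
 by (simp add: Ext_cocycles_def Ext_cochains_def mker_restrict)

lemma Ext_cobounds_iff:
 "f : Ext_cobounds K A (Suc n) M X \<longleftrightarrow> (EX g : mhom A (rm n) X. f = compose (car (rm (Suc n))) g (rd n))"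
 by (auto simp: Ext_cobounds_def Ext_cochains_def Ext_diff_def)

lemma submodule_Ext_cobounds:
 assumes X: "lmod A X"
 shows "submodule (Ext_cobounds K A (Suc n) M X) K (Hom_space A (rm (Suc n)) X)"
proof -
 interpret d: mod_hom K "Hom_space A (rm n) X" "Hom_space A (rm (Suc n)) X" "restrict (Ext_diff K A n M) (mhom A (rm n) X)"
  by (rule mod_homI[OF lm_Hom_space[OF res_lm X] lm_Hom_space[OF res_lm X] Ext_diff_hom[OF X]])
 show ?thesis using d.submodule_image[OF d.M.submodule_carrier]
  by (simp add: Ext_cobounds_def Ext_cochains_def)
qed

lemma Ext_cobounds_sub:
 assumes X: "lmod A X"
 shows "Ext_cobounds K A (Suc n) M X \<subseteq> Ext_cocycles K A (Suc n) M X"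
proof
 fix f assume "f : Ext_cobounds K A (Suc n) M X"
 then obtain g where g: "g : mhom A (rm n) X" "f = compose (car (rm (Suc n))) g (rd n)"
  unfolding Ext_cobounds_iff by blast
 show "f : Ext_cocycles K A (Suc n) M X"
  unfolding Ext_cocycles_iff g(2)
  using mhom_compose[OF res_lm res_diff_hom g(1)] mhom_closed[OF res_diff_hom] res_comp
   mod_hom.zero[OF mod_homI[OF res_lm X g(1)]]
  by (simp add: compose_eq)
qed

lemma Ext_quot:
 assumes X: "lmod A X"
 shows "submod_of K (submod (Hom_space A (rm (Suc n)) X) (Ext_cocycles K A (Suc n) M X)) (Ext_cobounds K A (Suc n) M X)"
 by (intro submod_ofI left_module_submod submodule_submod lm_Hom_space res_lm X
   submodule_Ext_cocycles submodule_Ext_cobounds Ext_cobounds_sub)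

lemma Ext_eq: "Ext K A n M X = quot (submod (Hom_space A (rm n) X) (Ext_cocycles K A n M X)) (Ext_cobounds K A n M X)"
 by (simp add: Ext_def Ext_cochains_def)

lemma lm_Ext: "lmod A X ==> lmod K (Ext K A (Suc n) M X)"
 unfolding Ext_eq by (rule submod_of.left_module_quot[OF Ext_quot])

lemma Ext_map_cos:
 assumes X: "lmod A X" and Y: "lmod A Y" and f: "f : mhom A X Y"
  and g: "g : Ext_cocycles K A (Suc n) M X"
 shows "Ext_map K A (Suc n) M Y f (Ext_cobounds K A (Suc n) M X +>\<^bsub>Hom_space A (rm (Suc n)) X\<^esub> g) =
  Ext_cobounds K A (Suc n) M Y +>\<^bsub>Hom_space A (rm (Suc n)) Y\<^esub> compose (car (rm (Suc n))) f g"
proof -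
 let ?Z = "%X. Ext_cocycles K A (Suc n) M X" and ?B = "%X. Ext_cobounds K A (Suc n) M X"
 let ?H = "%X. Hom_space A (rm (Suc n)) X" and ?c = "%g. compose (car (rm (Suc n))) f g"
 have h: "(\<lambda>g\<in>mhom A (rm (Suc n)) X. ?c g) : mhom K (?H X) (?H Y)"
  by (rule comp_left_hom[OF res_lm X Y f])
 note Z = submodule_Ext_cocycles[OF X, of "Suc n"] submodule_Ext_cocycles[OF Y, of "Suc n"]
 note HX = lm_Hom_space[OF res_lm X, of "Suc n"] and HY = lm_Hom_space[OF res_lm Y, of "Suc n"]
 have m: "g : mhom A (rm (Suc n)) X" if "g : ?Z X" for g using that Ext_cocycles_iff by blast
 have f0: "f \<zero>\<^sub>X = \<zero>\<^sub>Y" by (rule mod_hom.zero[OF mod_homI[OF X Y f]])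
 have cz: "?c g : ?Z Y" if "g : ?Z X" for g
  using that mhom_compose[OF res_lm m[OF that] f] mhom_closed[OF res_diff_hom] f0
  by (simp add: Ext_cocycles_iff compose_eq)
 have cb: "?c g : ?B Y" if "g : ?B X" for g
 proof -
  obtain g' where g': "g' : mhom A (rm n) X" "g = compose (car (rm (Suc n))) g' (rd n)"
   using \<open>g : ?B X\<close> unfolding Ext_cobounds_iff by blast
  have "?c g = compose (car (rm (Suc n))) (compose (car (rm n)) f g') (rd n)"
   using mhom_closed[OF res_diff_hom] by (auto simp: g' compose_def intro!: restrict_ext)
  then show ?thesis using mhom_compose[OF res_lm g'(1) f] unfolding Ext_cobounds_iff by blast
 qed
 let ?r = "restrict (\<lambda>g\<in>mhom A (rm (Suc n)) X. ?c g) (?Z X)"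
 have r: "?r : mhom K (submod (?H X) (?Z X)) (submod (?H Y) (?Z Y))"
  using mhom_restrict_sub[OF Z(1) HX h] cz m by (auto simp: mhom_submod[OF Z(2) HY])
 have "quot_map (submod (?H Y) (?Z Y)) (?B Y) ?c (?B X +>\<^bsub>submod (?H X) (?Z X)\<^esub> g) =
   ?B Y +>\<^bsub>submod (?H Y) (?Z Y)\<^esub> ?c g"
  by (rule quot_map_cos'[OF Ext_quot[OF X] Ext_quot[OF Y] r])
   (use m cb g Ext_cobounds_sub[OF X] in auto)
 then show ?thesis by (simp add: Ext_map_def Ext_cochains_def)
qed

text \<open>Cochains on \<open>P1\<close> compute the extension group, up to the image of the cochains on \<open>P0\<close>.\<close>

lemma Ext_by_chain_equiv:
 assumes P0: "projective K A P0" and P1: "projective K A P1" and p1: "p1 : mhom A P1 P0"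
  and ce: "chain_equiv P0 P1 p1 (rm m) (rm (Suc m)) (rm (Suc (Suc m))) (rd m) (rd (Suc m))"
 shows "EX c : mhom A (rm (Suc m)) P1. ALL X :: ('b, 'x) module. lmod A X -->
   (ALL h : mhom A P1 X. compose (car (rm (Suc m))) h c : Ext_cocycles K A (Suc m) M X &
    (compose (car (rm (Suc m))) h c : Ext_cobounds K A (Suc m) M X \<longleftrightarrow>
     (EX h' : mhom A P0 X. h = compose (car P1) h' p1))) &
   (ALL f : Ext_cocycles K A (Suc m) M X. EX h : mhom A P1 X.
    f \<ominus>\<^bsub>Hom_space A (rm (Suc m)) X\<^esub> compose (car (rm (Suc m))) h c : Ext_cobounds K A (Suc m) M X)"
proof -
 let ?R0 = "rm m" and ?R1 = "rm (Suc m)" and ?r = "rd m"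
 note lmP = projD(2)[OF P0] projD(2)[OF P1]
 obtain c d \<alpha> \<beta> s t where c: "c : mhom A ?R1 P1" and d: "d : mhom A P1 ?R1"
  and al: "\<alpha> : mhom A P0 ?R0" and be: "\<beta> : mhom A ?R0 P0" and s: "s : mhom A P0 P1" and t: "t : mhom A ?R0 ?R1"
  and c2: "ALL y : car (rm (Suc (Suc m))). c (rd (Suc m) y) = \<zero>\<^sub>P1"
  and pc: "ALL y : car ?R1. p1 (c y) = \<beta> (?r y)" and rd: "ALL x : car P1. ?r (d x) = \<alpha> (p1 x)"
  and cd: "ALL x : car P1. x \<ominus>\<^sub>P1 c (d x) = s (p1 x)"
  and dc: "ALL y : car ?R1. (y \<ominus>\<^sub>?R1 d (c y)) \<ominus>\<^sub>?R1 t (?r y) : rd (Suc m) ` car (rm (Suc (Suc m)))"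
  using ce unfolding chain_equiv_def by blast
 note cm = mhom_closed[OF c] mhom_closed[OF d] mhom_closed[OF al] mhom_closed[OF be] mhom_closed[OF s]
  mhom_closed[OF t] mhom_closed[OF p1] mhom_closed[OF res_diff_hom]
 show ?thesis
 proof (rule bexI[OF _ c], intro allI impI conjI ballI)
  fix X :: "('b, 'x) module" and h
  assume X: "lmod A X" and h: "h : mhom A P1 X"
  interpret h: mod_hom A P1 X h by (rule mod_homI[OF lmP(2) X h])
  show "compose (car ?R1) h c : Ext_cocycles K A (Suc m) M X"
   unfolding Ext_cocycles_iff
   using mhom_compose[OF res_lm c h] c2 cm by (simp add: compose_eq)
  show "compose (car ?R1) h c : Ext_cobounds K A (Suc m) M X \<longleftrightarrow>
    (EX h' : mhom A P0 X. h = compose (car P1) h' p1)"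
  proof
   assume "compose (car ?R1) h c : Ext_cobounds K A (Suc m) M X"
   then obtain g where g: "g : mhom A ?R0 X" "compose (car ?R1) h c = compose (car ?R1) g ?r"
    unfolding Ext_cobounds_iff by blast
   have hc: "h (c y) = g (?r y)" if "y :. ?R1" for y
    using fun_cong[OF g(2), of y] that by (simp add: compose_eq)
   \<comment> \<open>From \<open>id = c d + s p1\<close> one gets \<open>h = h c d + h s p1\<close>;
     since \<open>h c = g r\<close> and \<open>r d = \<alpha> p1\<close>, this is
     \<open>(g \<alpha> + h s) p1\<close>.\<close>
   let ?h = "\<lambda>x\<in>car P0. compose (car P0) g \<alpha> x \<oplus>\<^sub>X compose (car P0) h s x"
   have hm: "?h : mhom A P0 X"
    by (intro mhom_plus[OF lmP(1) X] mhom_compose[OF lmP(1) al g(1)] mhom_compose[OF lmP(1) s h])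
   have "h = compose (car P1) ?h p1"
   proof (rule mhom_eqI[OF h mhom_compose[OF lmP(2) p1 hm]])
    fix x assume x: "x :. P1"
    have "compose (car P1) ?h p1 x = g (\<alpha> (p1 x)) \<oplus>\<^sub>X h (s (p1 x))"
     using x cm by (simp add: compose_eq)
    also have "\<dots> = h (c (d x)) \<oplus>\<^sub>X h (x \<ominus>\<^sub>P1 c (d x))"
     using hc[of "d x"] rd cd x cm by (simp del: h.diff)
    also have "\<dots> = h x" using x cm h.N.add_diff_cancel by simp
    finally show "h x = compose (car P1) ?h p1 x" ..
   qed
   then show "EX h' : mhom A P0 X. h = compose (car P1) h' p1" using hm by blast
  next
   assume "EX h' : mhom A P0 X. h = compose (car P1) h' p1"
   then obtain h' where h': "h' : mhom A P0 X" "h = compose (car P1) h' p1" by blast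
   \<comment> \<open>Conversely \<open>h' p1 c = h' \<beta> r\<close>, because
     \<open>p1 c = \<beta> r\<close>.\<close>
   have "compose (car ?R1) h c = compose (car ?R1) (compose (car ?R0) h' \<beta>) ?r"
    using cm pc by (auto simp: h'(2) compose_def intro!: restrict_ext)
   then show "compose (car ?R1) h c : Ext_cobounds K A (Suc m) M X"
    unfolding Ext_cobounds_iff using mhom_compose[OF res_lm be h'(1)] by blast
  qed
 next
  fix X :: "('b, 'x) module" and f
  assume X: "lmod A X" and f: "f : Ext_cocycles K A (Suc m) M X"
  have fm: "f : mhom A ?R1 X" and f0: "!!y. y :. (rm (Suc (Suc m))) ==> f (rd (Suc m) y) = \<zero>\<^sub>X"
   using f by (auto simp: Ext_cocycles_iff)
  interpret f: mod_hom A ?R1 X f by (rule mod_homI[OF res_lm X fm])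
  \<comment> \<open>A cocycle kills the image of the next differential, so \<open>f\<close> applied
    to the second homotopy identity gives \<open>f - f d c = f t r\<close>, a coboundary.\<close>
  let ?h = "compose (car P1) f d"
  have h: "?h : mhom A P1 X" by (rule mhom_compose[OF lmP(2) d fm])
  interpret H: left_module K "Hom_space A ?R1 X" by (rule lm_Hom_space[OF res_lm X])
  have hc: "compose (car ?R1) ?h c : mhom A ?R1 X" by (rule mhom_compose[OF res_lm c h])
  have ft: "compose (car ?R1) (compose (car ?R0) f t) ?r : mhom A ?R1 X" (is "?ft : _")
   by (rule mhom_compose[OF res_lm res_diff_hom mhom_compose[OF res_lm t fm]])
  have "?ft \<oplus>\<^bsub>Hom_space A ?R1 X\<^esub> compose (car ?R1) ?h c = f"
  proof (rule mhom_eqI)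
   show "?ft \<oplus>\<^bsub>Hom_space A ?R1 X\<^esub> compose (car ?R1) ?h c : mhom A ?R1 X"
    using H.M.add.m_closed[of ?ft "compose (car ?R1) ?h c"] ft hc by simp
   show "f : mhom A ?R1 X" by (rule fm)
   fix y assume y: "y :. ?R1"
   have m: "d (c y) :. ?R1" "t (?r y) :. ?R1" using y cm by auto
   have "f ((y \<ominus>\<^sub>?R1 d (c y)) \<ominus>\<^sub>?R1 t (?r y)) = \<zero>\<^sub>X" using dc y f0 by force
   then have "f y \<ominus>\<^sub>X f (d (c y)) = f (t (?r y))"
    using y m f.N.diff_eq_zero_iff[of "f y \<ominus>\<^sub>X f (d (c y))" "f (t (?r y))"] by simp
   then have "f (t (?r y)) \<oplus>\<^sub>X f (d (c y)) = f y"
    using y m f.N.diff_add_cancel[of "f (d (c y))" "f y"] by simp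
   then show "(?ft \<oplus>\<^bsub>Hom_space A ?R1 X\<^esub> compose (car ?R1) ?h c) y = f y"
    using y cm by (simp add: compose_eq)
  qed
  then have "f \<ominus>\<^bsub>Hom_space A ?R1 X\<^esub> compose (car ?R1) ?h c = ?ft"
   using H.add_diff_cancel_right[of ?ft "compose (car ?R1) ?h c"] ft hc by simp
  then show "EX h : mhom A P1 X. f \<ominus>\<^bsub>Hom_space A ?R1 X\<^esub> compose (car ?R1) h c : Ext_cobounds K A (Suc m) M X"
   using h mhom_compose[OF res_lm t fm] unfolding Ext_cobounds_iff by blast
 qed
qed

text \<open>Both functors are quotients of the maps \<open>P1 \<rightarrow> X\<close>:
  \<open>u\<close> is the pairing with the translate, \<open>w\<close> takes the class of
  \<open>h c\<close>. Either one kills exactly the maps that factor through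
  \<open>P0\<close>.\<close>

lemma ext_transpose_natural:
 fixes N :: "('b, 'n) module"
 assumes N: "fd_module K A N"
  and ce: "chain_equiv (fst (pcov K A N)) (fst (pcov K A (syzygy K A N))) (snd (pcov K A (syzygy K A N)))
   (rm m) (rm (Suc m)) (rm (Suc (Suc m))) (rd m) (rd (Suc m))"
 shows "naturally_iso K A
   (%X :: ('b, 'x) module. dual K (reg K) (Hom_space A X (ar_translate K A N)))
   (%X Y f \<phi>. \<lambda>g\<in>mhom A Y (ar_translate K A N). \<phi> (compose (car X) g f))
   (Ext K A (Suc m) M) (%X Y f. Ext_map K A (Suc m) M Y f)"
proof -
 define P0 where "P0 = fst (pcov K A N)"
 define P1 where "P1 = fst (pcov K A (syzygy K A N))"
 define p1 where "p1 = snd (pcov K A (syzygy K A N))"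
 have P0: "projective K A P0" unfolding P0_def by (rule pcovD(1)[OF N])
 have P1: "projective K A P1" unfolding P1_def by (rule pcovD(1)[OF fdm_syzygy[OF N]])
 have p1: "p1 : mhom A P1 P0"
  unfolding P0_def P1_def p1_def by (rule pcov_syzygy(1)[OF N])
 obtain B \<xi> where B: "finite B" "B \<subseteq> car P1" "!!b. b : B ==> \<xi> b : mhom A P1 (reg A)"
  "!!p. p :. P1 ==> p = (\<Oplus>\<^bsub>P1\<^esub> b \<in> B. \<xi> b p *\<^sub>P1 b)" by (rule dual_basis[OF P1]) blast
 interpret D: dual_presentation K A P0 P1 p1 B \<xi>
  by (intro dual_presentation.intro dual_presentation_axioms.intro fd_algebra_axioms P0 P1 p1 B)
 have tau: "ar_translate K A N = D.tau"
  unfolding D.tau_def D.T_def D.Im_def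
  by (simp add: ar_translate_def transpose_mod_def case_prod_beta P0_def P1_def p1_def)
 obtain c where c: "c : mhom A (rm (Suc m)) P1"
  and cc: "ALL X :: ('b, 'x) module. lmod A X -->
   (ALL h : mhom A P1 X. compose (car (rm (Suc m))) h c : Ext_cocycles K A (Suc m) M X &
    (compose (car (rm (Suc m))) h c : Ext_cobounds K A (Suc m) M X \<longleftrightarrow>
     (EX h' : mhom A P0 X. h = compose (car P1) h' p1))) &
   (ALL f : Ext_cocycles K A (Suc m) M X. EX h : mhom A P1 X.
    f \<ominus>\<^bsub>Hom_space A (rm (Suc m)) X\<^esub> compose (car (rm (Suc m))) h c : Ext_cobounds K A (Suc m) M X)"
  using Ext_by_chain_equiv[OF P0 P1 p1 ce[folded P0_def P1_def p1_def], where 'x = 'x] by blast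
 let ?R = "rm (Suc m)"
 let ?H = "%X :: ('b, 'x) module. Hom_space A ?R X"
 let ?Z = "%X :: ('b, 'x) module. Ext_cocycles K A (Suc m) M X"
 let ?B = "%X :: ('b, 'x) module. Ext_cobounds K A (Suc m) M X"
 let ?W = "%X :: ('b, 'x) module. Hom_space A X D.tau"
 let ?k = "%h. compose (car ?R) h c"
 define u where "u X = (\<lambda>h\<in>mhom A P1 X. \<lambda>g\<in>mhom A X D.tau. D.pair h g)" for X :: "('b, 'x) module"
 define w where "w X = (\<lambda>h\<in>mhom A P1 X. ?B X +>\<^bsub>?H X\<^esub> ?k h)" for X :: "('b, 'x) module"
 have lx: "lmod A X" if "fd_module K A X" for X :: "('b, 'x) module" by (rule fdmD(1)[OF that])
 have kz: "?k h : ?Z X" if "lmod A X" "h : mhom A P1 X" for X h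
  using cc that by blast
 show ?thesis unfolding tau
 proof (rule nat_iso_span[where V = "%X. Hom_space A P1 X" and u = u and w = w])
  fix X :: "('b, 'x) module" assume X: "fd_module K A X"
  note X' = lx[OF X]
  interpret q: submod_of K "submod (?H X) (?Z X)" "?B X" by (rule Ext_quot[OF X'])
  show "lmod K (Hom_space A P1 X)" by (rule lm_Hom_space[OF D.lmP1 X'])
  show "lmod K (dual K (reg K) (?W X))" by (rule lm_vdual[OF lm_Hom_space[OF X' D.lm_tau]])
  show "lmod K (Ext K A (Suc m) M X)" by (rule lm_Ext[OF X'])
  show "u X : mhom K (Hom_space A P1 X) (dual K (reg K) (?W X))"
   unfolding u_def by (rule D.transpose_duality(2)[OF X])
  show "u X ` car (Hom_space A P1 X) = car (dual K (reg K) (?W X))"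
   unfolding u_def Hom_space_sel(1) by (rule D.transpose_duality(3)[OF X])
  have kh: "(\<lambda>h\<in>mhom A P1 X. ?k h) : mhom K (Hom_space A P1 X) (submod (?H X) (?Z X))"
   unfolding mhom_submod[OF submodule_Ext_cocycles[OF X'] lm_Hom_space[OF res_lm X']]
   using comp_right_hom[OF D.lmP1 res_lm X' c] kz[OF X'] by auto
  have wk: "w X = compose (car (Hom_space A P1 X)) (\<lambda>f\<in>car (submod (?H X) (?Z X)). ?B X +>\<^bsub>submod (?H X) (?Z X)\<^esub> f)
    (\<lambda>h\<in>mhom A P1 X. ?k h)"
   using kz[OF X'] by (auto simp: w_def compose_def intro!: restrict_ext)
  show "w X : mhom K (Hom_space A P1 X) (Ext K A (Suc m) M X)"
   unfolding wk Ext_eq by (rule mhom_compose[OF lm_Hom_space[OF D.lmP1 X'] kh q.quot_proj])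
  then have wm: "w X h :. (Ext K A (Suc m) M X)" if "h : mhom A P1 X" for h
   using mhom_closed[of "w X" K "Hom_space A P1 X"] that by simp
  show "w X ` car (Hom_space A P1 X) = car (Ext K A (Suc m) M X)"
  proof (intro equalityI subsetI)
   fix C assume "C :. (Ext K A (Suc m) M X)"
   then obtain f where f: "f : ?Z X" "C = ?B X +>\<^bsub>?H X\<^esub> f"
    unfolding Ext_eq by (auto simp: quot_carrier)
   then obtain h where h: "h : mhom A P1 X" "f \<ominus>\<^bsub>?H X\<^esub> ?k h : ?B X" using cc X' by blast
   have "f \<ominus>\<^bsub>submod (?H X) (?Z X)\<^esub> ?k h : ?B X"
    using h submod_diff_eq[OF lm_Hom_space[OF res_lm X'] submodule_Ext_cocycles[OF X'] f(1) kz[OF X' h(1)]] by simp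
   then have "C = w X h" using q.cos_eq[of f "?k h"] f kz[OF X' h(1)] h(1) by (simp add: w_def)
   then show "C : w X ` car (Hom_space A P1 X)" using h(1) by simp
  qed (use wm in auto)
 next
  fix X :: "('b, 'x) module" and h assume X: "fd_module K A X" and "h :. (Hom_space A P1 X)"
  then have h: "h : mhom A P1 X" by simp
  note X' = lx[OF X]
  interpret q: submod_of K "submod (?H X) (?Z X)" "?B X" by (rule Ext_quot[OF X'])
  have "w X h = \<zero>\<^bsub>Ext K A (Suc m) M X\<^esub> \<longleftrightarrow> ?k h : ?B X"
   using q.cos_zero[of "?k h"] kz[OF X' h] h by (simp add: w_def Ext_eq)
  also have "\<dots> \<longleftrightarrow> (EX h' : mhom A P0 X. h = compose (car P1) h' p1)" using cc X' h by blast
  finally show "u X h = \<zero>\<^bsub>dual K (reg K) (?W X)\<^esub> \<longleftrightarrow> w X h = \<zero>\<^bsub>Ext K A (Suc m) M X\<^esub>"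
   using D.transpose_duality(4)[OF X h] unfolding u_def by blast
 next
  fix X Y :: "('b, 'x) module" and f h
  assume X: "fd_module K A X" and Y: "fd_module K A Y" and f: "f : mhom A X Y"
   and "h :. (Hom_space A P1 X)"
  then have h: "h : mhom A P1 X" by simp
  note X' = lx[OF X] and Y' = lx[OF Y]
  \<comment> \<open>Composition with \<open>f\<close> serves both sides: in the pairing it moves
    from \<open>h\<close> to \<open>g\<close>, and it commutes with precomposition by
    \<open>c\<close>.\<close>
  let ?h = "compose (car P1) f h"
  have fh: "?h : mhom A P1 Y" by (rule mhom_compose[OF D.lmP1 h f])
  have gf: "compose (car X) g f : mhom A X D.tau" if "g : mhom A Y D.tau" for g
   by (rule mhom_compose[OF X' f that])
  have hb: "h b :. X" "b :. P1" if "b : B" for b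
   using mhom_closed[OF h, of b] that B(2) by auto
  have pp: "D.pair ?h g = D.pair h (compose (car X) g f)" if g: "g : mhom A Y D.tau" for g
   unfolding D.pair_def
   by (rule K.finsum_cong') (use hb D.pair_mem[OF X' h gf[OF g]] in "auto simp: compose_eq")
  have "u Y ?h = (\<lambda>g\<in>mhom A Y D.tau. u X h (compose (car X) g f))"
   using fh h gf pp by (auto simp: u_def intro!: restrict_ext)
  moreover have "w Y ?h = Ext_map K A (Suc m) M Y f (w X h)"
  proof -
   have "?k ?h = compose (car ?R) f (?k h)"
    using mhom_closed[OF c] by (auto simp: compose_def intro!: restrict_ext)
   then show ?thesis using Ext_map_cos[OF X' Y' f kz[OF X' h]] h fh by (simp add: w_def)
  qed
  ultimately show "EX v' : car (Hom_space A P1 Y).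
    u Y v' = (\<lambda>g\<in>mhom A Y D.tau. u X h (compose (car X) g f)) &
    w Y v' = Ext_map K A (Suc m) M Y f (w X h)"
   using fh by (intro bexI[of _ ?h]) auto
 qed
qed

text \<open>The image of \<open>rd k\<close> is the syzygy of order \<open>k + 1\<close> in the
  chosen resolution; the minimal syzygy of the same order is stably equivalent to it, starting from
  the identity of \<open>M\<close>.\<close>

lemma stab_syzygies:
 "EX a b. stab ((syzygy K A ^^ k) (syzygy K A M)) (submod (rm k) (rd k ` car (rm (Suc k)))) a b"
proof (induction k)
 case 0
 obtain \<epsilon> where e: "\<epsilon> : mhom A (rm 0) M" "\<epsilon> ` car (rm 0) = car M"
  "rd 0 ` car (rm 1) = mker (rm 0) M \<epsilon>"
  using resolution[OF M] by (auto simp: proj_res_def)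
 show ?case
  using stab_step[OF M M stab_id[OF M] pcovD[OF M] res_proj e(1,2)] e(3) by (simp add: syzygy_eq)
next
 case (Suc k)
 let ?N = "(syzygy K A ^^ k) (syzygy K A M)" and ?V = "submod (rm k) (rd k ` car (rm (Suc k)))"
 obtain a b where ab: "stab ?N ?V a b" using Suc by blast
 have N: "fd_module K A ?N" by (intro fdm_syzygy_pow fdm_syzygy M)
 have sub: "submodule (rd k ` car (rm (Suc k))) A (rm k)"
  by (rule mod_hom.submodule_image[OF mod_homI[OF res_lm res_lm res_diff_hom] left_module.submodule_carrier[OF res_lm]])
 have V: "fd_module K A ?V" by (rule fdm_submod[OF projD(1)[OF res_proj] sub])
 have r: "rd k : mhom A (rm (Suc k)) ?V" "rd k ` car (rm (Suc k)) = car ?V"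
  using res_diff_hom by (auto simp: mhom_submod[OF sub res_lm])
 have "mker (rm (Suc k)) ?V (rd k) = rd (Suc k) ` car (rm (Suc (Suc k)))"
  unfolding res_exact by (simp add: mker_def)
 then show ?case
  using stab_step[OF N V ab pcovD[OF N] res_proj r] by (simp add: syzygy_eq[of ?N])
qed

text \<open>The place where the vanishing syzygy enters the comparison: it is the kernel of the
  cover.\<close>

lemma pcov_inj:
 fixes N :: "('a, 'b) fdmod"
 assumes N: "fd_module K A N" and s: "car (syzygy K A N) = {\<zero>\<^bsub>syzygy K A N\<^esub>}"
 shows "inj_on (snd (pcov K A N)) (car (fst (pcov K A N)))"
proof -
 interpret p: mod_hom A "fst (pcov K A N)" N "snd (pcov K A N)"
  by (rule mod_homI[OF projD(2)[OF pcovD(1)[OF N]] fdmD(1)[OF N] pcovD(2)[OF N]])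
 show ?thesis unfolding p.inj_iff using s by (auto simp: syzygy_eq mker_def)
qed

text \<open>Degree 1 is separate because \<open>M\<close> itself may lie outside the universe, so it
  is not an iterate of \<open>syzygy\<close> on \<open>fdmod\<close>.\<close>

lemma chain_equiv_1:
 assumes z: "car (syzygy K A (syzygy K A M)) = {\<zero>\<^bsub>syzygy K A (syzygy K A M)\<^esub>}"
 shows "chain_equiv (fst (pcov K A M)) (fst (pcov K A (syzygy K A M))) (snd (pcov K A (syzygy K A M)))
  (rm 0) (rm (Suc 0)) (rm (Suc (Suc 0))) (rd 0) (rd (Suc 0))"
proof -
 obtain \<epsilon> where e: "\<epsilon> : mhom A (rm 0) M" "\<epsilon> ` car (rm 0) = car M"
  "rd 0 ` car (rm 1) = mker (rm 0) M \<epsilon>"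
  using resolution[OF M] by (auto simp: proj_res_def)
 show ?thesis
  by (rule chain_equivI[OF M M stab_id[OF M] pcovD[OF M] res_proj e(1,2) pcovD(1)[OF fdm_syzygy[OF M]]
     pcov_syzygy[OF M] pcov_inj[OF fdm_syzygy[OF M] z] res_proj res_diff_hom _ res_lm res_diff_hom res_exact])
   (use e(3) in simp)
qed

lemma chain_equiv_Suc:
 assumes zz: "car (syzygy K A (syzygy K A ((syzygy K A ^^ k) (syzygy K A M)))) =
  {\<zero>\<^bsub>syzygy K A (syzygy K A ((syzygy K A ^^ k) (syzygy K A M)))\<^esub>}"
 defines "N \<equiv> (syzygy K A ^^ k) (syzygy K A M)"
 shows "chain_equiv (fst (pcov K A N)) (fst (pcov K A (syzygy K A N))) (snd (pcov K A (syzygy K A N)))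
   (rm (Suc k)) (rm (Suc (Suc k))) (rm (Suc (Suc (Suc k)))) (rd (Suc k)) (rd (Suc (Suc k)))"
proof -
 let ?V = "submod (rm k) (rd k ` car (rm (Suc k)))"
 have N: "fd_module K A N" unfolding N_def by (intro fdm_syzygy_pow fdm_syzygy M)
 have sub: "submodule (rd k ` car (rm (Suc k))) A (rm k)"
  by (rule mod_hom.submodule_image[OF mod_homI[OF res_lm res_lm res_diff_hom] left_module.submodule_carrier[OF res_lm]])
 have V: "fd_module K A ?V" by (rule fdm_submod[OF projD(1)[OF res_proj] sub])
 have r: "rd k : mhom A (rm (Suc k)) ?V" "rd k ` car (rm (Suc k)) = car ?V"
  using res_diff_hom by (auto simp: mhom_submod[OF sub res_lm])
 have mk: "rd (Suc k) ` car (rm (Suc (Suc k))) = mker (rm (Suc k)) ?V (rd k)"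
  unfolding res_exact by (simp add: mker_def)
 obtain a b where ab: "stab N ?V a b" using stab_syzygies unfolding N_def by blast
 show ?thesis
  by (rule chain_equivI[OF N V ab pcovD[OF N] res_proj r pcovD(1)[OF fdm_syzygy[OF N]] pcov_syzygy[OF N]
     pcov_inj[OF fdm_syzygy[OF N] zz[folded N_def]] res_proj res_diff_hom mk res_lm res_diff_hom res_exact])
qed

text \<open>The assumption \<open>z\<close> speaks of the syzygy of order \<open>n + 1\<close>, the
  kernel of \<open>P1 \<rightarrow> P0\<close> for the presentation of the syzygy of order
  \<open>n - 1\<close>. The cases follow those of \<open>tau_n\<close>.\<close>

theorem tau_ext_natural:
 assumes n: "1 \<le> n" and z: "car ((syzygy K A ^^ n) (syzygy K A M)) = {\<zero>\<^bsub>(syzygy K A ^^ n) (syzygy K A M)\<^esub>}"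
 shows "naturally_iso K A
   (%X :: ('b, 'x) module. dual K (reg K) (Hom_space A X (tau_n K A n M)))
   (%X Y f \<phi>. \<lambda>g\<in>mhom A Y (tau_n K A n M). \<phi> (compose (car X) g f))
   (Ext K A n M) (%X Y f. Ext_map K A n M Y f)"
proof (cases "n = 1")
 case True
 with z have "car (syzygy K A (syzygy K A M)) = {\<zero>\<^bsub>syzygy K A (syzygy K A M)\<^esub>}" by simp
 from ext_transpose_natural[OF M chain_equiv_1[OF this]] show ?thesis by (simp add: tau_n_def True)
next
 case False
 with n obtain k where k: "n = Suc (Suc k)" by (metis One_nat_def Suc_le_D not0_implies_Suc)
 have N: "fd_module K A ((syzygy K A ^^ k) (syzygy K A M))" by (intro fdm_syzygy_pow fdm_syzygy M)
 from z have "car (syzygy K A (syzygy K A ((syzygy K A ^^ k) (syzygy K A M)))) =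
  {\<zero>\<^bsub>syzygy K A (syzygy K A ((syzygy K A ^^ k) (syzygy K A M)))\<^esub>}"
  unfolding k by simp
 from ext_transpose_natural[OF N chain_equiv_Suc[OF this]] show ?thesis by (simp add: tau_n_def k)
qed

end

end


section \<open>Tensor products\<close>

lemma free_space_sel [simp]:
 "car (free_space K S) = {f. (ALL p. f p :. K) & finite {p. f p ~= \<zero>\<^sub>K} & {p. f p ~= \<zero>\<^sub>K} \<subseteq> S}"
 "zero (free_space K S) = (%p. \<zero>\<^sub>K)" "add (free_space K S) = (%f g p. f p \<oplus>\<^sub>K g p)"
 "smult (free_space K S) = (%c f p. c \<otimes>\<^sub>K f p)"
 by (simp_all add: free_space_def)

context vs
begin

lemma free_space_closed:
 assumes "f :. (free_space K S)" shows "f p :. K"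
 using assms by simp

lemma free_space_memI:
 assumes "!!p. f p :. K" "finite T" "T \<subseteq> S" "!!p. p \<notin> T ==> f p = \<zero>\<^sub>K"
 shows "f :. (free_space K S)"
proof -
 have "{p. f p ~= \<zero>\<^sub>K} \<subseteq> T" using assms(4) by blast
 then show ?thesis using assms(1-3) by (auto intro: finite_subset)
qed

lemma lm_free_space:
 fixes S :: "'c set"
 shows "lmod K (free_space K S)"
proof -
 let ?F = "free_space K S"
 let ?s = "%f :: _ \<Rightarrow> 'k. {p. f p ~= \<zero>\<^sub>K}"
 have m: "f :. ?F ==> (ALL p. f p :. K) & finite (?s f) & ?s f \<subseteq> S" for f by simp
 have add: "(%p. f p \<oplus>\<^sub>K g p) :. ?F" if "f :. ?F" "g :. ?F" for f g
  by (rule free_space_memI[of _ "?s f \<union> ?s g"]) (use m[OF that(1)] m[OF that(2)] in auto)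
 have sm: "(%p. c \<otimes>\<^sub>K f p) :. ?F" if "f :. ?F" "c :. K" for f c
  by (rule free_space_memI[of _ "?s f"]) (use m[OF that(1)] that(2) in auto)
 have neg: "(%p. \<ominus>\<^sub>K f p) :. ?F" if "f :. ?F" for f
  by (rule free_space_memI[of _ "?s f"]) (use m[OF that(1)] in auto)
 have zero: "(%p. \<zero>\<^sub>K) :. ?F" by simp
 have sub: "car ?F \<subseteq> UNIV \<rightarrow>\<^sub>E car K" by auto
 have "restrict f UNIV = f" for f :: "'c \<Rightarrow> 'k" by (simp add: restrict_def)
 then have "abelian_group ?F"
  by (intro abelian_group_fun[of K ?F UNIV])
   (use sub add neg zero in "simp_all add: abelian_group_axioms del: free_space_sel(1)")
 then show ?thesis
  by (intro left_module.intro left_module_axioms.intro ring_axioms)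
   (use add sm free_space_closed[where S = S] in "auto simp: fun_eq_iff l_distr r_distr m_assoc simp del: free_space_sel(1)")
qed

lemma free_gen_mem: "p : S ==> free_gen K p :. (free_space K S)"
 by (rule free_space_memI[of _ "{p}"]) (auto simp: free_gen_def)

text \<open>The linear extension of \<phi> to the free space, written with the same sum as in
  \<open>tensor_lift\<close>.\<close>

definition flin :: "('k, 'z) module \<Rightarrow> ('p \<Rightarrow> 'z) \<Rightarrow> ('p \<Rightarrow> 'k) \<Rightarrow> 'z" where
 "flin Z \<phi> f = (\<Oplus>\<^bsub>Z\<^esub> p \<in> {p. f p ~= \<zero>\<^sub>K}. f p *\<^sub>Z \<phi> p)"

text \<open>Lets functions with different supports be summed over a common finite set.\<close>

lemma flin_superset:
 assumes Z: "lmod K Z" and f: "f :. (free_space K S)" and T: "finite T" "{p. f p ~= \<zero>\<^sub>K} \<subseteq> T" "T \<subseteq> S"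
  and phi: "!!p. p : S ==> \<phi> p :. Z"
 shows "flin Z \<phi> f = (\<Oplus>\<^bsub>Z\<^esub> p \<in> T. f p *\<^sub>Z \<phi> p)"
proof -
 interpret Z: left_module K Z by fact
 show ?thesis unfolding flin_def
  by (rule Z.M.add.finprod_mono_neutral_cong_left)
   (use T phi free_space_closed[OF f] in "auto intro!: Z.smult_l_null Z.smult_closed simp: subset_iff")
qed

lemma flin_hom:
 assumes Z: "lmod K Z" and phi: "!!p. p : S ==> \<phi> p :. Z"
 shows "(\<lambda>f\<in>car (free_space K S). flin Z \<phi> f) : mhom K (free_space K S) Z"
proof -
 let ?F = "free_space K S"
 let ?s = "%f :: _ \<Rightarrow> 'k. {p. f p ~= \<zero>\<^sub>K}"
 interpret Z: left_module K Z by fact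
 interpret F: left_module K ?F by (rule lm_free_space)
 have m: "f :. ?F ==> (ALL p. f p :. K) & finite (?s f) & ?s f \<subseteq> S" for f by simp
 show ?thesis
 proof (rule mhom_restrictI[OF lm_free_space])
  fix f assume f: "f :. ?F"
  then show "flin Z \<phi> f :. Z"
   using m[OF f] phi unfolding flin_def by (intro Z.M.finsum_closed) (auto intro!: Z.smult_closed)
 next
  fix f g assume f: "f :. ?F" and g: "g :. ?F"
  let ?T = "?s f \<union> ?s g"
  have T: "finite ?T" "?T \<subseteq> S" using m[OF f] m[OF g] by auto
  have fg: "f \<oplus>\<^sub>?F g :. ?F" using f g by (rule F.M.add.m_closed)
  have pT: "\<phi> p :. Z" if "p : ?T" for p by (rule phi[OF subsetD[OF T(2) that]])
  have fc: "f p :. K" "g p :. K" for p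
   by (rule free_space_closed[OF f], rule free_space_closed[OF g])
  have "flin Z \<phi> (f \<oplus>\<^sub>?F g) = (\<Oplus>\<^bsub>Z\<^esub> p \<in> ?T. (f \<oplus>\<^sub>?F g) p *\<^sub>Z \<phi> p)"
   by (rule flin_superset[OF Z fg T(1) _ T(2) phi]) auto
  also have "\<dots> = (\<Oplus>\<^bsub>Z\<^esub> p \<in> ?T. f p *\<^sub>Z \<phi> p \<oplus>\<^sub>Z g p *\<^sub>Z \<phi> p)"
   by (rule Z.M.finsum_cong') (use pT fc in "simp_all add: Z.smult_l_distr Pi_iff")
  also have "\<dots> = (\<Oplus>\<^bsub>Z\<^esub> p \<in> ?T. f p *\<^sub>Z \<phi> p) \<oplus>\<^sub>Z (\<Oplus>\<^bsub>Z\<^esub> p \<in> ?T. g p *\<^sub>Z \<phi> p)"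
   by (rule Z.M.finsum_addf) (use pT fc in "simp_all add: Pi_iff")
  also have "\<dots> = flin Z \<phi> f \<oplus>\<^sub>Z flin Z \<phi> g"
   using flin_superset[OF Z f T(1) _ T(2) phi] flin_superset[OF Z g T(1) _ T(2) phi] by simp
  finally show "flin Z \<phi> (f \<oplus>\<^sub>?F g) = flin Z \<phi> f \<oplus>\<^sub>Z flin Z \<phi> g" .
 next
  fix a f assume a: "a :. K" and f: "f :. ?F"
  have T: "finite (?s f)" "?s f \<subseteq> S" using m[OF f] by auto
  have af: "a *\<^sub>?F f :. ?F" using a f by (rule F.smult_closed)
  have pT: "\<phi> p :. Z" if "p : ?s f" for p by (rule phi[OF subsetD[OF T(2) that]])
  have fc: "f p :. K" for p by (rule free_space_closed[OF f])
  have "flin Z \<phi> (a *\<^sub>?F f) = (\<Oplus>\<^bsub>Z\<^esub> p \<in> ?s f. (a *\<^sub>?F f) p *\<^sub>Z \<phi> p)"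
   by (rule flin_superset[OF Z af T(1) _ T(2) phi]) (use a in auto)
  also have "\<dots> = (\<Oplus>\<^bsub>Z\<^esub> p \<in> ?s f. a *\<^sub>Z (f p *\<^sub>Z \<phi> p))"
   by (rule Z.M.finsum_cong') (use pT fc a in "simp_all add: Z.smult_assoc Pi_iff")
  also have "\<dots> = a *\<^sub>Z flin Z \<phi> f" unfolding flin_def
   by (rule Z.finsum_smult[symmetric]) (use pT fc a T in "simp_all add: Pi_iff")
  finally show "flin Z \<phi> (a *\<^sub>?F f) = a *\<^sub>Z flin Z \<phi> f" .
 qed
qed

lemma flin_gen:
 assumes Z: "lmod K Z" and phi: "!!p. p : S ==> \<phi> p :. Z" and p: "p : S"
 shows "flin Z \<phi> (free_gen K p) = \<phi> p"
proof -
 interpret Z: left_module K Z by fact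
 have "flin Z \<phi> (free_gen K p) = (\<Oplus>\<^bsub>Z\<^esub> q \<in> {p}. free_gen K p q *\<^sub>Z \<phi> q)"
  by (rule flin_superset[OF Z free_gen_mem[OF p] _ _ _ phi]) (use p in "auto simp: free_gen_def")
 then show ?thesis using phi[OF p] by (simp add: free_gen_def)
qed

lemma gen_free_space: "gen K (free_space K S) (free_gen K ` S)"
 unfolding gen_def
proof (intro conjI allI impI subsetI)
 show "x :. (free_space K S)" if "x : free_gen K ` S" for x
  using that by (elim imageE) (simp only: free_gen_mem)
next
 let ?F = "free_space K S"
 fix N f assume N: "submodule N K ?F" "free_gen K ` S \<subseteq> N" "f :. ?F"
 interpret F: left_module K ?F by (rule lm_free_space)
 let ?s = "{p. f p ~= \<zero>\<^sub>K}"
 have m: "finite ?s" "?s \<subseteq> S" "!!p. f p :. K" using N(3) by auto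
 have g: "f p *\<^sub>?F free_gen K p :. ?F" if "p : ?s" for p
  by (rule F.smult_closed[OF m(3) free_gen_mem]) (use that m(2) in auto)
 have "f = (\<Oplus>\<^bsub>?F\<^esub> p \<in> ?s. f p *\<^sub>?F free_gen K p)"
 proof
  fix q
  have "(\<Oplus>\<^bsub>?F\<^esub> p \<in> ?s. f p *\<^sub>?F free_gen K p) q = (\<Oplus>\<^bsub>K\<^esub> p \<in> ?s. (f p *\<^sub>?F free_gen K p) q)"
  proof (rule finsum_additive[OF F.M.abelian_group_axioms abelian_group_axioms, of "%h. h q"])
   show "h q :. K" if "h :. ?F" for h using that by (rule free_space_closed)
   show "(%p. f p *\<^sub>?F free_gen K p) : ?s \<rightarrow> car ?F" using g by (rule funcsetI)
  qed simp
  also have "\<dots> = (\<Oplus>\<^bsub>K\<^esub> p \<in> ?s. if q = p then f p else \<zero>\<^sub>K)"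
   using m(3) by (intro finsum_cong') (auto simp: free_gen_def)
  also have "\<dots> = f q"
  proof (cases "q : ?s")
   case True then show ?thesis using m by (intro finsum_singleton) auto
  next
   case False
   then have "(\<Oplus>\<^bsub>K\<^esub> p \<in> ?s. if q = p then f p else \<zero>\<^sub>K) = (\<Oplus>\<^bsub>K\<^esub> p \<in> ?s. \<zero>\<^sub>K)"
    by (intro finsum_cong') auto
   then show ?thesis using False by simp
  qed
  finally show "f q = (\<Oplus>\<^bsub>?F\<^esub> p \<in> ?s. f p *\<^sub>?F free_gen K p) q" ..
 qed
 moreover have "(\<Oplus>\<^bsub>?F\<^esub> p \<in> ?s. f p *\<^sub>?F free_gen K p) : N"
 proof (rule F.submod_finsum[OF N(1)], rule funcsetI)
  fix p assume "p : ?s"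
  then have "free_gen K p : N" using N(2) m(2) by blast
  then show "f p *\<^sub>?F free_gen K p : N" by (rule F.submod_smult[OF N(1) m(3)])
 qed
 ultimately show "f : N" by simp
qed

end

context fd_algebra
begin

definition balanced ::
 "('b, 'x) module \<Rightarrow> ('b, 'y) module \<Rightarrow> ('a, 'z) module \<Rightarrow> ('x \<Rightarrow> 'y \<Rightarrow> 'z) \<Rightarrow> bool" where
 "balanced X Y Z \<beta> \<longleftrightarrow>
  (ALL x : car X. ALL y : car Y. \<beta> x y :. Z) &
  (ALL x : car X. ALL x' : car X. ALL y : car Y. \<beta> (x \<oplus>\<^sub>X x') y = \<beta> x y \<oplus>\<^sub>Z \<beta> x' y) &
  (ALL x : car X. ALL y : car Y. ALL y' : car Y. \<beta> x (y \<oplus>\<^sub>Y y') = \<beta> x y \<oplus>\<^sub>Z \<beta> x y') &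
  (ALL a : car A. ALL x : car X. ALL y : car Y. \<beta> (a *\<^sub>X x) y = \<beta> x (a *\<^sub>Y y)) &
  (ALL c : car K. ALL x : car X. ALL y : car Y. \<beta> (unit_map c *\<^sub>X x) y = c *\<^sub>Z \<beta> x y)"

lemma balancedD:
 assumes "balanced X Y Z \<beta>"
 shows "[|x :. X; y :. Y|] ==> \<beta> x y :. Z"
  "[|x :. X; x' :. X; y :. Y|] ==> \<beta> (x \<oplus>\<^sub>X x') y = \<beta> x y \<oplus>\<^sub>Z \<beta> x' y"
  "[|x :. X; y :. Y; y' :. Y|] ==> \<beta> x (y \<oplus>\<^sub>Y y') = \<beta> x y \<oplus>\<^sub>Z \<beta> x y'"
  "[|a :. A; x :. X; y :. Y|] ==> \<beta> (a *\<^sub>X x) y = \<beta> x (a *\<^sub>Y y)"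
  "[|c :. K; x :. X; y :. Y|] ==> \<beta> (unit_map c *\<^sub>X x) y = c *\<^sub>Z \<beta> x y"
 using assms unfolding balanced_def by blast+

context
 fixes X :: "('b, 'x) module" and Y :: "('b, 'y) module"
 assumes X: "lmod (opp A) X" and Y: "lmod A Y"
begin

interpretation op: fd_algebra K "opp A" by (rule fd_algebra_opp)
interpretation X: left_module "opp A" X by (rule X)
interpretation Y: left_module A Y by (rule Y)

abbreviation "TF \<equiv> free_space K (car X \<times> car Y)"
abbreviation "TR \<equiv> tensor_rel K A X Y"
abbreviation "TT \<equiv> tensor K A X Y"
abbreviation "tn \<equiv> tens K A X Y"

interpretation TF: left_module K TF by (rule lm_free_space)

text \<open>The submodules over which \<open>tensor_rel\<close> intersects; \<open>TR\<close> is the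
  least of them.\<close>

definition trel where
 "trel N \<longleftrightarrow> submodule N K TF &
    (ALL x : car X. ALL x' : car X. ALL y : car Y.
     free_gen K (x \<oplus>\<^sub>X x', y) \<ominus>\<^sub>TF (free_gen K (x, y) \<oplus>\<^sub>TF free_gen K (x', y)) : N) &
    (ALL x : car X. ALL y : car Y. ALL y' : car Y.
     free_gen K (x, y \<oplus>\<^sub>Y y') \<ominus>\<^sub>TF (free_gen K (x, y) \<oplus>\<^sub>TF free_gen K (x, y')) : N) &
    (ALL a : car A. ALL x : car X. ALL y : car Y.
     free_gen K (a *\<^sub>X x, y) \<ominus>\<^sub>TF free_gen K (x, a *\<^sub>Y y) : N) &
    (ALL c : car K. ALL x : car X. ALL y : car Y.
     free_gen K (unit_map c *\<^sub>X x, y) \<ominus>\<^sub>TF (c *\<^sub>TF free_gen K (x, y)) : N)"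

lemma tensor_rel_eq: "TR = \<Inter>{N. trel N}"
 by (simp add: tensor_rel_def Let_def trel_def unit_map_def del: free_space_sel)

lemma g: "[|x :. X; y :. Y|] ==> free_gen K (x, y) :. TF"
 by (rule free_gen_mem) simp

lemma ucl: "[|c :. K; x :. X|] ==> unit_map c *\<^sub>X x :. X"
 using X.smult_closed[of "unit_map c" x] by simp

lemma acl: "[|a :. A; x :. X|] ==> a *\<^sub>X x :. X"
 using X.smult_closed[of a x] by simp

lemma trel_carrier: "trel (car TF)"
 unfolding trel_def
 by (intro conjI ballI TF.submodule_carrier TF.M.minus_closed TF.M.add.m_closed TF.smult_closed g
   X.M.add.m_closed Y.M.add.m_closed ucl acl Y.smult_closed)

lemma submodule_TR: "submodule TR K TF"
 unfolding tensor_rel_eq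
 by (rule TF.submodule_Inter) (use trel_carrier in "auto simp: trel_def simp del: free_space_sel")

lemma trel_TR: "trel TR"
 unfolding trel_def
proof (intro conjI ballI submodule_TR)
qed (auto simp: tensor_rel_eq trel_def simp del: free_space_sel)

interpretation q: submod_of K TF TR by (rule submod_ofI[OF lm_free_space submodule_TR])

lemma lm_tensor: "lmod K TT" unfolding tensor_def by (rule q.left_module_quot)

lemma tens_closed: "[|x :. X; y :. Y|] ==> tn x y :. TT"
 unfolding tensor_def tens_def by (rule q.cos_closed[OF g])

lemma tens_add_left:
 assumes "x :. X" "x' :. X" "y :. Y"
 shows "tn (x \<oplus>\<^sub>X x') y = tn x y \<oplus>\<^sub>TT tn x' y"
proof -
 have "tn (x \<oplus>\<^sub>X x') y = TR +>\<^sub>TF (free_gen K (x, y) \<oplus>\<^sub>TF free_gen K (x', y))"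
  unfolding tens_def
  using q.cos_eq[OF g TF.M.add.m_closed[OF g g], of "x \<oplus>\<^sub>X x'" y x y x' y] trel_TR[unfolded trel_def] assms
   X.M.add.m_closed by blast
 also have "\<dots> = tn x y \<oplus>\<^sub>TT tn x' y"
  unfolding tensor_def tens_def by (rule q.quot_add[OF g g, symmetric]) (use assms in auto)
 finally show ?thesis .
qed

lemma tens_add_right:
 assumes "x :. X" "y :. Y" "y' :. Y"
 shows "tn x (y \<oplus>\<^sub>Y y') = tn x y \<oplus>\<^sub>TT tn x y'"
proof -
 have "tn x (y \<oplus>\<^sub>Y y') = TR +>\<^sub>TF (free_gen K (x, y) \<oplus>\<^sub>TF free_gen K (x, y'))"
  unfolding tens_def
  using q.cos_eq[OF g TF.M.add.m_closed[OF g g], of x "y \<oplus>\<^sub>Y y'" x y x y'] trel_TR[unfolded trel_def] assms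
   Y.M.add.m_closed by blast
 also have "\<dots> = tn x y \<oplus>\<^sub>TT tn x y'"
  unfolding tensor_def tens_def by (rule q.quot_add[OF g g, symmetric]) (use assms in auto)
 finally show ?thesis .
qed

lemma tens_balanced:
 assumes "a :. A" "x :. X" "y :. Y"
 shows "tn (a *\<^sub>X x) y = tn x (a *\<^sub>Y y)"
 unfolding tens_def
 using q.cos_eq[OF g g, of "a *\<^sub>X x" y x "a *\<^sub>Y y"] trel_TR[unfolded trel_def] assms acl Y.smult_closed by blast

lemma tens_scal:
 assumes "c :. K" "x :. X" "y :. Y"
 shows "tn (unit_map c *\<^sub>X x) y = c *\<^sub>TT tn x y"
proof -
 have "tn (unit_map c *\<^sub>X x) y = TR +>\<^sub>TF (c *\<^sub>TF free_gen K (x, y))"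
  unfolding tens_def
  using q.cos_eq[OF g TF.smult_closed[OF assms(1) g], of "unit_map c *\<^sub>X x" y x y] trel_TR[unfolded trel_def] assms
   ucl by blast
 also have "\<dots> = c *\<^sub>TT tn x y"
  unfolding tensor_def tens_def by (rule q.quot_smult[OF assms(1) g, symmetric]) (use assms in auto)
 finally show ?thesis .
qed

text \<open>For balanced \<beta> the kernel of its linear extension satisfies \<open>trel\<close>,
  hence contains \<open>TR\<close>. So the extension is constant on each coset, its image there is a
  singleton, and \<open>the_elem\<close> returns the intended value.\<close>

lemma tensor_lift_hom:
 assumes Z: "lmod K Z" and b: "balanced X Y Z \<beta>"
 shows "(\<lambda>C\<in>car TT. tensor_lift K Z \<beta> C) : mhom K TT Z"
  and "[|x :. X; y :. Y|] ==> tensor_lift K Z \<beta> (tn x y) = \<beta> x y"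
proof -
 interpret Z: left_module K Z by fact
 let ?p = "%p. \<beta> (fst p) (snd p)"
 note bd = balancedD[OF b]
 have pc: "?p p :. Z" if "p : car X \<times> car Y" for p using bd(1) that by auto
 let ?l = "\<lambda>f\<in>car TF. flin Z ?p f"
 have l: "?l : mhom K TF Z" by (rule flin_hom[OF Z pc])
 interpret l: mod_hom K TF Z ?l by (rule mod_homI[OF lm_free_space Z l])
 have lg: "?l (free_gen K (x, y)) = \<beta> x y" if "x :. X" "y :. Y" for x y
  using flin_gen[where p = "(x, y)", OF Z pc] g[OF that] that by (simp del: free_space_sel)
 have lcos: "?l f = \<zero>\<^sub>Z" if "f : TR" for f
 proof -
  have z: "u \<ominus>\<^sub>Z u = \<zero>\<^sub>Z" if "u :. Z" for u using Z.diff_eq_zero_iff that by blast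
  note cl = g TF.M.add.m_closed X.M.add.m_closed Y.M.add.m_closed ucl acl Y.smult_closed TF.smult_closed TF.M.minus_closed
  have "trel (mker TF Z ?l)"
   unfolding trel_def
  proof (intro conjI ballI l.submodule_ker)
   fix x x' y assume h: "x :. X" "x' :. X" "y :. Y"
   let ?w = "free_gen K (x \<oplus>\<^sub>X x', y) \<ominus>\<^sub>TF (free_gen K (x, y) \<oplus>\<^sub>TF free_gen K (x', y))"
   have "?l ?w = \<beta> (x \<oplus>\<^sub>X x') y \<ominus>\<^sub>Z (\<beta> x y \<oplus>\<^sub>Z \<beta> x' y)"
    using h cl lg by (simp only: l.diff l.add)
   then show "?w : mker TF Z ?l" using h cl bd z by (simp add: mker_def del: free_space_sel)
  next
   fix x y y' assume h: "x :. X" "y :. Y" "y' :. Y"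
   let ?w = "free_gen K (x, y \<oplus>\<^sub>Y y') \<ominus>\<^sub>TF (free_gen K (x, y) \<oplus>\<^sub>TF free_gen K (x, y'))"
   have "?l ?w = \<beta> x (y \<oplus>\<^sub>Y y') \<ominus>\<^sub>Z (\<beta> x y \<oplus>\<^sub>Z \<beta> x y')"
    using h cl lg by (simp only: l.diff l.add)
   then show "?w : mker TF Z ?l" using h cl bd z by (simp add: mker_def del: free_space_sel)
  next
   fix a x y assume h: "a :. A" "x :. X" "y :. Y"
   let ?w = "free_gen K (a *\<^sub>X x, y) \<ominus>\<^sub>TF free_gen K (x, a *\<^sub>Y y)"
   have "?l ?w = \<beta> (a *\<^sub>X x) y \<ominus>\<^sub>Z \<beta> x (a *\<^sub>Y y)"
    using h cl lg by (simp only: l.diff)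
   then show "?w : mker TF Z ?l" using h cl bd z by (simp add: mker_def del: free_space_sel)
  next
   fix c x y assume h: "c :. K" "x :. X" "y :. Y"
   let ?w = "free_gen K (unit_map c *\<^sub>X x, y) \<ominus>\<^sub>TF (c *\<^sub>TF free_gen K (x, y))"
   have "?l ?w = \<beta> (unit_map c *\<^sub>X x) y \<ominus>\<^sub>Z c *\<^sub>Z \<beta> x y"
    using h cl lg by (simp only: l.diff l.smult)
   then show "?w : mker TF Z ?l" using h cl bd z by (simp add: mker_def del: free_space_sel)
  qed
  then have "f : mker TF Z ?l" using \<open>f : TR\<close> unfolding tensor_rel_eq by blast
  then show ?thesis unfolding mker_def by (rule CollectE) (rule conjunct2)
 qed
 obtain k where k: "k : mhom K (quot TF TR) Z" "ALL f : car TF. k (TR +>\<^sub>TF f) = ?l f"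
  using q.quot_lift[OF Z l lcos] by blast
 have tl: "tensor_lift K Z \<beta> C = k C" if C: "C :. TT" for C
 proof -
  obtain f where f: "f :. TF" "C = TR +>\<^sub>TF f" using C unfolding tensor_def by (rule q.quotE)
  have "flin Z ?p h = k C" if "h : C" for h
  proof -
   have "h :. TF" "TR +>\<^sub>TF h = C" using q.cos_mem[OF f(1)] that f(2) by auto
   then show ?thesis using k(2) by (metis (no_types, lifting) restrict_apply')
  qed
  moreover have "f : C" using q.cos_self[OF f(1)] f(2) by simp
  ultimately have "flin Z ?p ` C = {k C}" by (auto simp: image_iff intro: bexI[of _ f])
  then show ?thesis unfolding tensor_lift_def flin_def by simp
 qed
 have "(\<lambda>C\<in>car TT. tensor_lift K Z \<beta> C) = k"
  using tl mhom_ext[OF k(1)] by (auto simp: tensor_def intro!: extensionalityI[of _ "car (quot TF TR)"])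
 then show "(\<lambda>C\<in>car TT. tensor_lift K Z \<beta> C) : mhom K TT Z" using k(1) by (simp add: tensor_def)
 show "tensor_lift K Z \<beta> (tn x y) = \<beta> x y" if "x :. X" "y :. Y"
  using tl[OF tens_closed[OF that]] k(2) g[OF that] lg[OF that] unfolding tens_def by simp
qed

lemma gen_tensor: "gen K TT ((%(x, y). tn x y) ` (car X \<times> car Y))"
proof -
 have "gen K (quot TF TR) ((\<lambda>f\<in>car TF. TR +>\<^sub>TF f) ` (free_gen K ` (car X \<times> car Y)))"
  by (rule gen_image[OF lm_free_space q.left_module_quot q.quot_proj _ gen_free_space]) (auto simp: quot_carrier)
 moreover have "(\<lambda>f\<in>car TF. TR +>\<^sub>TF f) ` (free_gen K ` (car X \<times> car Y)) =
   (%(x, y). tn x y) ` (car X \<times> car Y)"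
  unfolding image_image by (rule image_cong) (use g in "auto simp: tens_def simp del: free_space_sel")
 ultimately show ?thesis by (simp add: tensor_def)
qed

lemma tensor_induct:
 assumes N: "submodule N K TT" and "!!x y. [|x :. X; y :. Y|] ==> tn x y : N" and "C :. TT"
 shows "C : N"
 by (rule genD[OF gen_tensor N _ assms(3)]) (use assms(2) in auto)

lemma tensor_hom_eq:
 assumes Z: "lmod K Z" and "f : mhom K TT Z" "f' : mhom K TT Z"
  and "!!x y. [|x :. X; y :. Y|] ==> f (tn x y) = f' (tn x y)" and "C :. TT"
 shows "f C = f' C"
 by (rule gen_hom_eq[OF lm_tensor Z assms(2,3) gen_tensor _ assms(5)]) (use assms(4) in auto)

lemma tens_left_hom:
 assumes y: "y :. Y"
 shows "(\<lambda>x\<in>car X. tn x y) : mhom K (scal (opp A) X) TT"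
proof -
 have "(\<lambda>x\<in>car (scal (opp A) X). tn x y) : mhom K (scal (opp A) X) TT"
  by (rule mhom_restrictI[OF op.lm_scal[OF X]])
   (use y tens_closed tens_add_left tens_scal in "auto simp flip: unit_map_def")
 then show ?thesis by simp
qed

lemma tens_right_hom:
 assumes x: "x :. X"
 shows "(\<lambda>y\<in>car Y. tn x y) : mhom K (scal A Y) TT"
proof -
 have "(\<lambda>y\<in>car (scal A Y). tn x y) : mhom K (scal A Y) TT"
  by (rule mhom_restrictI[OF lm_scal[OF Y]])
   (use x tens_closed tens_add_right tens_scal tens_balanced in "auto simp flip: unit_map_def")
 then show ?thesis by simp
qed

lemma fin_dim_tensor:
 assumes fX: "fin_dim K (scal (opp A) X)" and fY: "fin_dim K (scal A Y)"
 shows "fin_dim K TT"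
proof -
 interpret T: left_module K TT by (rule lm_tensor)
 obtain B where B: "finite B" "gen K (scal (opp A) X) B" using fin_dimE[OF fX] by metis
 obtain C where C: "finite C" "gen K (scal A Y) C" using fin_dimE[OF fY] by metis
 have BX: "B \<subseteq> car X" and CY: "C \<subseteq> car Y" using gen_sub[OF B(2)] gen_sub[OF C(2)] by auto
 let ?G = "(%(x, y). tn x y) ` (B \<times> C)"
 have "gen K TT ?G" unfolding gen_def
 proof (intro conjI allI impI subsetI)
  show "x :. TT" if "x : ?G" for x using that tens_closed BX CY by auto
 next
  fix N D assume N: "submodule N K TT" "?G \<subseteq> N" "D :. TT"
  have 1: "tn b y : N" if b: "b : B" and y: "y :. Y" for b y
  proof -
   have bX: "b :. X" using b BX by blast
   interpret t: mod_hom K "scal A Y" TT "\<lambda>y\<in>car Y. tn b y"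
    by (rule mod_homI[OF lm_scal[OF Y] lm_tensor tens_right_hom[OF bX]])
   have "C \<subseteq> {y : car (scal A Y). (\<lambda>y\<in>car Y. tn b y) y : N}" using N(2) b CY by auto
   from genD[OF C(2) t.submodule_vimage[OF N(1)] this] show ?thesis using y by auto
  qed
  have "tn x y : N" if x: "x :. X" and y: "y :. Y" for x y
  proof -
   interpret t: mod_hom K "scal (opp A) X" TT "\<lambda>x\<in>car X. tn x y"
    by (rule mod_homI[OF op.lm_scal[OF X] lm_tensor tens_left_hom[OF y]])
   have "B \<subseteq> {x : car (scal (opp A) X). (\<lambda>x\<in>car X. tn x y) x : N}" using 1[OF _ y] BX by auto
   from genD[OF B(2) t.submodule_vimage[OF N(1)] this] show ?thesis using x by auto
  qed
  then show "D : N" by (rule tensor_induct[OF N(1) _ N(3)])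
 qed
 then show ?thesis using B(1) C(1) by (intro fin_dimI[OF lm_tensor]) auto
qed

end

text \<open>The assumptions concern the restrictions, since identities enter \<open>Tor_diff\<close>
  and \<open>Tor_map\<close> as bare functions that are not extensional.\<close>

lemma tensor_map_hom:
 assumes X: "lmod (opp A) X" and Y: "lmod A Y" and X': "lmod (opp A) X'" and Y': "lmod A Y'"
  and f: "restrict f (car X) : mhom (opp A) X X'" and h: "restrict h (car Y) : mhom A Y Y'"
 shows "(\<lambda>C\<in>car (tensor K A X Y). tensor_map K A X' Y' f h C) : mhom K (tensor K A X Y) (tensor K A X' Y')"
  and "[|x :. X; y :. Y|] ==> tensor_map K A X' Y' f h (tens K A X Y x y) = tens K A X' Y' (f x) (h y)"
proof -
 have b: "balanced X Y (tensor K A X' Y') (%x y. tens K A X' Y' (f x) (h y))"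
  unfolding balanced_def
  using mhom_closed[OF f] mhom_closed[OF h] mhom_add[OF f] mhom_add[OF h] mhom_smult[OF f] mhom_smult[OF h]
   left_module.smult_closed[OF X] left_module.smult_closed[OF Y]
   abelian_monoid.a_closed[OF abelian_group.axioms(1)[OF left_module_group[OF X]]]
   abelian_monoid.a_closed[OF abelian_group.axioms(1)[OF left_module_group[OF Y]]]
   tens_closed[OF X' Y'] tens_add_left[OF X' Y'] tens_add_right[OF X' Y'] tens_balanced[OF X' Y'] tens_scal[OF X' Y']
  by simp
 show "(\<lambda>C\<in>car (tensor K A X Y). tensor_map K A X' Y' f h C) : mhom K (tensor K A X Y) (tensor K A X' Y')"
  unfolding tensor_map_def by (rule tensor_lift_hom(1)[OF X Y lm_tensor[OF X' Y'] b])
 show "[|x :. X; y :. Y|] ==> tensor_map K A X' Y' f h (tens K A X Y x y) = tens K A X' Y' (f x) (h y)"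
  unfolding tensor_map_def by (rule tensor_lift_hom(2)[OF X Y lm_tensor[OF X' Y'] b])
qed

end


lemma restrict_mhom: "f : mhom R M N ==> restrict f (car M) = f"
 by (simp add: extensional_restrict mhom_ext)

context fd_algebra
begin

lemma lm_dual_opp: "lmod (opp A) X ==> lmod A (dual K (opp A) X)"
 using fd_algebra.lm_dual[OF fd_algebra_opp, of X] by simp

lemma fdm_dual_opp: "fd_module K (opp A) X ==> fd_module K A (dual K (opp A) X)"
 using fd_algebra.fdm_dual[OF fd_algebra_opp, of X] by simp

subsection \<open>Duality between tensor products and homomorphisms\<close>

text \<open>The adjunction between homomorphisms from \<open>Y\<close> to the dual of
  \<open>X\<close> and functionals on the tensor product of \<open>X\<close> and \<open>Y\<close>,
  from left to right.\<close>

definition ev :: "('b, 'y) module \<Rightarrow> ('y \<Rightarrow> 'x \<Rightarrow> 'a) \<Rightarrow> ('x \<times> 'y \<Rightarrow> 'a) set \<Rightarrow> 'a" where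
 "ev Y h = tensor_lift K (reg K) (%x p. h p x)"

context
 fixes X :: "('b, 'x) module" and Y :: "('b, 'y) module"
 assumes X: "lmod (opp A) X" and Y: "lmod A Y"
begin

interpretation op: fd_algebra K "opp A" by (rule fd_algebra_opp)
interpretation X: left_module "opp A" X by (rule X)
interpretation Y: left_module A Y by (rule Y)

lemma ev_balanced:
 assumes h: "h : mhom A Y (dual K (opp A) X)"
 shows "balanced X Y (reg K) (%x p. h p x)"
proof -
 have m: "h p : mhom K (scal (opp A) X) (reg K)" if "p :. Y" for p
  using mhom_closed[OF h that] by simp
 show ?thesis unfolding balanced_def
  using mhom_closed[OF m] mhom_add[OF m] mhom_add[OF h] mhom_smult[OF h] op.scal_mhom_smult[OF X m]
  by (simp add: op.unit_map_def unit_map_def)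
qed

lemma ev_hom:
 assumes h: "h : mhom A Y (dual K (opp A) X)"
 shows "(\<lambda>C\<in>car (tensor K A X Y). ev Y h C) : mhom K (tensor K A X Y) (reg K)"
  "[|x :. X; y :. Y|] ==> ev Y h (tens K A X Y x y) = h y x"
 unfolding ev_def by (rule tensor_lift_hom[OF X Y lm_reg ev_balanced[OF h]])+

text \<open>Currying: \<open>h p\<close> is the functional
  \<open>x \<mapsto> l (x \<otimes> p)\<close>, and it agrees with \<open>l\<close> on pure tensors,
  which generate.\<close>

lemma ev_surj:
 assumes l: "l : mhom K (tensor K A X Y) (reg K)"
 shows "EX h : mhom A Y (dual K (opp A) X). ALL C : car (tensor K A X Y). ev Y h C = l C"
proof -
 let ?D = "dual K (opp A) X"
 let ?h = "\<lambda>p\<in>car Y. \<lambda>x\<in>car X. l (tens K A X Y x p)"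
 note T = lm_tensor[OF X Y]
 interpret l: mod_hom K "tensor K A X Y" "reg K" l by (rule mod_homI[OF T lm_reg l])
 have hp: "(\<lambda>x\<in>car X. l (tens K A X Y x p)) :. ?D" if p: "p :. Y" for p
 proof -
  have "compose (car (scal (opp A) X)) l (\<lambda>x\<in>car X. tens K A X Y x p) : mhom K (scal (opp A) X) (reg K)"
   by (rule mhom_compose[OF op.lm_scal[OF X] tens_left_hom[OF X Y p] l])
  moreover have "compose (car (scal (opp A) X)) l (\<lambda>x\<in>car X. tens K A X Y x p) =
    (\<lambda>x\<in>car X. l (tens K A X Y x p))" by (auto simp: compose_def intro!: restrict_ext)
  ultimately show ?thesis by simp
 qed
 have h: "?h : mhom A Y ?D"
 proof (rule mhom_restrictI[OF Y])
  show "(\<lambda>x\<in>car X. l (tens K A X Y x p)) :. ?D" if "p :. Y" for p by (rule hp[OF that])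
  show "(\<lambda>x\<in>car X. l (tens K A X Y x (p \<oplus>\<^sub>Y q))) =
    (\<lambda>x\<in>car X. l (tens K A X Y x p)) \<oplus>\<^sub>?D (\<lambda>x\<in>car X. l (tens K A X Y x q))"
   if "p :. Y" "q :. Y" for p q
   using that tens_closed[OF X Y] tens_add_right[OF X Y] by (auto intro!: restrict_ext)
  show "(\<lambda>x\<in>car X. l (tens K A X Y x (a *\<^sub>Y p))) = a *\<^sub>?D (\<lambda>x\<in>car X. l (tens K A X Y x p))"
   if "a :. A" "p :. Y" for a p
   using that tens_balanced[OF X Y] X.smult_closed by (auto intro!: restrict_ext)
 qed
 have "ev Y ?h C = l C" if C: "C :. (tensor K A X Y)" for C
  using tensor_hom_eq[OF X Y lm_reg ev_hom(1)[OF h] l _ C] ev_hom(2)[OF h] C tens_closed[OF X Y] by simp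
 then show ?thesis using h by blast
qed

lemma ev_linear:
 assumes C: "C :. (tensor K A X Y)"
 shows "(\<lambda>h\<in>mhom A Y (dual K (opp A) X). ev Y h C) : mhom K (Hom_space A Y (dual K (opp A) X)) (reg K)"
proof -
 let ?D = "dual K (opp A) X" and ?T = "tensor K A X Y"
 let ?H = "Hom_space A Y ?D"
 note D = lm_dual_opp[OF X] and T = lm_tensor[OF X Y]
 note H = lm_Hom_space[OF Y D]
 interpret H: left_module K ?H by (rule H)
 have "(\<lambda>h\<in>car ?H. ev Y h C) : mhom K ?H (reg K)"
 proof (rule mhom_restrictI[OF H])
  show "ev Y h C :. (reg K)" if "h :. ?H" for h
   using mhom_closed[OF ev_hom(1) C, of h] that C by simp
  fix h h' assume hh: "h :. ?H" "h' :. ?H"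
  then have m: "h : mhom A Y ?D" "h' : mhom A Y ?D" by simp_all
  have s: "h \<oplus>\<^sub>?H h' : mhom A Y ?D" using H.M.add.m_closed[OF hh] by simp
  have "(\<lambda>C\<in>car ?T. ev Y (h \<oplus>\<^sub>?H h') C) C =
    (\<lambda>C\<in>car ?T. (\<lambda>C\<in>car ?T. ev Y h C) C \<oplus>\<^bsub>reg K\<^esub> (\<lambda>C\<in>car ?T. ev Y h' C) C) C"
   by (rule tensor_hom_eq[OF X Y lm_reg ev_hom(1)[OF s] mhom_plus[OF T lm_reg ev_hom(1)[OF m(1)] ev_hom(1)[OF m(2)]] _ C])
    (use ev_hom(2)[OF s] ev_hom(2)[OF m(1)] ev_hom(2)[OF m(2)] tens_closed[OF X Y] in simp)
  then show "ev Y (h \<oplus>\<^sub>?H h') C = ev Y h C \<oplus>\<^bsub>reg K\<^esub> ev Y h' C" using C by simp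
 next
  fix c h assume c: "c :. K" and "h :. ?H"
  then have m: "h : mhom A Y ?D" by simp
  have s: "c *\<^sub>?H h : mhom A Y ?D" using H.smult_closed[OF c, of h] m by simp
  interpret k: left_module K "reg K" by (rule lm_reg)
  interpret e: mod_hom K ?T "reg K" "\<lambda>C\<in>car ?T. ev Y h C" by (rule mod_homI[OF T lm_reg ev_hom(1)[OF m]])
  have r: "(\<lambda>C\<in>car ?T. c \<otimes>\<^sub>K (\<lambda>C\<in>car ?T. ev Y h C) C) : mhom K ?T (reg K)"
  proof (rule mhom_restrictI[OF T])
   fix b C assume "b :. K" "C :. ?T"
   then show "c \<otimes>\<^sub>K (\<lambda>C\<in>car ?T. ev Y h C) (b *\<^sub>?T C) = b \<odot>\<^bsub>reg K\<^esub> (c \<otimes>\<^sub>K (\<lambda>C\<in>car ?T. ev Y h C) C)"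
    using c e.smult[of b C] e.closed[of C] by (simp add: K.m_lcomm del: e.smult)
  qed (use c e.closed e.add in "simp_all add: K.r_distr del: restrict_apply")
  have "(\<lambda>C\<in>car ?T. ev Y (c *\<^sub>?H h) C) C = (\<lambda>C\<in>car ?T. c \<otimes>\<^sub>K (\<lambda>C\<in>car ?T. ev Y h C) C) C"
  proof (rule tensor_hom_eq[OF X Y lm_reg ev_hom(1)[OF s] r _ C])
   fix x y assume xy: "x :. X" "y :. Y"
   have hy: "h y : mhom K (scal (opp A) X) (reg K)" using mhom_closed[OF m xy(2)] by simp
   have "(c *\<^sub>?H h) y x = c \<otimes>\<^sub>K h y x"
    using xy op.scal_mhom_smult[OF X hy c xy(1)] by (simp add: op.unit_map_def)
   then show "(\<lambda>C\<in>car ?T. ev Y (c *\<^sub>?H h) C) (tens K A X Y x y) =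
     (\<lambda>C\<in>car ?T. c \<otimes>\<^sub>K (\<lambda>C\<in>car ?T. ev Y h C) C) (tens K A X Y x y)"
    using ev_hom(2)[OF s xy] ev_hom(2)[OF m xy] tens_closed[OF X Y xy] by simp
  qed
  then show "ev Y (c *\<^sub>?H h) C = c \<odot>\<^bsub>reg K\<^esub> ev Y h C" using C by simp
 qed
 then show ?thesis by simp
qed

end

lemma ev_map_right:
 assumes X: "lmod (opp A) X" and Y: "lmod A Y" and Y': "lmod A Y'"
  and g: "g : mhom A Y Y'" and h: "h : mhom A Y' (dual K (opp A) X)" and C: "C :. (tensor K A X Y)"
 shows "ev Y' h (tensor_map K A X Y' (%x. x) g C) = ev Y (compose (car Y) h g) C"
proof -
 have i: "restrict (%x. x) (car X) : mhom (opp A) X X" by (rule mhom_id[OF X])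
 have g': "restrict g (car Y) : mhom A Y Y'" using g by (simp add: restrict_mhom)
 note t = tensor_map_hom[OF X Y X Y' i g']
 note hg = mhom_compose[OF Y g h]
 let ?T = "tensor K A X Y" and ?T' = "tensor K A X Y'"
 have cl: "tensor_map K A X Y' (%x. x) g C :. ?T'" if "C :. ?T" for C
  using mhom_closed[OF t(1) that] that by simp
 have "compose (car ?T) (\<lambda>C\<in>car ?T'. ev Y' h C) (\<lambda>C\<in>car ?T. tensor_map K A X Y' (%x. x) g C) C =
   (\<lambda>C\<in>car ?T. ev Y (compose (car Y) h g) C) C"
  by (rule tensor_hom_eq[OF X Y lm_reg mhom_compose[OF lm_tensor[OF X Y] t(1) ev_hom(1)[OF X Y' h]] ev_hom(1)[OF X Y hg] _ C])
   (use t(2) ev_hom(2)[OF X Y' h] ev_hom(2)[OF X Y hg] tens_closed[OF X Y] tens_closed[OF X Y'] mhom_closed[OF g]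
    in "simp add: compose_eq")
 then show ?thesis using C cl by (simp add: compose_eq)
qed

text \<open>The dual of \<open>f\<close>, the inner function of \<open>tau_hom_map\<close>. It is
  left unrestricted to coincide with that definition.\<close>

definition dmap :: "('b, 'x) module \<Rightarrow> ('x \<Rightarrow> 'y) \<Rightarrow> ('y \<Rightarrow> 'a) \<Rightarrow> 'x \<Rightarrow> 'a" where
 "dmap X f = (%\<psi>. compose (car X) \<psi> f)"

lemma dmap_hom:
 assumes X: "lmod (opp A) X" and Z: "lmod (opp A) Z" and f: "f : mhom (opp A) X Z"
 shows "restrict (dmap X f) (car (dual K (opp A) Z)) : mhom A (dual K (opp A) Z) (dual K (opp A) X)"
proof -
 interpret op: fd_algebra K "opp A" by (rule fd_algebra_opp)
 have c: "compose (car X) \<psi> f : mhom K (scal (opp A) X) (reg K)" if "\<psi> : mhom K (scal (opp A) Z) (reg K)" for \<psi>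
  using mhom_compose[OF op.lm_scal[OF X] op.mhom_scal[OF f] that] by simp
 show ?thesis
  by (rule mhom_restrictI[OF lm_dual_opp[OF Z]])
   (use c mhom_closed[OF f] mhom_smult[OF f] left_module.smult_closed[OF X]
    in "auto simp: dmap_def compose_def intro!: restrict_ext")
qed

lemma ev_map_left:
 assumes X: "lmod (opp A) X" and Z: "lmod (opp A) Z" and Y: "lmod A Y"
  and f: "f : mhom (opp A) X Z" and h: "h : mhom A Y (dual K (opp A) Z)" and C: "C :. (tensor K A X Y)"
 shows "ev Y h (tensor_map K A Z Y f (%p. p) C) = ev Y (compose (car Y) (dmap X f) h) C"
proof -
 have i: "restrict (%x. x) (car Y) : mhom A Y Y" by (rule mhom_id[OF Y])
 have f': "restrict f (car X) : mhom (opp A) X Z" using f by (simp add: restrict_mhom)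
 note t = tensor_map_hom[OF X Y Z Y f' i]
 have "compose (car Y) (restrict (dmap X f) (car (dual K (opp A) Z))) h = compose (car Y) (dmap X f) h"
  using mhom_closed[OF h] by (auto simp: compose_def simp del: dual_sel intro!: restrict_ext)
 then have fh: "compose (car Y) (dmap X f) h : mhom A Y (dual K (opp A) X)"
  using mhom_compose[OF Y h dmap_hom[OF X Z f]] by simp
 let ?T = "tensor K A X Y" and ?T' = "tensor K A Z Y"
 have cl: "tensor_map K A Z Y f (%p. p) C :. ?T'" if "C :. ?T" for C
  using mhom_closed[OF t(1) that] that by simp
 have "compose (car ?T) (\<lambda>C\<in>car ?T'. ev Y h C) (\<lambda>C\<in>car ?T. tensor_map K A Z Y f (%p. p) C) C =
   (\<lambda>C\<in>car ?T. ev Y (compose (car Y) (dmap X f) h) C) C"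
  by (rule tensor_hom_eq[OF X Y lm_reg mhom_compose[OF lm_tensor[OF X Y] t(1) ev_hom(1)[OF Z Y h]] ev_hom(1)[OF X Y fh] _ C])
   (use t(2) ev_hom(2)[OF Z Y h] ev_hom(2)[OF X Y fh] tens_closed[OF X Y] tens_closed[OF Z Y] mhom_closed[OF f]
    in "simp add: compose_eq dmap_def")
 then show ?thesis using C cl by (simp add: compose_eq)
qed

end

context vs
begin

text \<open>On the image of \<open>f\<close> the functional is \<open>l\<close> composed with a
  linear section of \<open>f\<close>; it is then extended to all of \<open>W\<close>.\<close>

lemma functional_through:
 assumes V: "lmod K V" and W: "fin_dim K W" and f: "f : mhom K V W" and l: "l : mhom K V (reg K)"
  and z: "!!v. [|v :. V; f v = \<zero>\<^sub>W|] ==> l v = \<zero>\<^sub>K"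
 shows "EX m : mhom K W (reg K). ALL v : car V. m (f v) = l v"
proof -
 note W' = fin_dimD[OF W]
 interpret f: mod_hom K V W f by (rule mod_homI[OF V W' f])
 interpret l: mod_hom K V "reg K" l by (rule mod_homI[OF V lm_reg l])
 let ?I = "f ` car V"
 have I: "submodule ?I K W" by (rule f.submodule_image[OF f.M.submodule_carrier])
 note fI = fin_dim_sub[OF W I]
 have fm: "f : mhom K V (submod W ?I)" using f by (simp add: mhom_submod[OF I W'])
 obtain s where s: "s : mhom K (submod W ?I) V" "ALL w : car (submod W ?I). f (s w) = w"
  using linear_section[OF V fI fm] by auto
 obtain m where m: "m : mhom K W (reg K)" "ALL x : ?I. m x = compose (car (submod W ?I)) l s x"
  using extend_functional[OF W I mhom_compose[OF fin_dimD[OF fI] s(1) l]] by blast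
 have "m (f v) = l v" if v: "v :. V" for v
 proof -
  have sv: "s (f v) :. V" using mhom_closed[OF s(1), of "f v"] v by simp
  have "f (s (f v) \<ominus>\<^sub>V v) = \<zero>\<^sub>W"
   using sv v s(2) f.N.diff_eq_zero_iff[of "f v" "f v"] by simp
  moreover have "s (f v) \<ominus>\<^sub>V v :. V" using sv v by simp
  ultimately have "l (s (f v) \<ominus>\<^sub>V v) = \<zero>\<^sub>K" using z by blast
  then have "l (s (f v)) = l v" using sv v l.closed[OF sv] l.closed[OF v] l.N.diff_eq_zero_iff[of "l (s (f v))" "l v"] by simp
  then show ?thesis using m(2) v by (simp add: compose_eq)
 qed
 then show ?thesis using m(1) by blast
qed

end

context fd_algebra
begin

subsection \<open>Torsion groups\<close>

context
 fixes M :: "('b, 'm) module"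
 assumes M: "fd_module K A M"
begin

abbreviation "Rm \<equiv> res_mod K A M"
abbreviation "Rd \<equiv> res_diff K A M"

lemma Tor_diff_hom:
 assumes X: "lmod (opp A) X"
 shows "(\<lambda>C\<in>car (tensor K A X (Rm (Suc n))). Tor_diff K A n X M C) : 
   mhom K (tensor K A X (Rm (Suc n))) (tensor K A X (Rm n))"
  "[|x :. X; y :. (Rm (Suc n))|] ==>
   Tor_diff K A n X M (tens K A X (Rm (Suc n)) x y) = tens K A X (Rm n) x (Rd n y)"
proof -
 have i: "restrict (%x. x) (car X) : mhom (opp A) X X" by (rule mhom_id[OF X])
 have g: "restrict (Rd n) (car (Rm (Suc n))) : mhom A (Rm (Suc n)) (Rm n)"
  using res_diff_hom[OF M, of n] by (simp add: restrict_mhom)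
 note t = tensor_map_hom[OF X res_lm[OF M] X res_lm[OF M] i g]
 show "(\<lambda>C\<in>car (tensor K A X (Rm (Suc n))). Tor_diff K A n X M C) : 
   mhom K (tensor K A X (Rm (Suc n))) (tensor K A X (Rm n))"
  unfolding Tor_diff_def by (rule t(1))
 show "[|x :. X; y :. (Rm (Suc n))|] ==>
   Tor_diff K A n X M (tens K A X (Rm (Suc n)) x y) = tens K A X (Rm n) x (Rd n y)"
  unfolding Tor_diff_def by (rule t(2))
qed

lemma Tor_cycles_iff:
 "C : Tor_cycles K A (Suc n) X M \<longleftrightarrow>
  C :. (tensor K A X (Rm (Suc n))) & Tor_diff K A n X M C = \<zero>\<^bsub>tensor K A X (Rm n)\<^esub>"
 by (simp add: Tor_cycles_def Tor_chains_def mker_def)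

lemma Tor_bounds_eq: "Tor_bounds K A n X M = Tor_diff K A n X M ` car (tensor K A X (Rm (Suc n)))"
 by (simp add: Tor_bounds_def Tor_chains_def)

lemma Tor_submodules:
 assumes X: "lmod (opp A) X"
 shows "submodule (Tor_cycles K A (Suc n) X M) K (tensor K A X (Rm (Suc n)))"
  "submodule (Tor_bounds K A n X M) K (tensor K A X (Rm n))"
proof -
 interpret d: mod_hom K "tensor K A X (Rm (Suc n))" "tensor K A X (Rm n)"
  "\<lambda>C\<in>car (tensor K A X (Rm (Suc n))). Tor_diff K A n X M C"
  by (rule mod_homI[OF lm_tensor[OF X res_lm[OF M]] lm_tensor[OF X res_lm[OF M]] Tor_diff_hom(1)[OF X]])
 have "mker (tensor K A X (Rm (Suc n))) (tensor K A X (Rm n))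
   (\<lambda>C\<in>car (tensor K A X (Rm (Suc n))). Tor_diff K A n X M C) = Tor_cycles K A (Suc n) X M"
  by (auto simp: Tor_cycles_iff mker_def)
 then show "submodule (Tor_cycles K A (Suc n) X M) K (tensor K A X (Rm (Suc n)))" using d.submodule_ker by simp
 show "submodule (Tor_bounds K A n X M) K (tensor K A X (Rm n))"
  using d.submodule_image[OF d.M.submodule_carrier] by (simp add: Tor_bounds_eq)
qed

lemma Tor_diff_diff:
 assumes X: "lmod (opp A) X" and C: "C :. (tensor K A X (Rm (Suc (Suc n))))"
 shows "Tor_diff K A n X M (Tor_diff K A (Suc n) X M C) = \<zero>\<^bsub>tensor K A X (Rm n)\<^esub>"
proof -
 note lm = lm_tensor[OF X res_lm[OF M]]
 note d = Tor_diff_hom[OF X]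
 let ?T = "%n. tensor K A X (Rm n)"
 have cl: "Tor_diff K A n X M C :. (?T n)" if "C :. (?T (Suc n))" for C n
  using mhom_closed[OF d(1) that] that by simp
 have z: "tens K A X (Rm n) x \<zero>\<^bsub>Rm n\<^esub> = \<zero>\<^bsub>?T n\<^esub>" if "x :. X" for x
  using mod_hom.zero[OF mod_homI[OF lm_scal[OF res_lm[OF M, of n]] lm_tensor[OF X res_lm[OF M]]
     tens_right_hom[OF X res_lm[OF M, of n] that]]]
   left_module.submod_zero[OF res_lm[OF M] left_module.submodule_carrier[OF res_lm[OF M]], of n] by simp
 have "compose (car (?T (Suc (Suc n)))) (\<lambda>C\<in>car (?T (Suc n)). Tor_diff K A n X M C)
   (\<lambda>C\<in>car (?T (Suc (Suc n))). Tor_diff K A (Suc n) X M C) C = (\<lambda>C\<in>car (?T (Suc (Suc n))). \<zero>\<^bsub>?T n\<^esub>) C"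
  by (rule tensor_hom_eq[OF X res_lm[OF M] lm mhom_compose[OF lm d(1) d(1)] mhom_zero[OF lm lm] _ C])
   (use d(2) tens_closed[OF X res_lm[OF M]] mhom_closed[OF res_diff_hom[OF M]] res_comp[OF M] z
    in "simp add: compose_eq")
 then show ?thesis using C cl by (simp add: compose_eq)
qed

lemma Tor_bounds_sub:
 "lmod (opp A) X ==> Tor_bounds K A (Suc n) X M \<subseteq> Tor_cycles K A (Suc n) X M"
 using mhom_closed[OF Tor_diff_hom(1), of X _ "Suc n"] Tor_diff_diff[of X _ n]
 by (auto simp: Tor_bounds_eq Tor_cycles_iff)

lemma Tor_quot:
 assumes X: "lmod (opp A) X"
 shows "submod_of K (submod (tensor K A X (Rm (Suc n))) (Tor_cycles K A (Suc n) X M)) (Tor_bounds K A (Suc n) X M)"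
 by (intro submod_ofI left_module_submod submodule_submod lm_tensor X res_lm M Tor_submodules Tor_bounds_sub)

lemma Tor_eq: "Tor K A n X M = quot (submod (tensor K A X (Rm n)) (Tor_cycles K A n X M)) (Tor_bounds K A n X M)"
 by (simp add: Tor_def Tor_chains_def)

lemma tensor_map_diff:
 assumes X: "lmod (opp A) X" and Z: "lmod (opp A) Z" and f: "f : mhom (opp A) X Z"
  and C: "C :. (tensor K A X (Rm (Suc n)))"
 shows "Tor_diff K A n Z M (tensor_map K A Z (Rm (Suc n)) f (%p. p) C) =
  tensor_map K A Z (Rm n) f (%p. p) (Tor_diff K A n X M C)"
proof -
 have f': "restrict f (car X) : mhom (opp A) X Z" using f by (simp add: restrict_mhom)
 have i: "restrict (%x. x) (car (Rm n)) : mhom A (Rm n) (Rm n)" for n by (rule mhom_id[OF res_lm[OF M]])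
 note t = tensor_map_hom[OF X res_lm[OF M] Z res_lm[OF M] f' i]
 note lx = lm_tensor[OF X res_lm[OF M]] and lz = lm_tensor[OF Z res_lm[OF M]]
 let ?T = "%n. tensor K A X (Rm n)" and ?S = "%n. tensor K A Z (Rm n)"
 note dx = Tor_diff_hom[OF X, where n = n] and dz = Tor_diff_hom[OF Z, where n = n]
 have cl: "tensor_map K A Z (Rm n) f (%p. p) C :. (?S n)" if "C :. (?T n)" for C n
  using mhom_closed[OF t(1) that] that by simp
 have dc: "Tor_diff K A n X M C :. (?T n)" if "C :. (?T (Suc n))" for C
  using mhom_closed[OF dx(1) that] that by simp
 have "compose (car (?T (Suc n))) (\<lambda>C\<in>car (?S (Suc n)). Tor_diff K A n Z M C)
   (\<lambda>C\<in>car (?T (Suc n)). tensor_map K A Z (Rm (Suc n)) f (%p. p) C) C =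
  compose (car (?T (Suc n))) (\<lambda>C\<in>car (?T n). tensor_map K A Z (Rm n) f (%p. p) C)
   (\<lambda>C\<in>car (?T (Suc n)). Tor_diff K A n X M C) C"
  by (rule tensor_hom_eq[OF X res_lm[OF M] lz mhom_compose[OF lx t(1) dz(1)] mhom_compose[OF lx dx(1) t(1)] _ C])
   (use t(2) dx(2) dz(2) tens_closed[OF X res_lm[OF M]] tens_closed[OF Z res_lm[OF M]] mhom_closed[OF f]
     mhom_closed[OF res_diff_hom[OF M]] in "simp add: compose_eq")
 then show ?thesis using C cl dc by (simp add: compose_eq)
qed

lemma Tor_map_cos:
 assumes X: "lmod (opp A) X" and Z: "lmod (opp A) Z" and f: "f : mhom (opp A) X Z"
  and C: "C : Tor_cycles K A (Suc n) X M"
 shows "tensor_map K A Z (Rm (Suc n)) f (%p. p) C : Tor_cycles K A (Suc n) Z M"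
  and "Tor_map K A (Suc n) Z M f (Tor_bounds K A (Suc n) X M +>\<^bsub>tensor K A X (Rm (Suc n))\<^esub> C) =
   Tor_bounds K A (Suc n) Z M +>\<^bsub>tensor K A Z (Rm (Suc n))\<^esub> tensor_map K A Z (Rm (Suc n)) f (%p. p) C"
proof -
 have f': "restrict f (car X) : mhom (opp A) X Z" using f by (simp add: restrict_mhom)
 have i: "restrict (%x. x) (car (Rm n)) : mhom A (Rm n) (Rm n)" for n by (rule mhom_id[OF res_lm[OF M]])
 note t = tensor_map_hom[OF X res_lm[OF M] Z res_lm[OF M] f' i]
 note lx = lm_tensor[OF X res_lm[OF M]] and lz = lm_tensor[OF Z res_lm[OF M]]
 let ?T = "%n. tensor K A X (Rm n)" and ?S = "%n. tensor K A Z (Rm n)"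
 let ?t = "tensor_map K A Z (Rm (Suc n)) f (%p. p)"
 have cl: "tensor_map K A Z (Rm n) f (%p. p) C :. (?S n)" if "C :. (?T n)" for C n
  using mhom_closed[OF t(1) that] that by simp
 have z: "tensor_map K A Z (Rm n) f (%p. p) \<zero>\<^bsub>?T n\<^esub> = \<zero>\<^bsub>?S n\<^esub>"
  using mod_hom.zero[OF mod_homI[OF lm_tensor[OF X res_lm[OF M, of n]] lm_tensor[OF Z res_lm[OF M, of n]] t(1)]]
   left_module.submod_zero[OF lx left_module.submodule_carrier[OF lx], of n] by simp
 have cz: "?t C : Tor_cycles K A (Suc n) Z M" if "C : Tor_cycles K A (Suc n) X M" for C
  using that cl tensor_map_diff[OF X Z f] z by (simp add: Tor_cycles_iff)
 show "?t C : Tor_cycles K A (Suc n) Z M" by (rule cz[OF C])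
 have cb: "?t C : Tor_bounds K A (Suc n) Z M" if "C : Tor_bounds K A (Suc n) X M" for C
  using that cl tensor_map_diff[OF X Z f, symmetric] by (auto simp: Tor_bounds_eq)
 have m: "C :. (?T (Suc n))" if "C : Tor_cycles K A (Suc n) X M" for C using that by (simp add: Tor_cycles_iff)
 let ?r = "restrict (\<lambda>C\<in>car (?T (Suc n)). ?t C) (Tor_cycles K A (Suc n) X M)"
 have r: "?r : mhom K (submod (?T (Suc n)) (Tor_cycles K A (Suc n) X M)) (submod (?S (Suc n)) (Tor_cycles K A (Suc n) Z M))"
  using mhom_restrict_sub[OF Tor_submodules(1)[OF X] lx t(1)] cz m
  by (auto simp: mhom_submod[OF Tor_submodules(1)[OF Z] lz])
 have "quot_map (submod (?S (Suc n)) (Tor_cycles K A (Suc n) Z M)) (Tor_bounds K A (Suc n) Z M) ?t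
   (Tor_bounds K A (Suc n) X M +>\<^bsub>submod (?T (Suc n)) (Tor_cycles K A (Suc n) X M)\<^esub> C) =
   Tor_bounds K A (Suc n) Z M +>\<^bsub>submod (?S (Suc n)) (Tor_cycles K A (Suc n) Z M)\<^esub> ?t C"
  by (rule quot_map_cos'[OF Tor_quot[OF X] Tor_quot[OF Z] r])
   (use m cb C Tor_bounds_sub[OF X] in auto)
 then show "Tor_map K A (Suc n) Z M f (Tor_bounds K A (Suc n) X M +>\<^bsub>?T (Suc n)\<^esub> C) =
   Tor_bounds K A (Suc n) Z M +>\<^bsub>?S (Suc n)\<^esub> ?t C"
  by (simp add: Tor_map_def Tor_chains_def)
qed

end

end


section \<open>Torsion groups and the translate\<close>

context dual_presentation
begin

text \<open>Pure homomorphisms recover all values of \<open>g\<close>. This uniqueness turns a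
  prescription of pairings into a function of the cycle in the comparison with Tor.\<close>

lemma pair_eqD:
 assumes X: "lmod A X" and g: "g : mhom A X tau" and g': "g' : mhom A X tau"
  and e: "!!h. h : mhom A P1 X ==> pair h g = pair h g'"
 shows "g = g'"
proof (rule mhom_eqI[OF g g'])
 fix x assume x: "x :. X"
 show "g x = g' x"
 proof (rule tau_eqI[OF mhom_closed[OF g x] mhom_closed[OF g' x]])
  fix f assume f: "f : mhom A P1 (reg A)"
  show "g x (cl f) = g' x (cl f)"
   using e[OF pure_hom[OF lmP1 X f x]] pair_pure[OF X f x g] pair_pure[OF X f x g'] by simp
 qed
qed

lemma pair_add_right:
 assumes X: "lmod A X" and h: "h : mhom A P1 X" and "g : mhom A X tau" "g' : mhom A X tau"
 shows "pair h (g \<oplus>\<^bsub>Hom_space A X tau\<^esub> g') = pair h g \<oplus>\<^sub>K pair h g'"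
proof -
 interpret W: left_module K "Hom_space A X tau" by (rule lm_Hom_space[OF X lm_tau])
 have s: "g \<oplus>\<^bsub>Hom_space A X tau\<^esub> g' :. (Hom_space A X tau)"
  by (rule W.M.add.m_closed) (use assms in simp_all)
 show ?thesis
  using mhom_add[OF pair_hom2[OF X h], of g g'] assms(3,4) s unfolding Hom_space_sel(1)
  by (metis Hom_space_sel(1) reg_sel(2) restrict_apply')
qed

lemma pair_smult_right:
 assumes X: "lmod A X" and h: "h : mhom A P1 X" and "g : mhom A X tau" "c :. K"
 shows "pair h (c \<odot>\<^bsub>Hom_space A X tau\<^esub> g) = c \<otimes>\<^sub>K pair h g"
proof -
 interpret W: left_module K "Hom_space A X tau" by (rule lm_Hom_space[OF X lm_tau])
 have s: "c \<odot>\<^bsub>Hom_space A X tau\<^esub> g :. (Hom_space A X tau)"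
  by (rule W.smult_closed) (use assms in simp_all)
 show ?thesis
  using mhom_smult[OF pair_hom2[OF X h] assms(4), of g] assms(3) s unfolding Hom_space_sel(1)
  by (metis Hom_space_sel(1) reg_sel(4) restrict_apply')
qed

end

context fd_algebra
begin

context
 fixes M :: "('b, 'm) module"
 assumes M: "fd_module K A M"
begin

abbreviation "rM \<equiv> res_mod K A M"
abbreviation "rD \<equiv> res_diff K A M"

text \<open>Both functors are quotients of the cycles: \<open>w\<close> takes the homology class,
  and \<open>u X C\<close> is the unique \<open>g\<close> whose pairing with every
  \<open>h : P1 \<rightarrow> D X\<close> is the value of \<open>h c\<close> at \<open>C\<close>
  under \<open>ev\<close>. The comparison of cochains with values in \<open>D X\<close> controls the
  kernel and the image.\<close>

lemma tor_transpose_natural: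
 fixes N :: "('b, 'n) module"
 assumes N: "fd_module K A N"
  and ce: "chain_equiv (fst (pcov K A N)) (fst (pcov K A (syzygy K A N))) (snd (pcov K A (syzygy K A N)))
   (rM m) (rM (Suc m)) (rM (Suc (Suc m))) (rD m) (rD (Suc m))"
 shows "naturally_iso K (opp A)
   (%X :: ('b, 'x) module. Hom_space A (dual K (opp A) X) (ar_translate K A N))
   (%X Y f h. compose (car (dual K (opp A) Y)) h (dmap X f))
   (%X. Tor K A (Suc m) X M) (%X Y f. Tor_map K A (Suc m) Y M f)"
proof -
 interpret op: fd_algebra K "opp A" by (rule fd_algebra_opp)
 define P0 where "P0 = fst (pcov K A N)"
 define P1 where "P1 = fst (pcov K A (syzygy K A N))"
 define p1 where "p1 = snd (pcov K A (syzygy K A N))"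
 have P0: "projective K A P0" unfolding P0_def by (rule pcovD(1)[OF N])
 have P1: "projective K A P1" unfolding P1_def by (rule pcovD(1)[OF fdm_syzygy[OF N]])
 have p1: "p1 : mhom A P1 P0" unfolding P0_def P1_def p1_def by (rule pcov_syzygy(1)[OF N])
 obtain B \<xi> where B: "finite B" "B \<subseteq> car P1" "!!b. b : B ==> \<xi> b : mhom A P1 (reg A)"
  "!!p. p :. P1 ==> p = (\<Oplus>\<^bsub>P1\<^esub> b \<in> B. \<xi> b p *\<^sub>P1 b)" by (rule dual_basis[OF P1]) blast
 interpret D: dual_presentation K A P0 P1 p1 B \<xi>
  by (intro dual_presentation.intro dual_presentation_axioms.intro fd_algebra_axioms P0 P1 p1 B)
 have tau: "ar_translate K A N = D.tau"
  unfolding D.tau_def D.T_def D.Im_def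
  by (simp add: ar_translate_def transpose_mod_def case_prod_beta P0_def P1_def p1_def)
 let ?R = "rM (Suc m)"
 obtain c where c: "c : mhom A ?R P1"
  and cc: "ALL X :: ('b, 'x \<Rightarrow> 'a) module. lmod A X -->
   (ALL h : mhom A P1 X. compose (car ?R) h c : Ext_cocycles K A (Suc m) M X &
    (compose (car ?R) h c : Ext_cobounds K A (Suc m) M X \<longleftrightarrow>
     (EX h' : mhom A P0 X. h = compose (car P1) h' p1))) &
   (ALL f : Ext_cocycles K A (Suc m) M X. EX h : mhom A P1 X.
    f \<ominus>\<^bsub>Hom_space A ?R X\<^esub> compose (car ?R) h c : Ext_cobounds K A (Suc m) M X)"
  using Ext_by_chain_equiv[OF M P0 P1 p1 ce[folded P0_def P1_def p1_def], where 'x = "'x \<Rightarrow> 'a"] by blast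
 let ?k = "%h. compose (car ?R) h c"
 let ?DX = "%X :: ('b, 'x) module. dual K (opp A) X"
 let ?T = "%n X :: ('b, 'x) module. tensor K A X (rM n)"
 let ?Z = "%X :: ('b, 'x) module. Tor_cycles K A (Suc m) X M"
 let ?B = "%X :: ('b, 'x) module. Tor_bounds K A (Suc m) X M"
 let ?V = "%X. submod (?T (Suc m) X) (?Z X)"
 let ?W = "%X :: ('b, 'x) module. Hom_space A (?DX X) D.tau"
 note lR = res_lm[OF M]
 have lx: "lmod (opp A) X" if "fd_module K (opp A) X" for X :: "('b, 'x) module" by (rule op.fdmD(1)[OF that])
 note lD = lm_dual_opp[OF lx] and fD = fdm_dual_opp
 have kz: "?k h : Ext_cocycles K A (Suc m) M (?DX X)" "?k h : mhom A ?R (?DX X)"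
  if "fd_module K (opp A) X" "h : mhom A P1 (?DX X)" for X h
  using cc lD[OF that(1)] that(2) Ext_cocycles_iff[OF M] by blast+
 have zT: "C :. (?T (Suc m) X)" "Tor_diff K A m X M C = \<zero>\<^bsub>?T m X\<^esub>" if "C : ?Z X" for C X
  using that by (simp_all add: Tor_cycles_iff[OF M])
 have ev0: "ev (rM n) f \<zero>\<^bsub>?T n X\<^esub> = \<zero>\<^sub>K"
  if "fd_module K (opp A) X" "f : mhom A (rM n) (?DX X)" for n f X
  using mod_hom.zero[OF mod_homI[OF lm_tensor[OF lx[OF that(1)] lR] lm_reg ev_hom(1)[OF lx[OF that(1)] lR that(2)]]]
   left_module.submod_zero[OF lm_tensor[OF lx[OF that(1)] lR] left_module.submodule_carrier[OF lm_tensor[OF lx[OF that(1)] lR]], of n]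
  by simp
 have evd: "ev (rM n) f (Tor_diff K A n X M C) = ev (rM (Suc n)) (compose (car (rM (Suc n))) f (rD n)) C"
  if "fd_module K (opp A) X" "f : mhom A (rM n) (?DX X)" "C :. (?T (Suc n) X)" for n f X C
  unfolding Tor_diff_def by (rule ev_map_right[OF lx[OF that(1)] lR lR res_diff_hom[OF M] that(2,3)])
 \<comment> \<open>Together with \<open>cyc0\<close>, this makes \<open>ev\<close> a pairing between
   cohomology with values in \<open>D X\<close> and homology: coboundaries vanish on cycles,
   cocycles on boundaries.\<close>
 have cob0: "ev ?R f C = \<zero>\<^sub>K"
  if X: "fd_module K (opp A) X" and f: "f : Ext_cobounds K A (Suc m) M (?DX X)" and C: "C : ?Z X" for X f C
 proof -
  obtain g where g: "g : mhom A (rM m) (?DX X)" "f = compose (car ?R) g (rD m)"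
   using f unfolding Ext_cobounds_iff[OF M] by blast
  then show ?thesis using evd[OF X g(1) zT(1)[OF C]] zT(2)[OF C] ev0[OF X g(1)] by simp
 qed
 have cyc0: "ev ?R f C = \<zero>\<^sub>K"
  if X: "fd_module K (opp A) X" and f: "f : Ext_cocycles K A (Suc m) M (?DX X)" and C: "C : ?B X" for X f C
 proof -
  obtain C' where C': "C' :. (?T (Suc (Suc m)) X)" "C = Tor_diff K A (Suc m) X M C'"
   using C by (auto simp: Tor_bounds_eq[OF M])
  have fm: "f : mhom A ?R (?DX X)" and f0: "ALL y : car (rM (Suc (Suc m))). f (rD (Suc m) y) = \<zero>\<^bsub>?DX X\<^esub>"
   using f unfolding Ext_cocycles_iff[OF M] by auto
  let ?z = "compose (car (rM (Suc (Suc m)))) f (rD (Suc m))"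
  have zm: "?z : mhom A (rM (Suc (Suc m))) (?DX X)" by (rule mhom_compose[OF lR res_diff_hom[OF M] fm])
  have "(\<lambda>C\<in>car (?T (Suc (Suc m)) X). ev (rM (Suc (Suc m))) ?z C) C' =
    (\<lambda>C\<in>car (?T (Suc (Suc m)) X). \<zero>\<^bsub>reg K\<^esub>) C'"
   by (rule tensor_hom_eq[OF lx[OF X] lR lm_reg ev_hom(1)[OF lx[OF X] lR zm]
      mhom_zero[OF lm_tensor[OF lx[OF X] lR] lm_reg] _ C'(1)])
    (use ev_hom(2)[OF lx[OF X] lR zm] tens_closed[OF lx[OF X] lR] f0 in "simp add: compose_eq")
  then show ?thesis using evd[OF X fm C'(1)] C' by simp
 qed
 define P where "P X C g \<longleftrightarrow> g : mhom A (?DX X) D.tau & (ALL h : mhom A P1 (?DX X). D.pair h g = ev ?R (?k h) C)"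
  for X C g
 \<comment> \<open>For \<open>h\<close> factoring through \<open>p1\<close> the cochain
   \<open>h c\<close> is a coboundary and vanishes on the cycle, so \<open>pair_rep\<close>
   represents the functional \<open>h \<mapsto> ev (h c) C\<close>.\<close>
 have ex: "EX g. P X C g" if X: "fd_module K (opp A) X" and C: "C : ?Z X" for X C
 proof -
  let ?H = "Hom_space A P1 (?DX X)"
  let ?l = "compose (car ?H) (\<lambda>f\<in>mhom A ?R (?DX X). ev ?R f C) (\<lambda>h\<in>mhom A P1 (?DX X). ?k h)"
  have l: "?l : mhom K ?H (reg K)"
   by (rule mhom_compose[OF lm_Hom_space[OF D.lmP1 lD[OF X]] comp_right_hom[OF D.lmP1 lR lD[OF X] c]
      ev_linear[OF lx[OF X] lR zT(1)[OF C]]])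
  have le: "?l h = ev ?R (?k h) C" if "h : mhom A P1 (?DX X)" for h
   using that kz(2)[OF X that] by (simp add: compose_eq)
  have "?l h = \<zero>\<^sub>K" if h: "h : D.ImX (?DX X)" for h
  proof -
   obtain h' where h': "h' : mhom A P0 (?DX X)" "h = compose (car P1) h' p1"
    using h by (auto simp: D.ImX_def[OF lD[OF X]])
   have hm: "h : mhom A P1 (?DX X)" unfolding h'(2) by (rule D.comp_p1[OF h'(1)])
   have "?k h : Ext_cobounds K A (Suc m) M (?DX X)" using cc lD[OF X] hm h' by blast
   then show ?thesis using cob0[OF X _ C] le[OF hm] by simp
  qed
  then obtain g where "g : mhom A (?DX X) D.tau" "ALL h : mhom A P1 (?DX X). D.pair h g = ?l h"
   using D.pair_rep[OF lD[OF X] l] by blast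
  then show ?thesis unfolding P_def using le by auto
 qed
 define u where "u X = (\<lambda>C\<in>?Z X. SOME g. P X C g)" for X
 define w where "w X = (\<lambda>C\<in>?Z X. ?B X +>\<^bsub>?T (Suc m) X\<^esub> C)" for X
 have uP: "P X C (u X C)" if "fd_module K (opp A) X" "C : ?Z X" for X C
  using someI_ex[OF ex[OF that]] that(2) by (simp add: u_def)
 have uI: "u X C = g" if "fd_module K (opp A) X" "C : ?Z X" "P X C g" for X C g
  by (rule D.pair_eqD[OF lD[OF that(1)]]) (use uP[OF that(1,2)] that(3) in "auto simp: P_def")
 have um: "u X C : mhom A (?DX X) D.tau" "!!h. h : mhom A P1 (?DX X) ==> D.pair h (u X C) = ev ?R (?k h) C"
  if "fd_module K (opp A) X" "C : ?Z X" for X C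
  using uP[OF that] by (auto simp: P_def)
 have evh: "(\<lambda>C\<in>car (?T (Suc m) X). ev ?R (?k h) C) : mhom K (?T (Suc m) X) (reg K)"
  if "fd_module K (opp A) X" "h : mhom A P1 (?DX X)" for X h
  by (rule ev_hom(1)[OF lx[OF that(1)] lR kz(2)[OF that]])
 have lV: "lmod K (?V X)" if "fd_module K (opp A) X" for X
  by (rule left_module_submod[OF lm_tensor[OF lx[OF that] lR] Tor_submodules(1)[OF M lx[OF that]]])
 have lW: "lmod K (?W X)" if "fd_module K (opp A) X" for X
  by (rule lm_Hom_space[OF lD[OF that] D.lm_tau])
 have uhom: "u X : mhom K (?V X) (?W X)" if X: "fd_module K (opp A) X" for X
 proof -
  interpret V: left_module K "?V X" by (rule lV[OF X])
  interpret W: left_module K "?W X" by (rule lW[OF X])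
  show ?thesis
  proof (rule mhomI)
   show "u X : extensional (car (?V X))" by (simp add: u_def)
   show "u X C :. (?W X)" if "C :. (?V X)" for C using um(1)[OF X] that by simp
  next
   fix C C' assume CC: "C :. (?V X)" "C' :. (?V X)"
   then have z: "C : ?Z X" "C' : ?Z X" "C \<oplus>\<^bsub>?V X\<^esub> C' : ?Z X" using V.M.add.m_closed[OF CC] by simp_all
   show "u X (C \<oplus>\<^bsub>?V X\<^esub> C') = u X C \<oplus>\<^bsub>?W X\<^esub> u X C'"
   proof (rule uI[OF X z(3)], unfold P_def, intro conjI ballI)
    show "u X C \<oplus>\<^bsub>?W X\<^esub> u X C' : mhom A (?DX X) D.tau"
     using W.M.add.m_closed[of "u X C" "u X C'"] um(1)[OF X z(1)] um(1)[OF X z(2)] by simp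
    fix h assume h: "h : mhom A P1 (?DX X)"
    show "D.pair h (u X C \<oplus>\<^bsub>?W X\<^esub> u X C') = ev ?R (?k h) (C \<oplus>\<^bsub>?V X\<^esub> C')"
     using D.pair_add_right[OF lD[OF X] h um(1)[OF X z(1)] um(1)[OF X z(2)]] um(2)[OF X z(1) h] um(2)[OF X z(2) h]
      mhom_add[OF evh[OF X h] zT(1)[OF z(1)] zT(1)[OF z(2)]] zT(1)[OF z(1)] zT(1)[OF z(2)] zT(1)[OF z(3)]
     by (simp del: Hom_space_sel)
   qed
  next
   fix a C assume a: "a :. K" and C: "C :. (?V X)"
   then have z: "C : ?Z X" "a \<odot>\<^bsub>?V X\<^esub> C : ?Z X" using V.smult_closed[OF a C] by simp_all
   show "u X (a \<odot>\<^bsub>?V X\<^esub> C) = a \<odot>\<^bsub>?W X\<^esub> u X C"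
   proof (rule uI[OF X z(2)], unfold P_def, intro conjI ballI)
    show "a \<odot>\<^bsub>?W X\<^esub> u X C : mhom A (?DX X) D.tau"
     using W.smult_closed[OF a, of "u X C"] um(1)[OF X z(1)] by simp
    fix h assume h: "h : mhom A P1 (?DX X)"
    show "D.pair h (a \<odot>\<^bsub>?W X\<^esub> u X C) = ev ?R (?k h) (a \<odot>\<^bsub>?V X\<^esub> C)"
     using D.pair_smult_right[OF lD[OF X] h um(1)[OF X z(1)] a] um(2)[OF X z(1) h]
      mhom_smult[OF evh[OF X h] a zT(1)[OF z(1)]] zT(1)[OF z(1)] zT(1)[OF z(2)]
     by (simp del: Hom_space_sel)
   qed
  qed
 qed
 have upair: "D.pair h (u X C) = (\<lambda>C\<in>car (?T (Suc m) X). ev ?R (?k h) C) C"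
  if "fd_module K (opp A) X" "C : ?Z X" "h : mhom A P1 (?DX X)" for X C h
  using um(2)[OF that] zT(1)[OF that(2)] by simp
 have fT: "fin_dim K (?T n X)" if "fd_module K (opp A) X" for n X
  by (rule fin_dim_tensor[OF lx[OF that] lR op.fdmD(2)[OF that] fdmD(2)[OF projD(1)[OF res_proj[OF M]]]])
 \<comment> \<open>On cycles every cocycle looks like some \<open>h c\<close>, from which it differs
   by a coboundary.\<close>
 have f_split: "EX h : mhom A P1 (?DX X). ALL C : ?Z X. ev ?R f C = ev ?R (?k h) C"
  if X: "fd_module K (opp A) X" and f: "f : Ext_cocycles K A (Suc m) M (?DX X)" for X f
 proof -
  obtain h where h: "h : mhom A P1 (?DX X)"
   "f \<ominus>\<^bsub>Hom_space A ?R (?DX X)\<^esub> ?k h : Ext_cobounds K A (Suc m) M (?DX X)"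
   using cc lD[OF X] f by blast
  have fm: "f : mhom A ?R (?DX X)" using f Ext_cocycles_iff[OF M] by blast
  have "ev ?R f C = ev ?R (?k h) C" if C: "C : ?Z X" for C
  proof -
   interpret e: mod_hom K "Hom_space A ?R (?DX X)" "reg K" "\<lambda>f\<in>mhom A ?R (?DX X). ev ?R f C"
    by (rule mod_homI[OF lm_Hom_space[OF lR lD[OF X]] lm_reg ev_linear[OF lx[OF X] lR zT(1)[OF C]]])
   have mm: "f :. (Hom_space A ?R (?DX X))" "?k h :. (Hom_space A ?R (?DX X))"
    using fm kz(2)[OF X h(1)] by simp_all
   have "f \<ominus>\<^bsub>Hom_space A ?R (?DX X)\<^esub> ?k h : mhom A ?R (?DX X)"
    using e.M.M.minus_closed[OF mm] by simp
   then have "(\<lambda>f\<in>mhom A ?R (?DX X). ev ?R f C) (f \<ominus>\<^bsub>Hom_space A ?R (?DX X)\<^esub> ?k h) = \<zero>\<^bsub>reg K\<^esub>"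
    using cob0[OF X h(2) C] by simp
   then show ?thesis
    using e.diff[OF mm] e.N.diff_eq_zero_iff[OF e.closed[OF mm(1)] e.closed[OF mm(2)]] mm by simp
  qed
  then show ?thesis using h(1) by blast
 qed
 show ?thesis unfolding tau
 proof (rule nat_iso_span[where V = ?V and u = u and w = w])
  fix X :: "('b, 'x) module" assume X: "fd_module K (opp A) X"
  interpret q: submod_of K "?V X" "?B X" by (rule Tor_quot[OF M lx[OF X]])
  show "lmod K (?V X)" by (rule lV[OF X])
  show "lmod K (?W X)" by (rule lW[OF X])
  show "lmod K (Tor K A (Suc m) X M)" unfolding Tor_eq[OF M] by (rule q.left_module_quot)
  show "u X : mhom K (?V X) (?W X)" by (rule uhom[OF X])
  have wq: "w X = (\<lambda>C\<in>car (?V X). ?B X +>\<^bsub>?V X\<^esub> C)" by (simp add: w_def)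
  show "w X : mhom K (?V X) (Tor K A (Suc m) X M)" unfolding wq Tor_eq[OF M] by (rule q.quot_proj)
  show "w X ` car (?V X) = car (Tor K A (Suc m) X M)"
   unfolding wq Tor_eq[OF M] quot_carrier by (rule image_cong) simp_all
  show "u X ` car (?V X) = car (?W X)"
  proof (rule ccontr)
   \<comment> \<open>A functional on the target that vanishes on the image is the pairing with some
     \<open>h\<close>. Then \<open>h c\<close> vanishes on all cycles; it will be shown to be a
     coboundary, so \<open>h\<close> factors through \<open>p1\<close> and the functional is
     zero.\<close>
   assume ne: "u X ` car (?V X) ~= car (?W X)"
   interpret u: mod_hom K "?V X" "?W X" "u X" by (rule mod_homI[OF lV[OF X] lW[OF X] uhom[OF X]])
   note sub = u.submodule_image[OF left_module.submodule_carrier[OF lV[OF X]]]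
   obtain g where g: "g :. (?W X)" "g \<notin> u X ` car (?V X)" using ne u.N.submod_sub[OF sub] by blast
   obtain l where l: "l : mhom K (?W X) (reg K)" "l g ~= \<zero>\<^sub>K" "ALL x : u X ` car (?V X). l x = \<zero>\<^sub>K"
    using separating_functional[OF D.transpose_duality(1)[OF fD[OF X]] sub g] by blast
   have "l :. (dual K (reg K) (?W X))" using l(1) lW[OF X] by (simp del: Hom_space_sel)
   then obtain h where h: "h : mhom A P1 (?DX X)" "l = (\<lambda>g\<in>mhom A (?DX X) D.tau. D.pair h g)"
    unfolding D.transpose_duality(3)[OF fD[OF X], symmetric] by auto
   have z: "ev ?R (?k h) C = \<zero>\<^sub>K" if C: "C : ?Z X" for C
    using l(3) um[OF X C] h C by auto
   let ?d = "\<lambda>C\<in>car (?T (Suc m) X). Tor_diff K A m X M C"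
   \<comment> \<open>The cycles are the kernel of the differential, so the functional attached to
     \<open>h c\<close> factors through it. Currying the resulting functional yields the cochain
     \<open>g'\<close> that bounds \<open>h c\<close>.\<close>
   obtain l' where l': "l' : mhom K (?T m X) (reg K)"
    "ALL C : car (?T (Suc m) X). l' (?d C) = (\<lambda>C\<in>car (?T (Suc m) X). ev ?R (?k h) C) C"
    using functional_through[OF lm_tensor[OF lx[OF X] lR] fT[OF X] Tor_diff_hom(1)[OF M lx[OF X]] evh[OF X h(1)]]
     z by (auto simp: Tor_cycles_iff[OF M])
   obtain g' where g': "g' : mhom A (rM m) (?DX X)" "ALL C : car (?T m X). ev (rM m) g' C = l' C"
    using ev_surj[OF lx[OF X] lR l'(1)] by blast
   have "?k h = compose (car ?R) g' (rD m)"
   proof (rule mhom_eqI[OF kz(2)[OF X h(1)] mhom_compose[OF lR res_diff_hom[OF M] g'(1)]])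
    fix y assume y: "y :. ?R"
    have dy: "rD m y :. (rM m)" by (rule mhom_closed[OF res_diff_hom[OF M] y])
    have m1: "?k h y : mhom K (scal (opp A) X) (reg K)"
     using mhom_closed[OF kz(2)[OF X h(1)] y] by simp
    have m2: "g' (rD m y) : mhom K (scal (opp A) X) (reg K)"
     using mhom_closed[OF g'(1) dy] by simp
    have "?k h y = g' (rD m y)"
    proof (rule mhom_eqI[OF m1 m2])
     fix x assume "x :. (scal (opp A) X)"
     then have x: "x :. X" by simp
     have t: "tens K A X ?R x y :. (?T (Suc m) X)" by (rule tens_closed[OF lx[OF X] lR x y])
     have t': "tens K A X (rM m) x (rD m y) :. (?T m X)" by (rule tens_closed[OF lx[OF X] lR x dy])
     have "?k h y x = ev ?R (?k h) (tens K A X ?R x y)"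
      by (rule ev_hom(2)[OF lx[OF X] lR kz(2)[OF X h(1)] x y, symmetric])
     also have "\<dots> = l' (?d (tens K A X ?R x y))" using bspec[OF l'(2) t] t by simp
     also have "\<dots> = l' (tens K A X (rM m) x (rD m y))"
      using t Tor_diff_hom(2)[OF M lx[OF X] x y] by simp
     also have "\<dots> = g' (rD m y) x"
      using bspec[OF g'(2) t'] ev_hom(2)[OF lx[OF X] lR g'(1) x dy] by simp
     finally show "?k h y x = g' (rD m y) x" .
    qed
    then show "?k h y = compose (car ?R) g' (rD m) y" using y by (simp add: compose_eq)
   qed
   then have "?k h : Ext_cobounds K A (Suc m) M (?DX X)"
    unfolding Ext_cobounds_iff[OF M] using g'(1) by blast
   then have "EX h' : mhom A P0 (?DX X). h = compose (car P1) h' p1" using cc lD[OF X] h(1) by blast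
   then have "h : D.ImX (?DX X)" by (auto simp: D.ImX_def[OF lD[OF X]])
   then have "l g = \<zero>\<^sub>K" using D.pair_ImX[OF lD[OF X], of g h] g(1) h(2) by simp
   then show False using l(2) by simp
  qed
 next
  fix X :: "('b, 'x) module" and C assume X: "fd_module K (opp A) X" and "C :. (?V X)"
  then have C: "C : ?Z X" by simp
  interpret q: submod_of K "?V X" "?B X" by (rule Tor_quot[OF M lx[OF X]])
  interpret W: left_module K "?W X" by (rule lW[OF X])
  have "w X C = \<zero>\<^bsub>Tor K A (Suc m) X M\<^esub> \<longleftrightarrow> C : ?B X"
   using q.cos_zero[of C] C by (simp add: w_def Tor_eq[OF M])
  also have "\<dots> \<longleftrightarrow> u X C = \<zero>\<^bsub>?W X\<^esub>"
  proof
   assume CB: "C : ?B X"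
   show "u X C = \<zero>\<^bsub>?W X\<^esub>"
   proof (rule uI[OF X C], unfold P_def, intro conjI ballI)
    show "\<zero>\<^bsub>?W X\<^esub> : mhom A (?DX X) D.tau" using W.M.zero_closed by simp
    fix h assume h: "h : mhom A P1 (?DX X)"
    have "D.pair h \<zero>\<^bsub>?W X\<^esub> = \<zero>\<^sub>K"
     using mod_hom.zero[OF mod_homI[OF lW[OF X] lm_reg D.pair_hom2[OF lD[OF X] h]]] W.M.zero_closed
     by (simp del: Hom_space_sel)
    then show "D.pair h \<zero>\<^bsub>?W X\<^esub> = ev ?R (?k h) C" using cyc0[OF X kz(1)[OF X h] CB] by simp
   qed
  next
   assume u0: "u X C = \<zero>\<^bsub>?W X\<^esub>"
   show "C : ?B X"
   proof (rule ccontr)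
    assume "C \<notin> ?B X"
    \<comment> \<open>A functional that separates \<open>C\<close> from the boundaries comes from a
      cochain, which is a cocycle because it kills the boundaries. On \<open>C\<close> it agrees
      with some \<open>h c\<close>, whose value there is the pairing of \<open>h\<close> with
      \<open>u X C\<close>, that is, zero.\<close>
    then obtain l where l: "l : mhom K (?T (Suc m) X) (reg K)" "l C ~= \<zero>\<^sub>K" "ALL x : ?B X. l x = \<zero>\<^sub>K"
     using separating_functional[OF fT[OF X] Tor_submodules(2)[OF M lx[OF X]] zT(1)[OF C]] by blast
    obtain f where f: "f : mhom A ?R (?DX X)" "ALL C : car (?T (Suc m) X). ev ?R f C = l C"
     using ev_surj[OF lx[OF X] lR l(1)] by blast
    have "f : Ext_cocycles K A (Suc m) M (?DX X)"
     unfolding Ext_cocycles_iff[OF M]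
    proof (intro conjI ballI f(1))
     fix y assume y: "y :. (rM (Suc (Suc m)))"
     have dy: "rD (Suc m) y :. ?R" by (rule mhom_closed[OF res_diff_hom[OF M] y])
     interpret DX: left_module A "?DX X" by (rule lD[OF X])
     have m1: "f (rD (Suc m) y) : mhom K (scal (opp A) X) (reg K)"
      using mhom_closed[OF f(1) dy] by simp
     have m2: "\<zero>\<^bsub>?DX X\<^esub> : mhom K (scal (opp A) X) (reg K)" using DX.M.zero_closed by simp
     show "f (rD (Suc m) y) = \<zero>\<^bsub>?DX X\<^esub>"
     proof (rule mhom_eqI[OF m1 m2])
      fix x assume "x :. (scal (opp A) X)"
      then have x: "x :. X" by simp
      have t: "tens K A X (rM (Suc (Suc m))) x y :. (?T (Suc (Suc m)) X)"
       by (rule tens_closed[OF lx[OF X] lR x y])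
      have t': "tens K A X ?R x (rD (Suc m) y) :. (?T (Suc m) X)"
       by (rule tens_closed[OF lx[OF X] lR x dy])
      have "tens K A X ?R x (rD (Suc m) y) : ?B X"
       unfolding Tor_bounds_eq[OF M] Tor_diff_hom(2)[OF M lx[OF X] x y, symmetric] using t by (rule imageI)
      then have "l (tens K A X ?R x (rD (Suc m) y)) = \<zero>\<^sub>K" using l(3) by blast
      then show "f (rD (Suc m) y) x = \<zero>\<^bsub>?DX X\<^esub> x"
       using bspec[OF f(2) t'] ev_hom(2)[OF lx[OF X] lR f(1) x dy] x by simp
     qed
    qed
    then obtain h where h: "h : mhom A P1 (?DX X)" "ALL C : ?Z X. ev ?R f C = ev ?R (?k h) C"
     using f_split[OF X] by blast
    have "D.pair h \<zero>\<^bsub>?W X\<^esub> = \<zero>\<^sub>K"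
     using mod_hom.zero[OF mod_homI[OF lW[OF X] lm_reg D.pair_hom2[OF lD[OF X] h(1)]]] W.M.zero_closed
     by (simp del: Hom_space_sel)
    then have "l C = \<zero>\<^sub>K" using um(2)[OF X C h(1)] u0 bspec[OF h(2) C] bspec[OF f(2) zT(1)[OF C]] by (simp del: Hom_space_sel)
    then show False using l(2) by simp
   qed
  qed
  finally show "u X C = \<zero>\<^bsub>?W X\<^esub> \<longleftrightarrow> w X C = \<zero>\<^bsub>Tor K A (Suc m) X M\<^esub>" by blast
 next
  fix X Y :: "('b, 'x) module" and f C
  assume X: "fd_module K (opp A) X" and Y: "fd_module K (opp A) Y" and f: "f : mhom (opp A) X Y"
   and "C :. (?V X)"
  then have C: "C : ?Z X" by simp
  let ?t = "tensor_map K A Y ?R f (%p. p)"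
  note tm = Tor_map_cos[OF M lx[OF X] lx[OF Y] f C]
  let ?g = "compose (car (?DX Y)) (u X C) (dmap X f)"
  have d: "restrict (dmap X f) (car (?DX Y)) : mhom A (?DX Y) (?DX X)" by (rule dmap_hom[OF lx[OF X] lx[OF Y] f])
  have geq: "compose (car (?DX Y)) (u X C) (restrict (dmap X f) (car (?DX Y))) = ?g"
   by (auto simp: compose_def simp del: dual_sel intro!: restrict_ext)
  have g: "?g : mhom A (?DX Y) D.tau"
   using mhom_compose[OF lD[OF Y] d um(1)[OF X C]] geq by simp
  \<comment> \<open>By uniqueness it suffices to compare pairings: \<open>dmap X f\<close> moves
    from one argument of \<open>pair\<close> to the other, and then \<open>ev_map_left\<close> turns
    it into the map on tensors.\<close>
  have "u Y (?t C) = ?g"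
  proof (rule uI[OF Y tm(1)], unfold P_def, intro conjI ballI g)
   fix h assume h: "h : mhom A P1 (?DX Y)"
   let ?fh = "compose (car P1) (dmap X f) h"
   have "compose (car P1) (restrict (dmap X f) (car (?DX Y))) h = ?fh"
    using mhom_closed[OF h] by (auto simp: compose_def simp del: dual_sel intro!: restrict_ext)
   then have fh: "?fh : mhom A P1 (?DX X)" using mhom_compose[OF D.lmP1 h d] by simp
   have hb: "h b :. (?DX Y)" "b :. P1" if "b : B" for b
    using mhom_closed[OF h, of b] that B(2) by auto
   have "D.pair h ?g = D.pair ?fh (u X C)"
    unfolding D.pair_def
    by (rule K.finsum_cong')
     (use hb D.pair_mem[OF lD[OF X] fh um(1)[OF X C]] in "auto simp: compose_eq simp del: dual_sel")
   also have "\<dots> = ev ?R (?k ?fh) C" by (rule um(2)[OF X C fh])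
   also have "?k ?fh = compose (car ?R) (dmap X f) (?k h)"
    using mhom_closed[OF c] by (auto simp: compose_def intro!: restrict_ext)
   also have "ev ?R (compose (car ?R) (dmap X f) (?k h)) C = ev ?R (?k h) (?t C)"
    by (rule ev_map_left[OF lx[OF X] lx[OF Y] lR f kz(2)[OF Y h] zT(1)[OF C], symmetric])
   finally show "D.pair h ?g = ev ?R (?k h) (?t C)" .
  qed
  moreover have "w Y (?t C) = Tor_map K A (Suc m) Y M f (w X C)"
   using tm C by (simp add: w_def)
  ultimately show "EX v' : car (?V Y). u Y v' = ?g & w Y v' = Tor_map K A (Suc m) Y M f (w X C)"
   using tm(1) by (intro bexI[of _ "?t C"]) auto
 qed
qed

theorem tau_tor_natural:
 assumes n: "1 \<le> n" and z: "car ((syzygy K A ^^ n) (syzygy K A M)) = {\<zero>\<^bsub>(syzygy K A ^^ n) (syzygy K A M)\<^esub>}"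
 shows "naturally_iso K (opp A)
   (%X :: ('b, 'x) module. Hom_space A (dual K (opp A) X) (tau_n K A n M))
   (%X Y f h. compose (car (dual K (opp A) Y)) h (dmap X f))
   (%X. Tor K A n X M) (%X Y f. Tor_map K A n Y M f)"
proof (cases "n = 1")
 case True
 with z have "car (syzygy K A (syzygy K A M)) = {\<zero>\<^bsub>syzygy K A (syzygy K A M)\<^esub>}" by simp
 from tor_transpose_natural[OF M chain_equiv_1[OF M this]] show ?thesis by (simp add: tau_n_def True)
next
 case False
 with n obtain k where k: "n = Suc (Suc k)" by (metis One_nat_def Suc_le_D not0_implies_Suc)
 have N: "fd_module K A ((syzygy K A ^^ k) (syzygy K A M))" by (intro fdm_syzygy_pow fdm_syzygy M)
 from z have "car (syzygy K A (syzygy K A ((syzygy K A ^^ k) (syzygy K A M)))) =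
  {\<zero>\<^bsub>syzygy K A (syzygy K A ((syzygy K A ^^ k) (syzygy K A M)))\<^esub>}"
  unfolding k by simp
 from tor_transpose_natural[OF N chain_equiv_Suc[OF M this]] show ?thesis by (simp add: tau_n_def k)
qed

end

end


section \<open>The enveloping algebra\<close>

text \<open>The enveloping algebra is built as a tensor product over \<open>reg K\<close>, to which
  the general facts on tensor products over an algebra apply once the field is an algebra over
  itself.\<close>

lemma (in vs) fd_algebra_base: "fd_algebra K (reg K)"
proof -
 have "fin_dim K (reg K)"
 proof (rule fin_dimI[OF lm_reg, of "{\<one>\<^sub>K}"])
  show "gen K (reg K) {\<one>\<^sub>K}"
   unfolding gen_def
  proof (intro conjI allI impI subsetI)
   fix N x assume "submodule N K (reg K)" "{\<one>\<^sub>K} \<subseteq> N" "x :. (reg K)"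
   then show "x : N" using left_module.submod_smult[OF lm_reg, of N x "\<one>\<^sub>K"] by simp
  qed simp
 qed simp
 moreover have "ring (reg K)"
  by (intro ring.intro ring_axioms.intro left_module_group[OF lm_reg] monoidI)
   (simp_all add: m_assoc l_distr r_distr)
 ultimately show ?thesis
  using lm_reg field_axioms
  by (auto simp: fd_algebra_def fd_algebra_axioms_def module_iff m_assoc m_lcomm)
qed

lemma (in vs) lm_opp_reg:
 assumes "lmod K V" shows "lmod (opp (reg K)) V" "lmod (reg K) V"
proof -
 interpret V: left_module K V by (rule assms)
 interpret k: fd_algebra K "reg K" by (rule fd_algebra_base)
 show "lmod (reg K) V"
  by (intro left_module.intro left_module_axioms.intro k.A.ring_axioms V.M.abelian_group_axioms)
   (simp_all add: V.smult_l_distr V.smult_r_distr V.smult_assoc)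
 have "(b \<otimes>\<^sub>K a) *\<^sub>V x = a *\<^sub>V (b *\<^sub>V x)" if "a :. K" "b :. K" "x :. V" for a b x
  using that by (simp add: m_comm[of b a] V.smult_assoc)
 then show "lmod (opp (reg K)) V"
  by (intro left_module.intro left_module_axioms.intro k.ring_opp V.M.abelian_group_axioms)
   (simp_all add: V.smult_l_distr V.smult_r_distr)
qed

context fd_algebra
begin

abbreviation "E \<equiv> env_alg K A"
abbreviation "tt \<equiv> tens K (reg K) A (opp A)"

interpretation k: fd_algebra K "reg K" by (rule fd_algebra_base)

lemma lm_alg: "lmod K A" "lmod K (opp A)"
proof -
 interpret op: fd_algebra K "opp A" by (rule fd_algebra_opp)
 show "lmod K A" "lmod K (opp A)"
  using module_axioms op.module_axioms module_iff by auto
qed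

lemmas lmT = lm_opp_reg(1)[OF lm_alg(1)] lm_opp_reg(2)[OF lm_alg(2)]

lemma env_sel [simp]:
 "car E = car (tensor K (reg K) A (opp A))" "add E = add (tensor K (reg K) A (opp A))"
 "zero E = zero (tensor K (reg K) A (opp A))" "smult E = smult (tensor K (reg K) A (opp A))"
 "one E = tt \<one>\<^sub>A \<one>\<^sub>A"
 by (simp_all add: env_alg_def tensor_alg_def Let_def)

lemma lm_env: "lmod K E"
 by (rule left_module_image[OF k.lm_tensor[OF lmT], where f = "%x. x"]) simp_all

text \<open>Plain bilinearity, which implies \<open>balanced\<close> over \<open>reg K\<close>.
  Additivity in the second argument is stated with the roles of \<open>a\<close> and
  \<open>b\<close> exchanged.\<close>

definition blin :: "('a, 'z) module \<Rightarrow> ('b \<Rightarrow> 'b \<Rightarrow> 'z) \<Rightarrow> bool" where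
 "blin Z \<beta> \<longleftrightarrow> (ALL a : car A. ALL b : car A. \<beta> a b :. Z &
  (ALL a' : car A. \<beta> (a \<oplus>\<^sub>A a') b = \<beta> a b \<oplus>\<^sub>Z \<beta> a' b & \<beta> b (a \<oplus>\<^sub>A a') = \<beta> b a \<oplus>\<^sub>Z \<beta> b a') &
  (ALL c : car K. \<beta> (c *\<^sub>A a) b = c *\<^sub>Z \<beta> a b & \<beta> a (c *\<^sub>A b) = c *\<^sub>Z \<beta> a b))"

lemma blinD:
 assumes "blin Z \<beta>" and "a :. A" "b :. A"
 shows "\<beta> a b :. Z"
  "a' :. A ==> \<beta> (a \<oplus>\<^sub>A a') b = \<beta> a b \<oplus>\<^sub>Z \<beta> a' b"
  "a' :. A ==> \<beta> b (a \<oplus>\<^sub>A a') = \<beta> b a \<oplus>\<^sub>Z \<beta> b a'"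
  "c :. K ==> \<beta> (c *\<^sub>A a) b = c *\<^sub>Z \<beta> a b"
  "c :. K ==> \<beta> a (c *\<^sub>A b) = c *\<^sub>Z \<beta> a b"
 using assms unfolding blin_def by blast+

lemma tensor_lift_env: "tensor_lift K (tensor K (reg K) A (opp A)) = tensor_lift K E"
 by (intro ext) (simp add: tensor_lift_def finsum_def)

lemma env_lift:
 assumes Z: "lmod K Z" and b: "blin Z \<beta>"
 shows "(\<lambda>C\<in>car E. tensor_lift K Z \<beta> C) : mhom K E Z"
  "[|a :. A; b :. A|] ==> tensor_lift K Z \<beta> (tt a b) = \<beta> a b"
proof -
 have u: "k.unit_map c = c" if "c :. K" for c using that by (simp add: k.unit_map_def)
 have "k.balanced A (opp A) Z \<beta>"
  unfolding k.balanced_def using b by (simp add: blin_def u)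
 note l = k.tensor_lift_hom[OF lmT Z this]
 show "(\<lambda>C\<in>car E. tensor_lift K Z \<beta> C) : mhom K E Z" using l(1) unfolding mhom_def by simp
 show "[|a :. A; b :. A|] ==> tensor_lift K Z \<beta> (tt a b) = \<beta> a b" using l(2) by simp
qed

lemma blin_tt: "blin E tt"
proof -
 have u: "k.unit_map c = c" if "c :. K" for c using that by (simp add: k.unit_map_def)
 show ?thesis
  unfolding blin_def
  using k.tens_closed[OF lmT] k.tens_add_left[OF lmT] k.tens_add_right[OF lmT] k.tens_balanced[OF lmT] k.tens_scal[OF lmT]
  by (auto simp: u)
qed

lemmas tt = blinD[OF blin_tt]

text \<open>There is no case for scalars or zero: a multiple of a pure tensor is pure, with the
  scalar absorbed in the first factor, and zero is the tensor of two zeros.\<close>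

lemma env_induct [consumes 1, case_names pure add]:
 assumes C: "C :. E"
  and 1: "!!a b. [|a :. A; b :. A|] ==> P (tt a b)"
  and 2: "!!C D. [|C :. E; D :. E; P C; P D|] ==> P (C \<oplus>\<^sub>E D)"
 shows "P C"
proof -
 interpret E: left_module K E by (rule lm_env)
 let ?Q = "%Q. (ALL a : car A. ALL b : car A. Q (tt a b)) &
  (ALL C : car E. ALL D : car E. Q C --> Q D --> Q (C \<oplus>\<^sub>E D))"
 \<comment> \<open>A single predicate need not be stable under scalars, so all admissible
   \<open>Q\<close> are taken at once: with \<open>Q\<close> also \<open>y \<mapsto> Q (c y)\<close>
   is admissible, and this closes \<open>?N\<close> under scalars.\<close>
 let ?N = "{C : car E. ALL Q. ?Q Q --> Q C}"
 have z: "tt \<zero>\<^sub>A \<zero>\<^sub>A = \<zero>\<^sub>E"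
  using tt(4)[of "\<zero>\<^sub>A" "\<zero>\<^sub>A" "\<zero>\<^sub>K"] tt(1)[of "\<zero>\<^sub>A" "\<zero>\<^sub>A"] E.smult_l_null[of "tt \<zero>\<^sub>A \<zero>\<^sub>A"]
   left_module.smult_l_null[OF lm_alg(1), of "\<zero>\<^sub>A"] by simp
 have "submodule ?N K E"
 proof (rule E.submodI)
  show "\<zero>\<^sub>E : ?N" using tt(1)[OF A.zero_closed A.zero_closed] A.zero_closed unfolding z[symmetric] by blast
  show "x \<oplus>\<^sub>E y : ?N" if xy: "x : ?N" "y : ?N" for x y
  proof (intro CollectI conjI allI impI)
   show "x \<oplus>\<^sub>E y :. E" using E.M.add.m_closed xy by blast
   fix Q assume Q: "?Q Q"
   note xy' = xy(1)[THEN CollectD] xy(2)[THEN CollectD]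
   have "Q x" "Q y" by (rule spec[OF conjunct2[OF xy'(1)], THEN mp, OF Q], rule spec[OF conjunct2[OF xy'(2)], THEN mp, OF Q])
   then show "Q (x \<oplus>\<^sub>E y)" using conjunct2[OF Q] xy'(1)[THEN conjunct1] xy'(2)[THEN conjunct1] by blast
  qed
  show "c *\<^sub>E x : ?N" if c: "c :. K" and x: "x : ?N" for c x
  proof (intro CollectI conjI allI impI)
   show "c *\<^sub>E x :. E" using E.smult_closed c x by blast
   fix Q assume Q: "?Q Q"
   have "?Q (%y. Q (c *\<^sub>E y))"
   proof (intro conjI ballI impI)
    fix a b assume ab: "a :. A" "b :. A"
    show "Q (c *\<^sub>E tt a b)"
     using conjunct1[OF Q] tt(4)[OF ab c] smult_closed[OF c ab(1)] ab by metis
   next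
    fix C D assume CD: "C :. E" "D :. E" "Q (c *\<^sub>E C)" "Q (c *\<^sub>E D)"
    show "Q (c *\<^sub>E (C \<oplus>\<^sub>E D))"
     using conjunct2[OF Q] CD E.smult_r_distr[OF c CD(1,2)] E.smult_closed[OF c] by (simp del: env_sel)
   qed
   then show "Q (c *\<^sub>E x)" by (rule spec[OF conjunct2[OF x[THEN CollectD]], of "%y. Q (c *\<^sub>E y)", THEN mp])
  qed
 qed blast
 then obtain N where N: "N = ?N" "submodule N K E" by blast
 note e = E.submod_sub[OF N(2)] E.submod_zero[OF N(2)] E.submod_add[OF N(2)] E.submod_smult[OF N(2)]
 have "submodule N K (tensor K (reg K) A (opp A))"
  by (rule left_module.submodI[OF k.lm_tensor[OF lmT]], rule subsetI) (use e in "simp_all only: env_sel")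
 then have "C : N"
 proof (rule k.tensor_induct[OF lmT])
  fix a b assume "a :. A" "b :. (opp A)"
  then show "tt a b : N" using tt(1)[of a b] unfolding N(1) by simp
 qed (use C in simp)
 then have "C : ?N" unfolding N(1) .
 note C' = spec[OF conjunct2[OF this[THEN CollectD]], of P, THEN mp]
 show ?thesis by (rule C') (use 1 2 in simp)
qed

lemma env_mult: "C \<otimes>\<^sub>E D = tensor_lift K E (%a b. tensor_lift K E (%a' b'. tt (a \<otimes>\<^sub>A a') (b' \<otimes>\<^sub>A b)) D) C"
 unfolding tensor_lift_env[symmetric] by (simp add: env_alg_def tensor_alg_def Let_def)

lemma blin_shift:
 assumes a: "a :. A" "b :. A"
 shows "blin E (%a' b'. tt (a \<otimes>\<^sub>A a') (b' \<otimes>\<^sub>A b))"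
 unfolding blin_def
 by (intro ballI conjI) (simp_all only: A.m_closed a A.r_distr A.l_distr tt(1,2,3) smult_mult_right smult_mult_left tt(4,5))

text \<open>The product is a lift inside a lift. The inner one has to be bilinear in the outer
  variables for an arbitrary second factor \<open>D\<close>, and this is shown by induction on
  \<open>D\<close>.\<close>

lemma blin_shift':
 assumes D: "D :. E"
 shows "blin E (%a b. tensor_lift K E (%a' b'. tt (a \<otimes>\<^sub>A a') (b' \<otimes>\<^sub>A b)) D)" (is "blin E (%a b. ?L a b D)")
 using D
proof (induct rule: env_induct)
 case (pure a' b')
 have "?L a b (tt a' b') = tt (a \<otimes>\<^sub>A a') (b' \<otimes>\<^sub>A b)" if "a :. A" "b :. A" for a b
  by (rule env_lift(2)[OF lm_env blin_shift[OF that] pure])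
 then show ?case
  unfolding blin_def
  by (intro ballI conjI) (simp_all only: A.a_closed A.m_closed pure smult_closed A.r_distr A.l_distr tt(1,2,3) smult_mult_right smult_mult_left tt(4,5))
next
 case (add C D)
 interpret E: left_module K E by (rule lm_env)
 have "?L a b (C \<oplus>\<^sub>E D) = ?L a b C \<oplus>\<^sub>E ?L a b D" if "a :. A" "b :. A" for a b
  using mhom_add[OF env_lift(1)[OF lm_env blin_shift[OF that]] add(1,2)] add(1,2) E.M.add.m_closed[OF add(1,2)]
  by (simp del: env_sel)
 then show ?case
  using add(3,4) unfolding blin_def
  by (simp add: E.M.add.m_ac E.smult_r_distr del: env_sel)
qed

lemma env_mult_hom:
 assumes D: "D :. E"
 shows "(\<lambda>C\<in>car E. C \<otimes>\<^sub>E D) : mhom K E E"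
 using env_lift(1)[OF lm_env blin_shift'[OF D]] by (simp add: env_mult)

lemma tt_mult:
 assumes "a :. A" "b :. A" "a' :. A" "b' :. A"
 shows "tt a b \<otimes>\<^sub>E tt a' b' = tt (a \<otimes>\<^sub>A a') (b' \<otimes>\<^sub>A b)"
 using env_lift(2)[OF lm_env blin_shift'[OF tt(1)[OF assms(3,4)]] assms(1,2)]
  env_lift(2)[OF lm_env blin_shift[OF assms(1,2)] assms(3,4)]
 by (simp add: env_mult)

lemma env_mult_laws:
 assumes "C :. E" "D :. E"
 shows "C \<otimes>\<^sub>E D :. E"
  "C' :. E ==> (C \<oplus>\<^sub>E C') \<otimes>\<^sub>E D = C \<otimes>\<^sub>E D \<oplus>\<^sub>E C' \<otimes>\<^sub>E D"
  "c :. K ==> (c *\<^sub>E C) \<otimes>\<^sub>E D = c *\<^sub>E (C \<otimes>\<^sub>E D)"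
  "D' :. E ==> C \<otimes>\<^sub>E (D \<oplus>\<^sub>E D') = C \<otimes>\<^sub>E D \<oplus>\<^sub>E C \<otimes>\<^sub>E D'"
  "c :. K ==> C \<otimes>\<^sub>E (c *\<^sub>E D) = c *\<^sub>E (C \<otimes>\<^sub>E D)"
proof -
 interpret E: left_module K E by (rule lm_env)
 have cl: "C \<otimes>\<^sub>E D :. E" if "C :. E" "D :. E" for C D
  using mhom_closed[OF env_mult_hom[OF that(2)] that(1)] that by simp
 have al: "(C \<oplus>\<^sub>E C') \<otimes>\<^sub>E D = C \<otimes>\<^sub>E D \<oplus>\<^sub>E C' \<otimes>\<^sub>E D"
  if "C :. E" "C' :. E" "D :. E" for C C' D
  using mhom_add[OF env_mult_hom[OF that(3)] that(1,2)] that E.M.add.m_closed[OF that(1,2)] by (simp del: env_sel)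
 have sl: "(c *\<^sub>E C) \<otimes>\<^sub>E D = c *\<^sub>E (C \<otimes>\<^sub>E D)"
  if "C :. E" "c :. K" "D :. E" for C c D
  using mhom_smult[OF env_mult_hom[OF that(3)] that(2,1)] that E.smult_closed[OF that(2,1)] by (simp del: env_sel)
 show "C \<otimes>\<^sub>E D :. E" by (rule cl[OF assms])
 show "(C \<oplus>\<^sub>E C') \<otimes>\<^sub>E D = C \<otimes>\<^sub>E D \<oplus>\<^sub>E C' \<otimes>\<^sub>E D" if "C' :. E"
  by (rule al[OF assms(1) that assms(2)])
 show "(c *\<^sub>E C) \<otimes>\<^sub>E D = c *\<^sub>E (C \<otimes>\<^sub>E D)" if "c :. K"
  by (rule sl[OF assms(1) that assms(2)])
 have ar: "C \<otimes>\<^sub>E (D \<oplus>\<^sub>E D') = C \<otimes>\<^sub>E D \<oplus>\<^sub>E C \<otimes>\<^sub>E D' & (c :. K --> C \<otimes>\<^sub>E (c *\<^sub>E D) = c *\<^sub>E (C \<otimes>\<^sub>E D))"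
  if D': "D' :. E" for D' c
  using assms(1)
 proof (induct rule: env_induct)
  case (pure a b)
  note h = env_lift(1)[OF lm_env blin_shift[OF pure]]
  have "tt a b \<otimes>\<^sub>E X = (\<lambda>C\<in>car E. tensor_lift K E (%a' b'. tt (a \<otimes>\<^sub>A a') (b' \<otimes>\<^sub>A b)) C) X" if "X :. E" for X
   using env_lift(2)[OF lm_env blin_shift'[OF that] pure] that by (simp add: env_mult)
  then show ?case
   using mhom_add[OF h assms(2) D'] mhom_smult[OF h _ assms(2), of c] assms(2) D' E.M.add.m_closed[OF assms(2) D'] E.smult_closed[of c D]
   by (simp del: env_sel)
 next
  case (add C C')
  have "D \<oplus>\<^sub>E D' :. E" "c :. K ==> c *\<^sub>E D :. E"
   using E.M.add.m_closed E.smult_closed assms(2) D' by blast+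
  then show ?case
   using add al cl assms(2) D' by (simp add: E.M.add.m_ac E.smult_r_distr del: env_sel)
 qed
 show "C \<otimes>\<^sub>E (D \<oplus>\<^sub>E D') = C \<otimes>\<^sub>E D \<oplus>\<^sub>E C \<otimes>\<^sub>E D'" if "D' :. E" using ar[OF that] by blast
 show "C \<otimes>\<^sub>E (c *\<^sub>E D) = c *\<^sub>E (C \<otimes>\<^sub>E D)" if "c :. K" using ar[OF assms(2)] that by blast
qed

theorem fd_algebra_env: "fd_algebra K E"
proof -
 interpret E: left_module K E by (rule lm_env)
 note L = env_mult_laws
 have one: "\<one>\<^sub>E \<otimes>\<^sub>E C = C & C \<otimes>\<^sub>E \<one>\<^sub>E = C" if "C :. E" for C
  using that
 proof (induct rule: env_induct)
  case (add C D)
  then show ?case using L(2,4) tt(1)[OF A.one_closed A.one_closed] by (simp only: env_sel(5))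
 qed (simp add: tt_mult)
 have "C \<otimes>\<^sub>E D \<otimes>\<^sub>E F = C \<otimes>\<^sub>E (D \<otimes>\<^sub>E F)" if "C :. E" "D :. E" "F :. E" for C D F
  using that
 proof (induct C rule: env_induct)
  case C: (pure a b)
  from C(3) show ?case
  proof (induct D rule: env_induct)
   case D: (pure a' b')
   from C(4) show ?case
   proof (induct F rule: env_induct)
    case (add F F')
    then show ?case using C D tt(1) L(1,4) tt_mult by (simp only: A.m_closed)
   qed (simp add: C D tt_mult A.m_assoc)
  next
   case (add D D')
   then show ?case using C tt(1) L(1,2,4) by (simp only:)
  qed
 qed (simp only: L(1,2))
 then have "monoid E"
  by (intro monoidI) (use L(1) one tt(1)[OF A.one_closed A.one_closed] in "simp_all only: env_sel(5)")
 then have r: "ring E"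
  by (intro ring.intro ring_axioms.intro E.M.abelian_group_axioms) (simp_all only: L(2,4))
 have f: "fin_dim K (tensor K (reg K) A (opp A))"
 proof -
  interpret op: fd_algebra K "opp A" by (rule fd_algebra_opp)
  \<comment> \<open>Restricting scalars along \<open>reg K\<close> changes nothing on elements of
    the field, so bases for the two structures coincide.\<close>
  have e: "vbasis K (scal B V) = vbasis K V" if "lmod K V" "B = reg K \<or> B = opp (reg K)" for B and V :: "('a, 'v) module"
  proof -
   have "(c *\<^sub>B \<one>\<^sub>B) = c" if "c :. K" for c using \<open>B = reg K \<or> B = opp (reg K)\<close> that by auto
   then have "(\<Oplus>\<^bsub>V\<^esub> b \<in> C. ((c b *\<^sub>B \<one>\<^sub>B) *\<^sub>V b)) = (\<Oplus>\<^bsub>V\<^esub> b \<in> C. c b *\<^sub>V b)"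
    if "c : C \<rightarrow>\<^sub>E car K" "C \<subseteq> car V" for c C
    using that left_module.smult_closed[OF \<open>left_module K V\<close>] left_module_group[OF \<open>left_module K V\<close>]
    by (intro abelian_monoid.finsum_cong' abelian_group.axioms(1)) (auto simp: PiE_def Pi_def subset_iff)
   then show ?thesis unfolding vbasis_def by (intro ext) (auto cong: conj_cong)
  qed
  have s: "fin_dim K (scal (opp (reg K)) A)" "fin_dim K (scal (reg K) (opp A))"
   using finite_dimensional op.finite_dimensional k.lm_scal[OF lmT(2)] e[OF lm_alg(1)] e[OF lm_alg(2)]
    fd_algebra.lm_scal[OF k.fd_algebra_opp lmT(1)]
   by (simp_all add: fin_dim_def module_iff)
  show ?thesis by (rule k.fin_dim_tensor[OF lmT s])
 qed
 have "(\<lambda>x\<in>car (tensor K (reg K) A (opp A)). x) : mhom K (tensor K (reg K) A (opp A)) E"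
  using mhom_id[OF k.lm_tensor[OF lmT]] by (simp add: mhom_def)
 then have "fin_dim K E" by (rule fin_dim_onto[OF f lm_env]) simp
 then show ?thesis
  by (intro fd_algebra.intro fd_algebra_axioms.intro K.field_axioms r lm_env[folded module_iff])
   (simp_all only: L(3,5))
qed

end


section \<open>Bimodules as modules over the enveloping algebra\<close>

context fd_algebra
begin

declare env_sel [simp del]

interpretation e: fd_algebra K E by (rule fd_algebra_env)

lemma env_homI:
 assumes X: "lmod E X" and Y: "lmod E Y"
  and cl: "!!x. x :. X ==> f x :. Y" and ext: "f : extensional (car X)"
  and add: "!!x y. [|x :. X; y :. X|] ==> f (x \<oplus>\<^sub>X y) = f x \<oplus>\<^sub>Y f y"
  and pure: "!!a b x. [|a :. A; b :. A; x :. X|] ==> f (tt a b *\<^sub>X x) = tt a b *\<^sub>Y f x"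
 shows "f : mhom E X Y"
proof (rule mhomI[OF cl ext add])
 interpret X: left_module E X by (rule X)
 interpret Y: left_module E Y by (rule Y)
 show "f (C *\<^sub>X x) = C *\<^sub>Y f x" if "C :. E" "x :. X" for C x
  using that
 proof (induct C rule: env_induct)
  case (add C D)
  then show ?case using assms(5) cl by (simp add: X.smult_l_distr Y.smult_l_distr)
 qed (rule pure)
qed

lemma env_submoduleI:
 assumes X: "lmod E X" and sub: "H \<subseteq> car X" and z: "\<zero>\<^sub>X : H"
  and ad: "!!x y. [|x : H; y : H|] ==> x \<oplus>\<^sub>X y : H"
  and p: "!!a b x. [|a :. A; b :. A; x : H|] ==> tt a b *\<^sub>X x : H"
 shows "submodule H E X"
proof -
 interpret X: left_module E X by (rule X)
 show ?thesis
 proof (rule X.submodI[OF sub z ad])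
  show "C *\<^sub>X x : H" if "C :. E" "x : H" for C x
   using that
  proof (induct C rule: env_induct)
   case (add C D)
   then show ?case using sub ad by (simp add: X.smult_l_distr subset_iff)
  qed (rule p)
 qed
qed

text \<open>A bimodule is given by a space and by \<beta> with \<open>\<beta> a b v\<close> standing
  for \<open>a v b\<close>. In the last law the second factors multiply in reversed order, as they
  do in the opposite algebra. \<open>reg_bimod\<close> and \<open>HB\<close> are obtained this
  way.\<close>

lemma env_module:
 fixes X :: "(('a, 'b) env, 'v) module"
 assumes V: "lmod K V" and X: "car X = car V" "add X = add V" "zero X = zero V"
   "!!C v. v :. V ==> C *\<^sub>X v = tensor_lift K V (%a b. \<beta> a b v) C"
  and bl: "!!v. v :. V ==> blin V (%a b. \<beta> a b v)"
  and ad: "!!a b v w. [|a :. A; b :. A; v :. V; w :. V|] ==>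
   \<beta> a b (v \<oplus>\<^sub>V w) = \<beta> a b v \<oplus>\<^sub>V \<beta> a b w"
  and one: "!!v. v :. V ==> \<beta> \<one>\<^sub>A \<one>\<^sub>A v = v"
  and mul: "!!a b a' b' v. [|a :. A; b :. A; a' :. A; b' :. A; v :. V|] ==>
   \<beta> a b (\<beta> a' b' v) = \<beta> (a \<otimes>\<^sub>A a') (b' \<otimes>\<^sub>A b) v"
 shows env_module_lm: "lmod E X"
  and env_module_pure: "!!a b v. [|a :. A; b :. A; v :. V|] ==> tt a b *\<^sub>X v = \<beta> a b v"
  and env_module_scal: "!!c v. [|c :. K; v :. V|] ==> (c *\<^sub>E \<one>\<^sub>E) *\<^sub>X v = c *\<^sub>V v"
  and env_module_fd: "fin_dim K V ==> fd_module K E X"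
proof -
 interpret V: left_module K V by (rule V)
 have h: "(\<lambda>C\<in>car E. C *\<^sub>X v) : mhom K E V" if "v :. V" for v
  using env_lift(1)[OF V bl[OF that]] that by (simp add: X cong: restrict_cong)
 show p: "tt a b *\<^sub>X v = \<beta> a b v" if "a :. A" "b :. A" "v :. V" for a b v
  using env_lift(2)[OF V bl[OF that(3)] that(1,2)] that by (simp add: X)
 have cl: "C *\<^sub>X v :. V" if "C :. E" "v :. V" for C v
  using mhom_closed[OF h[OF that(2)] that(1)] that by simp
 have al: "(C \<oplus>\<^sub>E D) *\<^sub>X v = C *\<^sub>X v \<oplus>\<^sub>V D *\<^sub>X v"
  if "C :. E" "D :. E" "v :. V" for C D v
  using mhom_add[OF h[OF that(3)] that(1,2)] that by simp
 have sl: "(c *\<^sub>E C) *\<^sub>X v = c *\<^sub>V (C *\<^sub>X v)" if "C :. E" "c :. K" "v :. V" for C c v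
  using mhom_smult[OF h[OF that(3)] that(2,1)] that by simp
 have o: "\<one>\<^sub>E *\<^sub>X v = v" if "v :. V" for v
  using p[OF A.one_closed A.one_closed that] one[OF that] by (simp add: env_sel(5))
 have ar: "C *\<^sub>X (v \<oplus>\<^sub>V w) = C *\<^sub>X v \<oplus>\<^sub>V C *\<^sub>X w" if "C :. E" "v :. V" "w :. V" for C v w
  using that
 proof (induct C rule: env_induct)
  case (add C D)
  then show ?case using cl al V.M.add.m_closed by (simp add: V.M.add.m_ac)
 qed (use ad p in simp)
 have as: "(C \<otimes>\<^sub>E D) *\<^sub>X v = C *\<^sub>X (D *\<^sub>X v)" if "C :. E" "D :. E" "v :. V" for C D v
  using that
 proof (induct C rule: env_induct)
  case C: (pure a b)
  from C(3) show ?case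
  proof (induct D rule: env_induct)
   case (pure a' b')
   then show ?case using C p[OF _ _ blinD(1)[OF bl[OF C(4)] pure]] mul by (simp add: tt_mult p C)
  next
   case (add D D')
   then show ?case using C tt(1)[OF C(1,2)] by (simp add: al ar cl env_mult_laws)
  qed
 next
  case (add C D)
  then show ?case by (simp add: al cl env_mult_laws)
 qed
 have "abelian_group X"
  by (rule abelian_groupI) (use V.M.l_neg V.M.a_inv_closed in "auto simp: X(1-3) V.M.add.m_ac")
 then show lm: "lmod E X"
  by (intro left_module.intro left_module_axioms.intro e.A.ring_axioms) (simp_all add: X(1-3) cl al ar as o)
 show s: "(c *\<^sub>E \<one>\<^sub>E) *\<^sub>X v = c *\<^sub>V v" if "c :. K" "v :. V" for c v
  using sl[OF e.A.one_closed that] o that by simp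
 show "fd_module K E X" if f: "fin_dim K V"
  unfolding fd_module_def
 proof (intro conjI lm)
  have "(\<lambda>v\<in>car V. v) : mhom K V (scal E X)"
   by (rule mhom_restrictI[OF V]) (simp_all add: X(1,2) s)
  then show "fin_dim K (scal E X)" by (rule fin_dim_onto[OF f e.lm_scal[OF lm]]) (simp add: X)
 qed
qed

lemma reg_bimod:
 shows fdm_reg_bimod: "fd_module K E (reg_bimod K A)"
  and reg_bimod_pure: "[|a :. A; b :. A; x :. A|] ==> tt a b \<odot>\<^bsub>reg_bimod K A\<^esub> x = a \<otimes>\<^sub>A x \<otimes>\<^sub>A b"
proof -
 have b: "blin A (%a b. a \<otimes>\<^sub>A x \<otimes>\<^sub>A b)" if "x :. A" for x
  using that by (simp add: blin_def A.l_distr A.r_distr smult_mult_left smult_mult_right)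
 note m = lm_alg(1) reg_bimod_def[THEN arg_cong[of _ _ carrier], simplified] reg_bimod_def[THEN arg_cong[of _ _ add], simplified]
  reg_bimod_def[THEN arg_cong[of _ _ zero], simplified]
 have s: "C \<odot>\<^bsub>reg_bimod K A\<^esub> x = tensor_lift K A (%a b. a \<otimes>\<^sub>A x \<otimes>\<^sub>A b) C" for C x by (simp add: reg_bimod_def)
 show "fd_module K E (reg_bimod K A)"
  by (rule env_module_fd[OF m s b _ _ _ finite_dimensional]) (simp_all add: A.l_distr A.r_distr A.m_assoc)
 show "[|a :. A; b :. A; x :. A|] ==> tt a b \<odot>\<^bsub>reg_bimod K A\<^esub> x = a \<otimes>\<^sub>A x \<otimes>\<^sub>A b"
  by (rule env_module_pure[OF m s b]) (simp_all add: A.l_distr A.r_distr A.m_assoc)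
qed

lemma blin_flip: "blin E (%a b. tt b a)"
 unfolding blin_def by (simp add: tt)

lemma flip_hom: "(\<lambda>C\<in>car E. flip K A C) : mhom K E E"
 unfolding flip_def by (rule env_lift(1)[OF lm_env blin_flip])

lemma flip_tt: "[|a :. A; b :. A|] ==> flip K A (tt a b) = tt b a"
 unfolding flip_def by (rule env_lift(2)[OF lm_env blin_flip])

lemma flip:
 assumes C: "C :. E"
 shows "flip K A C :. E" "D :. E ==> flip K A (C \<oplus>\<^sub>E D) = flip K A C \<oplus>\<^sub>E flip K A D"
  "D :. E ==> flip K A (C \<otimes>\<^sub>E D) = flip K A D \<otimes>\<^sub>E flip K A C"
  "c :. K ==> flip K A (c *\<^sub>E \<one>\<^sub>E) = c *\<^sub>E \<one>\<^sub>E" "flip K A \<one>\<^sub>E = \<one>\<^sub>E"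
proof -
 have cl: "flip K A C :. E" if "C :. E" for C using mhom_closed[OF flip_hom that] that by simp
 then show "flip K A C :. E" using C .
 have ad: "flip K A (C \<oplus>\<^sub>E D) = flip K A C \<oplus>\<^sub>E flip K A D" if "C :. E" "D :. E" for C D
  using mhom_add[OF flip_hom that] that by simp
 then show "flip K A (C \<oplus>\<^sub>E D) = flip K A C \<oplus>\<^sub>E flip K A D" if "D :. E" using C that by blast
 show o: "flip K A \<one>\<^sub>E = \<one>\<^sub>E" by (simp add: env_sel(5) flip_tt)
 show "flip K A (c *\<^sub>E \<one>\<^sub>E) = c *\<^sub>E \<one>\<^sub>E" if "c :. K"
  using mhom_smult[OF flip_hom that e.A.one_closed] that o by simp
 show "flip K A (C \<otimes>\<^sub>E D) = flip K A D \<otimes>\<^sub>E flip K A C" if "D :. E"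
  using C
 proof (induct C rule: env_induct)
  case C: (pure a b)
  from that show ?case
  proof (induct D rule: env_induct)
   case (add D F)
   then show ?case using tt(1)[OF C] by (simp add: e.A.r_distr e.A.l_distr ad cl)
  qed (simp add: tt_mult flip_tt C)
 next
  case (add C F)
  then show ?case using that by (simp add: e.A.r_distr e.A.l_distr ad cl)
 qed
qed

lemma twist_sel [simp]:
 "car (twist K A X) = car X" "add (twist K A X) = add X" "zero (twist K A X) = zero X"
 "smult (twist K A X) = (%c x. flip K A c *\<^sub>X x)"
 by (simp_all add: twist_def)

lemma fdm_twist:
 assumes X: "fd_module K E X" shows "fd_module K (opp E) (twist K A X)"
proof -
 interpret X: left_module E X by (rule e.fdmD(1)[OF X])
 interpret op: fd_algebra K "opp E" by (rule e.fd_algebra_opp)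
 have "abelian_group (twist K A X)"
  by (rule abelian_group.intro) (use X.M.abelian_group_axioms in "auto simp: abelian_group_def abelian_monoid_def abelian_group_axioms_def")
 then have lm: "lmod (opp E) (twist K A X)"
  by (intro left_module.intro left_module_axioms.intro op.A.ring_axioms)
   (simp_all add: flip flip(5)[OF e.A.one_closed] X.smult_l_distr X.smult_r_distr X.smult_assoc)
 have "(\<lambda>v\<in>car X. v) : mhom K (scal E X) (scal (opp E) (twist K A X))"
  by (rule mhom_restrictI[OF e.lm_scal[OF X.left_module_axioms], simplified]) (simp_all add: flip(4)[OF e.A.one_closed])
 then have "fin_dim K (scal (opp E) (twist K A X))"
  by (rule fin_dim_onto[OF e.fdmD(2)[OF X] op.lm_scal[OF lm]]) simp
 then show ?thesis using lm by (simp add: fd_module_def)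
qed

text \<open>Twisting before or after dualizing yields the same action, and \<open>flip\<close> fixes
  the scalars, so the functionals are the same. This brings the dual into the form in which the
  comparison with Tor uses it.\<close>

lemma bimod_dual_eq:
 assumes X: "lmod E X"
 shows "bimod_dual K A X = dual K (opp E) (twist K A X)"
proof -
 interpret X: left_module E X by (rule X)
 have "mhom K (scal E X) (reg K) = mhom K (scal (opp E) (twist K A X)) (reg K)"
  unfolding mhom_def by (auto simp: flip(4)[OF e.A.one_closed])
 then show ?thesis by (simp add: bimod_dual_def twist_def dual_def)
qed

text \<open>The comparison with Tor concerns right modules. Precomposing with \<open>twist\<close>,
  which leaves the underlying functions of homomorphisms unchanged, gives it for bimodules.\<close>

lemma naturally_iso_twist:
 assumes n: "naturally_iso K (opp E)
   (%X :: (('a, 'b) env, 'x) module. Hom_space E (dual K (opp E) X) (tau_A K A n))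
   (%X Y f h. compose (car (dual K (opp E) Y)) h (e.dmap X f))
   (%X. Tor K E n X (reg_bimod K A)) (%X Y f. Tor_map K E n Y (reg_bimod K A) f)"
 shows "naturally_iso K E (tau_hom K A n :: (('a, 'b) env, 'x) module \<Rightarrow> _) (tau_hom_map K A n) (HH_hom K A n) (HH_hom_map K A n)"
proof -
 obtain \<Phi> where P: "!!X :: (('a, 'b) env, 'x) module. fd_module K (opp E) X ==>
   \<Phi> X : miso K (Hom_space E (dual K (opp E) X) (tau_A K A n)) (Tor K E n X (reg_bimod K A))"
  "!!(X :: (('a, 'b) env, 'x) module) Y f \<xi>. [|fd_module K (opp E) X; fd_module K (opp E) Y; f : mhom (opp E) X Y;
   \<xi> :. (Hom_space E (dual K (opp E) X) (tau_A K A n))|] ==>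
   \<Phi> Y (compose (car (dual K (opp E) Y)) \<xi> (e.dmap X f)) = Tor_map K E n Y (reg_bimod K A) f (\<Phi> X \<xi>)"
  using n unfolding naturally_iso_def by blast
 have d: "bimod_dual K A X = dual K (opp E) (twist K A X)" if "fd_module K E X" for X :: "(('a, 'b) env, 'x) module"
  by (rule bimod_dual_eq[OF e.fdmD(1)[OF that]])
 have m: "f : mhom (opp E) (twist K A X) (twist K A Y)" if "f : mhom E X Y" for X Y :: "(('a, 'b) env, 'x) module" and f
  using that unfolding mhom_def by (auto simp: flip)
 show ?thesis
  unfolding naturally_iso_def
 proof (intro exI[of _ "%X. \<Phi> (twist K A X)"] conjI allI impI ballI)
  fix X :: "(('a, 'b) env, 'x) module" assume X: "fd_module K E X"
  show "\<Phi> (twist K A X) : miso K (tau_hom K A n X) (HH_hom K A n X)"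
   unfolding tau_hom_def HH_hom_def d[OF X] by (rule P(1)[OF fdm_twist[OF X]])
 next
  fix X Y :: "(('a, 'b) env, 'x) module" and f \<xi>
  assume XY: "fd_module K E X & fd_module K E Y & f : mhom E X Y" and xi: "\<xi> :. (tau_hom K A n X)"
  then show "\<Phi> (twist K A Y) (tau_hom_map K A n X Y f \<xi>) = HH_hom_map K A n X Y f (\<Phi> (twist K A X) \<xi>)"
   using P(2)[OF fdm_twist fdm_twist m, of X Y f \<xi>]
   by (simp add: tau_hom_def tau_hom_map_def HH_hom_map_def d e.dmap_def del: dual_sel)
 qed
qed

end


section \<open>Bimodules of linear maps\<close>

lemma mhom_factor:
 assumes X: "lmod R X" and W: "lmod R W" and Y: "lmod R Y"
  and q: "q : mhom R X W" "q ` car X = car W" and g: "g : mhom R X Y"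
  and z: "!!x. [|x :. X; q x = \<zero>\<^sub>W|] ==> g x = \<zero>\<^sub>Y"
 shows "EX k : mhom R W Y. ALL x : car X. k (q x) = g x"
proof -
 interpret q: mod_hom R X W q by (rule mod_homI[OF X W q(1)])
 interpret g: mod_hom R X Y g by (rule mod_homI[OF X Y g])
 let ?s = "inv_into (car X) q"
 have s: "?s w :. X" "q (?s w) = w" if "w :. W" for w
  using that q(2) by (auto intro: inv_into_into f_inv_into_f)
 have e: "g x = g y" if "x :. X" "y :. X" "q x = q y" for x y
  using z[of "x \<ominus>\<^sub>X y"] that g.N.diff_eq_zero_iff[of "g x" "g y"] q.N.diff_eq_zero_iff[of "q x" "q y"] by simp
 have "(\<lambda>w\<in>car W. g (?s w)) : mhom R W Y"
 proof (rule mhom_restrictI[OF W])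
  show "g (?s (x \<oplus>\<^sub>W y)) = g (?s x) \<oplus>\<^sub>Y g (?s y)" if "x :. W" "y :. W" for x y
   using e[of "?s (x \<oplus>\<^sub>W y)" "?s x \<oplus>\<^sub>X ?s y"] s that by simp
  show "g (?s (a *\<^sub>W x)) = a *\<^sub>Y g (?s x)" if "a :. R" "x :. W" for a x
   using e[of "?s (a *\<^sub>W x)" "a *\<^sub>X ?s x"] s that by simp
 qed (use s in simp)
 then show ?thesis
 proof (rule bexI[rotated], intro ballI)
  show "(\<lambda>w\<in>car W. g (?s w)) (q x) = g x" if "x :. X" for x
   using e[of "?s (q x)" x] s[of "q x"] that by simp
 qed
qed

lemma mhom_factor_inj:
 assumes X: "lmod R X" and Y: "lmod R Y" and V: "lmod R V"
  and i: "i : mhom R X Y" "inj_on i (car X)" and g: "g : mhom R V Y" "!!v. v :. V ==> g v : i ` car X"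
 shows "EX f : mhom R V X. ALL v : car V. i (f v) = g v"
proof -
 interpret i: mod_hom R X Y i by (rule mod_homI[OF X Y i(1)])
 interpret g: mod_hom R V Y g by (rule mod_homI[OF V Y g(1)])
 define t where "t v = inv_into (car X) i (g v)" for v
 have t: "t v :. X" "i (t v) = g v" if "v :. V" for v
  using g(2)[OF that] unfolding t_def by (auto intro: inv_into_into f_inv_into_f)
 have e: "x = y" if "i x = i y" "x :. X" "y :. X" for x y using inj_onD[OF i(2)] that by blast
 have "(\<lambda>v\<in>car V. t v) : mhom R V X"
  by (rule mhom_restrictI[OF V]) (auto intro!: e simp: t)
 then show ?thesis using t by (intro bexI) auto
qed

context fd_algebra
begin

interpretation e: fd_algebra K E by (rule fd_algebra_env)

text \<open>The bimodule of linear maps from \<open>Q\<close> to \<open>N\<close>: the left action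
  comes from \<open>N\<close>, the right action from the left action on \<open>Q\<close>, so that
  \<open>a f b\<close> sends \<open>q\<close> to \<open>a f (b q)\<close>.\<close>

definition HB :: "('b, 'q) module \<Rightarrow> ('b, 'n) module \<Rightarrow> (('a, 'b) env, 'q \<Rightarrow> 'n) module" where
 "HB Q N = \<lparr>carrier = mhom K (scal A Q) (scal A N), mult = undefined, one = undefined,
  zero = (\<lambda>q\<in>car Q. \<zero>\<^sub>N), add = (%f g. \<lambda>q\<in>car Q. f q \<oplus>\<^sub>N g q),
  smult = (%C f. tensor_lift K (Hom_space (reg K) (scal A Q) (scal A N)) (%a b. \<lambda>q\<in>car Q. a *\<^sub>N f (b *\<^sub>Q q)) C)\<rparr>"

lemma HB_sel [simp]:
 "car (HB Q N) = mhom K (scal A Q) (scal A N)" "zero (HB Q N) = (\<lambda>q\<in>car Q. \<zero>\<^sub>N)"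
 "add (HB Q N) = (%f g. \<lambda>q\<in>car Q. f q \<oplus>\<^sub>N g q)"
 by (simp_all add: HB_def)

lemma unit_map_comm: "[|lmod A M; c :. K; a :. A; x :. M|] ==>
  a *\<^sub>M (unit_map c *\<^sub>M x) = unit_map c *\<^sub>M (a *\<^sub>M x)"
 "[|lmod A M; c :. K; a :. A; x :. M|] ==>
  (c *\<^sub>A a) *\<^sub>M x = unit_map c *\<^sub>M (a *\<^sub>M x)"
 using left_module.smult_assoc[of A M a "unit_map c" x] left_module.smult_assoc[of A M "unit_map c" a x]
 by (simp_all add: unit_map_mult)

lemma HBD:
 assumes "\<phi> :. (HB Q N)" "q :. Q"
 shows "\<phi> q :. N" "q' :. Q ==> \<phi> (q \<oplus>\<^sub>Q q') = \<phi> q \<oplus>\<^sub>N \<phi> q'"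
  "c :. K ==> \<phi> (unit_map c *\<^sub>Q q) = unit_map c *\<^sub>N \<phi> q"
 using mhom_closed[of \<phi> K "scal A Q" "scal A N" q] mhom_add[of \<phi> K "scal A Q" "scal A N" q q']
  mhom_smult[of \<phi> K "scal A Q" "scal A N" c q] assms by (simp_all add: unit_map_def)

lemma HBI:
 assumes "lmod A Q" "!!q. q :. Q ==> f q :. N"
  and "!!q q'. [|q :. Q; q' :. Q|] ==> f (q \<oplus>\<^sub>Q q') = f q \<oplus>\<^sub>N f q'"
  and "!!c q. [|c :. K; q :. Q|] ==> f (unit_map c *\<^sub>Q q) = unit_map c *\<^sub>N f q"
 shows "(\<lambda>q\<in>car Q. f q) :. (HB Q N)"
 using mhom_restrictI[OF lm_scal[OF assms(1)], of f "scal A N"] assms(2-4) by (simp add: unit_map_def)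

lemma HB:
 assumes Q: "lmod A Q" and N: "lmod A N"
 shows lm_HB: "lmod E (HB Q N)"
  and HB_pure: "[|a :. A; b :. A; f :. (HB Q N)|] ==>
   tt a b \<odot>\<^bsub>HB Q N\<^esub> f = (\<lambda>q\<in>car Q. a *\<^sub>N f (b *\<^sub>Q q))"
  and fdm_HB: "fin_dim K (scal A Q) ==> fin_dim K (scal A N) ==> fd_module K E (HB Q N)"
proof -
 interpret Q: left_module A Q by (rule Q)
 interpret N: left_module A N by (rule N)
 let ?V = "Hom_space (reg K) (scal A Q) (scal A N)"
 have V: "lmod K ?V" by (rule lm_vHom[OF lm_scal[OF Q] lm_scal[OF N]])
 have vs: "c *\<^sub>?V f = (\<lambda>q\<in>car Q. unit_map c *\<^sub>N f q)" if "c :. K" for c f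
  using that by (simp add: unit_map_def)
 have sel: "car (HB Q N) = car ?V" "add (HB Q N) = add ?V" "zero (HB Q N) = zero ?V" by simp_all
 have sm: "C \<odot>\<^bsub>HB Q N\<^esub> v = tensor_lift K ?V (%a b. \<lambda>q\<in>car Q. a *\<^sub>N v (b *\<^sub>Q q)) C" for C v
  by (simp add: HB_def)
 have cl: "(\<lambda>q\<in>car Q. a *\<^sub>N v (b *\<^sub>Q q)) :. (HB Q N)"
  if "a :. A" "b :. A" "v :. (HB Q N)" for a b v
  by (rule HBI[OF Q]) (use that HBD[OF that(3)] unit_map_comm(1)[OF Q] unit_map_comm(1)[OF N] in
   \<open>simp_all del: HB_sel add: Q.smult_r_distr N.smult_r_distr\<close>)
 have bl: "blin ?V (%a b. \<lambda>q\<in>car Q. a *\<^sub>N v (b *\<^sub>Q q))" if "v :. ?V" for v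
 proof -
  have v: "v :. (HB Q N)" using that by simp
  show ?thesis
   unfolding blin_def sel(1)[symmetric]
   by (intro ballI conjI cl v; (rule ext)?)
    (use HBD[OF v] unit_map_comm[OF Q] unit_map_comm[OF N] in
     \<open>simp_all add: vs Q.smult_l_distr N.smult_l_distr N.smult_r_distr restrict_def del: HB_sel Hom_space_sel(4)\<close>)
 qed
 have ad: "(\<lambda>q\<in>car Q. a *\<^sub>N (v \<oplus>\<^sub>?V w) (b *\<^sub>Q q)) =
   (\<lambda>q\<in>car Q. a *\<^sub>N v (b *\<^sub>Q q)) \<oplus>\<^sub>?V (\<lambda>q\<in>car Q. a *\<^sub>N w (b *\<^sub>Q q))"
  if "a :. A" "b :. A" "v :. ?V" "w :. ?V" for a b v w
  using that HBD(1)[of v Q N] HBD(1)[of w Q N] by (auto simp: restrict_def N.smult_r_distr)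
 have one: "(\<lambda>q\<in>car Q. \<one>\<^sub>A *\<^sub>N v (\<one>\<^sub>A *\<^sub>Q q)) = v" if "v :. ?V" for v
  using that HBD(1)[of v Q N] mhom_ext[of v K "scal A Q" "scal A N"] by (auto simp: restrict_def extensional_def)
 have mul: "(\<lambda>q\<in>car Q. a *\<^sub>N (\<lambda>q\<in>car Q. a' *\<^sub>N v (b' *\<^sub>Q q)) (b *\<^sub>Q q)) =
   (\<lambda>q\<in>car Q. (a \<otimes>\<^sub>A a') *\<^sub>N v ((b' \<otimes>\<^sub>A b) *\<^sub>Q q))"
  if "a :. A" "b :. A" "a' :. A" "b' :. A" "v :. ?V" for a b a' b' v
  using that HBD(1)[of v Q N] by (auto simp: restrict_def Q.smult_assoc N.smult_assoc)
 show "lmod E (HB Q N)" by (rule env_module_lm[OF V sel sm bl ad one mul])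
 show "tt a b \<odot>\<^bsub>HB Q N\<^esub> f = (\<lambda>q\<in>car Q. a *\<^sub>N f (b *\<^sub>Q q))" if "a :. A" "b :. A" "f :. (HB Q N)"
  by (rule env_module_pure[OF V sel sm bl ad one mul that(1,2)]) (use that in simp_all)
 show "fd_module K E (HB Q N)" if "fin_dim K (scal A Q)" "fin_dim K (scal A N)"
  by (rule env_module_fd[OF V sel sm bl ad one mul fin_dim_vHom[OF that]])
qed

text \<open>A surjection onto \<open>N\<close> has a linear section, so composing with it is again
  surjective: \<open>HB Q\<close> is exact in its second argument.\<close>

lemma HB_post:
 assumes Q: "lmod A Q" and M: "lmod A M" and N: "fd_module K A N"
  and g: "g : mhom A M N" "g ` car M = car N"
 defines "G \<equiv> \<lambda>\<phi>\<in>car (HB Q M). compose (car Q) g \<phi>"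
 shows "G : mhom E (HB Q M) (HB Q N)" "G ` car (HB Q M) = car (HB Q N)"
proof -
 interpret g: mod_hom A M N g by (rule mod_homI[OF M fdmD(1)[OF N] g(1)])
 note lN = fdmD(1)[OF N]
 have cl: "compose (car Q) g \<phi> :. (HB Q N)" if "\<phi> :. (HB Q M)" for \<phi>
  using mhom_compose[OF lm_scal[OF Q] _ mhom_scal[OF g(1)], of \<phi>] that by simp
 show "G : mhom E (HB Q M) (HB Q N)"
 proof (rule env_homI[OF lm_HB[OF Q M] lm_HB[OF Q lN]])
  show "G \<phi> :. (HB Q N)" if "\<phi> :. (HB Q M)" for \<phi> using cl that by (simp add: G_def del: HB_sel)
  interpret H: left_module E "HB Q M" by (rule lm_HB[OF Q M])
  show "G (x \<oplus>\<^bsub>HB Q M\<^esub> y) = G x \<oplus>\<^bsub>HB Q N\<^esub> G y" if "x :. (HB Q M)" "y :. (HB Q M)" for x y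
   using H.M.add.m_closed[OF that] that HBD(1)[OF that(1)] HBD(1)[OF that(2)]
   by (auto simp: G_def compose_def restrict_def simp del: HB_sel(1))
  show "G (tt a b \<odot>\<^bsub>HB Q M\<^esub> x) = tt a b \<odot>\<^bsub>HB Q N\<^esub> G x"
   if "a :. A" "b :. A" "x :. (HB Q M)" for a b x
   using H.smult_closed[OF tt(1)[OF that(1,2)] that(3)] that cl[OF that(3)] HBD(1)[OF that(3)] left_module.smult_closed[OF Q that(2)]
   by (auto simp: G_def HB_pure[OF Q M] HB_pure[OF Q lN] compose_def restrict_def simp del: HB_sel(1))
 qed (simp add: G_def)
 obtain s where s: "s : mhom K (scal A N) (scal A M)" "ALL w : car N. g (s w) = w"
  using linear_section[OF lm_scal[OF M] fdmD(2)[OF N] mhom_scal[OF g(1)]] g(2) by auto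
 have "\<psi> : G ` car (HB Q M)" if p: "\<psi> :. (HB Q N)" for \<psi>
 proof (rule image_eqI)
  show c: "compose (car Q) s \<psi> :. (HB Q M)" using mhom_compose[OF lm_scal[OF Q] _ s(1), of \<psi>] p by simp
  show "\<psi> = G (compose (car Q) s \<psi>)"
   using c s(2) HBD(1)[OF p] mhom_ext[of \<psi> K "scal A Q" "scal A N"] p
   by (auto simp: G_def compose_def restrict_def extensional_def)
 qed
 then show "G ` car (HB Q M) = car (HB Q N)" using cl by (auto simp: G_def simp del: HB_sel)
qed

lemma HB_pre:
 assumes Q: "lmod A Q" and S: "lmod A S" and N: "lmod A N" and p: "p : mhom A Q S"
 shows "(\<lambda>\<phi>\<in>car (HB S N). compose (car Q) \<phi> p) : mhom E (HB S N) (HB Q N)" (is "?G : _")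
proof (rule env_homI[OF lm_HB[OF S N] lm_HB[OF Q N]])
 interpret p: mod_hom A Q S p by (rule mod_homI[OF Q S p])
 have cl: "compose (car Q) \<phi> p :. (HB Q N)" if "\<phi> :. (HB S N)" for \<phi>
  using mhom_compose[OF lm_scal[OF Q] mhom_scal[OF p], of \<phi>] that by simp
 then show "?G \<phi> :. (HB Q N)" if "\<phi> :. (HB S N)" for \<phi> using that by (simp del: HB_sel)
 interpret H: left_module E "HB S N" by (rule lm_HB[OF S N])
 show "?G (x \<oplus>\<^bsub>HB S N\<^esub> y) = ?G x \<oplus>\<^bsub>HB Q N\<^esub> ?G y" if "x :. (HB S N)" "y :. (HB S N)" for x y
  using H.M.add.m_closed[OF that] that by (auto simp: compose_def restrict_def simp del: HB_sel(1))
 show "?G (tt a b \<odot>\<^bsub>HB S N\<^esub> x) = tt a b \<odot>\<^bsub>HB Q N\<^esub> ?G x"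
  if "a :. A" "b :. A" "x :. (HB S N)" for a b x
  using H.smult_closed[OF tt(1)[OF that(1,2)] that(3)] that cl[OF that(3)] left_module.smult_closed[OF Q that(2)]
  by (auto simp: HB_pure[OF S N] HB_pure[OF Q N] compose_def restrict_def simp del: HB_sel(1))
qed simp

definition lft :: "(('a, 'b) env, 'x) module \<Rightarrow> ('b, 'x) module" where
 "lft X = \<lparr>carrier = car X, mult = undefined, one = undefined, zero = zero X, add = add X,
  smult = (%a x. tt a \<one>\<^sub>A *\<^sub>X x)\<rparr>"

lemma lft_sel [simp]:
 "car (lft X) = car X" "zero (lft X) = zero X" "add (lft X) = add X"
 "smult (lft X) = (%a x. tt a \<one>\<^sub>A *\<^sub>X x)"
 by (simp_all add: lft_def)

lemma tt_one: "lmod E X ==> x :. X ==> tt \<one>\<^sub>A \<one>\<^sub>A *\<^sub>X x = x"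
 using left_module.smult_one[of E X x] by (simp add: env_sel(5))

lemma tt_act:
 assumes X: "lmod E X" and ab: "a :. A" "b :. A" "x :. X"
 shows "tt a b *\<^sub>X x :. X"
  "[|a' :. A; b' :. A|] ==> tt a' b' *\<^sub>X (tt a b *\<^sub>X x) = tt (a' \<otimes>\<^sub>A a) (b \<otimes>\<^sub>A b') *\<^sub>X x"
  "a' :. A ==> tt (a \<oplus>\<^sub>A a') b *\<^sub>X x = tt a b *\<^sub>X x \<oplus>\<^sub>X tt a' b *\<^sub>X x"
  "b' :. A ==> tt a (b \<oplus>\<^sub>A b') *\<^sub>X x = tt a b *\<^sub>X x \<oplus>\<^sub>X tt a b' *\<^sub>X x"
  "y :. X ==> tt a b *\<^sub>X (x \<oplus>\<^sub>X y) = tt a b *\<^sub>X x \<oplus>\<^sub>X tt a b *\<^sub>X y"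
  "c :. K ==> tt (unit_map c) \<one>\<^sub>A *\<^sub>X x = e.unit_map c *\<^sub>X x"
  "c :. K ==> tt \<one>\<^sub>A (unit_map c) *\<^sub>X x = e.unit_map c *\<^sub>X x"
proof -
 interpret X: left_module E X by (rule X)
 note t = tt(1)[OF ab(1,2)]
 show "tt a b *\<^sub>X x :. X" by (rule X.smult_closed[OF t ab(3)])
 show "tt a' b' *\<^sub>X (tt a b *\<^sub>X x) = tt (a' \<otimes>\<^sub>A a) (b \<otimes>\<^sub>A b') *\<^sub>X x" if "a' :. A" "b' :. A"
  using X.smult_assoc[OF tt(1)[OF that] t ab(3)] by (simp add: tt_mult ab that)
 show "tt (a \<oplus>\<^sub>A a') b *\<^sub>X x = tt a b *\<^sub>X x \<oplus>\<^sub>X tt a' b *\<^sub>X x" if "a' :. A"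
  using X.smult_l_distr[OF t tt(1)[OF that ab(2)] ab(3)] tt(2)[OF ab(1,2) that] by simp
 show "tt a (b \<oplus>\<^sub>A b') *\<^sub>X x = tt a b *\<^sub>X x \<oplus>\<^sub>X tt a b' *\<^sub>X x" if "b' :. A"
  using X.smult_l_distr[OF t tt(1)[OF ab(1) that] ab(3)] tt(3)[OF ab(2,1) that] by simp
 show "tt a b *\<^sub>X (x \<oplus>\<^sub>X y) = tt a b *\<^sub>X x \<oplus>\<^sub>X tt a b *\<^sub>X y" if "y :. X"
  by (rule X.smult_r_distr[OF t ab(3) that])
 show "tt (unit_map c) \<one>\<^sub>A *\<^sub>X x = e.unit_map c *\<^sub>X x" "tt \<one>\<^sub>A (unit_map c) *\<^sub>X x = e.unit_map c *\<^sub>X x" if "c :. K"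
  using tt(4,5)[OF A.one_closed A.one_closed that] by (simp_all add: unit_map_def e.unit_map_def env_sel(5))
qed

lemma lm_lft:
 assumes X: "lmod E X" shows "lmod A (lft X)"
proof -
 interpret X: left_module E X by (rule X)
 have "abelian_group (lft X)"
  by (rule abelian_groupI) (use X.M.l_neg X.M.a_inv_closed in "auto simp: X.M.add.m_ac")
 then show ?thesis
  by (intro left_module.intro left_module_axioms.intro A.ring_axioms) (simp_all add: tt_act[OF X] tt_one[OF X])
qed

lemma fdm_lft:
 assumes X: "fd_module K E X" shows "fd_module K A (lft X)"
proof -
 note lm = e.fdmD(1)[OF X]
 have "(\<lambda>v\<in>car X. v) : mhom K (scal E X) (scal A (lft X))"
  by (rule mhom_restrictI[OF e.lm_scal[OF lm], simplified])
   (use tt_act(6)[OF lm A.one_closed A.one_closed] in "simp_all add: unit_map_def e.unit_map_def")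
 then have "fin_dim K (scal A (lft X))"
  by (rule fin_dim_onto[OF e.fdmD(2)[OF X] lm_scal[OF lm_lft[OF lm]]]) simp
 then show ?thesis using lm_lft[OF lm] by (simp add: fd_module_def)
qed

lemma mhom_lft: "f : mhom E X Y ==> f : mhom A (lft X) (lft Y)"
 unfolding mhom_def using tt(1) by auto

lemma lft_submod: "lft (submod X U) = submod (lft X) U"
 by (simp add: lft_def submod_def)

text \<open>The adjunct of \<open>f\<close> under coinduction: a left-linear map on \<open>X\<close>
  corresponds to the bimodule map \<open>x \<mapsto> (s \<mapsto> f (x s))\<close> into
  \<open>HB (reg A) N\<close>.\<close>

lemma act_hom:
 assumes X: "lmod E X" and N: "lmod A N" and Q: "lmod A Q"
  and f: "f : mhom A (lft X) N" and x: "x :. X"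
 shows "(\<lambda>s\<in>car A. f (tt \<one>\<^sub>A s *\<^sub>X x)) :. (HB (reg A) N)"
  "a :. A ==> s :. A ==> f (tt a s *\<^sub>X x) = a *\<^sub>N f (tt \<one>\<^sub>A s *\<^sub>X x)"
proof -
 interpret f: mod_hom A "lft X" N f by (rule mod_homI[OF lm_lft[OF X] N f])
 show g: "f (tt a s *\<^sub>X x) = a *\<^sub>N f (tt \<one>\<^sub>A s *\<^sub>X x)" if "a :. A" "s :. A" for a s
  using f.smult[of a "tt \<one>\<^sub>A s *\<^sub>X x"] that x by (simp add: tt_act[OF X])
 have "(\<lambda>s\<in>car (reg A). f (tt \<one>\<^sub>A s *\<^sub>X x)) :. (HB (reg A) N)"
 proof (rule HBI[OF lm_reg_alg])
  show "f (tt \<one>\<^sub>A (unit_map c \<odot>\<^bsub>reg A\<^esub> q) *\<^sub>X x) = unit_map c *\<^sub>N f (tt \<one>\<^sub>A q *\<^sub>X x)"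
   if "c :. K" "q :. (reg A)" for c q
   using that g[of "unit_map c" q] tt(4,5)[OF A.one_closed, of q c] by (simp add: unit_map_def[symmetric] unit_map_mult)
  show "f (tt \<one>\<^sub>A (q \<oplus>\<^bsub>reg A\<^esub> q') *\<^sub>X x) = f (tt \<one>\<^sub>A q *\<^sub>X x) \<oplus>\<^sub>N f (tt \<one>\<^sub>A q' *\<^sub>X x)"
   if "q :. (reg A)" "q' :. (reg A)" for q q'
   using that f.add[of "tt \<one>\<^sub>A q *\<^sub>X x" "tt \<one>\<^sub>A q' *\<^sub>X x"] x by (simp add: tt_act[OF X])
 qed (use x in "simp add: tt_act[OF X]")
 then show "(\<lambda>s\<in>car A. f (tt \<one>\<^sub>A s *\<^sub>X x)) :. (HB (reg A) N)" by simp
qed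

text \<open>Forgetting the right action is left adjoint to the exact functor
  \<open>HB (reg A)\<close>, hence preserves projectives. Concretely, the adjunct of
  \<open>f\<close> is lifted and then evaluated at \<open>\<one>\<close>.\<close>

lemma lft_projective:
 assumes P: "projective K E P" shows "projective K A (lft P)"
 unfolding projective_def
proof (intro conjI allI impI)
 show "fd_module K A (lft P)" by (rule fdm_lft[OF e.projD(1)[OF P]])
 fix M N :: "('a, 'b) fdmod" and g f
 assume "fd_module K A M & fd_module K A N & g : mhom A M N & g ` car M = car N & f : mhom A (lft P) N"
 then have M: "fd_module K A M" and N: "fd_module K A N" and g: "g : mhom A M N" "g ` car M = car N"
  and f: "f : mhom A (lft P) N" by auto
 note lP = e.projD(2)[OF P] and r = lm_reg_alg and lM = fdmD(1)[OF M] and lN = fdmD(1)[OF N]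
 note act = act_hom[OF lP lN lN f]
 interpret P: left_module E P by (rule lP)
 have "mod_hom A (lft P) N f" by (rule mod_homI[OF lm_lft[OF lP] lN f])
 then interpret f: mod_hom A "lft P" N f .
 let ?F = "\<lambda>p\<in>car P. \<lambda>s\<in>car A. f (tt \<one>\<^sub>A s *\<^sub>P p)"
 have F: "?F : mhom E P (HB (reg A) N)"
 proof (rule env_homI[OF lP lm_HB[OF r lN]])
  show "?F x :. (HB (reg A) N)" if "x :. P" for x using act(1)[OF that] that by (simp del: HB_sel)
  show "?F (x \<oplus>\<^sub>P y) = ?F x \<oplus>\<^bsub>HB (reg A) N\<^esub> ?F y" if "x :. P" "y :. P" for x y
   using that f.add[of "tt \<one>\<^sub>A _ *\<^sub>P x" "tt \<one>\<^sub>A _ *\<^sub>P y"] by (auto simp: tt_act[OF lP] restrict_def)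
  show "?F (tt a b *\<^sub>P x) = tt a b \<odot>\<^bsub>HB (reg A) N\<^esub> ?F x"
   if "a :. A" "b :. A" "x :. P" for a b x
   using that act(1)[OF that(3)] act(2)[OF that(3,1)] by (auto simp: HB_pure[OF r lN] tt_act[OF lP] restrict_def simp del: HB_sel)
 qed simp
 note fd = fdmD(2)[OF fdm_reg]
 obtain h where h: "h : mhom E P (HB (reg A) M)"
  "ALL p : car P. (\<lambda>\<phi>\<in>car (HB (reg A) M). compose (car (reg A)) g \<phi>) (h p) = ?F p"
  using e.proj_lift[OF P fdm_HB[OF r lM fd fdmD(2)[OF M]] fdm_HB[OF r lN fd fdmD(2)[OF N]] HB_post[OF r lM N g] F] by blast
 have hc: "h p :. (HB (reg A) M)" if "p :. P" for p by (rule mhom_closed[OF h(1) that])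
 show "EX h : mhom A (lft P) M. ALL p : car (lft P). g (h p) = f p"
 proof (intro bexI ballI)
  show "(\<lambda>p\<in>car (lft P). h p \<one>\<^sub>A) : mhom A (lft P) M"
  proof (rule mhom_restrictI[OF lm_lft[OF lP]])
   show "h x \<one>\<^sub>A :. M" if "x :. (lft P)" for x using HBD(1)[OF hc] that by simp
   show "h (x \<oplus>\<^bsub>lft P\<^esub> y) \<one>\<^sub>A = h x \<one>\<^sub>A \<oplus>\<^sub>M h y \<one>\<^sub>A" if "x :. (lft P)" "y :. (lft P)" for x y
    using mhom_add[OF h(1)] that by simp
   show "h (a \<odot>\<^bsub>lft P\<^esub> x) \<one>\<^sub>A = a *\<^sub>M h x \<one>\<^sub>A" if "a :. A" "x :. (lft P)" for a x
    using mhom_smult[OF h(1) tt(1)[OF that(1) A.one_closed]] that HB_pure[OF r lM _ _ hc] by simp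
  qed
  fix p assume p: "p :. (lft P)"
  then have "(\<lambda>\<phi>\<in>car (HB (reg A) M). compose (car (reg A)) g \<phi>) (h p) \<one>\<^sub>A = ?F p \<one>\<^sub>A" using h(2) by simp
  then show "g ((\<lambda>p\<in>car (lft P). h p \<one>\<^sub>A) p) = f p"
   using p hc by (simp add: compose_eq tt_one[OF lP] del: HB_sel)
 qed
qed

end


lemma (in left_module) diff_zero: "x :. M ==> x \<ominus>\<^sub>M \<zero>\<^sub>M = x"
 by (simp add: M.minus_eq)

section \<open>Vanishing of first extension groups of bimodules\<close>

context fd_algebra
begin

interpretation e: fd_algebra K E by (rule fd_algebra_env)

text \<open>The first Ext from \<open>L\<close> to \<open>X\<close> over the enveloping algebra
  vanishes: restriction from the cover to the syzygy is surjective on maps to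
  \<open>X\<close>.\<close>

definition good :: "(('a, 'b) env, 'm) module \<Rightarrow> (('a, 'b) env, 'x) module \<Rightarrow> bool" where
 "good L X \<longleftrightarrow> (ALL f : mhom E (syzygy K E L) X. EX F : mhom E (fst (pcov K E L)) X. ALL u : car (syzygy K E L). F u = f u)"

text \<open>\<open>L\<close> is projective from the left, so its cover splits by a left-linear
  section \<open>s\<close>, and \<open>x - s (p x)\<close> retracts the cover onto the syzygy. The
  syzygy is thus left projective again.\<close>

lemma lft_retraction:
 assumes L: "fd_module K E L" and pL: "projective K A (lft L)"
 shows "EX \<rho> : mhom A (lft (fst (pcov K E L))) (lft (syzygy K E L)). ALL u : car (syzygy K E L). \<rho> u = u"
  "projective K A (lft (syzygy K E L))"
proof -
 define P where "P = fst (pcov K E L)"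
 define p where "p = snd (pcov K E L)"
 have P: "projective K E P" and p: "p : mhom E P L" "p ` car P = car L"
  unfolding P_def p_def by (rule e.pcovD[OF L])+
 note fP = fdm_lft[OF e.projD(1)[OF P]] and lP = lm_lft[OF e.projD(2)[OF P]] and lL = lm_lft[OF e.fdmD(1)[OF L]]
 obtain s where s: "s : mhom A (lft L) (lft P)" "ALL l : car L. p (s l) = l"
  using projective_section[OF pL fP mhom_lft[OF p(1)]] p(2) by auto
 interpret p: mod_hom A "lft P" "lft L" p by (rule mod_homI[OF lP lL mhom_lft[OF p(1)]])
 interpret s: mod_hom A "lft L" "lft P" s by (rule mod_homI[OF lL lP s(1)])
 have syz: "lft (syzygy K E L) = submod (lft P) (mker (lft P) (lft L) p)"
  unfolding e.syzygy_eq lft_submod P_def[symmetric] p_def[symmetric] by (simp add: mker_def)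
 let ?r = "\<lambda>x\<in>car (lft P). (\<lambda>x\<in>car (lft P). x) x \<ominus>\<^bsub>lft P\<^esub> compose (car (lft P)) s p x"
 have re: "?r x = x \<ominus>\<^bsub>lft P\<^esub> s (p x)" if "x :. P" for x using that by (simp add: compose_eq)
 have "?r : mhom A (lft P) (lft P)"
  by (rule mhom_diff[OF lP lP mhom_id[OF lP] mhom_compose[OF lP p.hom s(1)]])
 moreover have "p (?r x) = \<zero>\<^sub>L" if "x :. P" for x
  unfolding re[OF that] using that p.closed[of x] s(2) s.closed[of "p x"] p.N.diff_eq_zero_iff[of "p x" "p x"] by simp
 moreover have "?r x :. P" if "x :. P" for x
  unfolding re[OF that] using p.M.M.minus_closed[of x "s (p x)"] that p.closed[of x] s.closed[of "p x"] by simp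
 ultimately have r: "?r : mhom A (lft P) (lft (syzygy K E L))"
  unfolding syz mhom_submod[OF p.submodule_ker lP] by (auto simp: mker_def)
 have ru: "?r u = u" if "u :. (syzygy K E L)" for u
 proof -
  have "u :. P" "p u = \<zero>\<^sub>L" using that unfolding e.syzygy_eq P_def p_def by (auto simp: mker_def)
  then show ?thesis unfolding re[OF \<open>u :. P\<close>] using s.zero left_module.diff_zero[OF lP, of u] by simp
 qed
 show "EX \<rho> : mhom A (lft (fst (pcov K E L))) (lft (syzygy K E L)). ALL u : car (syzygy K E L). \<rho> u = u"
  using r ru unfolding P_def by blast
 have "(\<lambda>x\<in>mker (lft P) (lft L) p. x) : mhom A (lft (syzygy K E L)) (lft P)"
  unfolding syz by (rule mhom_inclusion[OF p.submodule_ker lP])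
 then show "projective K A (lft (syzygy K E L))"
  by (rule retract_projective[OF lft_projective[OF P] fdm_lft[OF e.fdm_syzygy[OF L]] _ r])
   (use ru syz in "auto simp: lft_def submod_def")
qed

text \<open>The first Ext from \<open>L\<close> to \<open>HB Q N\<close> is that from
  \<open>L \<otimes> Q\<close> to \<open>N\<close>, tensored over \<open>A\<close>, and vanishes
  because the cover of \<open>L\<close> splits from the left and \<open>Q\<close> is projective. The
  proof writes the extension down from a left-linear retraction and a dual basis of
  \<open>Q\<close>.\<close>

lemma good_HB_projective:
 assumes L: "fd_module K E L" and pL: "projective K A (lft L)" and Q: "projective K A Q" and N: "lmod A N"
 shows "good L (HB Q N)"
 unfolding good_def
proof
 fix f assume f: "f : mhom E (syzygy K E L) (HB Q N)"
 define P where "P = fst (pcov K E L)"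
 have P: "projective K E P" unfolding P_def by (rule e.pcovD(1)[OF L])
 note lP = e.projD(2)[OF P] and lQ = projD(2)[OF Q] and lW = e.fdmD(1)[OF e.fdm_syzygy[OF L]]
 have Ws: "u :. (syzygy K E L) ==> u :. P" "smult (syzygy K E L) = smult P" for u
  unfolding e.syzygy_eq P_def by (auto simp: mker_def)
 obtain \<rho> where r: "\<rho> : mhom A (lft P) (lft (syzygy K E L))" "ALL u : car (syzygy K E L). \<rho> u = u"
  using lft_retraction(1)[OF L pL] unfolding P_def by blast
 obtain B \<xi> where B: "finite B" "B \<subseteq> car Q" "!!b. b : B ==> \<xi> b : mhom A Q (reg A)"
  "!!p. p :. Q ==> p = (\<Oplus>\<^bsub>Q\<^esub> b \<in> B. \<xi> b p *\<^sub>Q b)" by (rule dual_basis[OF Q]) blast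
 interpret P: left_module E P by (rule lP)
 interpret N: left_module A N by (rule N)
 interpret Q: left_module A Q by (rule lQ)
 interpret r: mod_hom A "lft P" "lft (syzygy K E L)" \<rho> by (rule mod_homI[OF lm_lft[OF lP] lm_lft[OF lW] r(1)])
 interpret f: mod_hom E "syzygy K E L" "HB Q N" f by (rule mod_homI[OF lW lm_HB[OF lQ N] f])
 have rc: "\<rho> x :. (syzygy K E L)" if "x :. P" for x using r.closed[of x] that by simp
 have fc: "f u :. (HB Q N)" if "u :. (syzygy K E L)" for u by (rule f.closed[OF that])
 \<comment> \<open>\<open>G x y b\<close> is \<open>f (\<rho> (x y)) b\<close>. The retraction is
   only left linear, so the right factor \<open>y\<close> is applied before it.\<close>
 define G where "G x y = f (\<rho> (tt \<one>\<^sub>A y *\<^sub>P x))" for x y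
 have Gc: "G x y :. (HB Q N)" if "x :. P" "y :. A" for x y
  unfolding G_def by (rule fc[OF rc[OF tt_act(1)[OF lP A.one_closed that(2,1)]]])
 have Gb: "G x y b :. N" if "x :. P" "y :. A" "b :. Q" for x y b
  by (rule HBD(1)[OF Gc[OF that(1,2)] that(3)])
 have Gl: "G (x \<oplus>\<^sub>P x') y b = G x y b \<oplus>\<^sub>N G x' y b"
  if "x :. P" "x' :. P" "y :. A" "b :. Q" for x x' y b
  using that r.add[of "tt \<one>\<^sub>A y *\<^sub>P x" "tt \<one>\<^sub>A y *\<^sub>P x'"] f.add[OF rc rc, of "tt \<one>\<^sub>A y *\<^sub>P x" "tt \<one>\<^sub>A y *\<^sub>P x'"]
  by (simp add: G_def tt_act[OF lP])
 have Gr: "G x (y \<oplus>\<^sub>A y') b = G x y b \<oplus>\<^sub>N G x y' b"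
  if "x :. P" "y :. A" "y' :. A" "b :. Q" for x y y' b
  using that r.add[of "tt \<one>\<^sub>A y *\<^sub>P x" "tt \<one>\<^sub>A y' *\<^sub>P x"] f.add[OF rc rc, of "tt \<one>\<^sub>A y *\<^sub>P x" "tt \<one>\<^sub>A y' *\<^sub>P x"]
  by (simp add: G_def tt_act[OF lP])
 have Gs: "G (tt a a' *\<^sub>P x) y b = a *\<^sub>N G x (a' \<otimes>\<^sub>A y) b"
  if "a :. A" "a' :. A" "x :. P" "y :. A" "b :. Q" for a a' x y b
 proof -
  have c: "tt \<one>\<^sub>A (a' \<otimes>\<^sub>A y) *\<^sub>P x :. P" using that by (simp add: tt_act[OF lP])
  have "\<rho> (tt \<one>\<^sub>A y *\<^sub>P (tt a a' *\<^sub>P x)) = tt a \<one>\<^sub>A \<odot>\<^bsub>syzygy K E L\<^esub> \<rho> (tt \<one>\<^sub>A (a' \<otimes>\<^sub>A y) *\<^sub>P x)"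
   using r.smult[of a "tt \<one>\<^sub>A (a' \<otimes>\<^sub>A y) *\<^sub>P x"] that c by (simp add: tt_act[OF lP])
  then show ?thesis
   using f.smult[OF tt(1)[OF that(1) A.one_closed] rc[OF c]] that HB_pure[OF lQ N that(1) A.one_closed fc[OF rc[OF c]]]
   by (simp add: G_def)
 qed
 have Gk: "G x (unit_map c \<otimes>\<^sub>A y) b = unit_map c *\<^sub>N G x y b"
  if "x :. P" "y :. A" "c :. K" "b :. Q" for x y c b
 proof -
  have "tt \<one>\<^sub>A y *\<^sub>P (tt \<one>\<^sub>A (unit_map c) *\<^sub>P x) = tt \<one>\<^sub>A y *\<^sub>P (tt (unit_map c) \<one>\<^sub>A *\<^sub>P x)"
   using that tt_act(6,7)[OF lP A.one_closed A.one_closed] by simp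
  then show ?thesis
   using Gs[of "unit_map c" "\<one>\<^sub>A" x y b] that by (simp add: G_def tt_act(2)[OF lP])
 qed
 have xi: "\<xi> b q :. A" "q' :. Q ==> \<xi> b (q \<oplus>\<^sub>Q q') = \<xi> b q \<oplus>\<^sub>A \<xi> b q'"
  "a :. A ==> \<xi> b (a *\<^sub>Q q) = a \<otimes>\<^sub>A \<xi> b q" "b :. Q"
  if "b : B" "q :. Q" for b q q' a
  using mhom_closed[OF B(3)[OF that(1)] that(2)] mhom_add[OF B(3)[OF that(1)] that(2)]
   mhom_smult[OF B(3)[OF that(1)] _ that(2)] B(2) that by auto
 have m: "(%b. G x (\<xi> b q) b) : B \<rightarrow> car N" if "x :. P" "q :. Q" for x q
  using Gb[OF that(1)] xi[OF _ that(2)] by auto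
 \<comment> \<open>The factor \<open>y\<close> is filled with the dual basis coefficients of
   \<open>q\<close>. Their left linearity in \<open>q\<close> gives back the right linearity in
   \<open>x\<close> that the retraction lacks.\<close>
 let ?F = "\<lambda>x\<in>car P. \<lambda>q\<in>car Q. \<Oplus>\<^bsub>N\<^esub> b \<in> B. G x (\<xi> b q) b"
 have F: "?F : mhom E P (HB Q N)"
 proof (rule env_homI[OF lP lm_HB[OF lQ N]])
  show c: "?F x :. (HB Q N)" if x: "x :. P" for x
  proof -
   have "(\<lambda>q\<in>car Q. \<Oplus>\<^bsub>N\<^esub> b \<in> B. G x (\<xi> b q) b) :. (HB Q N)"
   proof (rule HBI[OF lQ])
    show "(\<Oplus>\<^bsub>N\<^esub> b \<in> B. G x (\<xi> b q) b) :. N" if "q :. Q" for q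
     by (rule N.M.finsum_closed[OF m[OF x that]])
    show "(\<Oplus>\<^bsub>N\<^esub> b \<in> B. G x (\<xi> b (q \<oplus>\<^sub>Q q')) b) = (\<Oplus>\<^bsub>N\<^esub> b \<in> B. G x (\<xi> b q) b) \<oplus>\<^sub>N (\<Oplus>\<^bsub>N\<^esub> b \<in> B. G x (\<xi> b q') b)"
     if "q :. Q" "q' :. Q" for q q'
     unfolding N.M.finsum_addf[OF m[OF x that(1)] m[OF x that(2)], symmetric]
     by (rule N.M.finsum_cong') (use that x xi Gr Gb in auto)
    show "(\<Oplus>\<^bsub>N\<^esub> b \<in> B. G x (\<xi> b (unit_map c *\<^sub>Q q)) b) = unit_map c *\<^sub>N (\<Oplus>\<^bsub>N\<^esub> b \<in> B. G x (\<xi> b q) b)"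
     if "c :. K" "q :. Q" for c q
     unfolding N.finsum_smult[OF B(1) unit_map[OF that(1)] m[OF x that(2)]]
     by (rule N.M.finsum_cong') (use that x xi Gk Gb in "auto intro!: N.smult_closed")
   qed
   then show ?thesis using x by simp
  qed
  show "?F (x \<oplus>\<^sub>P y) = ?F x \<oplus>\<^bsub>HB Q N\<^esub> ?F y" if xy: "x :. P" "y :. P" for x y
  proof -
   have "(\<Oplus>\<^bsub>N\<^esub> b \<in> B. G (x \<oplus>\<^sub>P y) (\<xi> b q) b) = (\<Oplus>\<^bsub>N\<^esub> b \<in> B. G x (\<xi> b q) b) \<oplus>\<^sub>N (\<Oplus>\<^bsub>N\<^esub> b \<in> B. G y (\<xi> b q) b)"
    if "q :. Q" for q
    unfolding N.M.finsum_addf[OF m[OF xy(1) that] m[OF xy(2) that], symmetric]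
    by (rule N.M.finsum_cong') (use that xy xi Gl Gb in auto)
   then show ?thesis using xy by (auto simp: restrict_def)
  qed
  show "?F (tt a a' *\<^sub>P x) = tt a a' \<odot>\<^bsub>HB Q N\<^esub> ?F x"
   if a: "a :. A" "a' :. A" and x: "x :. P" for a a' x
  proof -
   have "(\<Oplus>\<^bsub>N\<^esub> b \<in> B. G (tt a a' *\<^sub>P x) (\<xi> b q) b) = a *\<^sub>N (\<Oplus>\<^bsub>N\<^esub> b \<in> B. G x (\<xi> b (a' *\<^sub>Q q)) b)"
    if q: "q :. Q" for q
    unfolding N.finsum_smult[OF B(1) a(1) m[OF x Q.smult_closed[OF a(2) q]]]
    by (rule N.M.finsum_cong') (use q x a xi Gs Gb in "auto intro!: N.smult_closed")
   then show ?thesis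
    using a x c[OF x] tt_act(1)[OF lP a x] by (auto simp: HB_pure[OF lQ N] restrict_def simp del: HB_sel)
  qed
 qed simp
 have "?F u = f u" if u: "u :. (syzygy K E L)" for u
 proof -
  have uP: "u :. P" by (rule Ws(1)[OF u])
  have "(\<Oplus>\<^bsub>N\<^esub> b \<in> B. G u (\<xi> b q) b) = f u q" if q: "q :. Q" for q
  proof -
   \<comment> \<open>On the syzygy the retraction is the identity and \<open>f\<close> is right
     linear, so \<open>f (u y) b = f u (y b)\<close>; summing over the dual basis returns
     \<open>f u q\<close>.\<close>
   have "G u y b = f u (y *\<^sub>Q b)" if "y :. A" "b :. Q" for y b
   proof -
    have w: "tt \<one>\<^sub>A y *\<^sub>P u :. (syzygy K E L)"
     using tt_act(1)[OF lW A.one_closed that(1) u] by (simp add: Ws(2))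
    show ?thesis
     using f.smult[OF tt(1)[OF A.one_closed that(1)] u] r(2) w that HBD(1)[OF fc[OF u] Q.smult_closed[OF that]]
     by (simp add: G_def Ws(2) HB_pure[OF lQ N _ _ fc[OF u]])
   qed
   then have "(\<Oplus>\<^bsub>N\<^esub> b \<in> B. G u (\<xi> b q) b) = (\<Oplus>\<^bsub>scal A N\<^esub> b \<in> B. f u (\<xi> b q *\<^sub>Q b))"
    unfolding finsum_scal by (intro N.M.finsum_cong') (use xi q HBD(1)[OF fc[OF u]] in "auto intro!: Q.smult_closed")
   also have "\<dots> = f u (\<Oplus>\<^bsub>scal A Q\<^esub> b \<in> B. \<xi> b q *\<^sub>Q b)"
    by (rule mod_hom.finsum[OF mod_homI[OF lm_scal[OF lQ] lm_scal[OF N]], symmetric])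
     (use fc[OF u] xi q in "auto intro!: Q.smult_closed")
   also have "\<dots> = f u q" using B(4)[OF q] by simp
   finally show ?thesis .
  qed
  then show ?thesis
   using uP mhom_ext[of "f u" K "scal A Q" "scal A N"] fc[OF u] by (auto simp: restrict_def extensional_def)
 qed
 then show "EX F : mhom E (fst (pcov K E L)) (HB Q N). ALL u : car (syzygy K E L). F u = f u"
  using F unfolding P_def by blast
qed

text \<open>Dimension shifting along the kernel \<open>Z\<close> of
  \<open>\<pi> : Q \<rightarrow> S\<close>. It yields the short exact sequence of
  \<open>HB S N\<close>, \<open>HB Q N\<close> and \<open>HB Z N\<close>; the first Ext from
  \<open>L\<close> to \<open>HB Z N\<close> and that from its syzygy to \<open>HB Q N\<close>
  vanish, hence so does the one from the syzygy to \<open>HB S N\<close>.\<close>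

lemma good_shift:
 fixes L :: "(('a, 'b) env, 'm) module"
 assumes L: "fd_module K E L" and pL: "projective K A (lft L)" and Q: "projective K A Q"
  and S: "lmod A S" and \<pi>: "\<pi> : mhom A Q S" "\<pi> ` car Q = car S" and N: "fd_module K A N"
  and good: "good L (HB (submod Q (mker Q S \<pi>)) N)"
 shows "good (syzygy K E L) (HB S N)"
 unfolding good_def
proof
 define W where "W = syzygy K E L"
 define P where "P = fst (pcov K E L)"
 define R where "R = fst (pcov K E W)"
 define q where "q = snd (pcov K E W)"
 define U where "U = syzygy K E W"
 define Z where "Z = mker Q S \<pi>"
 fix f assume "f : mhom E (syzygy K E (syzygy K E L)) (HB S N)"
 then have f: "f : mhom E U (HB S N)" by (simp add: U_def W_def)
 have fW: "fd_module K E W" unfolding W_def by (rule e.fdm_syzygy[OF L])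
 have P: "projective K E P" unfolding P_def by (rule e.pcovD(1)[OF L])
 have R: "projective K E R" "q : mhom E R W" "q ` car R = car W" unfolding R_def q_def by (rule e.pcovD[OF fW])+
 have q2: "q : mhom E R P" unfolding R_def q_def P_def W_def by (rule e.pcov_syzygy(1)[OF L])
 note lP = e.projD(2)[OF P] and lR = e.projD(2)[OF R(1)] and lW = e.fdmD(1)[OF fW] and lN = fdmD(1)[OF N]
  and lQ = projD(2)[OF Q]
 interpret \<pi>: mod_hom A Q S \<pi> by (rule mod_homI[OF lQ S \<pi>(1)])
 interpret q: mod_hom E R W q by (rule mod_homI[OF lR lW R(2)])
 have subZ: "submodule Z A Q" unfolding Z_def by (rule \<pi>.submodule_ker)
 have fZ: "fd_module K A (submod Q Z)" by (rule fdm_submod[OF projD(1)[OF Q] subZ])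
 note lZ = fdmD(1)[OF fZ] and subK = submodule_scal[OF lQ subZ]
 have U: "U = submod R (mker R W q)" unfolding U_def R_def q_def by (rule e.syzygy_eq)
 have lU: "lmod E U" unfolding U_def by (rule e.fdmD(1)[OF e.fdm_syzygy[OF fW]])
 \<comment> \<open>\<open>pre\<close> and \<open>res\<close> are the two maps of the sequence of
   bimodules: composition with \<pi> and restriction to \<open>Z\<close>.\<close>
 define pre where "pre = (\<lambda>\<phi>\<in>car (HB S N). compose (car Q) \<phi> \<pi>)"
 define res where "res = (\<lambda>\<phi>\<in>car (HB Q N). compose (car (submod Q Z)) \<phi> (\<lambda>x\<in>Z. x))"
 have pre: "pre : mhom E (HB S N) (HB Q N)" unfolding pre_def by (rule HB_pre[OF lQ S lN \<pi>(1)])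
 have res: "res : mhom E (HB Q N) (HB (submod Q Z) N)"
  unfolding res_def by (rule HB_pre[OF lZ lQ lN mhom_inclusion[OF subZ lQ]])
 note lSN = lm_HB[OF S lN] and lQN = lm_HB[OF lQ lN] and lZN = lm_HB[OF lZ lN]
 interpret r: mod_hom E "HB Q N" "HB (submod Q Z) N" res by (rule mod_homI[OF lQN lZN res])
 interpret p: mod_hom E "HB S N" "HB Q N" pre by (rule mod_homI[OF lSN lQN pre])
 have re: "res \<phi> z = \<phi> z" if "\<phi> :. (HB Q N)" "z : Z" for \<phi> z
  using that by (simp add: res_def compose_eq del: HB_sel)
 have r0: "res \<phi> = \<zero>\<^bsub>HB (submod Q Z) N\<^esub> \<longleftrightarrow> (ALL z : Z. \<phi> z = \<zero>\<^sub>N)" if "\<phi> :. (HB Q N)" for \<phi>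
  using that by (auto simp: res_def compose_def restrict_def fun_eq_iff simp del: HB_sel(1))
 have ronto: "res ` car (HB Q N) = car (HB (submod Q Z) N)"
 proof
  show "car (HB (submod Q Z) N) \<subseteq> res ` car (HB Q N)"
  proof
   fix \<psi> assume p: "\<psi> :. (HB (submod Q Z) N)"
   then have "\<psi> : mhom K (submod (scal A Q) Z) (scal A N)" by (simp add: scal_submod)
   then obtain \<phi> where phi: "\<phi> : mhom K (scal A Q) (scal A N)" "ALL x : Z. \<phi> x = \<psi> x"
    using extend_functional[OF fdmD(2)[OF projD(1)[OF Q]] subK] by blast
   then have "res \<phi> = \<psi>"
    using mhom_ext[of \<psi> K "scal A (submod Q Z)" "scal A N"] p
    by (auto simp: res_def compose_def restrict_def extensional_def)
   then show "\<psi> : res ` car (HB Q N)" using phi(1) by auto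
  qed
 qed (use r.closed in blast)
 have pe: "pre \<phi> x = \<phi> (\<pi> x)" if "\<phi> :. (HB S N)" "x :. Q" for \<phi> x
  using that by (simp add: pre_def compose_eq del: HB_sel)
 have pinj: "inj_on pre (car (HB S N))"
 proof (rule inj_onI)
  fix x y assume xy: "x :. (HB S N)" "y :. (HB S N)" "pre x = pre y"
  show "x = y"
  proof (rule mhom_eqI[of x K "scal A S" "scal A N" y K])
   show "x s = y s" if "s :. (scal A S)" for s
    using that \<pi>(2) pe[OF xy(1)] pe[OF xy(2)] xy(3) by (metis imageE scal_sel(1))
  qed (use xy in simp_all)
 qed
 have pim: "\<phi> : pre ` car (HB S N)" if phi: "\<phi> :. (HB Q N)" "ALL z : Z. \<phi> z = \<zero>\<^sub>N" for \<phi>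
 proof -
  obtain \<psi> where psi: "\<psi> : mhom K (scal A S) (scal A N)" "ALL x : car (scal A Q). \<psi> (\<pi> x) = \<phi> x"
   using mhom_factor[OF lm_scal[OF lQ] lm_scal[OF S] lm_scal[OF lN] mhom_scal[OF \<pi>(1)], of \<phi>] phi \<pi>(2)
   by (auto simp: Z_def mker_def)
  have "pre \<psi> = \<phi>"
   by (rule mhom_eqI[of "pre \<psi>" K "scal A Q" "scal A N" \<phi> K])
    (use p.closed[of \<psi>] psi phi pe[of \<psi>] in auto)
  then show ?thesis using psi by auto
 qed
 have f1: "compose (car U) pre f : mhom E U (HB Q N)" by (rule mhom_compose[OF lU f pre])
 \<comment> \<open>The composite of \<open>f\<close> with \<open>pre\<close> extends to the cover
   \<open>R\<close> as \<open>g\<close>, since \<open>Q\<close> is projective.\<close>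
 have "good W (HB Q N)"
  unfolding W_def by (rule good_HB_projective[OF e.fdm_syzygy[OF L] lft_retraction(2)[OF L pL] Q lN])
 then obtain g where g: "g : mhom E R (HB Q N)" "ALL u : car U. g u = pre (f u)"
  using bspec[OF iffD1[OF good_def], of W "HB Q N", OF _ f1[unfolded U_def]] unfolding R_def U_def
  by (simp add: compose_eq del: HB_sel) blast
 interpret g: mod_hom E R "HB Q N" g by (rule mod_homI[OF lR lQN g(1)])
 interpret f: mod_hom E U "HB S N" f by (rule mod_homI[OF lU lSN f])
 have rg: "res (g x) = \<zero>\<^bsub>HB (submod Q Z) N\<^esub>" if "x :. U" for x
 proof -
  have "x :. R" using that by (simp add: U mker_def)
  then have gx: "g x :. (HB Q N)" by (rule g.closed)
  show ?thesis
  proof (rule iffD2[OF r0[OF gx]], rule ballI)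
   fix z assume "z : Z"
   then have z: "z :. Q" "\<pi> z = \<zero>\<^sub>S" by (auto simp: Z_def mker_def)
   have "f x : mhom K (scal A S) (scal A N)" using f.closed[OF that] by simp
   from mod_hom.zero[OF mod_homI[OF lm_scal[OF S] lm_scal[OF lN] this]]
   have "f x \<zero>\<^sub>S = \<zero>\<^sub>N" by simp
   then show "g x z = \<zero>\<^sub>N" using g(2) that pe[OF f.closed[OF that] z(1)] z(2) by simp
  qed
 qed
 \<comment> \<open>\<open>res g\<close> vanishes on the second syzygy and so descends to the first
   one, where the assumption extends it to \<open>P\<close>; projectivity of \<open>P\<close> then
   lifts it back to \<open>HB Q N\<close> as \<open>h'\<close>.\<close>
 obtain k where k: "k : mhom E W (HB (submod Q Z) N)" "ALL x : car R. k (q x) = compose (car R) res g x"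
  using mhom_factor[OF lR lW lZN R(2,3) mhom_compose[OF lR g(1) res]] rg by (auto simp: compose_eq U mker_def simp del: HB_sel)
 obtain h where h: "h : mhom E P (HB (submod Q Z) N)" "ALL u : car W. h u = k u"
  using good k(1) unfolding good_def P_def W_def Z_def by blast
 obtain h' where h': "h' : mhom E P (HB Q N)" "ALL x : car P. res (h' x) = h x"
  using e.proj_lift[OF P fdm_HB[OF lQ lN fdmD(2)[OF projD(1)[OF Q]] fdmD(2)[OF N]]
   fdm_HB[OF lZ lN fdmD(2)[OF fZ] fdmD(2)[OF N]] res ronto h(1)] by blast
 interpret h: mod_hom E P "HB Q N" h' by (rule mod_homI[OF lP lQN h'(1)])
 have qP: "q x :. P" if "x :. R" for x by (rule mhom_closed[OF q2 that])
 \<comment> \<open>The correction by \<open>h' q\<close> has zero restriction to \<open>Z\<close>,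
   so it comes from \<open>HB S N\<close>. On the second syzygy \<open>q\<close> vanishes and the
   correction changes nothing.\<close>
 let ?d = "\<lambda>x\<in>car R. g x \<ominus>\<^bsub>HB Q N\<^esub> compose (car R) h' q x"
 have d: "?d : mhom E R (HB Q N)" by (rule mhom_diff[OF lR lQN g(1) mhom_compose[OF lR q2 h'(1)]])
 have de: "?d x = g x \<ominus>\<^bsub>HB Q N\<^esub> h' (q x)" if "x :. R" for x using that by (simp add: compose_eq)
 have "?d x : pre ` car (HB S N)" if x: "x :. R" for x
 proof -
  note c = g.closed[OF x] h.closed[OF qP[OF x]]
  have "res (?d x) = res (g x) \<ominus>\<^bsub>HB (submod Q Z) N\<^esub> res (h' (q x))" unfolding de[OF x] by (rule r.diff[OF c])
  also have "\<dots> = \<zero>\<^bsub>HB (submod Q Z) N\<^esub>"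
   using k(2) h(2) h'(2) x qP[OF x] q.closed[OF x] r.N.diff_eq_zero_iff[OF r.closed[OF c(1)] r.closed[OF c(1)]]
   by (simp add: compose_eq del: HB_sel)
  finally show ?thesis using pim r0 mhom_closed[OF d x] by blast
 qed
 then obtain F where F: "F : mhom E R (HB S N)" "ALL v : car R. pre (F v) = ?d v"
  using mhom_factor_inj[OF lSN lQN lR pre pinj d] by blast
 have "F u = f u" if u: "u :. U" for u
 proof -
  have uR: "u :. R" "q u = \<zero>\<^sub>P" using u unfolding U W_def e.syzygy_eq P_def by (auto simp: mker_def)
  have "pre (F u) = g u \<ominus>\<^bsub>HB Q N\<^esub> \<zero>\<^bsub>HB Q N\<^esub>" using F(2) uR de[OF uR(1)] h.zero by (simp del: HB_sel)
  also have "\<dots> = pre (f u)" using left_module.diff_zero[OF lQN g.closed[OF uR(1)]] g(2) u by (simp del: HB_sel)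
  finally show ?thesis using inj_onD[OF pinj _ mhom_closed[OF F(1) uR(1)] f.closed[OF u]] by blast
 qed
 then show "EX F : mhom E (fst (pcov K E (syzygy K E L))) (HB S N). ALL u : car (syzygy K E (syzygy K E L)). F u = f u"
  using F(1) unfolding U_def R_def W_def by blast
qed

end


section \<open>Projective dimension and dimension shifting\<close>

context fd_algebra
begin

interpretation e: fd_algebra K E by (rule fd_algebra_env)

text \<open>Projective dimension at most \<open>n\<close>, unrolled one projective at a time in
  order to match \<open>good_shift\<close>.\<close>

primrec pdle :: "nat \<Rightarrow> ('a, 'b) fdmod \<Rightarrow> bool" where
 "pdle 0 S \<longleftrightarrow> projective K A S"
| "pdle (Suc j) S \<longleftrightarrow> (EX (Q :: ('a, 'b) fdmod) \<pi>. projective K A Q & \<pi> : mhom A Q S & \<pi> ` car Q = car S &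
  pdle j (submod Q (mker Q S \<pi>)))"

text \<open>A module of projective dimension at most \<open>k + 1\<close> needs \<open>k + 1\<close>
  shifts, which end at the syzygy of order \<open>k + 1\<close> of \<open>M\<close>. The case
  \<open>k = 0\<close> is already one shift, with a projective kernel.\<close>

lemma good_pow:
 assumes M: "fd_module K E M" and pM: "projective K A (lft M)" and N: "fd_module K A N"
 shows "fd_module K A S ==> pdle (Suc k) S ==> good ((syzygy K E ^^ k) (syzygy K E M)) (HB S N)"
proof (induct k arbitrary: S)
 case 0
 then obtain Q :: "('a, 'b) fdmod" and \<pi> where Q: "projective K A Q" "\<pi> : mhom A Q S" "\<pi> ` car Q = car S"
  "projective K A (submod Q (mker Q S \<pi>))" by auto
 show ?case
  using good_shift[OF M pM Q(1) fdmD(1)[OF 0(1)] Q(2,3) N good_HB_projective[OF M pM Q(4) fdmD(1)[OF N]]] by simp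
next
 case (Suc k)
 then obtain Q :: "('a, 'b) fdmod" and \<pi> where Q: "projective K A Q" "\<pi> : mhom A Q S" "\<pi> ` car Q = car S"
  "pdle (Suc k) (submod Q (mker Q S \<pi>))" by auto
 let ?L = "(syzygy K E ^^ k) (syzygy K E M)"
 have s: "fd_module K A (submod Q (mker Q S \<pi>))"
  by (rule fdm_submod[OF projD(1)[OF Q(1)] mod_hom.submodule_ker[OF mod_homI[OF projD(2)[OF Q(1)] fdmD(1)[OF Suc(2)] Q(2)]]])
 have L: "fd_module K E ?L" by (intro e.fdm_syzygy_pow e.fdm_syzygy M)
 have "projective K A (lft ((syzygy K E ^^ i) (syzygy K E M)))" for i
 proof (induct i)
  case (Suc i)
  then show ?case using lft_retraction(2)[OF e.fdm_syzygy_pow[OF e.fdm_syzygy[OF M]] Suc] by simp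
 qed (use lft_retraction(2)[OF M pM] in simp)
 then show ?case
  using good_shift[OF L _ Q(1) fdmD(1)[OF Suc(2)] Q(2,3) N Suc(1)[OF s Q(4)]] by simp
qed

text \<open>The kernel of the augmentation is resolved by the shifted resolution, with \<delta> at
  index 0 as the new augmentation. At \<open>n = 0\<close> the augmentation is an isomorphism
  because the term at index 1 is zero.\<close>

lemma proj_res_pdle:
 fixes S :: "('a, 'b) fdmod"
 shows "[|fd_module K A S; proj_res K A S P \<delta> \<epsilon>; ALL m>n. car (P m) = {\<zero>\<^bsub>P m\<^esub>}|] ==> pdle n S"
proof (induct n arbitrary: S P \<delta> \<epsilon>)
 case 0
 then have r: "projective K A (P 0)" "projective K A (P 1)" "\<epsilon> : mhom A (P 0) S" "\<epsilon> ` car (P 0) = car S"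
  "\<delta> 0 : mhom A (P 1) (P 0)" "\<delta> 0 ` car (P 1) = mker (P 0) S \<epsilon>" "car (P 1) = {\<zero>\<^bsub>P 1\<^esub>}"
  unfolding proj_res_def by auto
 interpret f: mod_hom A "P 0" S \<epsilon> by (rule mod_homI[OF projD(2)[OF r(1)] fdmD(1)[OF 0(1)] r(3)])
 have "mker (P 0) S \<epsilon> = {\<zero>\<^bsub>P 0\<^esub>}"
  using r(6,7) mod_hom.zero[OF mod_homI[OF projD(2)[OF r(2)] projD(2)[OF r(1)] r(5)]] by auto
 then have "inj_on \<epsilon> (car (P 0))" unfolding f.inj_iff by (auto simp: mker_def)
 then show ?case using iso_projective[OF r(1) fdmD(1)[OF 0(1)] misoI[OF r(3) _ r(4)]] by simp
next
 case (Suc n)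
 then have r: "!!m. projective K A (P m)" "\<epsilon> : mhom A (P 0) S" "\<epsilon> ` car (P 0) = car S"
  "!!m. \<delta> m : mhom A (P (Suc m)) (P m)" "\<delta> 0 ` car (P 1) = mker (P 0) S \<epsilon>"
  "!!m. \<delta> (Suc m) ` car (P (Suc (Suc m))) = mker (P (Suc m)) (P m) (\<delta> m)"
  unfolding proj_res_def by auto
 let ?Z = "submod (P 0) (mker (P 0) S \<epsilon>)"
 have sub: "submodule (mker (P 0) S \<epsilon>) A (P 0)"
  by (rule mod_hom.submodule_ker[OF mod_homI[OF projD(2)[OF r(1)] fdmD(1)[OF Suc(2)] r(2)]])
 have "proj_res K A ?Z (%m. P (Suc m)) (%m. \<delta> (Suc m)) (\<delta> 0)"
  unfolding proj_res_def mhom_submod[OF sub projD(2)[OF r(1)]] using r by (auto simp: mker_def)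
 from Suc(1)[OF fdm_submod[OF projD(1)[OF r(1)] sub] this] Suc(4) have "pdle n ?Z" by simp
 then show ?case using r(1,2,3) by (auto intro!: exI[of _ "P 0"] exI[of _ \<epsilon>])
qed

text \<open>A finite bound makes the set of lengths nonempty, and a nonempty set of extended
  naturals attains its infimum, so a resolution of length at most \<open>d\<close> exists.\<close>

lemma gl_dim_pdle:
 assumes d: "gl_dim K A = enat d" and S: "fd_module K A S" shows "pdle d S"
proof -
 define T where "T = {enat n | n. EX P \<delta> \<epsilon>. proj_res K A S P \<delta> \<epsilon> & (ALL m>n. car (P m) = {\<zero>\<^bsub>P m\<^esub>})}"
 have i: "Inf T \<le> enat d"
  unfolding T_def d[symmetric] gl_dim_def proj_dim_def[symmetric] by (rule Sup_upper) (use S in blast)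
 then have ne: "T ~= {}" by (auto simp: Inf_enat_def)
 have "Inf T : T" unfolding Inf_enat_def if_not_P[OF ne] by (rule LeastI_ex) (use ne in blast)
 then obtain n where n: "enat n : T" "n \<le> d" using i unfolding T_def by force
 then obtain P \<delta> \<epsilon> where "proj_res K A S P \<delta> \<epsilon>" "ALL m>n. car (P m) = {\<zero>\<^bsub>P m\<^esub>}" unfolding T_def by auto
 then show ?thesis using n(2) by (intro proj_res_pdle[OF S]) auto
qed

text \<open>From the left the algebra is free on one generator, here the index set
  \<open>{()}\<close>.\<close>

lemma projective_lft_reg_bimod: "projective K A (lft (reg_bimod K A))"
proof (rule retract_projective[OF projective_free[of "{()}"] fdm_lft[OF fdm_reg_bimod]])
 have c: "car (reg_bimod K A) = car A" "add (reg_bimod K A) = add A" by (simp_all add: reg_bimod_def)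
 note lm = lm_lft[OF e.fdmD(1)[OF fdm_reg_bimod]]
 show "(\<lambda>x\<in>car (lft (reg_bimod K A)). \<lambda>b\<in>{()}. x) : mhom A (lft (reg_bimod K A)) (free {()})"
  by (rule mhom_restrictI[OF lm]) (auto simp: c reg_bimod_pure restrict_def)
 show "(\<lambda>f\<in>car (free {()}). f ()) : mhom A (free {()}) (lft (reg_bimod K A))"
  by (rule mhom_restrictI[OF lm_free]) (auto simp: c reg_bimod_pure PiE_def Pi_def)
 show "(\<lambda>f\<in>car (free {()}). f ()) ((\<lambda>x\<in>car (lft (reg_bimod K A)). \<lambda>b\<in>{()}. x) q) = q"
  if "q :. (lft (reg_bimod K A))" for q using that by (simp add: c PiE_def)
qed simp

lemma syzygy_zero:
 assumes L: "fd_module K E L"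
  and g: "!!X :: ('a, ('a, 'b) env) fdmod. fd_module K E X ==> good L X"
 shows "car (syzygy K E L) = {\<zero>\<^bsub>syzygy K E L\<^esub>}"
proof -
 define P where "P = fst (pcov K E L)"
 define p where "p = snd (pcov K E L)"
 have U: "syzygy K E L = submod P (mker P L p)" unfolding P_def p_def by (rule e.syzygy_eq)
 have fU: "fd_module K E (syzygy K E L)" by (rule e.fdm_syzygy[OF L])
 have lP: "lmod E P" unfolding P_def by (rule e.projD(2)[OF e.pcovD(1)[OF L]])
 obtain \<rho> where r: "\<rho> : mhom E P (syzygy K E L)" "ALL u : car (syzygy K E L). \<rho> u = u"
  using g[OF fU] mhom_id[OF e.fdmD(1)[OF fU]] unfolding good_def P_def by fastforce
 interpret r: mod_hom E P "syzygy K E L" \<rho> by (rule mod_homI[OF lP e.fdmD(1)[OF fU] r(1)])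
 have sub: "\<rho> x : mker P L p" "\<rho> x :. P" if "x :. P" for x
  using r.closed[OF that] unfolding U by (auto simp: mker_def)
 \<comment> \<open>The extension of the identity splits \<open>P\<close> as its kernel plus the
   syzygy. By minimality of the cover this kernel is all of \<open>P\<close>, so the identity of the
   syzygy is zero.\<close>
 let ?N = "mker P (syzygy K E L) \<rho>"
 have "?N <+>\<^bsub>P\<^esub> mker P L p = car P"
 proof
  show "car P \<subseteq> ?N <+>\<^bsub>P\<^esub> mker P L p"
  proof
   fix x assume x: "x :. P"
   have "\<rho> (x \<ominus>\<^sub>P \<rho> x) = \<zero>\<^bsub>syzygy K E L\<^esub>"
    using r.diff[OF x sub(2)[OF x]] r(2) r.closed[OF x] r.N.diff_eq_zero_iff[OF r.closed[OF x] r.closed[OF x]] by simp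
   then have "x \<ominus>\<^sub>P \<rho> x : ?N" using x sub(2)[OF x] by (simp add: mker_def)
   moreover have "x = (x \<ominus>\<^sub>P \<rho> x) \<oplus>\<^sub>P \<rho> x" using r.M.diff_add_cancel[OF sub(2)[OF x] x] by simp
   ultimately show "x : ?N <+>\<^bsub>P\<^esub> mker P L p" using sub(1)[OF x] by (auto simp: set_add_def set_mult_def)
  qed
 qed (auto simp: set_add_def set_mult_def mker_def)
 then have NP: "?N = car P"
  using e.pcov[OF L] r.submodule_ker unfolding proj_cover_def P_def[symmetric] p_def[symmetric] by blast
 have "u = \<zero>\<^bsub>syzygy K E L\<^esub>" if u: "u :. (syzygy K E L)" for u
 proof -
  have "u : ?N" unfolding NP using u by (simp add: U mker_def)
  then show ?thesis using r(2) u by (simp add: mker_def)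
 qed
 then show ?thesis using r.N.M.zero_closed by blast
qed

text \<open>The kernel of the cover is everything, so the zero submodule supplements it and
  minimality makes the cover zero.\<close>

lemma syzygy_of_zero:
 assumes L: "fd_module K E L" and z: "car L = {\<zero>\<^sub>L}"
 shows "car (syzygy K E L) = {\<zero>\<^bsub>syzygy K E L\<^esub>}"
proof -
 let ?P = "fst (pcov K E L)"
 interpret P: left_module E ?P by (rule e.projD(2)[OF e.pcovD(1)[OF L]])
 have k: "mker ?P L (snd (pcov K E L)) = car ?P"
  using mhom_closed[OF e.pcovD(2)[OF L]] z by (auto simp: mker_def)
 have "{\<zero>\<^sub>?P} <+>\<^bsub>?P\<^esub> car ?P = car ?P" by (force simp: set_add_def set_mult_def)
 then have "{\<zero>\<^sub>?P} = car ?P" using e.pcov[OF L] P.submodule_zero k unfolding proj_cover_def by metis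
 then show ?thesis by (simp add: e.syzygy_eq k)
qed

text \<open>The middle term of a short exact sequence: extend the image of \<open>f\<close> in
  \<open>Y\<close>, lift the extension \<open>h\<close> to \<open>X\<close> through the projective
  cover, and correct the difference, which lies in the kernel of \<open>c\<close>.\<close>

lemma good_extension:
 fixes X Y :: "('a, ('a, 'b) env) fdmod"
 assumes L: "fd_module K E L" and X: "fd_module K E X" and Y: "fd_module K E Y" and c: "c : mhom E X Y" "c ` car X = car Y"
  and gY: "good L Y" and gZ: "good L (submod X (mker X Y c))"
 shows "good L X"
 unfolding good_def
proof
 let ?P = "fst (pcov K E L)" and ?U = "syzygy K E L"
 fix f assume f: "f : mhom E ?U X"
 note P = e.pcovD(1)[OF L] and lU = e.fdmD(1)[OF e.fdm_syzygy[OF L]] and lX = e.fdmD(1)[OF X] and lY = e.fdmD(1)[OF Y]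
 note lP = e.projD(2)[OF P]
 have UP: "u :. ?P" if "u :. ?U" for u using that unfolding e.syzygy_eq by (auto simp: mker_def)
 interpret c: mod_hom E X Y c by (rule mod_homI[OF lX lY c(1)])
 interpret f: mod_hom E ?U X f by (rule mod_homI[OF lU lX f])
 obtain h where h: "h : mhom E ?P Y" "ALL u : car ?U. h u = compose (car ?U) c f u"
  using gY mhom_compose[OF lU f c(1)] unfolding good_def by blast
 obtain h' where h': "h' : mhom E ?P X" "ALL x : car ?P. c (h' x) = h x" using e.proj_lift[OF P X Y c h(1)] by blast
 interpret h: mod_hom E ?P X h' by (rule mod_homI[OF lP lX h'(1)])
 have hU: "restrict h' (car ?U) : mhom E ?U X"
  unfolding e.syzygy_eq using mhom_restrict_sub[OF e.submodule_syzygy[OF L] lP h'(1)] by simp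
 let ?d = "\<lambda>u\<in>car ?U. f u \<ominus>\<^sub>X restrict h' (car ?U) u"
 have "c (?d u) = \<zero>\<^sub>Y" "?d u :. X" if u: "u :. ?U" for u
  using u UP[OF u] h(2) h'(2) c.diff[OF f.closed[OF u] h.closed[OF UP[OF u]]] f.closed[OF u] h.closed[OF UP[OF u]]
   c.N.diff_eq_zero_iff[of "c (f u)" "c (f u)"] by (simp_all add: compose_eq)
 then have "?d : mhom E ?U (submod X (mker X Y c))"
  unfolding mhom_submod[OF c.submodule_ker lX] using mhom_diff[OF lU lX f hU] by (auto simp: mker_def)
 then obtain k where k: "k : mhom E ?P (submod X (mker X Y c))" "ALL u : car ?U. k u = ?d u"
  using gZ unfolding good_def by blast
 have k': "k : mhom E ?P X" using k(1) unfolding mhom_submod[OF c.submodule_ker lX] by blast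
 have "(\<lambda>x\<in>car ?P. h' x \<oplus>\<^sub>X k x) u = f u" if u: "u :. ?U" for u
  using u UP[OF u] k(2) c.M.add_diff_cancel[OF h.closed[OF UP[OF u]] f.closed[OF u]] by simp
 then show "EX F : mhom E ?P X. ALL u : car ?U. F u = f u"
  using mhom_plus[OF lP lX h'(1) k'] by blast
qed

lemma good_retract:
 assumes L: "fd_module K E L" and X: "lmod E X" and H: "lmod E H" and j: "j : mhom E X H" and T: "T : mhom E H X"
  and Tj: "!!x. x :. X ==> T (j x) = x" and g: "good L H"
 shows "good L X"
 unfolding good_def
proof
 note lU = e.fdmD(1)[OF e.fdm_syzygy[OF L]] and lP = e.projD(2)[OF e.pcovD(1)[OF L]]
 fix f assume f: "f : mhom E (syzygy K E L) X"
 obtain F where F: "F : mhom E (fst (pcov K E L)) H" "ALL u : car (syzygy K E L). F u = compose (car (syzygy K E L)) j f u"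
  using g mhom_compose[OF lU f j] unfolding good_def by blast
 have "compose (car (fst (pcov K E L))) T F u = f u" if "u :. (syzygy K E L)" for u
  using that F(2) Tj[OF mhom_closed[OF f that]] e.submodule_syzygy[OF L] unfolding e.syzygy_eq by (simp add: compose_eq mker_def)
 then show "EX F : mhom E (fst (pcov K E L)) X. ALL u : car (syzygy K E L). F u = f u"
  using mhom_compose[OF lP F(1) T] by blast
qed

text \<open>Read off from the duality, where this Hom space embeds into the dual of the maps from
  \<open>P1\<close> to \<open>X\<close>. It is wanted for the equality of dimensions.\<close>

lemma fin_dim_Hom_ar:
 assumes N: "fd_module K A N" and X: "fd_module K A X"
 shows "fin_dim K (Hom_space A X (ar_translate K A N))"
proof -
 define P0 where "P0 = fst (pcov K A N)"
 define P1 where "P1 = fst (pcov K A (syzygy K A N))"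
 define p1 where "p1 = snd (pcov K A (syzygy K A N))"
 have P: "projective K A P0" "projective K A P1" "p1 : mhom A P1 P0"
  unfolding P0_def P1_def p1_def by (rule pcovD(1)[OF N] pcovD(1)[OF fdm_syzygy[OF N]] pcov_syzygy(1)[OF N])+
 obtain B \<xi> where B: "finite B" "B \<subseteq> car P1" "!!b. b : B ==> \<xi> b : mhom A P1 (reg A)"
  "!!p. p :. P1 ==> p = (\<Oplus>\<^bsub>P1\<^esub> b \<in> B. \<xi> b p *\<^sub>P1 b)" by (rule dual_basis[OF P(2)]) blast
 interpret D: dual_presentation K A P0 P1 p1 B \<xi>
  by (intro dual_presentation.intro dual_presentation_axioms.intro fd_algebra_axioms P B)
 have "ar_translate K A N = D.tau"
  unfolding D.tau_def D.T_def D.Im_def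
  by (simp add: ar_translate_def transpose_mod_def case_prod_beta P0_def P1_def p1_def)
 then show ?thesis using D.transpose_duality(1)[OF X] by simp
qed

lemma fin_dim_Hom_tau:
 assumes M: "fd_module K A M" and X: "fd_module K A X"
 shows "fin_dim K (Hom_space A X (tau_n K A n M))"
 unfolding tau_n_def
 using fin_dim_Hom_ar[OF M X] fin_dim_Hom_ar[OF fdm_syzygy_pow[OF fdm_syzygy[OF M]] X] by simp

end


context fd_algebra
begin

interpretation e: fd_algebra K E by (rule fd_algebra_env)

subsection \<open>The radical\<close>

abbreviation "jr \<equiv> jacobson_radical A"

text \<open>A proper left ideal over \<open>I\<close> of greatest dimension is maximal, since any
  larger one would have strictly greater dimension.\<close>

lemma ex_max_left_ideal:
 assumes I: "submodule I A (reg A)" "I ~= car A"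
 shows "EX J. max_left_ideal A J & I \<subseteq> J"
proof -
 let ?V = "scal A (reg A)"
 let ?P = "%J. submodule J A (reg A) & J ~= car A & I \<subseteq> J"
 note lV = lm_scal[OF lm_reg_alg] and fV = fdmD(2)[OF fdm_reg]
 have b: "ALL J. ?P J --> vdim K (submod ?V J) < vdim K ?V"
  using vdim_sub_less[OF fV] submodule_scal[OF lm_reg_alg] by simp
 have "?P I" using I by blast
 from ex_has_greatest_nat[of ?P I "%J. vdim K (submod ?V J)" "vdim K ?V", OF this b]
 obtain J where JJ: "?P J & (ALL J'. ?P J' --> vdim K (submod ?V J') \<le> vdim K (submod ?V J))" by (elim exE)
 note J = conjunct1[OF JJ] spec[OF conjunct2[OF JJ], THEN mp]
 have "J' = J \<or> J' = car A" if J': "submodule J' A (reg A)" "J \<subseteq> J'" for J'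
 proof (rule ccontr)
  assume n: "\<not> (J' = J \<or> J' = car A)"
  note s = submodule_scal[OF lm_reg_alg J'(1)] submodule_scal[OF lm_reg_alg conjunct1[OF J(1)]]
  have "vdim K (submod (submod ?V J') J) < vdim K (submod ?V J')"
   by (rule vdim_sub_less[OF fin_dim_sub[OF fV s(1)] submodule_submod[OF lV s J'(2)]]) (use n in auto)
  moreover have "?P J'" using n J' J(1) by blast
  ultimately show False using J(2)[of J'] by (simp add: submod_submod)
 qed
 then show ?thesis using J(1) unfolding max_left_ideal_def by blast
qed

lemma submodule_jr: "submodule jr A (reg A)"
proof -
 have "jr = \<Inter>(insert (car (reg A)) (Collect (max_left_ideal A)))" by (auto simp: jacobson_radical_def)
 then show ?thesis
  using left_module.submodule_Inter[OF lm_reg_alg, of "insert (car (reg A)) (Collect (max_left_ideal A))"]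
   left_module.submodule_carrier[OF lm_reg_alg] by (auto simp: max_left_ideal_def)
qed

lemma jr_laws:
 shows jr_closed: "x : jr ==> x :. A" and jr_add: "[|x : jr; y : jr|] ==> x \<oplus>\<^sub>A y : jr"
  and jr_left: "[|a :. A; x : jr|] ==> a \<otimes>\<^sub>A x : jr" and jr_minus: "x : jr ==> \<ominus>\<^sub>A x : jr"
  and jr_zero: "\<zero>\<^sub>A : jr"
 using left_module.submodD[OF lm_reg_alg submodule_jr] by simp_all

text \<open>If the left ideal generated by \<open>1 - c\<close> were proper, a maximal left ideal
  would contain it together with \<open>c\<close>, hence also 1.\<close>

lemma jr_left_inverse:
 assumes c: "c : jr" shows "EX u : car A. u \<otimes>\<^sub>A (\<one>\<^sub>A \<ominus>\<^sub>A c) = \<one>\<^sub>A"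
proof -
 interpret R: left_module A "reg A" by (rule lm_reg_alg)
 note cA = jr_closed[OF c]
 let ?y = "\<one>\<^sub>A \<ominus>\<^sub>A c"
 let ?I = "(%u. u \<otimes>\<^sub>A ?y) ` car A"
 have y: "?y :. A" using cA by simp
 have "submodule ?I A (reg A)"
 proof (rule R.submodI)
  show "a \<oplus>\<^bsub>reg A\<^esub> b : ?I" if "a : ?I" "b : ?I" for a b using that y by (auto simp: A.l_distr[symmetric] simp del: A.l_distr)
  show "a \<odot>\<^bsub>reg A\<^esub> x : ?I" if "a :. A" "x : ?I" for a x using that y by (auto simp: A.m_assoc[symmetric] simp del: A.m_assoc)
  show "\<zero>\<^bsub>reg A\<^esub> : ?I" using y by (auto intro!: image_eqI[of _ _ "\<zero>\<^sub>A"])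
 qed (use y in auto)
 moreover have "?I \<subseteq> J ==> \<not> max_left_ideal A J" for J
 proof
  assume J: "?I \<subseteq> J" "max_left_ideal A J"
  then have s: "submodule J A (reg A)" "J ~= car A" unfolding max_left_ideal_def by auto
  have "\<one>\<^sub>A \<otimes>\<^sub>A ?y : J" "c : J" using J c by (auto simp: jacobson_radical_def simp del: A.l_one)
  then have "?y \<oplus>\<^sub>A c : J" using R.submod_add[OF s(1)] y by simp
  then have o: "\<one>\<^sub>A : J" using R.diff_add_cancel[of c "\<one>\<^sub>A"] cA by (simp add: a_minus_def)
  have "x : J" if "x :. A" for x using R.submod_smult[OF s(1) that o] that by simp
  then show False using s R.submod_sub[OF s(1)] by auto
 qed
 ultimately have "?I = car A" using ex_max_left_ideal[of ?I] by blast
 then show ?thesis using A.one_closed by (metis (no_types, lifting) imageE)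
qed

text \<open>A left inverse \<open>u\<close> of \<open>1 - c\<close> equals \<open>1 + u c\<close>,
  again of the form 1 minus a radical element. So \<open>u\<close> has a left inverse too, which
  must be \<open>1 - c\<close>.\<close>

lemma jr_right_inverse:
 assumes c: "c : jr" shows "EX u : car A. (\<one>\<^sub>A \<ominus>\<^sub>A c) \<otimes>\<^sub>A u = \<one>\<^sub>A"
proof -
 note cA = jr_closed[OF c]
 let ?y = "\<one>\<^sub>A \<ominus>\<^sub>A c"
 have y: "?y :. A" using cA by simp
 obtain u where u: "u :. A" "u \<otimes>\<^sub>A ?y = \<one>\<^sub>A" using jr_left_inverse[OF c] by blast
 have "u \<otimes>\<^sub>A ?y = u \<ominus>\<^sub>A u \<otimes>\<^sub>A c" using u(1) cA by (simp add: a_minus_def A.r_distr A.r_minus)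
 then have "u \<ominus>\<^sub>A u \<otimes>\<^sub>A c = \<one>\<^sub>A" using u(2) by simp
 then have "u = \<one>\<^sub>A \<ominus>\<^sub>A (\<ominus>\<^sub>A (u \<otimes>\<^sub>A c))"
  using left_module.diff_add_cancel[OF lm_reg_alg, of "u \<otimes>\<^sub>A c" u] u(1) cA by (simp add: a_minus_def)
 then obtain v where v: "v :. A" "v \<otimes>\<^sub>A u = \<one>\<^sub>A"
  using jr_left_inverse[OF jr_minus[OF jr_left[OF u(1) c]]] by auto
 have "v = v \<otimes>\<^sub>A (u \<otimes>\<^sub>A ?y)" using u v by simp
 also have "\<dots> = ?y" unfolding A.m_assoc[OF v(1) u(1) y, symmetric] v(2) using y by simp
 finally show ?thesis using u(1) v(2) by auto
qed

text \<open>The radical is defined by left ideals, and closure on the right needs an argument: for a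
  maximal \<open>I\<close> without \<open>a\<close>, the left ideal of all \<open>y\<close> with
  \<open>y a\<close> in \<open>I\<close> is maximal as well, hence contains
  \<open>b\<close>.\<close>

lemma jr_right:
 assumes b: "b : jr" and a: "a :. A" shows "b \<otimes>\<^sub>A a : jr"
proof -
 interpret R: left_module A "reg A" by (rule lm_reg_alg)
 note bA = jr_closed[OF b]
 have "b \<otimes>\<^sub>A a : I" if I: "max_left_ideal A I" for I
 proof (cases "a : I")
  case True
  then show ?thesis using R.submod_smult[of I b a] I bA unfolding max_left_ideal_def by simp
 next
  case False
  have s: "submodule I A (reg A)" and m: "!!J. [|submodule J A (reg A); I \<subseteq> J|] ==> J = I \<or> J = car A"
   using I unfolding max_left_ideal_def by auto
  note sI = R.submodD[OF s, simplified]
  let ?J = "{y : car A. y \<otimes>\<^sub>A a : I}"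
  have "submodule ?J A (reg A)"
   by (rule R.submodI) (use a sI in "auto simp: A.l_distr A.m_assoc")
  moreover have "\<one>\<^sub>A \<notin> ?J" using False a by simp
  then have "?J ~= car A" using A.one_closed by blast
  moreover have "J' = ?J \<or> J' = car A" if J': "submodule J' A (reg A)" "?J \<subseteq> J'" for J'
  proof (rule disjCI)
   assume n: "J' ~= car A"
   note sJ = R.submodD[OF J'(1), simplified]
   show "J' = ?J"
   proof (rule ccontr)
    assume "J' ~= ?J"
    then obtain y where y: "y : J'" "y \<otimes>\<^sub>A a \<notin> I" using J'(2) sJ(1) by blast
    have yA: "y :. A" using sJ(1) y(1) .
    \<comment> \<open>The left ideal \<open>I + A y a\<close> strictly contains \<open>I\<close>,
      hence contains \<open>a\<close>. Solving \<open>a = i + z y a\<close> puts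
      \<open>1 - z y\<close> into \<open>?J\<close>, so the larger ideal \<open>J'\<close> contains
      both \<open>1 - z y\<close> and \<open>z y\<close>.\<close>
    let ?S = "{i \<oplus>\<^sub>A z \<otimes>\<^sub>A (y \<otimes>\<^sub>A a) | i z. i : I & z :. A}"
    have S: "i \<oplus>\<^sub>A z \<otimes>\<^sub>A (y \<otimes>\<^sub>A a) : ?S" if "i : I" "z :. A" for i z using that by blast
    have "submodule ?S A (reg A)"
    proof (rule R.submodI)
     show "?S \<subseteq> car (reg A)" using sI(1) yA a by auto
     show "\<zero>\<^bsub>reg A\<^esub> : ?S" using S[OF sI(2) A.zero_closed] yA a by simp
    next
     fix u v assume "u : ?S" "v : ?S"
     then obtain i z i' z' where uv: "u = i \<oplus>\<^sub>A z \<otimes>\<^sub>A (y \<otimes>\<^sub>A a)" "v = i' \<oplus>\<^sub>A z' \<otimes>\<^sub>A (y \<otimes>\<^sub>A a)"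
      "i : I" "z :. A" "i' : I" "z' :. A" by blast
     then have "u \<oplus>\<^sub>A v = (i \<oplus>\<^sub>A i') \<oplus>\<^sub>A (z \<oplus>\<^sub>A z') \<otimes>\<^sub>A (y \<otimes>\<^sub>A a)"
      using sI(1) yA a by (simp add: A.l_distr A.add.m_ac)
     then show "u \<oplus>\<^bsub>reg A\<^esub> v : ?S" using S[OF sI(3)[OF uv(3,5)], of "z \<oplus>\<^sub>A z'"] uv(4,6) by simp
    next
     fix c u assume c: "c :. A" and "u : ?S"
     then obtain i z where u: "u = i \<oplus>\<^sub>A z \<otimes>\<^sub>A (y \<otimes>\<^sub>A a)" "i : I" "z :. A" by blast
     then have "c \<otimes>\<^sub>A u = c \<otimes>\<^sub>A i \<oplus>\<^sub>A (c \<otimes>\<^sub>A z) \<otimes>\<^sub>A (y \<otimes>\<^sub>A a)"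
      using sI(1) yA a c by (simp add: A.r_distr A.m_assoc)
     then show "c \<odot>\<^bsub>reg A\<^esub> u : ?S" using S[OF sI(4)[OF c u(2)], of "c \<otimes>\<^sub>A z"] c u(3) by simp
    qed
    moreover have "I \<subseteq> ?S" using S[OF _ A.zero_closed] sI(1) yA a by fastforce
    moreover have "y \<otimes>\<^sub>A a : ?S" using S[OF sI(2) A.one_closed] yA a by simp
    ultimately have "a : ?S" using m[of ?S] y(2) a by blast
    then obtain i z where iz: "a = i \<oplus>\<^sub>A z \<otimes>\<^sub>A (y \<otimes>\<^sub>A a)" "i : I" "z :. A" by blast
    have "(\<one>\<^sub>A \<ominus>\<^sub>A z \<otimes>\<^sub>A y) \<otimes>\<^sub>A a = a \<ominus>\<^sub>A z \<otimes>\<^sub>A (y \<otimes>\<^sub>A a)"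
     using iz(3) yA a by (simp add: a_minus_def A.l_distr A.l_minus A.m_assoc)
    also have "\<dots> = i"
     by (subst iz(1)) (use R.add_diff_cancel_right[of i "z \<otimes>\<^sub>A (y \<otimes>\<^sub>A a)"] sI(1)[OF iz(2)] iz(3) yA a in "simp add: a_minus_def")
    finally have "\<one>\<^sub>A \<ominus>\<^sub>A z \<otimes>\<^sub>A y : J'" using iz yA J'(2) by auto
    then have "(\<one>\<^sub>A \<ominus>\<^sub>A z \<otimes>\<^sub>A y) \<oplus>\<^sub>A z \<otimes>\<^sub>A y : J'" using sJ(3) sJ(4)[OF iz(3) y(1)] by blast
    then have "\<one>\<^sub>A : J'" using R.diff_add_cancel[of "z \<otimes>\<^sub>A y" "\<one>\<^sub>A"] iz(3) yA by (simp add: a_minus_def)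
    then have "x : J'" if "x :. A" for x using sJ(4)[OF that] that by fastforce
    then show False using n sJ(1) by blast
   qed
  qed
  ultimately have "max_left_ideal A ?J" unfolding max_left_ideal_def by blast
  then show ?thesis using b unfolding jacobson_radical_def by blast
 qed
 then show ?thesis using bA a by (simp add: jacobson_radical_def)
qed

text \<open>Choose a nonzero \<open>x\<close> whose right submodule \<open>x A\<close> has least
  dimension. If \<open>x b\<close> were nonzero for a radical \<open>b\<close>, then
  \<open>x b A\<close> would be \<open>x A\<close>, so \<open>x = x b a\<close> for some
  \<open>a\<close>, and \<open>1 - b a\<close> is invertible on the right, forcing
  \<open>x = 0\<close>. This replaces nilpotency of the radical.\<close>

lemma right_socle:
 assumes X: "fd_module K E X" and nz: "car X ~= {\<zero>\<^sub>X}"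
 defines "Z \<equiv> {x : car X. ALL b : jr. tt \<one>\<^sub>A b *\<^sub>X x = \<zero>\<^sub>X}"
 shows "submodule Z E X" "EX x : Z. x ~= \<zero>\<^sub>X"
proof -
 note lX = e.fdmD(1)[OF X]
 interpret X: left_module E X by (rule lX)
 have z: "tt a b *\<^sub>X \<zero>\<^sub>X = \<zero>\<^sub>X" if "a :. A" "b :. A" for a b using tt(1)[OF that] by simp
 show "submodule Z E X"
 proof (rule env_submoduleI[OF lX])
  show "tt a b *\<^sub>X x : Z" if ab: "a :. A" "b :. A" and x: "x : Z" for a b x
  proof -
   have xX: "x :. X" using x by (simp add: Z_def)
   have "tt \<one>\<^sub>A c *\<^sub>X (tt a b *\<^sub>X x) = tt a \<one>\<^sub>A *\<^sub>X (tt \<one>\<^sub>A (b \<otimes>\<^sub>A c) *\<^sub>X x)" if "c : jr" for c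
    using jr_closed[OF that] ab xX by (simp add: tt_act[OF lX])
   moreover have "tt \<one>\<^sub>A (b \<otimes>\<^sub>A c) *\<^sub>X x = \<zero>\<^sub>X" if "c : jr" for c
    using x jr_left[OF ab(2) that] by (simp add: Z_def)
   ultimately show ?thesis using tt_act(1)[OF lX ab xX] z ab by (simp add: Z_def)
  qed
 qed (auto simp: Z_def z jr_closed tt_act[OF lX])
 have V: "lmod K (scal E X)" and fV: "fin_dim K (scal E X)" by (rule e.lm_scal[OF lX], rule e.fdmD(2)[OF X])
 let ?C = "%x. (%a. tt \<one>\<^sub>A a *\<^sub>X x) ` car A"
 have sC: "submodule (?C x) K (scal E X)" if x: "x :. X" for x
 proof (rule left_module.submodI[OF V])
  show "u \<oplus>\<^bsub>scal E X\<^esub> v : ?C x" if "u : ?C x" "v : ?C x" for u v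
   using that x by (auto simp: tt_act(4)[OF lX, symmetric])
  show "c \<odot>\<^bsub>scal E X\<^esub> u : ?C x" if c: "c :. K" and u: "u : ?C x" for c u
  proof -
   obtain a where a: "a :. A" "u = tt \<one>\<^sub>A a *\<^sub>X x" using u by blast
   have "c \<odot>\<^bsub>scal E X\<^esub> u = tt \<one>\<^sub>A (a \<otimes>\<^sub>A unit_map c) *\<^sub>X x"
    using tt_act(7)[OF lX A.one_closed A.one_closed _ c, of u] a c x by (simp add: e.scal_smult tt_act[OF lX] del: scal_sel(4))
   then show ?thesis using a c by simp
  qed
  have "\<zero>\<^bsub>scal E X\<^esub> = tt \<one>\<^sub>A \<zero>\<^sub>A *\<^sub>X x"
   using X.smult_l_null[OF x] tt(5)[OF A.one_closed A.zero_closed, of "\<zero>\<^sub>K"] left_module.smult_l_null[OF lm_alg(1), of "\<zero>\<^sub>A"]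
    left_module.smult_l_null[OF lm_env tt(1)[OF A.one_closed A.zero_closed]] by simp
  then show "\<zero>\<^bsub>scal E X\<^esub> : ?C x" by simp
 qed (use x tt_act[OF lX] in auto)
 have "EX x. x :. X & x ~= \<zero>\<^sub>X" using nz X.M.zero_closed by blast
 then obtain x0 where "x0 :. X & x0 ~= \<zero>\<^sub>X" by blast
 from ex_has_least_nat[of "%x. x :. X & x ~= \<zero>\<^sub>X" x0 "%x. vdim K (submod (scal E X) (?C x))", OF this]
 obtain x where xx: "(x :. X & x ~= \<zero>\<^sub>X) & (ALL y. y :. X & y ~= \<zero>\<^sub>X -->
  vdim K (submod (scal E X) (?C x)) \<le> vdim K (submod (scal E X) (?C y)))" by (elim exE)
 then have x: "x :. X" "x ~= \<zero>\<^sub>X" by simp_all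
 have xm: "vdim K (submod (scal E X) (?C x)) \<le> vdim K (submod (scal E X) (?C y))" if "y :. X" "y ~= \<zero>\<^sub>X" for y
  using spec[OF conjunct2[OF xx], of y] that by simp
 have "tt \<one>\<^sub>A b *\<^sub>X x = \<zero>\<^sub>X" if b: "b : jr" for b
 proof (rule ccontr)
  assume n: "tt \<one>\<^sub>A b *\<^sub>X x ~= \<zero>\<^sub>X"
  note bA = jr_closed[OF b]
  let ?y = "tt \<one>\<^sub>A b *\<^sub>X x"
  have y: "?y :. X" using x bA by (simp add: tt_act[OF lX])
  have sub: "?C ?y \<subseteq> ?C x" using x(1) bA by (auto simp: tt_act[OF lX])
  have "?C ?y = ?C x"
  proof (rule ccontr)
   assume "?C ?y ~= ?C x"
   then have "vdim K (submod (submod (scal E X) (?C x)) (?C ?y)) < vdim K (submod (scal E X) (?C x))"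
    by (intro vdim_sub_less[OF fin_dim_sub[OF fV sC[OF x(1)]] submodule_submod[OF V sC[OF x(1)] sC[OF y] sub]]) simp
   then show False using xm[OF y n] by (simp add: submod_submod)
  qed
  moreover have "x : ?C x" using tt_one[OF lX x(1)] by (metis A.one_closed imageI)
  ultimately obtain a where a: "a :. A" "x = tt \<one>\<^sub>A a *\<^sub>X ?y" by blast
  then have xa: "x = tt \<one>\<^sub>A (b \<otimes>\<^sub>A a) *\<^sub>X x" using bA x by (simp add: tt_act[OF lX])
  \<comment> \<open>From \<open>x = x c\<close> it follows that \<open>x (1 - c)\<close> is zero;
    multiplying by a right inverse of \<open>1 - c\<close> gives the contradiction.\<close>
  let ?c = "b \<otimes>\<^sub>A a"
  have c: "?c :. A" using bA a by simp
  have "tt \<one>\<^sub>A (\<one>\<^sub>A \<ominus>\<^sub>A ?c) *\<^sub>X x \<oplus>\<^sub>X x = tt \<one>\<^sub>A ((\<one>\<^sub>A \<ominus>\<^sub>A ?c) \<oplus>\<^sub>A ?c) *\<^sub>X x"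
   using tt_act(4)[OF lX A.one_closed _ x(1) c, of "\<one>\<^sub>A \<ominus>\<^sub>A ?c"] c xa by simp
  also have "\<dots> = x" using left_module.diff_add_cancel[OF lm_reg_alg, of ?c "\<one>\<^sub>A"] c tt_one[OF lX x(1)] by (simp add: a_minus_def)
  finally have "tt \<one>\<^sub>A (\<one>\<^sub>A \<ominus>\<^sub>A ?c) *\<^sub>X x = \<zero>\<^sub>X"
   using X.M.add.r_cancel_one'[of x "tt \<one>\<^sub>A (\<one>\<^sub>A \<ominus>\<^sub>A ?c) *\<^sub>X x"] x(1) c
   by (metis A.minus_closed A.one_closed X.M.l_neg X.M.add.inv_closed X.M.add.r_cancel_one tt_act(1)[OF lX])
  moreover obtain u where u: "u :. A" "(\<one>\<^sub>A \<ominus>\<^sub>A ?c) \<otimes>\<^sub>A u = \<one>\<^sub>A"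
   using jr_right_inverse[OF jr_right[OF b a(1)]] by blast
  moreover have "x = tt \<one>\<^sub>A u *\<^sub>X (tt \<one>\<^sub>A (\<one>\<^sub>A \<ominus>\<^sub>A ?c) *\<^sub>X x)"
   using u c x(1) tt_one[OF lX x(1)] by (simp add: tt_act[OF lX])
  ultimately show False using x(2) z[of "\<one>\<^sub>A" u] by simp
 qed
 then show "EX x : Z. x ~= \<zero>\<^sub>X" using x unfolding Z_def by blast
qed

text \<open>Take the value at 1 of a bimodule section of the multiplication map. Multiplying it by
  \<open>s\<close> on either side gives the value of the section at \<open>s\<close>.\<close>

lemma separable_casimir:
 assumes "separable_alg K A"
 shows "EX C : car E. C \<odot>\<^bsub>reg_bimod K A\<^esub> \<one>\<^sub>A = \<one>\<^sub>A & (ALL s : car A. tt s \<one>\<^sub>A \<otimes>\<^sub>E C = tt \<one>\<^sub>A s \<otimes>\<^sub>E C)"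
proof -
 have c: "car (reg_bimod K A) = car A" by (simp add: reg_bimod_def)
 interpret B: left_module E "reg_bimod K A" by (rule e.fdmD(1)[OF fdm_reg_bimod])
 let ?m = "\<lambda>C\<in>car (reg E). C \<odot>\<^bsub>reg_bimod K A\<^esub> \<one>\<^sub>A"
 have m: "?m : mhom E (reg E) (reg_bimod K A)"
  by (rule mhom_restrictI[OF e.lm_reg_alg]) (simp_all add: c B.smult_l_distr B.smult_assoc B.smult_closed[unfolded c] )
 have "?m ` car (reg E) = car (reg_bimod K A)"
 proof
  show "car (reg_bimod K A) \<subseteq> ?m ` car (reg E)"
  proof
   fix x assume "x :. (reg_bimod K A)"
   then have x: "x :. A" by (simp add: c)
   show "x : ?m ` car (reg E)"
    by (rule image_eqI[of _ _ "tt x \<one>\<^sub>A"]) (use x tt(1)[OF x A.one_closed] reg_bimod_pure[OF x A.one_closed A.one_closed] in simp_all)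
  qed
 qed (use mhom_closed[OF m] in blast)
 then obtain s where s: "s : mhom E (reg_bimod K A) (reg E)" "ALL p : car A. ?m (s p) = p"
  using e.projective_section[OF assms[unfolded separable_alg_def] e.fdm_reg m] by (auto simp: c)
 have C: "s \<one>\<^sub>A :. E" using mhom_closed[OF s(1), of "\<one>\<^sub>A"] by (simp add: c)
 have "tt a b \<otimes>\<^sub>E s \<one>\<^sub>A = s (a \<otimes>\<^sub>A b)" if "a :. A" "b :. A" for a b
  using mhom_smult[OF s(1) tt(1)[OF that], of "\<one>\<^sub>A"] that by (simp add: c reg_bimod_pure)
 then show ?thesis using bspec[OF s(2) A.one_closed] C by (intro bexI[OF _ C]) auto
qed

end


section \<open>The separable quotient and the vanishing of high syzygies\<close>

context fd_algebra
begin

interpretation e: fd_algebra K E by (rule fd_algebra_env)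

abbreviation "rq \<equiv> quot_alg A jr"
abbreviation "cs \<equiv> %a. jr +>\<^sub>A a"

lemma submod_of_jr: "submod_of K A jr"
proof (rule submod_ofI[OF lm_alg(1) left_module.submodI[OF lm_alg(1)]])
 show "c *\<^sub>A x : jr" if "c :. K" "x : jr" for c x
  using jr_left[OF unit_map[OF that(1)] that(2)] that jr_closed by (simp add: unit_map_mult)
qed (auto simp: jr_laws)

lemma rq_laws:
 "car rq = cs ` car A" "\<one>\<^sub>rq = cs \<one>\<^sub>A"
 "[|a :. A; b :. A|] ==> cs a \<oplus>\<^sub>rq cs b = cs (a \<oplus>\<^sub>A b)"
 "[|a :. A; b :. A|] ==> cs a \<otimes>\<^sub>rq cs b = cs (a \<otimes>\<^sub>A b)"
 "[|c :. K; a :. A|] ==> c *\<^sub>rq cs a = cs (c *\<^sub>A a)"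
 "[|a :. A; b :. A|] ==> cs a = cs b \<longleftrightarrow> a \<ominus>\<^sub>A b : jr"
proof -
 interpret q: submod_of K A jr by (rule submod_of_jr)
 have "ideal jr A"
  by (rule idealI[OF A.ring_axioms A.add.subgroupI]) (use jr_laws jr_right jr_zero in auto)
 then show "[|a :. A; b :. A|] ==> cs a \<otimes>\<^sub>rq cs b = cs (a \<otimes>\<^sub>A b)"
  by (simp add: quot_alg_def ideal.rcoset_mult_add)
qed (simp_all add: quot_alg_def quot_carrier submod_of.quot_add[OF submod_of_jr] submod_of.quot_smult[OF submod_of_jr] submod_of.cos_eq[OF submod_of_jr])

lemma fd_algebra_rq: "fd_algebra K rq"
proof -
 interpret q: submod_of K A jr by (rule submod_of_jr)
 note L = rq_laws
 have lm: "lmod K rq"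
  by (rule left_module_image[OF q.left_module_quot, where f = "%x. x"]) (simp_all add: quot_alg_def)
 have "monoid rq"
  by (rule monoidI) (auto simp: L(1,2,4) A.m_assoc)
 then have r: "ring rq"
  by (intro ring.intro ring_axioms.intro left_module_group[OF lm]) (auto simp: L(1,3,4) A.l_distr A.r_distr)
 have h: "(\<lambda>a\<in>car A. cs a) : mhom K A rq"
  by (rule mhom_restrictI[OF lm_alg(1)]) (simp_all add: L)
 show ?thesis
  by (intro fd_algebra.intro fd_algebra_axioms.intro K.field_axioms r lm[folded module_iff] fin_dim_onto[OF finite_dimensional lm h])
   (auto simp: L(1,4,5) smult_mult_left smult_mult_right)
qed

text \<open>Write \<open>e0\<close> as a sum of tensors \<open>e \<otimes> e'\<close> in the
  quotient algebra. The map \<open>j\<close> sends \<open>x\<close> to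
  \<open>s \<mapsto> x s\<close>, and \<phi> is sent back to the sum of the elements
  \<open>\<phi>(e) e'\<close>. The Casimir identity makes this right linear, and the product of
  \<open>e0\<close> being 1 makes it a retraction of \<open>j\<close>.\<close>

lemma good_killed:
 fixes X :: "('a, ('a, 'b) env) fdmod"
 assumes sep: "separable_alg K rq" and L: "fd_module K E L" and X: "fd_module K E X"
  and kill: "!!b x. [|b : jr; x :. X|] ==> tt \<one>\<^sub>A b *\<^sub>X x = \<zero>\<^sub>X"
  and g: "!!S :: ('a, 'b) fdmod. fd_module K A S ==> good L (HB S (lft X))"
 shows "good L X"
proof -
 interpret S: fd_algebra K rq by (rule fd_algebra_rq)
 interpret es: fd_algebra K "env_alg K rq" by (rule S.fd_algebra_env)
 note R = rq_laws and lX = e.fdmD(1)[OF X]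
 interpret X: left_module E X by (rule lX)
 interpret V: left_module K "scal E X" by (rule e.lm_scal[OF lX])
 have co: "a_r_coset (reg A) = a_r_coset A" by (intro ext) (simp add: a_r_coset_def r_coset_def)
 \<comment> \<open>Two versions of the quotient are in use: \<open>?Q\<close> as a left module,
   copied into the universe as \<open>S\<close> because \<open>g\<close> quantifies there, and
   \<open>rq\<close> as an algebra carrying the Casimir element. Both consist of the same
   cosets.\<close>
 let ?Q = "quot (reg A) jr"
 interpret sq: submod_of A "reg A" jr by (rule submod_ofI[OF lm_reg_alg submodule_jr])
 note Qf = sq.cos_closed[unfolded co] sq.quot_add[unfolded co] sq.quot_smult[unfolded co]
 obtain S :: "('a, 'b) fdmod" and f where S: "fd_module K A S" "f : miso A ?Q S"
  using ex_coordinate_module[OF fdm_quot[OF fdm_reg submodule_jr]] by blast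
 note lS = fdmD(1)[OF S(1)] and lN = lm_lft[OF lX]
 have f: "f : mhom A ?Q S" "inj_on f (car ?Q)" "f ` car ?Q = car S" using S(2) unfolding miso_def bij_betw_def by auto
 interpret f: mod_hom A ?Q S f by (rule mod_homI[OF sq.left_module_quot lS f(1)])
 define k where "k a = f (cs a)" for a
 have kc: "k a :. S" "b :. A ==> k (a \<oplus>\<^sub>A b) = k a \<oplus>\<^sub>S k b"
  "b :. A ==> k (b \<otimes>\<^sub>A a) = b *\<^sub>S k a" if "a :. A" for a b
  using that Qf f.closed[of "cs a"] f.add[of "cs a" "cs b"] f.smult[of b "cs a"] unfolding k_def by simp_all
 have keq: "cs a = cs b" if "k a = k b" "a :. A" "b :. A" for a b
  using inj_onD[OF f(2)] that Qf(1) unfolding k_def by simp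
 have "car S = k ` car A"
  unfolding f(3)[symmetric] quot_carrier co by (auto simp: k_def)
 then have "EX a : car A. k a = q" if "q :. S" for q using that by auto
 \<comment> \<open>A set-theoretic choice of representatives for the elements of \<open>S\<close>;
   by \<open>act\<close>, the right action on \<open>X\<close> does not depend on it.\<close>
 then obtain w where w: "!!q. q :. S ==> w q :. A & k (w q) = q" by metis
 have act: "tt c a *\<^sub>X x = tt c b *\<^sub>X x"
  if e: "cs a = cs b" and ab: "a :. A" "b :. A" "c :. A" and x: "x :. X" for a b c x
 proof -
  have d: "a \<ominus>\<^sub>A b : jr" using e R(6)[OF ab(1,2)] by simp
  have dA: "a \<ominus>\<^sub>A b :. A" using ab by simp
  have "tt c a *\<^sub>X x = tt c ((a \<ominus>\<^sub>A b) \<oplus>\<^sub>A b) *\<^sub>X x"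
   using left_module.diff_add_cancel[OF lm_reg_alg, of b a] ab by (simp add: a_minus_def)
  also have "\<dots> = tt c \<one>\<^sub>A *\<^sub>X (tt \<one>\<^sub>A (a \<ominus>\<^sub>A b) *\<^sub>X x) \<oplus>\<^sub>X tt c b *\<^sub>X x"
   using tt_act(2,4)[OF lX _ dA x] dA ab x by simp
  also have "\<dots> = tt c b *\<^sub>X x"
   using kill[OF d x] tt(1)[OF ab(3) A.one_closed] tt_act(1)[OF lX ab(3,2) x] by simp
  finally show ?thesis .
 qed
 define j where "j = (\<lambda>x\<in>car X. \<lambda>q\<in>car S. tt \<one>\<^sub>A (w q) *\<^sub>X x)"
 have jk: "j x (k a) = tt \<one>\<^sub>A a *\<^sub>X x" if "x :. X" "a :. A" for x a
  using act[OF keq[of "w (k a)" a] _ _ A.one_closed that(1)] w[OF kc(1)[OF that(2)]] that kc(1) by (simp add: j_def)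
 have sk: "P q" if "!!a. a :. A ==> P (k a)" "q :. S" for P q using that w[of q] by metis
 have jH: "j x :. (HB S (lft X))" if x: "x :. X" for x
 proof -
  have "(\<lambda>q\<in>car S. j x q) :. (HB S (lft X))"
  proof (rule HBI[OF lS])
   show "j x q :. (lft X)" if "q :. S" for q using that x w[OF that] by (simp add: j_def tt_act[OF lX])
   show "j x (q \<oplus>\<^sub>S q') = j x q \<oplus>\<^bsub>lft X\<^esub> j x q'" if "q :. S" "q' :. S" for q q'
    using w[OF that(1)] w[OF that(2)] kc(2)[of "w q" "w q'"] jk[OF x, of "w q"] jk[OF x, of "w q'"] jk[OF x, of "w q \<oplus>\<^sub>A w q'"] x
    by (simp add: tt_act[OF lX])
   show "j x (unit_map c *\<^sub>S q) = unit_map c \<odot>\<^bsub>lft X\<^esub> j x q" if c: "c :. K" and q: "q :. S" for c q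
    using w[OF q] kc(3)[of "w q" "unit_map c"] jk[OF x, of "w q"] jk[OF x, of "unit_map c \<otimes>\<^sub>A w q"] x c
     tt(4)[OF A.one_closed _ c, of "w q"] tt(5)[OF A.one_closed _ c, of "w q"]
    by (simp add: tt_act(2)[OF lX] unit_map_def smult_mult_left)
  qed
  moreover have "(\<lambda>q\<in>car S. j x q) = j x" using x by (auto simp: j_def restrict_def)
  ultimately show ?thesis by simp
 qed
 have Heq: "\<phi> = \<psi>" if "\<phi> :. (HB S (lft X))" "\<psi> :. (HB S (lft X))" "!!a. a :. A ==> \<phi> (k a) = \<psi> (k a)" for \<phi> \<psi>
 proof (rule mhom_eqI[of \<phi> K "scal A S" "scal A (lft X)" \<psi> K])
  show "\<phi> q = \<psi> q" if "q :. (scal A S)" for q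
   using \<open>!!a. a :. A ==> \<phi> (k a) = \<psi> (k a)\<close> w[of q] that by (metis scal_sel(1))
 qed (use that in simp_all)
 note lH = lm_HB[OF lS lN] and Hp = HB_pure[OF lS lN]
 interpret H: left_module E "HB S (lft X)" by (rule lH)
 have Hk: "\<phi> (k a) :. X" if "\<phi> :. (HB S (lft X))" "a :. A" for \<phi> a
  using HBD(1)[OF that(1) kc(1)[OF that(2)]] by simp
 have pk: "(tt a b \<odot>\<^bsub>HB S (lft X)\<^esub> \<phi>) (k c) = tt a \<one>\<^sub>A *\<^sub>X \<phi> (k (b \<otimes>\<^sub>A c))"
  if "a :. A" "b :. A" "c :. A" "\<phi> :. (HB S (lft X))" for a b c \<phi>
  using that kc[OF that(3)] Hp[OF that(1,2,4)] by simp
 have j: "j : mhom E X (HB S (lft X))"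
 proof (rule env_homI[OF lX lH jH])
  show "j : extensional (car X)" by (simp add: j_def)
  show "j (x \<oplus>\<^sub>X y) = j x \<oplus>\<^bsub>HB S (lft X)\<^esub> j y" if "x :. X" "y :. X" for x y
   by (rule Heq[OF jH H.M.add.m_closed[OF jH[OF that(1)] jH[OF that(2)]]]) (use that kc(1) jk in "simp_all add: tt_act[OF lX]")
  show "j (tt a b *\<^sub>X x) = tt a b \<odot>\<^bsub>HB S (lft X)\<^esub> j x"
   if "a :. A" "b :. A" "x :. X" for a b x
  proof (rule Heq[OF jH H.smult_closed[OF tt(1)[OF that(1,2)] jH[OF that(3)]]])
   show "j (tt a b *\<^sub>X x) (k c) = (tt a b \<odot>\<^bsub>HB S (lft X)\<^esub> j x) (k c)" if c: "c :. A" for c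
    unfolding pk[OF \<open>a :. A\<close> \<open>b :. A\<close> c jH[OF \<open>x :. X\<close>]]
    using that \<open>a :. A\<close> \<open>b :. A\<close> \<open>x :. X\<close> by (simp add: jk tt_act[OF lX])
  qed (use that in "simp add: tt_act[OF lX]")
 qed
 have "EX a : car A. cs a = s" if "s :. rq" for s using that R(1) by auto
 then obtain p where p: "!!s. s :. rq ==> p s :. A & cs (p s) = s" by metis
 \<comment> \<open>The elements \<open>\<phi>(s) t\<close> for \<open>s\<close> and \<open>t\<close>
   in the quotient algebra. The representative of \<open>t\<close> does not matter because the
   radical kills \<open>X\<close> from the right.\<close>
 define \<beta> where "\<beta> \<phi> s t = tt \<one>\<^sub>A (p t) *\<^sub>X \<phi> (f s)" for \<phi> s t
 have cR: "cs a :. rq" if "a :. A" for a using that R(1) by simp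
 have bk: "\<beta> \<phi> (cs a) (cs b) = tt \<one>\<^sub>A b *\<^sub>X \<phi> (k a)"
  if "\<phi> :. (HB S (lft X))" "a :. A" "b :. A" for \<phi> a b
  unfolding \<beta>_def k_def[symmetric] using p[OF cR[OF that(3)]] by (intro act) (use that Hk in auto)
 have bl: "S.blin (scal E X) (\<beta> \<phi>)" if phi: "\<phi> :. (HB S (lft X))" for \<phi>
 proof -
  have ku: "k (c *\<^sub>A a) = unit_map c *\<^sub>S k a" if "c :. K" "a :. A" for c a
   using kc(3)[OF that(2) unit_map[OF that(1)]] that by (simp add: unit_map_mult)
  have u: "tt (unit_map c) \<one>\<^sub>A *\<^sub>X x = (c *\<^sub>E \<one>\<^sub>E) *\<^sub>X x" if "c :. K" "x :. X" for c x
   using tt_act(6)[OF lX A.one_closed A.one_closed that(2,1)] by (simp add: e.unit_map_def)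
  have u': "tt \<one>\<^sub>A (c *\<^sub>A b) *\<^sub>X x = (c *\<^sub>E \<one>\<^sub>E) *\<^sub>X (tt \<one>\<^sub>A b *\<^sub>X x)" if "c :. K" "b :. A" "x :. X" for c b x
   using tt(5)[OF A.one_closed that(2,1)] X.smult_assoc[of "e.unit_map c" "tt \<one>\<^sub>A b" x] that tt(1)[OF A.one_closed that(2)]
    e.unit_map_mult(1)[OF that(1), of "tt \<one>\<^sub>A b"] e.unit_map[OF that(1)] by (simp add: e.unit_map_def)
  have v: "tt \<one>\<^sub>A b *\<^sub>X (e.unit_map c *\<^sub>X x) = (c *\<^sub>E \<one>\<^sub>E) *\<^sub>X (tt \<one>\<^sub>A b *\<^sub>X x)" if "c :. K" "b :. A" "x :. X" for c b x
   using e.unit_map_comm(1)[OF lX that(1) tt(1)[OF A.one_closed that(2)] that(3)] by (simp add: e.unit_map_def[symmetric])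
  show ?thesis
   unfolding S.blin_def R(1) ball_simps(9)
   by (intro ballI conjI)
    (use HBD(2,3)[OF phi] in "simp_all add: R bk[OF phi] kc Hk[OF phi] tt_act[OF lX] ku u u' v")
 qed
 note lV = e.lm_scal[OF lX]
 \<comment> \<open>The linear extension of \<beta> to the enveloping algebra of the quotient; the
   retraction is its value at the Casimir element.\<close>
 define T where "T \<phi> C = (if C :. S.E then tensor_lift K (scal E X) (\<beta> \<phi>) C else undefined)" for \<phi> C
 have Th: "T \<phi> : mhom K S.E (scal E X)" if "\<phi> :. (HB S (lft X))" for \<phi>
 proof -
  have "T \<phi> = (\<lambda>C\<in>car S.E. tensor_lift K (scal E X) (\<beta> \<phi>) C)" by (simp add: T_def fun_eq_iff restrict_def)
  then show ?thesis using S.env_lift(1)[OF lV bl[OF that]] by simp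
 qed
 have Tp: "T \<phi> (S.tt (cs a) (cs b)) = tt \<one>\<^sub>A b *\<^sub>X \<phi> (k a)"
  if "\<phi> :. (HB S (lft X))" "a :. A" "b :. A" for \<phi> a b
  using S.env_lift(2)[OF lV bl[OF that(1)] cR[OF that(2)] cR[OF that(3)]] S.tt(1)[OF cR[OF that(2)] cR[OF that(3)]] bk[OF that]
  by (simp add: T_def)
 have Tc: "T \<phi> C :. X" if "\<phi> :. (HB S (lft X))" "C :. S.E" for \<phi> C
  using mhom_closed[OF Th[OF that(1)] that(2)] by simp
 have Ta: "T \<phi> (C \<oplus>\<^bsub>S.E\<^esub> D) = T \<phi> C \<oplus>\<^sub>X T \<phi> D" if "\<phi> :. (HB S (lft X))" "C :. S.E" "D :. S.E" for \<phi> C D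
  using mhom_add[OF Th[OF that(1)] that(2,3)] by simp
 have ind [consumes 1, case_names 1 2]: "P C" if C: "C :. S.E" and P: "!!a b. [|a :. A; b :. A|] ==> P (S.tt (cs a) (cs b))"
  "!!C D. [|C :. S.E; D :. S.E; P C; P D|] ==> P (C \<oplus>\<^bsub>S.E\<^esub> D)" for P C
  by (rule S.env_induct[where P = P, OF C _ P(2)]) (use P(1) R(1) in auto)
 obtain e0 where e0: "e0 :. S.E" "e0 \<odot>\<^bsub>reg_bimod K rq\<^esub> \<one>\<^sub>rq = \<one>\<^sub>rq"
  "!!s. s :. rq ==> S.tt s \<one>\<^sub>rq \<otimes>\<^bsub>S.E\<^esub> e0 = S.tt \<one>\<^sub>rq s \<otimes>\<^bsub>S.E\<^esub> e0"
  using S.separable_casimir[OF sep] by blast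
 have tm: "S.tt (cs a) (cs b) :. S.E" if "a :. A" "b :. A" for a b
  by (rule S.tt(1)[OF cR[OF that(1)] cR[OF that(2)]])
 have tp: "S.tt (cs a) (cs b) \<otimes>\<^bsub>S.E\<^esub> S.tt (cs a') (cs b') = S.tt (cs (a \<otimes>\<^sub>A a')) (cs (b' \<otimes>\<^sub>A b))"
  if "a :. A" "b :. A" "a' :. A" "b' :. A" for a b a' b'
  using S.tt_mult[OF cR[OF that(1)] cR[OF that(2)] cR[OF that(3)] cR[OF that(4)]] that by (simp add: R(4))
 have o: "\<one>\<^sub>rq = cs \<one>\<^sub>A" by (rule R(2))
 have T1: "T (\<phi> \<oplus>\<^bsub>HB S (lft X)\<^esub> \<psi>) C = T \<phi> C \<oplus>\<^sub>X T \<psi> C"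
  if C: "C :. S.E" and h: "\<phi> :. (HB S (lft X))" "\<psi> :. (HB S (lft X))" for \<phi> \<psi> C
  using C
 proof (induct rule: ind)
  case (1 a b)
  have "(\<phi> \<oplus>\<^bsub>HB S (lft X)\<^esub> \<psi>) (k a) = \<phi> (k a) \<oplus>\<^sub>X \<psi> (k a)" using kc(1)[OF 1(1)] by simp
  then show ?case using 1 Tp[OF H.M.add.m_closed[OF h]] Tp[OF h(1)] Tp[OF h(2)] Hk[OF h(1)] Hk[OF h(2)]
   by (simp add: tt_act[OF lX] del: HB_sel)
 next
  case (2 C D)
  then show ?case using Ta h Tc H.M.add.m_closed[OF h] by (simp add: X.M.add.m_ac del: HB_sel)
 qed
 \<comment> \<open>The left factor passes through. The right factor \<open>b\<close> ends up on the
   first leg of \<open>C\<close>; by the Casimir identity it can be moved to the second leg, where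
   \<open>T3\<close> turns it into the right action on \<open>X\<close>.\<close>
 have T2: "T (tt a b \<odot>\<^bsub>HB S (lft X)\<^esub> \<phi>) C = tt a \<one>\<^sub>A *\<^sub>X T \<phi> (S.tt (cs b) (cs \<one>\<^sub>A) \<otimes>\<^bsub>S.E\<^esub> C)"
  if C: "C :. S.E" and h: "\<phi> :. (HB S (lft X))" and ab: "a :. A" "b :. A" for \<phi> C a b
  using C
 proof (induct rule: ind)
  case (1 c d)
  then show ?case
   using Tp[OF H.smult_closed[OF tt(1)[OF ab] h]] Tp[OF h] pk[OF ab 1(1) h] Hk[OF h] ab by (simp add: tp tt_act[OF lX])
 next
  case (2 C D)
  then show ?case
   using Ta[OF H.smult_closed[OF tt(1)[OF ab] h]] Ta[OF h] tm[OF ab(2) A.one_closed] Tc[OF h] ab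
   by (simp add: es.A.r_distr tt_act[OF lX] del: HB_sel)
 qed
 have T3: "T \<phi> (S.tt (cs \<one>\<^sub>A) (cs b) \<otimes>\<^bsub>S.E\<^esub> C) = tt \<one>\<^sub>A b *\<^sub>X T \<phi> C"
  if C: "C :. S.E" and h: "\<phi> :. (HB S (lft X))" and b: "b :. A" for \<phi> C b
  using C
 proof (induct rule: ind)
  case (1 c d)
  then show ?case using Tp[OF h] Hk[OF h] b by (simp add: tp tt_act[OF lX])
 next
  case (2 C D)
  then show ?case using Ta[OF h] tm[OF A.one_closed b] Tc[OF h] b by (simp add: es.A.r_distr tt_act[OF lX])
 qed
 interpret B: left_module S.E "reg_bimod K rq" by (rule es.fdmD(1)[OF S.fdm_reg_bimod])
 have Bc: "car (reg_bimod K rq) = car rq" "add (reg_bimod K rq) = add rq" by (simp_all add: reg_bimod_def)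
 \<comment> \<open>On the image of \<open>j\<close> both legs act on \<open>x\<close> from the
   right, so only their product in the quotient matters; for the Casimir element this product is
   1.\<close>
 have T4: "T (j x) C = j x (f (C \<odot>\<^bsub>reg_bimod K rq\<^esub> \<one>\<^sub>rq))" if C: "C :. S.E" and x: "x :. X" for x C
  using C
 proof (induct rule: ind)
  case (1 a b)
  have "S.tt (cs a) (cs b) \<odot>\<^bsub>reg_bimod K rq\<^esub> \<one>\<^sub>rq = cs (a \<otimes>\<^sub>A b)"
   using S.reg_bimod_pure[OF cR[OF 1(1)] cR[OF 1(2)] S.A.one_closed] cR 1 by (simp add: R(4))
  then show ?case using Tp[OF jH[OF x] 1] jk[OF x] 1 x by (simp add: k_def[symmetric] tt_act[OF lX])
 next
  case (2 C D)
  have "EX a : car A. C \<odot>\<^bsub>reg_bimod K rq\<^esub> \<one>\<^sub>rq = cs a" if "C :. S.E" for C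
   using B.smult_closed[OF that, of "\<one>\<^sub>rq"] S.A.one_closed unfolding Bc(1) by (auto simp only: R(1))
  then obtain a b where ab: "a :. A" "b :. A" "C \<odot>\<^bsub>reg_bimod K rq\<^esub> \<one>\<^sub>rq = cs a" "D \<odot>\<^bsub>reg_bimod K rq\<^esub> \<one>\<^sub>rq = cs b"
   using 2(1,2) by metis
  have "(C \<oplus>\<^bsub>S.E\<^esub> D) \<odot>\<^bsub>reg_bimod K rq\<^esub> \<one>\<^sub>rq = cs (a \<oplus>\<^sub>A b)"
   using B.smult_l_distr[OF 2(1,2), of "\<one>\<^sub>rq"] ab by (simp add: Bc R(3))
  then show ?case
   using 2 ab Ta[OF jH[OF x] 2(1,2)] jk[OF x] x by (simp add: k_def[symmetric] tt_act[OF lX])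
 qed
 let ?T = "\<lambda>\<phi>\<in>car (HB S (lft X)). T \<phi> e0"
 have "?T : mhom E (HB S (lft X)) X"
 proof (rule env_homI[OF lH lX])
  show "?T (\<phi> \<oplus>\<^bsub>HB S (lft X)\<^esub> \<psi>) = ?T \<phi> \<oplus>\<^sub>X ?T \<psi>" if "\<phi> :. (HB S (lft X))" "\<psi> :. (HB S (lft X))" for \<phi> \<psi>
   using T1[OF e0(1) that] that H.M.add.m_closed[OF that] by (simp del: HB_sel)
  show "?T (tt a b \<odot>\<^bsub>HB S (lft X)\<^esub> \<phi>) = tt a b *\<^sub>X ?T \<phi>"
   if ab: "a :. A" "b :. A" and h: "\<phi> :. (HB S (lft X))" for a b \<phi>
   using T2[OF e0(1) h ab] T3[OF e0(1) h ab(2)] e0(3)[OF cR[OF ab(2)]] h H.smult_closed[OF tt(1)[OF ab] h] ab Tc[OF h e0(1)]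
   by (simp add: o tt_act[OF lX] del: HB_sel)
 qed (use Tc e0(1) in "simp_all del: HB_sel")
 moreover have "?T (j x) = x" if x: "x :. X" for x
  using T4[OF e0(1) x] e0(2) jk[OF x A.one_closed] tt_one[OF lX x] jH[OF x] by (simp add: o k_def del: HB_sel)
 ultimately show ?thesis by (rule good_retract[OF L lX lH j _ _ g[OF S(1)]])
qed

text \<open>With \<open>W k\<close> the syzygy of order \<open>k + 1\<close>, the index
  \<open>d\<close> stands for order \<open>d + 1\<close>. The first Ext from the syzygy of order
  \<open>d\<close> to every bimodule is shown to vanish, by induction on the dimension of the
  bimodule with its right socle split off.\<close>

theorem syzygies_vanish:
 assumes sep: "separable_alg K rq" and d: "gl_dim K A = enat d" "1 \<le> d" "d \<le> n"
 defines "W \<equiv> %n. (syzygy K E ^^ n) (syzygy K E (reg_bimod K A))"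
 shows "car (W n) = {\<zero>\<^bsub>W n\<^esub>}"
proof -
 have W: "fd_module K E (W k)" for k unfolding W_def by (intro e.fdm_syzygy_pow e.fdm_syzygy fdm_reg_bimod)
 have Ws: "W (Suc k) = syzygy K E (W k)" for k by (simp add: W_def)
 \<comment> \<open>\<open>W k\<close> is the syzygy of order \<open>d\<close>, which is what
   \<open>good_pow\<close> reaches for modules of projective dimension at most
   \<open>d = k + 1\<close>.\<close>
 obtain k where k: "d = Suc k" using d(2) by (cases d) auto
 have gH: "good (W k) (HB S N)" if "fd_module K A S" "fd_module K A N" for S :: "('a, 'b) fdmod" and N :: "('b, 'n) module"
  unfolding W_def by (rule good_pow[OF fdm_reg_bimod projective_lft_reg_bimod that(2,1) gl_dim_pdle[OF d(1)[unfolded k] that(1)]])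
 have "good (W k) X" if "fd_module K E X" for X :: "('a, ('a, 'b) env) fdmod"
  using that
 proof (induct "vdim K (scal E X)" arbitrary: X rule: less_induct)
  case less
  note X = less(2)
  define Z where "Z = {x : car X. ALL b : jr. tt \<one>\<^sub>A b *\<^sub>X x = \<zero>\<^sub>X}"
  interpret X: left_module E X by (rule e.fdmD(1)[OF X])
  show ?case
  proof (cases "car X = {\<zero>\<^sub>X}")
   case True
   \<comment> \<open>On the zero bimodule the radical acts as zero, so the killed case applies
     directly.\<close>
   show ?thesis
    by (rule good_killed[OF sep W X _ gH[OF _ fdm_lft[OF X]]]) (use True tt(1)[OF A.one_closed] jr_closed in simp_all)
  next
   case False
   have Z: "submodule Z E X" "EX x : Z. x ~= \<zero>\<^sub>X" unfolding Z_def by (rule right_socle[OF X False])+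
   interpret q: submod_of E X Z by (rule submod_ofI[OF X.left_module_axioms Z(1)])
   \<comment> \<open>The quotient by the socle is a type of cosets; its coordinate copy brings it
     back to the type over which the induction runs.\<close>
   obtain Y :: "('a, ('a, 'b) env) fdmod" and g where Y: "fd_module K E Y" "g : miso E (quot X Z) Y"
    using e.ex_coordinate_module[OF e.fdm_quot[OF X Z(1)]] by blast
   have g: "g : mhom E (quot X Z) Y" "inj_on g (car (quot X Z))" "g ` car (quot X Z) = car Y"
    using Y(2) unfolding miso_def bij_betw_def by auto
   interpret g: mod_hom E "quot X Z" Y g by (rule mod_homI[OF q.left_module_quot e.fdmD(1)[OF Y(1)] g(1)])
   let ?c = "compose (car X) g (\<lambda>x\<in>car X. Z +>\<^sub>X x)"
   have c: "?c : mhom E X Y" by (rule mhom_compose[OF X.left_module_axioms q.quot_proj g(1)])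
   have co: "?c ` car X = car Y" unfolding compose_image g(3)[symmetric] quot_carrier by (simp cong: image_cong)
   have "?c x = \<zero>\<^sub>Y \<longleftrightarrow> x : Z" if x: "x :. X" for x
   proof -
    have "g (Z +>\<^sub>X x) = \<zero>\<^sub>Y \<longleftrightarrow> Z +>\<^sub>X x = Z"
     using g.inj_iff g(2) q.cos_closed[OF x] g.zero by auto
    then show ?thesis using x q.cos_zero[OF x] by (simp add: compose_eq)
   qed
   then have kc: "mker X Y ?c = Z" "!!x. x : Z ==> ?c x = \<zero>\<^sub>Y" using X.submod_sub[OF Z(1)] by (auto simp: mker_def)
   obtain z where z: "z : Z" "z ~= \<zero>\<^sub>X" using Z(2) by blast
   have "vdim K (scal E Y) < vdim K (scal E X)"
    by (rule vdim_onto_less[OF e.fdmD(2)[OF X] e.lm_scal[OF e.fdmD(1)[OF Y(1)]] e.mhom_scal[OF c], of z])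
     (use co z kc(2) X.submod_sub[OF Z(1)] in simp_all)
   then have gY: "good (W k) Y" using less(1) Y(1) by blast
   have fZ: "fd_module K E (submod X Z)" by (rule e.fdm_submod[OF X Z(1)])
   have gZ: "good (W k) (submod X Z)"
    by (rule good_killed[OF sep W fZ _ gH[OF _ fdm_lft[OF fZ]]]) (simp_all add: Z_def)
   show ?thesis by (rule good_extension[OF W X Y(1) c co gY]) (simp add: kc(1) gZ)
  qed
 qed
 \<comment> \<open>The vanishing at index \<open>d\<close> propagates to all later indices, since
   the syzygy of a zero module is zero.\<close>
 from syzygy_zero[OF W this] have "car (W d) = {\<zero>\<^bsub>W d\<^esub>}" by (simp add: k Ws)
 with d(3) show ?thesis
  by (induct n rule: dec_induct) (simp_all add: Ws syzygy_of_zero[OF W])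
qed

text \<open>\<open>vdim\<close> is meaningful only when a basis exists; finite dimension is known on
  the side of the translate and is carried over by the isomorphism.\<close>

lemma vdim_naturally_iso:
 fixes X :: "('b, 'x) module"
 assumes M: "fd_module K A M" and X: "fd_module K A X" and n: "1 \<le> n"
  and i: "naturally_iso K A (%X :: ('b, 'x) module. dual K (reg K) (Hom_space A X (tau_n K A n M))) Fm (Ext K A n M) Gm"
 shows "vdim K (dual K (reg K) (Hom_space A X (tau_n K A n M))) = vdim K (Ext K A n M X)"
proof -
 obtain \<phi> where p: "\<phi> : miso K (dual K (reg K) (Hom_space A X (tau_n K A n M))) (Ext K A n M X)"
  using i X unfolding naturally_iso_def by blast
 obtain m where "n = Suc m" using n by (cases n) auto
 then have "lmod K (Ext K A n M X)" using lm_Ext[OF M fdmD(1)[OF X]] by simp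
 then show ?thesis by (rule vdim_iso[OF fin_dim_vdual[OF fin_dim_Hom_tau[OF M X]] _ p])
qed

end

theorem proposition4p1:
  fixes K :: "'k ring" and \<Lambda> :: "('k, 'a) module" and d :: nat
  assumes "fd_algebra K \<Lambda>"
    and "separable_alg K (quot_alg \<Lambda> (jacobson_radical \<Lambda>))"
    and "gl_dim K \<Lambda> = enat d" and "1 \<le> d"
  shows "naturally_iso K (env_alg K \<Lambda>)
           (tau_coh K \<Lambda> d :: (('k, 'a) env, 'x) module \<Rightarrow> _) (tau_coh_map K \<Lambda> d)
           (HH_coh K \<Lambda> d) (HH_coh_map K \<Lambda> d) \<and>
         naturally_iso K (env_alg K \<Lambda>)
           (tau_hom K \<Lambda> d :: (('k, 'a) env, 'x) module \<Rightarrow> _) (tau_hom_map K \<Lambda> d)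
           (HH_hom K \<Lambda> d) (HH_hom_map K \<Lambda> d) \<and>
         int (vdim K (tau_coh K \<Lambda> d (reg_bimod K \<Lambda>)))
           - int (vdim K (HH_coh K \<Lambda> d (reg_bimod K \<Lambda>))) = 0 \<and>
         (\<forall>n \<ge> 1. n \<notin> {1..d - 1} \<longrightarrow>
           naturally_iso K (env_alg K \<Lambda>)
             (tau_coh K \<Lambda> n :: (('k, 'a) env, 'x) module \<Rightarrow> _) (tau_coh_map K \<Lambda> n)
             (HH_coh K \<Lambda> n) (HH_coh_map K \<Lambda> n) \<and>
           naturally_iso K (env_alg K \<Lambda>)
             (tau_hom K \<Lambda> n :: (('k, 'a) env, 'x) module \<Rightarrow> _) (tau_hom_map K \<Lambda> n)
             (HH_hom K \<Lambda> n) (HH_hom_map K \<Lambda> n))"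
proof -
  interpret L: fd_algebra K \<Lambda> by (rule assms(1))
  interpret E: fd_algebra K "env_alg K \<Lambda>" by (rule L.fd_algebra_env)
  note M = L.fdm_reg_bimod
  note z = L.syzygies_vanish[OF assms(2-4)]
  have coh: "naturally_iso K (env_alg K \<Lambda>) (tau_coh K \<Lambda> n :: (('k, 'a) env, 'y) module \<Rightarrow> _) (tau_coh_map K \<Lambda> n)
      (HH_coh K \<Lambda> n) (HH_coh_map K \<Lambda> n)" if "d \<le> n" for n
    unfolding tau_coh_def[abs_def] tau_coh_map_def[abs_def] HH_coh_def[abs_def] HH_coh_map_def[abs_def] tau_A_def
    by (rule E.tau_ext_natural[OF M order_trans[OF assms(4) that] z[OF that]])
  have hom: "naturally_iso K (env_alg K \<Lambda>) (tau_hom K \<Lambda> n :: (('k, 'a) env, 'y) module \<Rightarrow> _) (tau_hom_map K \<Lambda> n)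
      (HH_hom K \<Lambda> n) (HH_hom_map K \<Lambda> n)" if "d \<le> n" for n
    \<comment> \<open>The comparison with Tor over the enveloping algebra is taken for right modules
      and then untwisted.\<close>
    by (rule L.naturally_iso_twist[unfolded tau_A_def]) (rule E.tau_tor_natural[OF M order_trans[OF assms(4) that] z[OF that]])
  have "vdim K (tau_coh K \<Lambda> d (reg_bimod K \<Lambda>)) = vdim K (HH_coh K \<Lambda> d (reg_bimod K \<Lambda>))"
    unfolding tau_coh_def HH_coh_def tau_A_def
    by (rule E.vdim_naturally_iso[OF M M assms(4) E.tau_ext_natural[OF M assms(4) z[OF order_refl]]])
  \<comment> \<open>This includes \<open>d = 1\<close>, where the middle range \<open>{1..0}\<close>
    is empty. For \<open>n > d\<close> the comparison still applies because the syzygy of order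
    \<open>n + 1\<close> vanishes as well.\<close>
  moreover have "d \<le> n" if "1 \<le> n" "n \<notin> {1..d - 1}" for n using that by auto
  ultimately show ?thesis using coh hom by auto
qed

end
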